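(* Let $X$, $\alpha\in[0,1)$, $A$, $B$, $L=A+B$ and $N$ be as in the context, and suppose that $L$ and $N$ satisfy: (H1) $\dim \mathsf{N}[L]=m\ge 1$ (with $m$ finite); (H2) $\mathsf{N}[L]\cap \mathsf{R}[L]=\{0\}$; (H3) $\sigma(L)\cap\{i\mathbb{R}\}=\{0\}$; (H4) there is $c>0$ such that $\|N(u_1)-N(u_2)\|\le c\,\|u_1-u_2\|_\alpha$ for all $u_1,u_2\in X_\alpha$ in a neighborhood of $0\in X$; (H5) there are $c>0$, $\kappa_1,\kappa_2\ge 1$ and $\kappa_3>1$ such that, for all $u=u^{(0)}+u^{(1)}\in X_\alpha$ with $u^{(0)}\in \mathsf{N}[L]$, $u^{(1)}\in\mathsf{R}[L]$, $$\|N(u^{(0)}+u^{(1)})\|\le c\left[\big(\|u^{(0)}\|+\|u^{(1)}\|^{\kappa_1}\big)\|u^{(1)}\|^{\kappa_2}+\|u^{(1)}\|_\alpha^{\kappa_3}\right].$$ Consider the evolution problem $$\frac{du}{dt}+Lu+N(u)=0,\qquad u(0)\in X. \quad ( * )$$ If $\Re[\sigma(L_1)]>0$, then there is $\rho_0>0$ such that if $\|u(0)\|_\alpha<\rho_0$, there is a unique corresponding solution $u=u(t)$ to $( * )$ for all $t>0$, satisfying $$u\in C([0,T];X_\alpha)\cap C((0,T];X_1)\cap C^1((0,T];X)\quad\text{for all }T>0.$$ Moreover, the solution $u=0$ to $( * )$ is exponentially stable in $X_\alpha$, namely: (a) for any $\varepsilon>0$ there is $\delta>0$ such that $\|u(0)\|_\alpha<\delta$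 implies $\sup_{t\ge0}\|u(t)\|_\alpha<\varepsilon$; (b) there are $\eta,c,\kappa>0$ such that $\|u(0)\|_\alpha<\eta$ implies $$\|u(t)-\bar u\|_\alpha\le c\,\|u^{(1)}(0)\|_\alpha\,e^{-\kappa t}\quad\text{for all }t>0,$$ for some $\bar u\in\mathsf{N}[L]$. Finally, if $\Re[\sigma(L_1)]\cap(-\infty,0)\ne\emptyset$, then the solution $u=0$ to $( * )$ is unstable in $X_\alpha$, namely, property (a) does not hold.
   Context: $X$ is a real Banach space with norm $\|\cdot\|$ (spectra are understood in the complexification). $A$ is a linear, sectorial operator in $X$ with compact inverse and $\Re[\sigma(A)]>0$. For $\alpha\in[0,1]$, $X_\alpha=\{u\in X:\ \|u\|_\alpha:=\|A^\alpha u\|<\infty\}$, with $X_0\equiv X$, $\|\cdot\|_0\equiv\|\cdot\|$; in particular $X_1=D(A)$. $B$ is a linear operator in $X$ with $D(B)\supset D(A)$ and $\|Bu\|\le c_1\|u\|_\alpha$ for some fixed $\alpha\in[0,1)$ and constant $c_1$; the same $\alpha$ is used throughout. $L=A+B$ with $D(L)=D(A)$. $N$ is a (nonlinear) map from $X_\alpha$ into $X$. $\mathsf{N}[\cdot]$ and $\mathsf{R}[\cdot]$ denote null space and range, and $\sigma(\cdot)$ the spectrum. Under these assumptions on $A,B$ the operator $L$ is sectorial, Fredholm of index $0$, with compact resolvent (hence discrete spectrum), and, under (H1)-(H3), $X=\mathsf{N}[L]\oplus\mathsf{R}[L]$. Accordingly every $u\in X$ is written uniquely as $u=u^{(0)}+u^{(1)}$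 with $u^{(0)}=\mathcal{Q}u\in\mathsf{N}[L]$, $u^{(1)}=\mathcal{P}u\in\mathsf{R}[L]$, where $\mathcal Q$ and $\mathcal P$ are the spectral projections of $L$ associated with the spectral sets $\{0\}$ and $\sigma(L)\setminus\{0\}$. $L_1:=\mathcal{P}L=L\mathcal{P}$ is the part of $L$ in $\mathsf{R}[L]$, and $\sigma(L_1)=\sigma(L)\setminus\{0\}$. "$\Re[\sigma(L_1)]>0$" means that every element of $\sigma(L_1)$ has positive real part; "$\Re[\sigma(L_1)]\cap(-\infty,0)\neq\emptyset$" means that some element of $\sigma(L_1)$ has negative real part. *)

theory Defs
  imports "HOL-Analysis.Analysis"
begin

text \<open>
  An unbounded operator in a real Banach space is given by its domain \<open>D\<close> and a total
  function whose values outside \<open>D\<close> are irrelevant.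
\<close>

definition linear_op :: "'x::real_vector set \<Rightarrow> ('x \<Rightarrow> 'x) \<Rightarrow> bool" where
  "linear_op D A \<longleftrightarrow> subspace D \<and>
     (\<forall>u\<in>D. \<forall>v\<in>D. A (u + v) = A u + A v) \<and> (\<forall>r. \<forall>u\<in>D. A (r *\<^sub>R u) = r *\<^sub>R A u)"

definition null_space :: "'x set \<Rightarrow> ('x \<Rightarrow> 'x::zero) \<Rightarrow> 'x set" where
  "null_space D A = {u \<in> D. A u = 0}"

definition range_space :: "'x set \<Rightarrow> ('x \<Rightarrow> 'x) \<Rightarrow> 'x set" where
  "range_space D A = A ` D"

text \<open>
  The complexification of \<open>X\<close> is \<open>X \<times> X\<close>, where \<open>(x, y)\<close> stands for \<open>x + i y\<close>, and the
  complexification of \<open>A\<close> is \<open>map_prod A A\<close> on \<open>D \<times> D\<close>.  The library norm of the product is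
  equivalent to (but in general not equal to) a norm that is homogeneous over the complex
  numbers.  It is used below only in conditions of the form ``there is a constant such that'',
  which do not change when the norm is replaced by an equivalent one.
\<close>

definition cscale :: "complex \<Rightarrow> 'x::real_vector \<times> 'x \<Rightarrow> 'x \<times> 'x" where
  "cscale z w = (Re z *\<^sub>R fst w - Im z *\<^sub>R snd w, Re z *\<^sub>R snd w + Im z *\<^sub>R fst w)"

definition cshift :: "('x \<Rightarrow> 'x) \<Rightarrow> complex \<Rightarrow> 'x::real_vector \<times> 'x \<Rightarrow> 'x \<times> 'x" where
  "cshift A z w = cscale z w - map_prod A A w"

text \<open>
  The operator is regarded as acting in the subspace \<open>Y\<close>, which is \<open>UNIV\<close> for an operator in
  \<open>X\<close> and the range of \<open>L\<close> for the part of \<open>L\<close> in its range.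
\<close>

definition resolvent_set ::
  "'x::real_normed_vector set \<Rightarrow> 'x set \<Rightarrow> ('x \<Rightarrow> 'x) \<Rightarrow> complex set" where
  "resolvent_set Y D A = {z. bij_betw (cshift A z) (D \<times> D) (Y \<times> Y) \<and>
     (\<exists>K. \<forall>w \<in> D \<times> D. norm w \<le> K * norm (cshift A z w))}"

definition spectrum :: "'x::real_normed_vector set \<Rightarrow> 'x set \<Rightarrow> ('x \<Rightarrow> 'x) \<Rightarrow> complex set" where
  "spectrum Y D A = - resolvent_set Y D A"

text \<open>
  Sectorial operators in the sense of Henry: the resolvent set contains the complement of a
  sector with vertex \<open>a\<close> opening to the right, with the bound \<open>M / |z - a|\<close> on the resolvent.
\<close>

definition sectorial :: "'x::banach set \<Rightarrow> ('x \<Rightarrow> 'x) \<Rightarrow> bool" where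
  "sectorial D A \<longleftrightarrow> linear_op D A \<and> closed {(u, A u) | u. u \<in> D} \<and> closure D = UNIV \<and>
     (\<exists>(a::real) \<phi> M. 0 < \<phi> \<and> \<phi> < pi / 2 \<and> M \<ge> 1 \<and>
        (\<forall>z. z \<noteq> of_real a \<and> \<phi> \<le> \<bar>Arg (z - of_real a)\<bar> \<longrightarrow>
           z \<in> resolvent_set UNIV D A \<and>
           (\<forall>w \<in> D \<times> D. norm w \<le> M / cmod (z - of_real a) * norm (cshift A z w))))"

definition compact_inverse :: "'x::banach set \<Rightarrow> ('x \<Rightarrow> 'x) \<Rightarrow> bool" where
  "compact_inverse D A \<longleftrightarrow>
     bij_betw A D UNIV \<and> compact (closure (inv_into D A ` cball 0 1))"

text \<open>
  For \<open>0 < \<alpha> < 1\<close> and \<open>A\<close> sectorial with spectrum in the open right half-plane, this is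
  \<open>A\<^sup>-\<^sup>\<alpha> v = sin (\<pi> \<alpha>) / \<pi> \<integral>\<^sub>0\<^sup>\<infinity> s\<^sup>-\<^sup>\<alpha> (s + A)\<^sup>-\<^sup>1 v ds\<close> (Balakrishnan).  The integrand is
  continuous and absolutely integrable; the Henstock--Kurzweil integral of the library is used
  because, unlike its Bochner integral, it does not require \<open>X\<close> to be separable.
\<close>

definition neg_frac_power :: "'x::banach set \<Rightarrow> ('x \<Rightarrow> 'x) \<Rightarrow> real \<Rightarrow> 'x \<Rightarrow> 'x" where
  "neg_frac_power D A \<alpha> v = (sin (pi * \<alpha>) / pi) *\<^sub>R
     integral {0<..} (\<lambda>s. s powr (- \<alpha>) *\<^sub>R inv_into D (\<lambda>u. s *\<^sub>R u + A u) v)"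

text \<open>The domain \<open>X\<^sub>\<alpha>\<close> of \<open>A\<^sup>\<alpha>\<close>, the power \<open>A\<^sup>\<alpha> = (A\<^sup>-\<^sup>\<alpha>)\<^sup>-\<^sup>1\<close> and its norm, for \<open>\<alpha>\<close> in \<open>[0, 1]\<close>.\<close>

definition frac_dom :: "'x::banach set \<Rightarrow> ('x \<Rightarrow> 'x) \<Rightarrow> real \<Rightarrow> 'x set" where
  "frac_dom D A \<alpha> =
     (if \<alpha> = 0 then UNIV else if \<alpha> = 1 then D else range (neg_frac_power D A \<alpha>))"

definition frac_power :: "'x::banach set \<Rightarrow> ('x \<Rightarrow> 'x) \<Rightarrow> real \<Rightarrow> 'x \<Rightarrow> 'x" where
  "frac_power D A \<alpha> u =
     (if \<alpha> = 0 then u else if \<alpha> = 1 then A u else inv (neg_frac_power D A \<alpha>) u)"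

definition frac_norm :: "'x::banach set \<Rightarrow> ('x \<Rightarrow> 'x) \<Rightarrow> real \<Rightarrow> 'x \<Rightarrow> real" where
  "frac_norm D A \<alpha> u = norm (frac_power D A \<alpha> u)"

text \<open>The component \<open>u\<^sup>(\<^sup>1\<^sup>)\<close> in the decomposition along \<open>X = N[L] \<oplus> R[L]\<close>.\<close>

definition range_part :: "'x::banach set \<Rightarrow> ('x \<Rightarrow> 'x) \<Rightarrow> 'x \<Rightarrow> 'x" where
  "range_part D L u = (THE v. v \<in> range_space D L \<and> u - v \<in> null_space D L)"

text \<open>\<open>u \<in> C(S; X\<^sub>\<alpha>)\<close>\<close>

definition continuous_into_frac ::
  "'x::banach set \<Rightarrow> ('x \<Rightarrow> 'x) \<Rightarrow> real \<Rightarrow> real set \<Rightarrow> (real \<Rightarrow> 'x) \<Rightarrow> bool" where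
  "continuous_into_frac D A \<alpha> S u \<longleftrightarrow> (\<forall>t\<in>S. u t \<in> frac_dom D A \<alpha> \<and>
     ((\<lambda>s. frac_norm D A \<alpha> (u s - u t)) \<longlongrightarrow> 0) (at t within S))"

text \<open>\<open>u \<in> C([0,T]; X\<^sub>\<alpha>) \<inter> C((0,T]; X\<^sub>1) \<inter> C\<^sup>1((0,T]; X)\<close>\<close>

definition regular_upto ::
  "'x::banach set \<Rightarrow> ('x \<Rightarrow> 'x) \<Rightarrow> real \<Rightarrow> real \<Rightarrow> (real \<Rightarrow> 'x) \<Rightarrow> bool" where
  "regular_upto D A \<alpha> T u \<longleftrightarrow>
     continuous_into_frac D A \<alpha> {0..T} u \<and>
     continuous_into_frac D A 1 {0<..T} u \<and>
     (\<exists>u'. continuous_on {0<..T} u' \<and>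
        (\<forall>t\<in>{0<..T}. (u has_vector_derivative u' t) (at t within {0<..T})))"

text \<open>
  Solutions of \<open>du/dt + L u + N(u) = 0\<close> on \<open>[0, \<tau>)\<close>, where \<open>0 < \<tau> \<le> \<infinity>\<close>; the operator \<open>A\<close>
  with domain \<open>D\<close> only serves to define the spaces \<open>X\<^sub>\<alpha>\<close>.
\<close>

definition solution_on :: "'x::banach set \<Rightarrow> ('x \<Rightarrow> 'x) \<Rightarrow> real \<Rightarrow> ('x \<Rightarrow> 'x) \<Rightarrow> ('x \<Rightarrow> 'x) \<Rightarrow>
    ereal \<Rightarrow> (real \<Rightarrow> 'x) \<Rightarrow> bool" where
  "solution_on D A \<alpha> L N \<tau> u \<longleftrightarrow>
     (\<forall>T>0. ereal T < \<tau> \<longrightarrow> regular_upto D A \<alpha> T u) \<and>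
     (\<forall>t>0. ereal t < \<tau> \<longrightarrow> (u has_vector_derivative - (L (u t) + N (u t))) (at t))"

text \<open>
  Stability of \<open>u = 0\<close> in \<open>X\<^sub>\<alpha>\<close>.  Solutions that exist only on a bounded interval are included:
  without this, a solution that leaves a neighbourhood of \<open>0\<close> and then ceases to exist would
  not count against stability.  The solutions with \<open>\<tau> = \<infinity>\<close> give the supremum over \<open>t \<ge> 0\<close>.
\<close>

definition stable_zero ::
  "'x::banach set \<Rightarrow> ('x \<Rightarrow> 'x) \<Rightarrow> real \<Rightarrow> ('x \<Rightarrow> 'x) \<Rightarrow> ('x \<Rightarrow> 'x) \<Rightarrow> bool" where
  "stable_zero D A \<alpha> L N \<longleftrightarrow>
     (\<forall>\<epsilon>>0. \<exists>\<delta>>0. \<forall>\<tau>>0. \<forall>u.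
        solution_on D A \<alpha> L N \<tau> u \<and> frac_norm D A \<alpha> (u 0) < \<delta> \<longrightarrow>
          bdd_above ((\<lambda>t. frac_norm D A \<alpha> (u t)) ` {t. 0 \<le> t \<and> ereal t < \<tau>}) \<and>
          (SUP t\<in>{t. 0 \<le> t \<and> ereal t < \<tau>}. frac_norm D A \<alpha> (u t)) < \<epsilon>)"

end

theory Submission
  imports Defs
begin

text \<open>
  In the coordinate \<open>v = A\<^sup>\<alpha> u\<close> the problem lives in the fixed space \<open>X\<close>.  Resolvent bounds in a sector
  survive perturbations that are bounded from \<open>X\<^sub>\<alpha>\<close> to \<open>X\<close>, so that \<open>L\<close>, shifted or modified on its null
  space, generates an analytic semigroup whose decay rate is read off the spectrum.  By (H5) the
  nonlinearity is bounded by \<open>K \<parallel>u\<parallel>\<^sub>\<alpha>\<^sup>p\<^sup>-\<^sup>1 \<parallel>u\<^sup>(\<^sup>1\<^sup>)\<parallel>\<^sub>\<alpha>\<close> near \<open>0\<close>, with \<open>p > 1\<close>.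

  Stability: let \<open>Q\<close> be the projection onto \<open>N[L]\<close> along \<open>R[L]\<close>, which Riesz's theory of compact operators
  provides.  The spectrum of \<open>L + Q\<close> is in the right half-plane, and \<open>u\<^sup>(\<^sup>1\<^sup>)\<close> satisfies the integral equation of
  its semigroup; since the nonlinearity is a small multiple of \<open>u\<^sup>(\<^sup>1\<^sup>)\<close>, it decays exponentially, and
  \<open>u\<^sup>(\<^sup>0\<^sup>)\<close> converges because its derivative decays as well.

  Instability, without spectral projections: let \<open>- \<beta> < 0\<close> be the infimum of the real part on \<open>\<sigma>(L)\<close>.
  Choose an eigenvalue with real part \<open>- \<beta>' < - \<beta> / p\<close> and follow the linear solution along its
  eigenvector from size \<open>\<theta> e\<^sup>-\<^sup>\<beta>\<^sup>'\<^sup>T\<close> to size \<open>\<theta>\<close>.  The semigroup grows at most like \<open>e\<^sup>s\<^sup>t\<close> with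
  \<open>\<beta> < s < p \<beta>'\<close>, so the nonlinear correction at time \<open>T\<close> is of the order \<open>\<theta>\<^sup>p\<close>, which is smaller than \<open>\<theta>\<close>.
\<close>

subsection \<open>Dominated integrals of vector-valued functions\<close>

text \<open>The obstacle is that N is controlled only in the norm of X_\<alpha>, while the semigroup
  acts in X. Every resolvent and semigroup operator is therefore carried together with its factor
  through \<open>J\<close>: if R = J Y, the bound |\<zeta>|^(\<alpha>-1) on Y becomes the integrable
  singularity t^(-\<alpha>) of the Duhamel kernel, and Y J is the same operator seen in X_\<alpha>.
  Perturbation arguments concern large |\<zeta>| only, and the spectrum settles the rest; hence one
  construction serves both L + Q and L + s, the added term being compensated on the right-hand side.
  Since N is controlled only near 0, existence is proved for an equation cut off by a radial
  retraction; a continuity argument in time shows that small solutions never meet the cutoff. The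
  exponent is p = min 2 \<kappa>3, because the mixed terms of (H5) are at least quadratic near 0 and
  the last one has order \<kappa>3. In the unstable case the solution is followed only up to the
  time at which it has reached a fixed size, since beyond it the cutoff may become active.\<close>

lemmas integral_split = Henstock_Kurzweil_Integration.integral_combine

text \<open>The primitive of \<open>f\<close> based at \<open>b\<close> has increments bounded by
  those of the indefinite integral of \<open>g\<close>, which is uniformly continuous. It therefore
  extends continuously to the singular endpoint \<open>a\<close>, and the fundamental theorem with
  derivatives in the open interval gives the integral.\<close>

lemma integrable_left_dominated:
  fixes f :: "real \<Rightarrow> 'a::banach" and g :: "real \<Rightarrow> real"
  assumes cont: "continuous_on {a<..b} f" and g: "g integrable_on {a..b}"
    and le: "\<And>x. x \<in> {a<..b} \<Longrightarrow> norm (f x) \<le> g x"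
  shows "f integrable_on {a..b}"
proof (cases "a < b")
  case True
  define \<Phi> where "\<Phi> x = - integral {x..b} f" for x
  define G where "G x = integral {a..x} g" for x
  have intf: "f integrable_on {x..y}" if "a < x" "y \<le> b" for x y
    by (rule integrable_continuous_interval) (use that in \<open>auto intro: continuous_on_subset[OF cont]\<close>)
  have intg: "g integrable_on {x..y}" if "a \<le> x" "y \<le> b" for x y
    using integrable_subinterval_real[OF g, of x y] that by auto
  have diff: "\<Phi> y - \<Phi> x = integral {x..y} f" if "a < x" "x \<le> y" "y \<le> b" for x y
    using integral_split[of x y b f] intf[of x b] that by (simp add: \<Phi>_def algebra_simps)
  have Gd: "G y - G x = integral {x..y} g" if "a \<le> x" "x \<le> y" "y \<le> b" for x y
    using integral_split[of a x y g] intg[of a y] that by (simp add: G_def algebra_simps)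
  have est: "dist (\<Phi> x) (\<Phi> y) \<le> dist (G x) (G y)" if "a < x" "x \<le> y" "y \<le> b" for x y
  proof -
    have "norm (integral {x..y} f) \<le> integral {x..y} g"
      using that by (intro integral_norm_bound_integral intf intg le) auto
    hence "norm (\<Phi> y - \<Phi> x) \<le> G y - G x" using diff Gd that by simp
    thus ?thesis by (simp add: dist_norm norm_minus_commute)
  qed
  have est': "dist (\<Phi> x) (\<Phi> y) \<le> dist (G x) (G y)" if "x \<in> {a<..b}" "y \<in> {a<..b}" for x y
    using est[of x y] est[of y x] that by (cases "x \<le> y") (auto simp: dist_commute)
  have "continuous_on {a..b} G" unfolding G_def by (rule indefinite_integral_continuous_1[OF g])
  hence ucG: "uniformly_continuous_on {a..b} G" by (simp add: compact_uniformly_continuous)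
  have "uniformly_continuous_on {a<..b} \<Phi>" unfolding uniformly_continuous_on_def
  proof (intro allI impI)
    fix e :: real assume "e > 0"
    then obtain d where d: "d > 0" "\<forall>x\<in>{a..b}. \<forall>x'\<in>{a..b}. dist x' x < d \<longrightarrow> dist (G x') (G x) < e"
      using ucG unfolding uniformly_continuous_on_def by meson
    show "\<exists>d>0. \<forall>x\<in>{a<..b}. \<forall>x'\<in>{a<..b}. dist x' x < d \<longrightarrow> dist (\<Phi> x') (\<Phi> x) < e"
      using d est' by (intro exI[of _ d]) (auto intro!: le_less_trans[OF est'])
  qed
  then obtain h where h: "uniformly_continuous_on (closure {a<..b}) h" "\<And>x. x \<in> {a<..b} \<Longrightarrow> \<Phi> x = h x"
    by (rule uniformly_continuous_on_extension_on_closure) blast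
  have "(f has_integral (h b - h a)) {a..b}"
  proof (rule fundamental_theorem_of_calculus_interior)
    show "continuous_on {a..b} h" using uniformly_continuous_imp_continuous[OF h(1)] True by simp
    fix x assume x: "x \<in> {a<..<b}"
    define c where "c = (a + x) / 2"
    have c: "a < c" "c < x" using x by (auto simp: c_def)
    have "((\<lambda>u. integral {c..u} f) has_vector_derivative f x) (at x within {c..b})"
      by (rule integral_has_vector_derivative) (use c x in \<open>auto intro: continuous_on_subset[OF cont]\<close>)
    hence "((\<lambda>u. integral {c..u} f) has_vector_derivative f x) (at x)"
      using at_within_Icc_at[of c x b] c x by auto
    hence "((\<lambda>u. \<Phi> c + integral {c..u} f) has_vector_derivative f x) (at x)"
      by (auto intro!: derivative_eq_intros)
    thus "(h has_vector_derivative f x) (at x)"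
    proof (rule has_vector_derivative_transform_within_open)
      show "open {c<..<b}" "x \<in> {c<..<b}" using c x by auto
      show "\<Phi> c + integral {c..u} f = h u" if "u \<in> {c<..<b}" for u
        using that diff[of c u] h(2)[of u] c by (simp add: algebra_simps)
    qed
  qed (use True in auto)
  thus ?thesis by blast
next
  case False
  thus ?thesis by (cases "a = b") (use integrable_on_refl[of f b] in auto)
qed

lemma integrable_right_dominated:
  fixes f :: "real \<Rightarrow> 'a::banach" and g :: "real \<Rightarrow> real"
  assumes cont: "continuous_on {a..<b} f" and g: "g integrable_on {a..b}"
    and le: "\<And>x. x \<in> {a..<b} \<Longrightarrow> norm (f x) \<le> g x"
  shows "f integrable_on {a..b}"
proof -
  have "(\<lambda>x. f (- x)) integrable_on {-b..-a}"
  proof (rule integrable_left_dominated)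
    show "continuous_on {- b<..- a} (\<lambda>x. f (- x))"
      by (rule continuous_on_compose2[OF cont]) (auto intro: continuous_intros)
    show "(\<lambda>x. g (- x)) integrable_on {- b..- a}" using g by simp
  qed (use le in auto)
  thus ?thesis by simp
qed

text \<open>The Cauchy criterion over growing boxes: the integrals over two nested boxes differ by
  two outer pieces, and there the integral of \<open>f\<close> is bounded by that of
  \<open>g\<close>.\<close>

lemma integrable_unbounded_dominated:
  fixes f :: "real \<Rightarrow> 'a::banach" and g :: "real \<Rightarrow> real"
  assumes f: "\<And>a b. (\<lambda>x. if x \<in> S then f x else 0) integrable_on {a..b}"
    and g: "g integrable_on S" and le: "\<And>x. x \<in> S \<Longrightarrow> norm (f x) \<le> g x"
  shows "f integrable_on S"
proof (rule iffD2[OF integrable_alt_subset], intro conjI allI impI)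
  let ?f = "\<lambda>x. if x \<in> S then f x else 0" and ?g = "\<lambda>x. if x \<in> S then g x else 0"
  show "?f integrable_on cbox a b" for a b using f by simp
  fix e :: real assume "e > 0"
  from conjunct2[OF iffD1[OF integrable_alt_subset g], rule_format, OF this] obtain B
    where B0: "B > 0 \<and> (\<forall>a b c d. ball 0 B \<subseteq> cbox a b \<and> cbox a b \<subseteq> cbox c d \<longrightarrow>
      norm (integral (cbox a b) ?g - integral (cbox c d) ?g) < e)" ..
  note B = conjunct1[OF B0] conjunct2[OF B0, rule_format, OF conjI]
  have gi: "?g integrable_on {a..b}" for a b using integrable_altD(1)[OF g, of a b] by simp
  have "norm (integral (cbox a b) ?f - integral (cbox c d) ?f) < e"
    if ab: "ball 0 B \<subseteq> cbox a b" "cbox a b \<subseteq> cbox c d" for a b c d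
  proof -
    have "(0::real) \<in> ball 0 B" using B(1) by simp
    hence "0 \<in> cbox a b" using ab(1) by (rule subsetD[rotated])
    hence 1: "a \<le> b" by simp
    hence 2: "c \<le> a" "b \<le> d" using ab(2) by (simp_all add: atLeastatMost_subset_iff)
    have fc: "integral {c..d} ?f = integral {c..a} ?f + integral {a..b} ?f + integral {b..d} ?f"
      using integral_split[of c a d ?f]
        integral_split[of a b d ?f] 1 2 f by (simp add: add.assoc)
    have gc: "integral {c..d} ?g = integral {c..a} ?g + integral {a..b} ?g + integral {b..d} ?g"
      using integral_split[of c a d ?g]
        integral_split[of a b d ?g] 1 2 gi by (simp add: add.assoc)
    have bd: "norm (integral {x..y} ?f) \<le> integral {x..y} ?g" for x y
      by (rule integral_norm_bound_integral[OF f gi]) (use le in auto)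
    have "norm (integral {a..b} ?f - integral {c..d} ?f) \<le> norm (integral {c..a} ?f) + norm (integral {b..d} ?f)"
      using norm_triangle_ineq4[of "- integral {b..d} ?f" "integral {c..a} ?f"] unfolding fc by (simp add: algebra_simps)
    also have "\<dots> \<le> integral {c..a} ?g + integral {b..d} ?g" by (intro add_mono bd)
    also have "\<dots> = integral {c..d} ?g - integral {a..b} ?g" using gc by simp
    also have "\<dots> < e" using B(2)[OF ab] by (simp add: abs_less_iff)
    finally show ?thesis by simp
  qed
  thus "\<exists>B>0. \<forall>a b c d. ball 0 B \<subseteq> cbox a b \<and> cbox a b \<subseteq> cbox c d \<longrightarrow>
      norm (integral (cbox a b) ?f - integral (cbox c d) ?f) < e" using B(1) by (intro exI[of _ B]) simp
qed

lemma integrable_UNIV_dominated: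
  fixes f :: "real \<Rightarrow> 'a::banach" and g :: "real \<Rightarrow> real"
  assumes cont: "continuous_on UNIV f" and g: "g integrable_on UNIV" and le: "\<And>x. norm (f x) \<le> g x"
  shows "f integrable_on UNIV"
  by (rule integrable_unbounded_dominated[OF _ g])
    (use le in \<open>auto intro: integrable_continuous_interval continuous_on_subset[OF cont]\<close>)

lemma integrable_Ioi_dominated:
  fixes f :: "real \<Rightarrow> 'a::banach" and g :: "real \<Rightarrow> real"
  assumes cont: "continuous_on {0<..} f" and g: "g integrable_on {0<..}"
    and le: "\<And>x. x > 0 \<Longrightarrow> norm (f x) \<le> g x"
  shows "f integrable_on {0<..}"
proof (rule integrable_unbounded_dominated[OF _ g])
  fix a b :: real
  let ?f = "\<lambda>x. if x \<in> {0<..} then f x else 0" and ?g = "\<lambda>x. if x \<in> {0<..} then g x else 0"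
  have gi: "?g integrable_on {a..b}" for a b using integrable_altD(1)[OF g, of a b] by simp
  have 1: "?f integrable_on {0..c}" for c
  proof (rule integrable_left_dominated[OF _ gi])
    show "continuous_on {0<..c} ?f" by (rule continuous_on_eq[OF continuous_on_subset[OF cont]]) auto
  qed (use le in auto)
  have 2: "?f integrable_on {c..0}" for c by (rule integrable_eq[of "\<lambda>x. 0"]) auto
  \<comment> \<open>An interval around 0 that contains \<open>{a..b}\<close> covers all positions of
    \<open>a\<close> and \<open>b\<close> relative to the singular point 0 at once.\<close>
  have "?f integrable_on {- \<bar>a\<bar> - \<bar>b\<bar> ..\<bar>a\<bar> + \<bar>b\<bar>}"
    by (rule Henstock_Kurzweil_Integration.integrable_combine[OF _ _ 2 1]) auto
  thus "?f integrable_on {a..b}" by (rule integrable_subinterval_real) auto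
qed (use le in auto)

text \<open>Improper integrals are evaluated below by the fundamental theorem on
  \<open>{-n..n}\<close>; this is the passage to the limit.\<close>

lemma tendsto_integral_symmetric:
  fixes f :: "real \<Rightarrow> 'a::banach"
  assumes "f integrable_on S"
  shows "((\<lambda>n. integral {-n..n} (\<lambda>x. if x \<in> S then f x else 0)) \<longlongrightarrow> integral S f) at_top"
proof -
  have "(f has_integral integral S f) S" using assms by (simp add: integrable_integral)
  note * = conjunct2[OF this[unfolded has_integral_alt'[of f]], rule_format]
  show ?thesis
  proof (rule tendstoI)
    fix e :: real assume "e > 0"
    from *[OF this] obtain B where B0: "B > 0 \<and> (\<forall>a b. ball 0 B \<subseteq> cbox a b \<longrightarrow>
       norm (integral (cbox a b) (\<lambda>x. if x \<in> S then f x else 0) - integral S f) < e)" ..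
    note B = conjunct1[OF B0] conjunct2[OF B0, rule_format]
    have "ball 0 B \<subseteq> cbox (-n) n" if "n \<ge> B" for n :: real using that by (auto simp: dist_real_def)
    hence "dist (integral {-n..n} (\<lambda>x. if x \<in> S then f x else 0)) (integral S f) < e" if "n \<ge> B" for n
      using B(2)[of "-n" n] that by (simp add: dist_norm)
    thus "\<forall>\<^sub>F n in at_top. dist (integral {-n..n} (\<lambda>x. if x \<in> S then f x else 0)) (integral S f) < e"
      unfolding eventually_at_top_linorder by (intro exI[of _ B]) simp
  qed
qed

lemma integral_derivative_UNIV:
  fixes H :: "real \<Rightarrow> 'a::banach"
  assumes der: "\<And>x. (H has_vector_derivative h x) (at x)" and int: "h integrable_on UNIV"
    and "(H \<longlongrightarrow> L) at_top" "(H \<longlongrightarrow> M) at_bot"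
  shows "integral UNIV h = L - M"
proof -
  have "integral {-n..n} h = H n - H (-n)" if "n \<ge> 0" for n
    by (rule integral_unique, rule fundamental_theorem_of_calculus)
      (use that in \<open>auto intro: has_vector_derivative_at_within der\<close>)
  hence "\<forall>\<^sub>F n in at_top. H n - H (-n) = integral {-n..n} (\<lambda>x. if x \<in> UNIV then h x else 0)"
    unfolding eventually_at_top_linorder by (intro exI[of _ 0]) simp
  moreover have "((\<lambda>n. H n - H (-n)) \<longlongrightarrow> L - M) at_top"
    by (intro tendsto_diff assms(3) filterlim_compose[OF assms(4)] filterlim_uminus_at_bot_at_top)
  ultimately have "((\<lambda>n. integral {-n..n} (\<lambda>x. if x \<in> UNIV then h x else 0)) \<longlongrightarrow> L - M) at_top"
    by (rule Lim_transform_eventually[rotated])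
  from tendsto_unique[OF _ tendsto_integral_symmetric[OF int] this] show ?thesis by simp
qed

lemma integral_derivative_Ioi:
  fixes H :: "real \<Rightarrow> 'a::banach"
  assumes der: "\<And>x. x > 0 \<Longrightarrow> (H has_vector_derivative h x) (at x)" and int: "h integrable_on {0<..}"
    and L: "(H \<longlongrightarrow> L) at_top" and cont: "continuous_on {0..} H"
  shows "integral {0<..} h = L - H 0"
proof -
  let ?h = "\<lambda>x. if x \<in> {0<..} then h x else 0"
  have "integral {-n..n} ?h = H n - H 0" if "n \<ge> 0" for n
  proof -
    have i: "(h has_integral (H n - H 0)) {0..n}" by (rule fundamental_theorem_of_calculus_interior)
        (use that in \<open>auto intro: der continuous_on_subset[OF cont]\<close>)
    have 1: "(?h has_integral (H n - H 0)) {0..n}" by (rule has_integral_spike_finite[OF _ _ i, of "{0}"]) auto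
    have 2: "(?h has_integral 0) {-n..0}" by (rule has_integral_is_0) auto
    have "(?h has_integral (0 + (H n - H 0))) {-n..n}"
      by (rule has_integral_combine[OF _ _ 2 1]) (use that in auto)
    thus ?thesis by (simp add: integral_unique)
  qed
  hence "\<forall>\<^sub>F n in at_top. H n - H 0 = integral {-n..n} ?h"
    unfolding eventually_at_top_linorder by (intro exI[of _ 0]) simp
  moreover have "((\<lambda>n. H n - H 0) \<longlongrightarrow> L - H 0) at_top" by (intro tendsto_diff L tendsto_const)
  ultimately have "((\<lambda>n. integral {-n..n} ?h) \<longlongrightarrow> L - H 0) at_top" by (rule Lim_transform_eventually[rotated])
  from tendsto_unique[OF _ tendsto_integral_symmetric[OF int] this] show ?thesis by simp
qed

subsection \<open>Complexification\<close>

lemma cscale_add_left: "cscale (z + w) x = cscale z x + cscale w x"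
  by (simp add: cscale_def algebra_simps)

lemma cscale_add_right: "cscale z (x + y) = cscale z x + cscale z y"
  by (simp add: cscale_def algebra_simps)

lemma cscale_mult: "cscale (z * w) x = cscale z (cscale w x)"
  by (simp add: cscale_def algebra_simps)

lemma cscale_of_real: "cscale (of_real r) x = r *\<^sub>R x"
  by (cases x) (simp add: cscale_def)

lemma cscale_one [simp]: "cscale 1 x = x" and cscale_zero_left [simp]: "cscale 0 x = 0"
  by (simp_all add: cscale_def zero_prod_def)

lemma cscale_scaleR_left: "cscale (r *\<^sub>R z) x = r *\<^sub>R cscale z x"
  by (cases x) (simp add: cscale_def algebra_simps)

lemma cscale_scaleR_right: "cscale z (r *\<^sub>R x) = r *\<^sub>R cscale z x"
  by (cases x) (simp add: cscale_def algebra_simps)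

lemma cscale_minus_left: "cscale (- z) x = - cscale z x"
  by (cases x) (simp add: cscale_def)

lemma cscale_minus_right: "cscale z (- x) = - cscale z x"
  by (cases x) (simp add: cscale_def)

lemma cscale_diff_left: "cscale (z - w) x = cscale z x - cscale w x"
  by (simp add: cscale_def algebra_simps)

lemma cscale_diff_right: "cscale z (x - y) = cscale z x - cscale z y"
  by (simp add: cscale_def algebra_simps)

lemma cscale_commute: "cscale z (cscale w x) = cscale w (cscale z x)"
  by (simp add: cscale_mult[symmetric] mult.commute)

text \<open>The map from \<open>(x, y)\<close> to \<open>(- y, x)\<close> is an isometry, so the
  real and the imaginary part of \<open>z\<close> contribute at most \<open>cmod z\<close> each. The
  factor 2 is the price of the product norm and reappears in later constants.\<close>

lemma norm_cscale_le: "norm (cscale z w) \<le> 2 * cmod z * norm w"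
proof -
  have eq: "cscale z w = Re z *\<^sub>R w + Im z *\<^sub>R (- snd w, fst w)" by (cases w) (simp add: cscale_def)
  have "norm (- snd w, fst w) = norm w" by (cases w) (simp add: norm_prod_def add.commute)
  hence "norm (cscale z w) \<le> \<bar>Re z\<bar> * norm w + \<bar>Im z\<bar> * norm w"
    unfolding eq by (metis norm_triangle_ineq norm_scaleR)
  also have "\<dots> \<le> cmod z * norm w + cmod z * norm w"
    by (intro add_mono mult_right_mono abs_Re_le_cmod abs_Im_le_cmod norm_ge_zero)
  finally show ?thesis by simp
qed

type_synonym 'x cop = "('x \<times> 'x) \<Rightarrow>\<^sub>L ('x \<times> 'x)"

text \<open>The type \<open>'x cop\<close> is only a real Banach space, so complex multiples of
  operators are written as compositions with \<open>cblin z\<close>. Operator-valued contour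
  integrals then are ordinary integrals in this space.\<close>

definition cblin :: "complex \<Rightarrow> ('x::real_normed_vector \<times> 'x) \<Rightarrow>\<^sub>L ('x \<times> 'x)" where
  "cblin z = Blinfun (cscale z)"

lemma cblin_apply [simp]: "blinfun_apply (cblin z) w = cscale z w"
proof -
  have "bounded_linear (cscale z :: 'a \<times> 'a \<Rightarrow> _)" by (rule bounded_linear_intro[where K = "2 * cmod z"])
      (use norm_cscale_le in \<open>auto simp: cscale_add_right cscale_scaleR_right mult.commute\<close>)
  thus ?thesis by (simp add: cblin_def bounded_linear_Blinfun_apply)
qed

lemma norm_cblin: "norm (cblin z) \<le> 2 * cmod z"
  by (rule norm_blinfun_bound) (simp_all add: norm_cscale_le)

lemma cblin_add: "cblin (z + w) = cblin z + cblin w"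
  by (rule blinfun_eqI) (simp add: cscale_add_left blinfun.add_left)

lemma cblin_mult: "cblin (z * w) = cblin z o\<^sub>L cblin w"
  by (rule blinfun_eqI) (simp add: cscale_mult)

lemma cblin_one: "cblin 1 = id_blinfun"
  by (rule blinfun_eqI) simp

lemma bounded_linear_cblin: "bounded_linear cblin"
  by (rule bounded_linear_intro[where K = 2])
    (use norm_cblin in \<open>auto simp: cblin_add mult.commute intro!: blinfun_eqI
      simp: cscale_scaleR_left blinfun.scaleR_left\<close>)

lemma norm_blinfun_compose_mult:
  "norm f \<le> a \<Longrightarrow> norm g \<le> b \<Longrightarrow> norm (f o\<^sub>L g) \<le> a * b"
  by (rule order_trans[OF norm_blinfun_compose]) (auto intro!: mult_mono intro: order_trans[OF norm_ge_zero])

definition dg :: "('x::real_normed_vector \<Rightarrow>\<^sub>L 'x) \<Rightarrow> 'x cop" where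
  "dg J = Blinfun (map_prod J J)"

lemma norm_map_prod_le:
  assumes "norm (f (fst w)) \<le> c * norm (fst v)" "norm (f (snd w)) \<le> c * norm (snd v)" "0 \<le> c"
  shows "norm (map_prod f f w) \<le> c * norm v"
proof -
  have "norm (map_prod f f w) \<le> sqrt ((c * norm (fst v))\<^sup>2 + (c * norm (snd v))\<^sup>2)"
    unfolding norm_prod_def using assms by (intro real_sqrt_le_mono add_mono power_mono) auto
  also have "\<dots> = sqrt (c\<^sup>2 * ((norm (fst v))\<^sup>2 + (norm (snd v))\<^sup>2))"
    by (simp add: power_mult_distrib algebra_simps)
  also have "\<dots> = c * norm v" using assms(3) by (simp add: real_sqrt_mult norm_prod_def)
  finally show ?thesis .
qed

lemma dg_apply [simp]: "blinfun_apply (dg J) w = map_prod J J w"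
proof -
  have "bounded_linear (map_prod J J)" by (rule bounded_linear_intro[where K = "norm J"])
     (auto simp: map_prod_def blinfun.add_right blinfun.scaleR_right split_beta mult.commute[of _ "norm J"]
       intro!: norm_map_prod_le[unfolded map_prod_def split_beta] norm_blinfun)
  thus ?thesis by (simp add: dg_def bounded_linear_Blinfun_apply)
qed

lemma norm_dg: "norm (dg J) \<le> norm J"
  by (rule norm_blinfun_bound) (auto intro!: norm_map_prod_le norm_blinfun)

lemma map_prod_cscale:
  "map_prod (blinfun_apply J) (blinfun_apply J) (cscale z w) = cscale z (map_prod J J w)"
  by (cases w) (simp add: cscale_def blinfun.bilinear_simps)

lemma dg_id [simp]: "dg id_blinfun = id_blinfun"
  by (rule blinfun_eqI) (simp add: map_prod_def split_beta)

lemma inj_map_prod: "inj f \<Longrightarrow> inj (map_prod f f)"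
  by (simp add: prod.inj_map)

subsection \<open>Resolvents\<close>

text \<open>\<open>R\<close> is the inverse of \<open>\<zeta> + L\<close> on the complexification; the sign matches semigroups
  \<open>e\<^sup>-\<^sup>t\<^sup>L\<close>, so that \<open>\<zeta>\<close> corresponds to the spectral parameter \<open>- \<zeta>\<close> of \<open>L\<close>.\<close>

definition resolv ::
  "'x::real_normed_vector set \<Rightarrow> ('x \<Rightarrow> 'x) \<Rightarrow> complex \<Rightarrow> 'x cop \<Rightarrow> bool" where
  "resolv D L \<zeta> R \<longleftrightarrow> (\<forall>w. R w \<in> D \<times> D \<and> cscale \<zeta> (R w) + map_prod L L (R w) = w) \<and>
     (\<forall>w \<in> D \<times> D. R (cscale \<zeta> w + map_prod L L w) = w)"

lemma resolvD:
  assumes "resolv D L \<zeta> R"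
  shows "R w \<in> D \<times> D" "fst (R w) \<in> D" "snd (R w) \<in> D" "cscale \<zeta> (R w) + map_prod L L (R w) = w"
    "map_prod L L (R w) = w - cscale \<zeta> (R w)" 
    "w \<in> D \<times> D \<Longrightarrow> R (cscale \<zeta> w + map_prod L L w) = w"
proof -
  show 1: "R w \<in> D \<times> D" and 2: "cscale \<zeta> (R w) + map_prod L L (R w) = w"
    using assms unfolding resolv_def by blast+
  thus "fst (R w) \<in> D" "snd (R w) \<in> D" by (auto simp: mem_Times_iff)
  show "map_prod L L (R w) = w - cscale \<zeta> (R w)" using 2 by (metis add_diff_cancel_left')
  show "w \<in> D \<times> D \<Longrightarrow> R (cscale \<zeta> w + map_prod L L w) = w" using assms by (auto simp: resolv_def)
qed

context
  fixes D :: "'x::real_normed_vector set" and L :: "'x \<Rightarrow> 'x"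
  assumes lin: "linear_op D L"
begin

lemma linear_opD:
  "0 \<in> D" "u \<in> D \<Longrightarrow> v \<in> D \<Longrightarrow> u + v \<in> D" "u \<in> D \<Longrightarrow> v \<in> D \<Longrightarrow> u - v \<in> D" "u \<in> D \<Longrightarrow> r *\<^sub>R u \<in> D"
  "u \<in> D \<Longrightarrow> - u \<in> D"
  "u \<in> D \<Longrightarrow> v \<in> D \<Longrightarrow> L (u + v) = L u + L v" "u \<in> D \<Longrightarrow> v \<in> D \<Longrightarrow> L (u - v) = L u - L v"
  "u \<in> D \<Longrightarrow> L (r *\<^sub>R u) = r *\<^sub>R L u" "L 0 = 0" "u \<in> D \<Longrightarrow> L (- u) = - L u"
proof -
  have D: "subspace D" and
    a: "\<And>u v. u \<in> D \<Longrightarrow> v \<in> D \<Longrightarrow> L (u + v) = L u + L v" and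
    s: "\<And>r u. u \<in> D \<Longrightarrow> L (r *\<^sub>R u) = r *\<^sub>R L u" using lin by (auto simp: linear_op_def)
  show z: "0 \<in> D" using D by (simp add: subspace_0)
  show "u \<in> D \<Longrightarrow> v \<in> D \<Longrightarrow> u + v \<in> D" "u \<in> D \<Longrightarrow> v \<in> D \<Longrightarrow> u - v \<in> D" "u \<in> D \<Longrightarrow> r *\<^sub>R u \<in> D"
    using D by (auto simp: subspace_add subspace_diff subspace_scale)
  show n: "u \<in> D \<Longrightarrow> - u \<in> D" for u using D by (simp add: subspace_neg)
  show "u \<in> D \<Longrightarrow> v \<in> D \<Longrightarrow> L (u + v) = L u + L v" "u \<in> D \<Longrightarrow> L (r *\<^sub>R u) = r *\<^sub>R L u" using a s by auto
  show nL: "u \<in> D \<Longrightarrow> L (- u) = - L u" for u using s[of u "-1"] by simp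
  show "u \<in> D \<Longrightarrow> v \<in> D \<Longrightarrow> L (u - v) = L u - L v" using a[of u "-v"] n nL by simp
  show "L 0 = 0" using s[of 0 0] z by simp
qed

lemma cx_linear:
  assumes "w \<in> D \<times> D"
  shows "v \<in> D \<times> D \<Longrightarrow> w + v \<in> D \<times> D" "v \<in> D \<times> D \<Longrightarrow> w - v \<in> D \<times> D" "cscale z w \<in> D \<times> D" "r *\<^sub>R w \<in> D \<times> D"
    "v \<in> D \<times> D \<Longrightarrow> map_prod L L (w + v) = map_prod L L w + map_prod L L v"
    "v \<in> D \<times> D \<Longrightarrow> map_prod L L (w - v) = map_prod L L w - map_prod L L v"
    "map_prod L L (cscale z w) = cscale z (map_prod L L w)"
    "map_prod L L (r *\<^sub>R w) = r *\<^sub>R map_prod L L w" using assms by (auto simp: linear_opD cscale_def)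

lemma resolv_unique:
  assumes "resolv D L \<zeta> R" "resolv D L \<zeta> S"
  shows "R = S"
proof (rule blinfun_eqI)
  fix w
  have "R w = R (cscale \<zeta> (S w) + map_prod L L (S w))" using resolvD(4)[OF assms(2)] by simp
  also have "\<dots> = S w" using resolvD(6)[OF assms(1) resolvD(1)[OF assms(2)]] .
  finally show "R w = S w" .
qed

lemma resolv_cscale:
  assumes "resolv D L \<zeta> R"
  shows "R (cscale z w) = cscale z (R w)"
proof -
  have "cscale z w = cscale \<zeta> (cscale z (R w)) + map_prod L L (cscale z (R w))"
    using resolvD(1,5)[OF assms, of w] by (simp add: cx_linear cscale_diff_right cscale_commute[of z])
  thus ?thesis using resolvD(6)[OF assms cx_linear(3)[OF resolvD(1)[OF assms]]] by metis
qed

lemma resolvent_identity: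
  assumes "resolv D L \<zeta> R" "resolv D L \<mu> S"
  shows "R - S = cblin (\<mu> - \<zeta>) o\<^sub>L (R o\<^sub>L S)"
proof (rule blinfun_eqI)
  fix w
  have "w = (cscale \<zeta> (S w) + map_prod L L (S w)) + cscale (\<mu> - \<zeta>) (S w)"
    using resolvD(5)[OF assms(2), of w] by (simp add: cscale_diff_left)
  hence "R w = R (cscale \<zeta> (S w) + map_prod L L (S w)) + R (cscale (\<mu> - \<zeta>) (S w))" by (metis blinfun.add_right)
  also have "\<dots> = S w + cscale (\<mu> - \<zeta>) (R (S w))"
    using resolvD(6)[OF assms(1) resolvD(1)[OF assms(2)]] resolv_cscale[OF assms(1)] by simp
  finally show "blinfun_apply (R - S) w = (cblin (\<mu> - \<zeta>) o\<^sub>L (R o\<^sub>L S)) w" by (simp add: blinfun.diff_left)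
qed

lemma cshift_minus: "cshift L (- \<zeta>) w = - (cscale \<zeta> w + map_prod L L w)"
  by (simp add: cshift_def cscale_minus_left)

text \<open>The sign in \<open>g\<close> cancels the one in \<open>cshift_minus\<close>. The second
  conclusion transfers every explicit estimate to the norm of the resolvent, so that the sectorial
  bound M / |z - a| is not lost in the existential constant of \<open>resolvent_set\<close>.\<close>

lemma resolv_of_resolvent_set:
  assumes "- \<zeta> \<in> resolvent_set UNIV D L"
  obtains R where "resolv D L \<zeta> R"
    "\<And>K. 0 \<le> K \<Longrightarrow> (\<And>w. w \<in> D \<times> D \<Longrightarrow> norm w \<le> K * norm (cshift L (- \<zeta>) w)) \<Longrightarrow> norm R \<le> K"
proof -
  let ?f = "cshift L (- \<zeta>)"
  from assms obtain K where bij: "bij_betw ?f (D \<times> D) UNIV"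
    and K: "\<And>w. w \<in> D \<times> D \<Longrightarrow> norm w \<le> K * norm (?f w)" by (auto simp: resolvent_set_def)
  define g where "g w = - inv_into (D \<times> D) ?f w" for w
  have gD: "g w \<in> D \<times> D" for w
  proof -
    have "inv_into (D \<times> D) ?f w \<in> D \<times> D" using bij by (metis UNIV_I bij_betw_imp_surj_on inv_into_into)
    from cx_linear(3)[OF this, of "-1"] show ?thesis by (simp add: g_def cscale_minus_left)
  qed
  have fneg: "?f (- w) = - ?f w" if "w \<in> D \<times> D" for w
    using cx_linear(7)[OF that, of "-1"] by (simp add: cshift_def cscale_minus_left cscale_minus_right)
  have fg: "?f (g w) = - w" for w
  proof -
    have "?f (inv_into (D \<times> D) ?f w) = w" using bij by (metis UNIV_I bij_betw_inv_into_right)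
    moreover have "inv_into (D \<times> D) ?f w \<in> D \<times> D" using bij by (metis UNIV_I bij_betw_imp_surj_on inv_into_into)
    ultimately show ?thesis unfolding g_def using fneg by simp
  qed
  have uniq: "w = v" if "w \<in> D \<times> D" "v \<in> D \<times> D" "?f w = ?f v" for w v
    using bij that by (metis bij_betw_inv_into_left)
  have fadd: "?f (w + v) = ?f w + ?f v" if "w \<in> D \<times> D" "v \<in> D \<times> D" for w v
    unfolding cshift_def using cx_linear(5)[OF that] by (simp add: cscale_add_right)
  have fsc: "?f (r *\<^sub>R w) = r *\<^sub>R ?f w" if "w \<in> D \<times> D" for w r unfolding cshift_def using cx_linear(8)[OF that]
    by (simp add: cscale_scaleR_right algebra_simps)
  have ngK: "norm (g w) \<le> norm w * K'" if "\<And>w. w \<in> D \<times> D \<Longrightarrow> norm w \<le> K' * norm (?f w)" for w K'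
    using that[OF gD[of w]] fg[of w] by (simp add: mult.commute)
  have bl: "bounded_linear g"
  proof (rule bounded_linear_intro)
    show "g (x + y) = g x + g y" for x y by (rule uniq) (use gD cx_linear(1) in \<open>auto simp: fadd fg\<close>)
    show "g (r *\<^sub>R x) = r *\<^sub>R g x" for r x by (rule uniq) (use gD cx_linear(4) in \<open>auto simp: fsc fg\<close>)
    show "norm (g x) \<le> norm x * K" for x using ngK[OF K] .
  qed
  have app: "blinfun_apply (Blinfun g) = g" using bl by (simp add: bounded_linear_Blinfun_apply)
  show ?thesis
  proof
    show "resolv D L \<zeta> (Blinfun g)" unfolding resolv_def app
    proof (intro conjI allI ballI)
      show "g w \<in> D \<times> D" for w by (rule gD)
      show "cscale \<zeta> (g w) + map_prod L L (g w) = w" for w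
        using fg[of w] unfolding cshift_minus neg_equal_iff_equal .
      show "g (cscale \<zeta> w + map_prod L L w) = w" if "w \<in> D \<times> D" for w
        by (rule uniq[OF gD that]) (simp only: fg, simp add: cshift_minus)
    qed
    show "norm (Blinfun g) \<le> K" if "0 \<le> K" "\<And>w. w \<in> D \<times> D \<Longrightarrow> norm w \<le> K * norm (?f w)" for K
      by (rule norm_blinfun_bound) (use that ngK in \<open>auto simp: app mult.commute\<close>)
  qed
qed

lemma resolvent_set_of_resolv:
  assumes "resolv D L \<zeta> R"
  shows "- \<zeta> \<in> resolvent_set UNIV D L"
  unfolding resolvent_set_def
proof (intro CollectI conjI exI ballI)
  have fR: "cshift L (- \<zeta>) w = v \<longleftrightarrow> w = R (- v)" if "w \<in> D \<times> D" for w v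
  proof
    assume "cshift L (- \<zeta>) w = v"
    hence "cscale \<zeta> w + map_prod L L w = - v" unfolding cshift_minus by (metis minus_minus)
    thus "w = R (- v)" using resolvD(6)[OF assms that] by simp
  next
    assume "w = R (- v)"
    thus "cshift L (- \<zeta>) w = v" using resolvD(4)[OF assms, of "- v"] by (simp only: cshift_minus) simp
  qed
  show "bij_betw (cshift L (- \<zeta>)) (D \<times> D) (UNIV \<times> UNIV)" unfolding UNIV_Times_UNIV
  proof (rule bij_betw_byWitness[where f' = "\<lambda>v. R (- v)"])
    show "\<forall>a\<in>D \<times> D. R (- cshift L (- \<zeta>) a) = a" using fR by metis
    show "\<forall>a\<in>UNIV. cshift L (- \<zeta>) (R (- a)) = a" using fR[OF resolvD(1)[OF assms]] by metis
    show "(\<lambda>v. R (- v)) ` UNIV \<subseteq> D \<times> D" by (rule image_subsetI, rule resolvD(1)[OF assms])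
  qed simp
  show "norm w \<le> norm R * norm (cshift L (- \<zeta>) w)" if "w \<in> D \<times> D" for w
    using norm_blinfun[of R "- cshift L (- \<zeta>) w"] fR[OF that] by (metis norm_minus_cancel)
qed

end

text \<open>The map x -> y - T x is a contraction and \<open>V y\<close> is its fixed point;
  linearity of \<open>V\<close> follows from uniqueness.\<close>

lemma neumann:
  fixes T :: "'a::banach \<Rightarrow>\<^sub>L 'a"
  assumes T: "norm T < 1"
  obtains V :: "'a \<Rightarrow>\<^sub>L 'a" where "\<And>x. V x + T (V x) = x" "\<And>x. V (x + T x) = x" "norm V \<le> 1 / (1 - norm T)"
proof -
  have ex: "\<exists>!x. y - T x = x" for y
  proof -
    have "\<exists>!x. y - T x = x" by (rule banach_fix_type[where c = "norm T"])
        (use T in \<open>auto simp: dist_norm blinfun.diff_right[symmetric]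
          intro: order_trans[OF norm_blinfun] simp: norm_minus_commute\<close>)
    thus ?thesis .
  qed
  define V where "V y = (THE x. y - T x = x)" for y
  have V: "y - T (V y) = V y" for y unfolding V_def by (rule theI'[OF ex])
  have uniq: "x = V y" if "y - T x = x" for x y using ex V that by blast
  have nV: "norm (V y) \<le> norm y * (1 / (1 - norm T))" for y
  proof -
    have "norm (V y) \<le> norm y + norm T * norm (V y)"
      using norm_triangle_ineq4[of y "T (V y)"] norm_blinfun[of T "V y"] V[of y] by simp
    hence "norm (V y) * (1 - norm T) \<le> norm y" by (simp add: algebra_simps)
    thus ?thesis using T by (simp add: pos_le_divide_eq)
  qed
  have bl: "bounded_linear V"
  proof (rule bounded_linear_intro)
    show "V (x + y) = V x + V y" for x y
      by (rule uniq[symmetric]) (use V[of x] V[of y] in \<open>simp add: blinfun.add_right, metis add_diff_add\<close>)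
    show "V (r *\<^sub>R x) = r *\<^sub>R V x" for r x
      by (rule uniq[symmetric]) (use V[of x] in \<open>simp add: blinfun.scaleR_right, metis scaleR_diff_right\<close>)
  qed (rule nV)
  hence app: "blinfun_apply (Blinfun V) = V" by (simp add: bounded_linear_Blinfun_apply)
  show ?thesis
  proof (rule that[of "Blinfun V"])
    show "blinfun_apply (Blinfun V) x + T (Blinfun V x) = x" for x
      using V[of x] by (simp add: app algebra_simps)
    show "Blinfun V (x + T x) = x" for x unfolding app by (rule uniq[symmetric]) simp
    show "norm (Blinfun V) \<le> 1 / (1 - norm T)"
      by (rule norm_blinfun_bound) (use T nV in \<open>auto simp: app mult.commute\<close>)
  qed
qed

text \<open>\<open>R\<close> is a right parametrix, (\<zeta> + L) R = 1 + T, and the resolvent is R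
  (1 + T)^(-1). That \<open>R\<close> maps onto \<open>D \<times> D\<close> makes it a left inverse
  as well. The relation V + V T = 1 is passed on for the estimate in X_\<alpha> in
  \<open>ares_perturb\<close>.\<close>

lemma resolv_neumann:
  fixes D :: "'x::banach set" and L :: "'x \<Rightarrow> 'x"
    and R T :: "'x cop"
  assumes R: "\<And>w. R w \<in> D \<times> D" "\<And>w. w \<in> D \<times> D \<Longrightarrow> \<exists>v. w = R v"
    and T: "\<And>w. cscale \<zeta> (R w) + map_prod L L (R w) = w + T w" "norm T \<le> 1 / 2"
  obtains V :: "'x cop" where "resolv D L \<zeta> (R o\<^sub>L V)" "\<And>x. V x + V (T x) = x" "norm V \<le> 2"
proof -
  have "norm T < 1" using T(2) by simp
  then obtain V :: "'x cop" where V: "\<And>x. V x + T (V x) = x" "\<And>x. V (x + T x) = x" "norm V \<le> 1 / (1 - norm T)"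
    using neumann[of T] by metis
  show ?thesis
  proof
    show "resolv D L \<zeta> (R o\<^sub>L V)" unfolding resolv_def
    proof (intro conjI allI ballI)
      show "(R o\<^sub>L V) w \<in> D \<times> D" for w using R(1) by simp
      show "cscale \<zeta> ((R o\<^sub>L V) w) + map_prod L L ((R o\<^sub>L V) w) = w" for w
        using T(1)[of "V w"] V(1)[of w] by simp
      fix w assume "w \<in> D \<times> D"
      then obtain v where w: "w = R v" using R(2) by blast
      show "(R o\<^sub>L V) (cscale \<zeta> w + map_prod L L w) = w" unfolding w T(1) by (simp add: V(2))
    qed
    show "V x + V (T x) = x" for x using V(2)[of x] by (simp add: blinfun.add_right)
    have "1 / (1 - norm T) \<le> 2" using T(2) by (simp add: divide_simps)
    thus "norm V \<le> 2" using V(3) by simp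
  qed
qed

text \<open>The resolvent at \<zeta> is a parametrix at \<mu> with error (\<mu> - \<zeta>) R. In the
  constant 4 one factor 2 comes from \<open>norm_cblin\<close>, the other from the threshold 1/2 for
  the error.\<close>

lemma resolv_open:
  fixes D :: "'x::banach set"
  assumes R: "resolv D L \<zeta> R" and "4 * cmod (\<mu> - \<zeta>) * norm R \<le> 1"
  obtains S :: "'x cop" where "resolv D L \<mu> S" "norm S \<le> 2 * norm R"
proof -
  have "norm (cblin (\<mu> - \<zeta>) o\<^sub>L R) \<le> (2 * cmod (\<mu> - \<zeta>)) * norm R"
    by (intro norm_blinfun_compose_mult norm_cblin order_refl)
  also have "\<dots> \<le> 1 / 2" using assms(2) by simp
  finally have T: "norm (cblin (\<mu> - \<zeta>) o\<^sub>L R) \<le> 1 / 2" .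
  obtain V :: "'x cop" where "resolv D L \<mu> (R o\<^sub>L V)" "norm V \<le> 2"
  proof (rule resolv_neumann[OF resolvD(1)[OF R] _ _ T])
    show "\<exists>v. w = R v" if "w \<in> D \<times> D" for w using resolvD(6)[OF R that] by metis
    show "cscale \<mu> (R w) + map_prod L L (R w) = w + blinfun_apply (cblin (\<mu> - \<zeta>) o\<^sub>L R) w" for w
      using resolvD(5)[OF R, of w] by (simp add: cscale_diff_left)
  qed
  thus ?thesis
    using that[of "R o\<^sub>L V"] norm_blinfun_compose_mult[OF order_refl, of V 2 R] by (simp add: mult.commute)
qed

subsection \<open>Resolvent bounds in sectors\<close>

lemma blinfun_compose_assoc: "(f o\<^sub>L g) o\<^sub>L h = f o\<^sub>L (g o\<^sub>L h)"
  by (rule blinfun_eqI) simp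

lemma blinfun_compose_id [simp]: "f o\<^sub>L id_blinfun = f" "id_blinfun o\<^sub>L f = f"
  by (rule blinfun_eqI, simp)+

text \<open>\<open>J\<close> plays the role of \<open>A\<^sup>-\<^sup>\<alpha>\<close>, so \<open>Y = J\<^sup>-\<^sup>1 R\<close> is the resolvent as a map into \<open>X\<^sub>\<alpha>\<close>
  and \<open>Y J\<close> is the resolvent as an operator in \<open>X\<^sub>\<alpha>\<close>, both transported to \<open>X\<close>.\<close>

definition res_bd :: "'x::banach set \<Rightarrow> ('x \<Rightarrow> 'x) \<Rightarrow> ('x \<Rightarrow>\<^sub>L 'x) \<Rightarrow> real \<Rightarrow> real \<Rightarrow> complex \<Rightarrow> real \<Rightarrow> bool" where
  "res_bd D L J \<alpha> M \<zeta> s \<longleftrightarrow> (\<exists>R Y. resolv D L \<zeta> R \<and> R = dg J o\<^sub>L Y \<and>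
     norm R \<le> M / s \<and> norm Y \<le> M * s powr (\<alpha> - 1) \<and> norm (Y o\<^sub>L dg J) \<le> M / s)"

text \<open>Only large |\<zeta>| are constrained, in a sector whose boundary Re \<zeta> = - d |Im
  \<zeta>| lies in the left half-plane. This makes the property stable under lower order
  perturbations, whatever they do to the spectrum.\<close>

definition ares :: "'x::banach set \<Rightarrow> ('x \<Rightarrow> 'x) \<Rightarrow> ('x \<Rightarrow>\<^sub>L 'x) \<Rightarrow> real \<Rightarrow> bool" where
  "ares D L J \<alpha> \<longleftrightarrow> (\<exists>d>0. \<exists>r>0. \<exists>M. \<forall>\<zeta>. r \<le> cmod \<zeta> \<and> - d * \<bar>Im \<zeta>\<bar> \<le> Re \<zeta> \<longrightarrow>
     res_bd D L J \<alpha> M \<zeta> (cmod \<zeta>))"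

text \<open>The bounds hold in a whole sector with vertex - \<omega>. For \<omega> > 0 the shift of
  the vertex becomes the exponential decay rate of the semigroup.\<close>

definition region ::
  "'x::banach set \<Rightarrow> ('x \<Rightarrow> 'x) \<Rightarrow> ('x \<Rightarrow>\<^sub>L 'x) \<Rightarrow> real \<Rightarrow> real \<Rightarrow> real \<Rightarrow> real \<Rightarrow> bool" where
  "region D L J \<alpha> \<omega> d M \<longleftrightarrow> (\<forall>\<zeta>. \<zeta> + of_real \<omega> \<noteq> 0 \<and> - d * \<bar>Im \<zeta>\<bar> \<le> Re \<zeta> + \<omega> \<longrightarrow>
     res_bd D L J \<alpha> M \<zeta> (cmod (\<zeta> + of_real \<omega>)))"

text \<open>The half-angle \<phi> in \<open>sectorial\<close> becomes the slope cot \<phi>: an angle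
  below \<phi> has smaller sine and larger cosine, which would force Re z > cot \<phi> |Im
  z|.\<close>

lemma Arg_ge:
  assumes "0 < \<phi>" "\<phi> < pi / 2" "z \<noteq> 0" "Re z \<le> cos \<phi> / sin \<phi> * \<bar>Im z\<bar>"
  shows "\<phi> \<le> \<bar>Arg z\<bar>"
proof (rule ccontr)
  assume "\<not> \<phi> \<le> \<bar>Arg z\<bar>"
  hence a: "\<bar>Arg z\<bar> < \<phi>" by simp
  have z: "z = cmod z * exp (\<i> * of_real (Arg z))" using Arg_eq[OF assms(3)] .
  have "Re z = cmod z * cos (Arg z)" "Im z = cmod z * sin (Arg z)"
    by (subst z, simp add: Re_exp, subst z, simp add: Im_exp)
  moreover have "\<bar>sin (Arg z)\<bar> = sin \<bar>Arg z\<bar>" using a assms(2) sin_ge_zero[of "\<bar>Arg z\<bar>"] by (auto simp: abs_if)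
  ultimately have re: "Re z = cmod z * cos \<bar>Arg z\<bar>" and im: "\<bar>Im z\<bar> = cmod z * sin \<bar>Arg z\<bar>"
    by (simp_all add: abs_mult)
  have s: "0 < sin \<phi>" using assms by (intro sin_gt_zero) auto
  have "sin \<bar>Arg z\<bar> \<le> sin \<phi>" using a assms by (intro sin_monotone_2pi_le) auto
  hence "cos \<phi> * sin \<bar>Arg z\<bar> \<le> cos \<phi> * sin \<phi>" using cos_gt_zero_pi[of \<phi>] assms by (intro mult_left_mono) auto
  hence "cos \<phi> / sin \<phi> * sin \<bar>Arg z\<bar> \<le> cos \<phi>" using s by (simp add: divide_simps)
  also have "\<dots> < cos \<bar>Arg z\<bar>" using a assms by (intro cos_monotone_0_pi) auto
  finally have "cmod z * (cos \<phi> / sin \<phi> * sin \<bar>Arg z\<bar>) < cmod z * cos \<bar>Arg z\<bar>"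
    using assms(3) by (intro mult_strict_left_mono) auto
  thus False using assms(4) re im by (simp add: algebra_simps)
qed

text \<open>Moving the vertex from \<open>a\<close> to 0 costs half of the slope and a disc around
  0.\<close>

lemma ares_of_sectorial:
  fixes D :: "'x::banach set"
  assumes "sectorial D A"
  shows "ares D A id_blinfun 0"
proof -
  obtain a :: real and \<phi> M where lin: "linear_op D A" and p: "0 < \<phi>" "\<phi> < pi / 2" "M \<ge> 1"
    and S: "\<And>z. z \<noteq> of_real a \<Longrightarrow> \<phi> \<le> \<bar>Arg (z - of_real a)\<bar> \<Longrightarrow> z \<in> resolvent_set UNIV D A"
      "\<And>z w. z \<noteq> of_real a \<Longrightarrow> \<phi> \<le> \<bar>Arg (z - of_real a)\<bar> \<Longrightarrow> w \<in> D \<times> D \<Longrightarrow>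
        norm w \<le> M / cmod (z - of_real a) * norm (cshift A z w)" using assms unfolding sectorial_def by blast
  define d where "d = cos \<phi> / sin \<phi>"
  have d: "0 < d" unfolding d_def using p sin_gt_zero[of \<phi>] cos_gt_zero_pi[of \<phi>] by (intro divide_pos_pos) auto
  \<comment> \<open>The first term makes |Re \<zeta>| > 2 |a| wherever |Im \<zeta>| is too small to
    absorb the shift by \<open>a\<close>; the second makes |\<zeta>| comparable with the distance
    from - \<zeta> to \<open>a\<close>.\<close>
  define r where "r = 2 * \<bar>a\<bar> / d + 2 * \<bar>a\<bar> + 1"
  have rb: "2 * \<bar>a\<bar> / d \<ge> 0" using d by simp
  have r0: "r > 0" "2 * \<bar>a\<bar> < r" using rb unfolding r_def by linarith+
  have "res_bd D A id_blinfun 0 (2 * M) \<zeta> (cmod \<zeta>)" if z: "r \<le> cmod \<zeta>" "- (d / 2) * \<bar>Im \<zeta>\<bar> \<le> Re \<zeta>" for \<zeta>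
  proof -
    define z where "z = - \<zeta>"
    have ne: "z - of_real a \<noteq> 0"
    proof
      assume "z - of_real a = 0"
      hence "\<zeta> = - of_real a" unfolding z_def by (metis eq_iff_diff_eq_0 minus_minus)
      thus False using z(1) r0 by simp
    qed
    have "Re (z - of_real a) \<le> d * \<bar>Im (z - of_real a)\<bar>"
    proof (cases "\<bar>Im \<zeta>\<bar> \<ge> 2 * \<bar>a\<bar> / d")
      case True
      hence "d * \<bar>Im \<zeta>\<bar> / 2 \<ge> \<bar>a\<bar>" using d by (simp add: divide_simps mult.commute)
      thus ?thesis using z(2) by (simp add: z_def)
    next
      case False
      hence i: "d / 2 * \<bar>Im \<zeta>\<bar> \<le> \<bar>a\<bar>" using d by (simp add: divide_simps mult.commute)
      have "r \<le> \<bar>Re \<zeta>\<bar> + \<bar>Im \<zeta>\<bar>" using z(1) cmod_le[of \<zeta>] by simp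
      hence "\<bar>Re \<zeta>\<bar> > 2 * \<bar>a\<bar>" using False unfolding r_def by linarith
      hence "Re \<zeta> > 2 * \<bar>a\<bar>" using z(2) i by linarith
      hence "Re (z - of_real a) \<le> 0" by (simp add: z_def)
      also have "0 \<le> d * \<bar>Im (z - of_real a)\<bar>" using d by simp
      finally show ?thesis .
    qed
    hence ar: "\<phi> \<le> \<bar>Arg (z - of_real a)\<bar>" using Arg_ge[OF p(1,2) ne] by (simp add: d_def)
    have "cmod \<zeta> / 2 \<le> cmod (z - of_real a)"
    proof -
      have "cmod \<zeta> \<le> cmod (z - of_real a) + \<bar>a\<bar>"
        using norm_triangle_ineq[of "z - of_real a" "of_real a"] by (simp add: z_def)
      thus ?thesis using z(1) r0 by linarith
    qed
    hence b: "M / cmod (z - of_real a) \<le> 2 * M / cmod \<zeta>"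
    proof -
      have "M / cmod (z - of_real a) \<le> M / (cmod \<zeta> / 2)"
        using \<open>cmod \<zeta> / 2 \<le> _\<close> p(3) z(1) r0 by (intro divide_left_mono mult_pos_pos) auto
      thus ?thesis by (simp add: mult.commute)
    qed
    have zne: "z \<noteq> of_real a" using ne by simp
    obtain R :: "'x cop" where R: "resolv D A \<zeta> R"
      "\<And>K. 0 \<le> K \<Longrightarrow> (\<And>w. w \<in> D \<times> D \<Longrightarrow> norm w \<le> K * norm (cshift A (- \<zeta>) w)) \<Longrightarrow> norm R \<le> K"
      using resolv_of_resolvent_set[OF lin, of \<zeta>] S(1)[OF zne ar] unfolding z_def by blast
    have "norm R \<le> M / cmod (z - of_real a)" by (rule R(2)) (use p(3) S(2)[OF zne ar] in \<open>auto simp: z_def\<close>)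
    hence nR: "norm R \<le> 2 * M / cmod \<zeta>" using b by simp
    have "cmod \<zeta> powr (0 - 1) = 1 / cmod \<zeta>" using z(1) r0 by (simp add: powr_minus divide_simps)
    thus ?thesis unfolding res_bd_def using R(1) nR
      by (intro exI[of _ R]) (auto simp: blinfun_compose_assoc intro!: blinfun_eqI)
  qed
  hence "\<forall>\<zeta>. r \<le> cmod \<zeta> \<and> - (d / 2) * \<bar>Im \<zeta>\<bar> \<le> Re \<zeta> \<longrightarrow>
      res_bd D A id_blinfun 0 (2 * M) \<zeta> (cmod \<zeta>)" by simp
  moreover have "d / 2 > 0" using d by simp
  ultimately show ?thesis unfolding ares_def using r0(1) by metis
qed

text \<open>Points where the bound n fails within distance 1/(n+1) of \<open>K\<close> would
  accumulate at a point of \<open>K\<close>, against the local bound there. It supplies the strip to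
  the left of the imaginary axis in \<open>region_of_ares\<close>.\<close>

lemma compact_uniform_nbhd:
  fixes K :: "'a::metric_space set" and P :: "'a \<Rightarrow> real \<Rightarrow> bool"
  assumes K: "compact K" and loc: "\<And>x. x \<in> K \<Longrightarrow> \<exists>e>0. \<exists>C. \<forall>y. dist x y < e \<longrightarrow> P y C"
    and mono: "\<And>y C C'. P y C \<Longrightarrow> C \<le> C' \<Longrightarrow> P y C'"
  shows "\<exists>e>0. \<exists>C. \<forall>x\<in>K. \<forall>y. dist x y < e \<longrightarrow> P y C"
proof (rule ccontr)
  assume neg: "\<not> ?thesis"
  have "\<exists>x y. x \<in> K \<and> dist x y < 1 / (real n + 1) \<and> \<not> P y (real n)" for n :: nat
  proof -
    have "1 / (real n + 1) > 0" by simp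
    with neg show ?thesis by meson
  qed
  then obtain x y where xy: "\<And>n. x n \<in> K" "\<And>n. dist (x n) (y n) < 1 / (real n + 1)" "\<And>n. \<not> P (y n) (real n)"
    by metis
  obtain l r where l: "l \<in> K" "strict_mono (r :: nat \<Rightarrow> nat)" "(x \<circ> r) \<longlonglongrightarrow> l"
    using K xy(1) unfolding compact_def by metis
  obtain e C where eC: "e > 0" "\<And>y. dist l y < e \<Longrightarrow> P y C" using loc[OF l(1)] by blast
  have "\<forall>\<^sub>F n in sequentially. dist ((x \<circ> r) n) l < e / 2"
    using l(3) eC(1) tendstoD[of "x \<circ> r" l sequentially "e / 2"] by simp
  moreover have "\<forall>\<^sub>F n in sequentially. 1 / (real n + 1) < e / 2"
    using order_tendstoD(2)[OF LIMSEQ_inverse_real_of_nat, of "e / 2"] eC(1)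
    by (simp add: inverse_eq_divide add.commute)
  moreover have "\<forall>\<^sub>F n in sequentially. C \<le> real n"
    using filterlim_real_sequentially unfolding filterlim_at_top by blast
  ultimately have "\<forall>\<^sub>F n in sequentially. False"
  proof eventually_elim
    case (elim n)
    have rn: "n \<le> r n" using l(2) by (simp add: strict_mono_imp_increasing)
    have "1 / (real (r n) + 1) \<le> 1 / (real n + 1)" using rn by (simp add: divide_simps)
    hence "dist (x (r n)) (y (r n)) < e / 2" using xy(2)[of "r n"] elim by linarith
    hence "dist l (y (r n)) < e" using elim dist_triangle[of l "y (r n)" "x (r n)"] by (simp add: dist_commute)
    hence "P (y (r n)) C" by (rule eC(2))
    hence "P (y (r n)) (real (r n))" by (rule mono) (use elim rn in simp)
    thus False using xy(3) by blast
  qed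
  thus False by simp
qed

text \<open>The resolvent identity in the form R = S (1 + (\<mu> - \<zeta>) R): once one resolvent
  factors through \<open>J\<close>, all of them do.\<close>

lemma resolv_factor:
  fixes D :: "'x::banach set"
  assumes lin: "linear_op D L" and "resolv D L \<mu> S" "S = dg J o\<^sub>L Y" "resolv D L \<zeta> R"
  shows "R = dg J o\<^sub>L (Y o\<^sub>L (id_blinfun + (cblin (\<mu> - \<zeta>) o\<^sub>L R)))"
proof (rule blinfun_eqI)
  fix w
  have *: "S - R = cblin (\<zeta> - \<mu>) o\<^sub>L (S o\<^sub>L R)" by (rule resolvent_identity[OF lin assms(2,4)])
  have "R w = S w - (S - R) w" by (simp add: blinfun.diff_left)
  also have "\<dots> = S w - cscale (\<zeta> - \<mu>) (S (R w))" unfolding * by simp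
  also have "\<dots> = S (w + cscale (\<mu> - \<zeta>) (R w))"
    by (simp add: blinfun.add_right blinfun.diff_right resolv_cscale[OF lin assms(2)] cscale_diff_left)
  finally show "R w = (dg J o\<^sub>L (Y o\<^sub>L (id_blinfun + (cblin (\<mu> - \<zeta>) o\<^sub>L R)))) w"
    by (simp add: assms(3) blinfun.add_left)
qed

text \<open>As in \<open>ares_of_sectorial\<close>, a shift of the vertex is absorbed by half of the
  slope where |Im \<zeta>| is large, while small |Im \<zeta>| outside the disc forces Re \<zeta> >
  0.\<close>

lemma region_geometry:
  assumes d: "0 < d" "\<delta>' = d / 2" and w: "0 < \<omega>" and r: "r = r0 + 4 * \<omega> / d + 4 * \<omega> + 1" "0 < r0"
    and z: "r \<le> cmod \<zeta>" "- \<delta>' * \<bar>Im \<zeta>\<bar> \<le> Re \<zeta> + \<omega>"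
  shows "- d * \<bar>Im \<zeta>\<bar> \<le> Re \<zeta>"
proof (cases "\<bar>Im \<zeta>\<bar> \<ge> 2 * \<omega> / d")
  case True
  hence "\<omega> \<le> d / 2 * \<bar>Im \<zeta>\<bar>" using d by (simp add: divide_simps mult.commute)
  thus ?thesis using z(2) d(2) by simp
next
  case False
  hence i: "d / 2 * \<bar>Im \<zeta>\<bar> \<le> \<omega>" using d by (simp add: divide_simps mult.commute)
  have "r \<le> \<bar>Re \<zeta>\<bar> + \<bar>Im \<zeta>\<bar>" using z(1) cmod_le[of \<zeta>] by simp
  moreover have "2 * \<omega> / d \<le> 4 * \<omega> / d" using d w by (simp add: divide_right_mono)
  ultimately have "\<bar>Re \<zeta>\<bar> > 4 * \<omega>" using False unfolding r(1) using r(2) by linarith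
  hence "Re \<zeta> > 0" using z(2) i d(2) w by auto
  moreover have "- d * \<bar>Im \<zeta>\<bar> \<le> 0" using d by simp
  ultimately show ?thesis by linarith
qed

text \<open>The half-disc \<open>K\<close> in the closed right half-plane is compact and free of
  spectrum of - L, so the resolvent is bounded on a neighbourhood of it. The vertex can therefore be
  moved slightly to the left; outside the disc the asymptotic bounds take over.\<close>

lemma region_of_ares:
  fixes D :: "'x::banach set"
  assumes lin: "linear_op D L" and ares: "ares D L J \<alpha>" and al: "0 \<le> \<alpha>" "\<alpha> < 1"
    and sp: "\<And>z. z \<in> spectrum UNIV D L \<Longrightarrow> 0 < Re z"
  obtains \<omega> d M where "0 < \<omega>" "0 < d" "d \<le> 1" "0 < M" "region D L J \<alpha> \<omega> d M"
proof -
  obtain \<delta>0 r0 M0 where d0: "\<delta>0 > 0" and r0: "r0 > 0"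
    and M0: "\<And>\<zeta>. r0 \<le> cmod \<zeta> \<Longrightarrow> - \<delta>0 * \<bar>Im \<zeta>\<bar> \<le> Re \<zeta> \<Longrightarrow> res_bd D L J \<alpha> M0 \<zeta> (cmod \<zeta>)"
    using ares unfolding ares_def by blast
  define \<delta>1 where "\<delta>1 = min \<delta>0 1"
  have d1: "0 < \<delta>1" "\<delta>1 \<le> \<delta>0" "\<delta>1 \<le> 1" using d0 by (auto simp: \<delta>1_def)
  define r where "r = r0 + 4 * 1 / \<delta>1 + 4 * 1 + 1"
  have "4 * 1 / \<delta>1 > 0" using d1 by simp
  hence r: "r > r0" "r > 1" using r0 unfolding r_def by linarith+
  define K where "K = cball 0 r \<inter> {\<zeta>. 0 \<le> Re \<zeta>}"
  have K: "compact K" unfolding K_def by (intro compact_Int_closed compact_cball closed_halfspace_Re_ge)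
  have "\<exists>e>0. \<exists>C. \<forall>\<zeta>. dist x \<zeta> < e \<longrightarrow> (\<exists>R. resolv D L \<zeta> R \<and> norm R \<le> C)" if "x \<in> K" for x
  proof -
    have "- x \<in> resolvent_set UNIV D L" using that sp[of "- x"] unfolding K_def spectrum_def by force
    then obtain R :: "'x cop" where R: "resolv D L x R" using resolv_of_resolvent_set[OF lin] by metis
    have "\<exists>S. resolv D L \<zeta> S \<and> norm S \<le> 2 * norm R" if "dist x \<zeta> < 1 / (4 * norm R + 1)" for \<zeta>
    proof -
      have "4 * cmod (\<zeta> - x) * norm R \<le> cmod (\<zeta> - x) * (4 * norm R + 1)" by (simp add: algebra_simps)
      also have "\<dots> \<le> 1" using that by (simp add: dist_norm norm_minus_commute pos_less_divide_eq add_nonneg_pos)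
      finally show ?thesis using resolv_open[OF R] by metis
    qed
    moreover have "1 / (4 * norm R + 1) > 0" by (simp add: add_nonneg_pos)
    ultimately show ?thesis by meson
  qed
  hence "\<exists>e>0. \<exists>C. \<forall>x\<in>K. \<forall>\<zeta>. dist x \<zeta> < e \<longrightarrow> (\<exists>R. resolv D L \<zeta> R \<and> norm R \<le> C)"
    by (rule compact_uniform_nbhd[OF K]) (auto intro: order_trans)
  then obtain e C where e: "e > 0"
    and C: "\<And>x \<zeta>. x \<in> K \<Longrightarrow> dist x \<zeta> < e \<Longrightarrow> \<exists>R. resolv D L \<zeta> R \<and> norm R \<le> C" by metis
  \<comment> \<open>Together with \<open>d * r \<le> \<epsilon>\<close> below, every point of the
    shifted sector in the disc has real part at least - 2 \<epsilon>, hence lies less than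
    \<open>e\<close> away from \<open>K\<close>.\<close>
  define \<epsilon> where "\<epsilon> = min 1 (e / 4)"
  have eps: "0 < \<epsilon>" "\<epsilon> \<le> 1" "\<epsilon> < e / 2" using e by (auto simp: \<epsilon>_def)
  define \<omega> where "\<omega> = \<epsilon>"
  define d where "d = min (\<delta>1 / 2) (\<epsilon> / r)"
  have del: "0 < d" "d \<le> \<delta>1 / 2" "d \<le> 1" "d * r \<le> \<epsilon>" using d1 eps r by (auto simp: d_def min_def divide_simps)
  obtain R0 Y0 where R0: "resolv D L (of_real r) R0" "R0 = dg J o\<^sub>L Y0"
    using M0[of "of_real r"] r r0 unfolding res_bd_def by auto
  define C1 where "C1 = norm Y0 * (1 + 2 * (2 * r) * \<bar>C\<bar>)"
  have C1: "0 \<le> C1" using r by (auto simp: C1_def intro!: mult_nonneg_nonneg add_nonneg_nonneg)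
  have compact_part: "\<exists>R Y. resolv D L \<zeta> R \<and> R = dg J o\<^sub>L Y \<and> norm R \<le> \<bar>C\<bar> \<and> norm Y \<le> C1 \<and>
      norm (Y o\<^sub>L dg J) \<le> C1 * norm J" if z: "cmod \<zeta> \<le> r" "- d * \<bar>Im \<zeta>\<bar> \<le> Re \<zeta> + \<omega>" for \<zeta>
  proof -
    have "d * \<bar>Im \<zeta>\<bar> \<le> d * r" using del abs_Im_le_cmod[of \<zeta>] z(1) by (intro mult_left_mono) auto
    hence re: "- 2 * \<epsilon> \<le> Re \<zeta>" using z(2) del unfolding \<omega>_def by linarith
    \<comment> \<open>The point of the closed right half-plane nearest to \<zeta>.\<close>
    define x where "x = (if 0 \<le> Re \<zeta> then \<zeta> else \<i> * of_real (Im \<zeta>))"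
    have "x \<in> K" using z(1) abs_Im_le_cmod[of \<zeta>] by (auto simp: K_def x_def norm_mult)
    moreover have "dist x \<zeta> < e"
    proof (cases "0 \<le> Re \<zeta>")
      case False
      hence "x - \<zeta> = - of_real (Re \<zeta>)" by (simp add: x_def complex_eq_iff)
      thus ?thesis using False re eps by (simp add: dist_norm)
    qed (use e in \<open>simp add: x_def\<close>)
    ultimately obtain R where R: "resolv D L \<zeta> R" "norm R \<le> C" using C by blast
    let ?Y = "Y0 o\<^sub>L (id_blinfun + (cblin (of_real r - \<zeta>) o\<^sub>L R))"
    have "cmod (of_real r - \<zeta>) \<le> 2 * r" using norm_triangle_ineq4[of "of_real r" \<zeta>] z(1) r by simp
    hence "norm (cblin (of_real r - \<zeta>) :: ('x \<times> 'x) \<Rightarrow>\<^sub>L _) \<le> 2 * (2 * r)"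
      by (intro order_trans[OF norm_cblin]) simp
    hence "norm (cblin (of_real r - \<zeta>) o\<^sub>L R) \<le> 2 * (2 * r) * \<bar>C\<bar>"
      using R(2) by (intro norm_blinfun_compose_mult) auto
    hence "norm (id_blinfun + (cblin (of_real r - \<zeta>) o\<^sub>L R)) \<le> 1 + 2 * (2 * r) * \<bar>C\<bar>"
      by (intro order_trans[OF norm_triangle_ineq] add_mono norm_blinfun_id_le)
    hence nY: "norm ?Y \<le> C1" unfolding C1_def by (intro norm_blinfun_compose_mult) auto
    have "norm (?Y o\<^sub>L dg J) \<le> C1 * norm J" by (intro norm_blinfun_compose_mult nY norm_dg)
    thus ?thesis using R nY resolv_factor[OF lin R0 R(1)] by (intro exI[of _ R] exI[of _ ?Y]) auto
  qed
  define C2 where "C2 = \<bar>C\<bar> + C1 + C1 * norm J"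
  have C2: "\<bar>C\<bar> \<le> C2" "C1 \<le> C2" "C1 * norm J \<le> C2" "0 \<le> C2" using C1 by (auto simp: C2_def add_nonneg_nonneg)
  \<comment> \<open>The first term serves |\<zeta>| > r, where |\<zeta> + \<omega>| \<le> 2
    |\<zeta>|; the terms with \<open>r + 1\<close> serve the disc, where |\<zeta> + \<omega>| \<le>
    r + 1.\<close>
  define M where "M = 4 * \<bar>M0\<bar> + C2 * (r + 1) + C2 * (r + 1) powr (1 - \<alpha>) + 1"
  have m0: "0 \<le> C2 * (r + 1)" "0 \<le> C2 * (r + 1) powr (1 - \<alpha>)" using C2 r by auto
  have "region D L J \<alpha> \<omega> d M" unfolding region_def
  proof (intro allI impI, elim conjE)
    fix \<zeta> :: complex assume z: "\<zeta> + of_real \<omega> \<noteq> 0" "- d * \<bar>Im \<zeta>\<bar> \<le> Re \<zeta> + \<omega>"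
    define s where "s = cmod (\<zeta> + of_real \<omega>)"
    have s: "0 < s" using z(1) by (simp add: s_def)
    have sb: "s \<le> cmod \<zeta> + \<omega>" using norm_triangle_ineq[of \<zeta> "of_real \<omega>"] eps unfolding s_def \<omega>_def by simp
    show "res_bd D L J \<alpha> M \<zeta> (cmod (\<zeta> + of_real \<omega>))"
    proof (cases "cmod \<zeta> \<le> r")
      case True
      from compact_part[OF True z(2)] obtain R Y where RY0: "resolv D L \<zeta> R" "R = dg J o\<^sub>L Y"
        "norm R \<le> \<bar>C\<bar>" "norm Y \<le> C1" "norm (Y o\<^sub>L dg J) \<le> C1 * norm J" by metis
      note RY = RY0(1,2) order_trans[OF RY0(3) C2(1)] order_trans[OF RY0(4) C2(2)] order_trans[OF RY0(5) C2(3)]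
      have sr: "s \<le> r + 1" using True sb eps unfolding \<omega>_def by linarith
      have "C2 * s \<le> M" using mult_left_mono[OF sr C2(4)] m0 unfolding M_def by linarith
      hence 1: "C2 \<le> M / s" using s by (simp add: pos_le_divide_eq)
      have "s powr (1 - \<alpha>) \<le> (r + 1) powr (1 - \<alpha>)" using sr s al by (intro powr_mono2) auto
      hence "C2 * s powr (1 - \<alpha>) \<le> M" using mult_left_mono[OF _ C2(4)] m0 unfolding M_def by (smt (verit))
      hence "C2 * s powr (1 - \<alpha>) * s powr (\<alpha> - 1) \<le> M * s powr (\<alpha> - 1)" by (intro mult_right_mono) auto
      moreover have "s powr (1 - \<alpha>) * s powr (\<alpha> - 1) = 1" using s by (simp flip: powr_add)
      ultimately have 2: "C2 \<le> M * s powr (\<alpha> - 1)" by (simp add: mult.assoc)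
      show ?thesis unfolding res_bd_def s_def[symmetric] using RY 1 2 by (intro exI[of _ R] exI[of _ Y]) auto
    next
      case False
      have "- (\<delta>1 / 2) * \<bar>Im \<zeta>\<bar> \<le> Re \<zeta> + \<omega>" using z(2) mult_right_mono[OF del(2), of "\<bar>Im \<zeta>\<bar>"] by simp
      hence "- (\<delta>1 / 2) * \<bar>Im \<zeta>\<bar> \<le> Re \<zeta> + 1" using eps unfolding \<omega>_def by linarith
      hence "- \<delta>1 * \<bar>Im \<zeta>\<bar> \<le> Re \<zeta>"
        using region_geometry[OF d1(1) refl zero_less_one r_def r0, of \<zeta>] False by simp
      hence "- \<delta>0 * \<bar>Im \<zeta>\<bar> \<le> Re \<zeta>" using mult_right_mono[OF d1(2), of "\<bar>Im \<zeta>\<bar>"] by simp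
      with M0[of \<zeta>] False r obtain R Y where RY: "resolv D L \<zeta> R" "R = dg J o\<^sub>L Y"
        "norm R \<le> M0 / cmod \<zeta>" "norm Y \<le> M0 * cmod \<zeta> powr (\<alpha> - 1)" "norm (Y o\<^sub>L dg J) \<le> M0 / cmod \<zeta>"
        unfolding res_bd_def by auto
      have c: "0 < cmod \<zeta>" "s \<le> 2 * cmod \<zeta>" using False r r0 sb eps unfolding \<omega>_def by linarith+
      have M: "4 * \<bar>M0\<bar> \<le> M" using m0 unfolding M_def by linarith
      have "M0 / cmod \<zeta> \<le> \<bar>M0\<bar> / (s / 2)" using c s by (intro frac_le) auto
      also have "\<dots> \<le> M / s" using M s by (simp add: divide_simps)
      finally have 1: "M0 / cmod \<zeta> \<le> M / s" .
      have "cmod \<zeta> powr (\<alpha> - 1) \<le> (s / 2) powr (\<alpha> - 1)" using c s al by (intro powr_mono2') auto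
      also have "\<dots> = 2 powr (1 - \<alpha>) * s powr (\<alpha> - 1)"
        using s powr_minus_divide[of "2::real" "\<alpha> - 1"] by (simp add: powr_divide)
      also have "\<dots> \<le> 2 * s powr (\<alpha> - 1)"
        using powr_mono[of "1 - \<alpha>" 1 "2::real"] al by (intro mult_right_mono) auto
      finally have "M0 * cmod \<zeta> powr (\<alpha> - 1) \<le> \<bar>M0\<bar> * (2 * s powr (\<alpha> - 1))" by (intro mult_mono) auto
      also have "\<dots> \<le> M * s powr (\<alpha> - 1)"
      proof -
        have "2 * \<bar>M0\<bar> \<le> M" using M by linarith
        from mult_right_mono[OF this, of "s powr (\<alpha> - 1)"] show ?thesis by (simp add: mult_ac)
      qed
      finally have 2: "M0 * cmod \<zeta> powr (\<alpha> - 1) \<le> M * s powr (\<alpha> - 1)" .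
      show ?thesis unfolding res_bd_def s_def[symmetric] using RY 1 2 by (intro exI[of _ R] exI[of _ Y]) auto
    qed
  qed
  moreover have "0 < M" using m0 unfolding M_def by linarith
  ultimately show ?thesis using that[of \<omega> d M] eps del unfolding \<omega>_def by blast
qed

text \<open>Here B R = B J Y has norm at most c M |\<zeta>|^(\<alpha>-1), which is small for large
  |\<zeta>| because \<alpha> < 1. So the resolvent of \<open>A\<close> is a parametrix for
  \<open>L\<close>.\<close>

lemma ares_perturb:
  fixes D :: "'x::banach set" and J :: "'x \<Rightarrow>\<^sub>L 'x"
  assumes A: "linear_op D A" and ares: "ares D A J \<alpha>" and al: "0 \<le> \<alpha>" "\<alpha> < 1"
    and B: "linear_op D B" "\<And>v. J v \<in> D \<Longrightarrow> norm (B (J v)) \<le> c * norm v"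
    and L: "\<And>u. u \<in> D \<Longrightarrow> L u = A u + B u"
  shows "ares D L J \<alpha>"
proof -
  obtain d r0 M0 where d: "d > 0" and r0: "r0 > 0"
    and M0: "\<And>\<zeta>. r0 \<le> cmod \<zeta> \<Longrightarrow> - d * \<bar>Im \<zeta>\<bar> \<le> Re \<zeta> \<Longrightarrow> res_bd D A J \<alpha> M0 \<zeta> (cmod \<zeta>)"
    using ares unfolding ares_def by blast
  define M where "M = \<bar>M0\<bar> + 1"
  define c' where "c' = \<bar>c\<bar> + 1"
  \<comment> \<open>Chosen such that c' M |\<zeta>|^(\<alpha>-1) \<le> 1/2 for |\<zeta>| \<ge>
    r.\<close>
  define r where "r = max r0 ((2 * c' * M) powr (1 / (1 - \<alpha>)))"
  have pos: "0 < M" "0 < c'" "0 < r" "r0 \<le> r" using r0 by (auto simp: M_def c'_def r_def)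
  have "res_bd D L J \<alpha> (2 * M) \<zeta> (cmod \<zeta>)" if z: "r \<le> cmod \<zeta>" "- d * \<bar>Im \<zeta>\<bar> \<le> Re \<zeta>" for \<zeta>
  proof -
    let ?s = "cmod \<zeta>"
    have s: "0 < ?s" "r0 \<le> ?s" using z pos by linarith+
    obtain R Y where RY: "resolv D A \<zeta> R" "R = dg J o\<^sub>L Y"
        "norm R \<le> M0 / ?s" "norm Y \<le> M0 * ?s powr (\<alpha> - 1)" "norm (Y o\<^sub>L dg J) \<le> M0 / ?s"
      using M0[OF s(2) z(2)] unfolding res_bd_def by blast
    have le: "M0 / ?s \<le> M / ?s" "M0 * ?s powr (\<alpha> - 1) \<le> M * ?s powr (\<alpha> - 1)"
      using s by (auto simp: M_def intro!: divide_right_mono mult_right_mono)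
    note nR = order_trans[OF RY(3) le(1)] and nY = order_trans[OF RY(4) le(2)]
      and nYJ = order_trans[OF RY(5) le(1)]
    have "2 * c' * M = ((2 * c' * M) powr (1 / (1 - \<alpha>))) powr (1 - \<alpha>)" using pos al by (simp add: powr_powr)
    also have "\<dots> \<le> ?s powr (1 - \<alpha>)" using z(1) al by (intro powr_mono2) (auto simp: r_def)
    finally have "2 * c' * M * ?s powr (\<alpha> - 1) \<le> ?s powr (1 - \<alpha>) * ?s powr (\<alpha> - 1)"
      by (intro mult_right_mono) auto
    also have "\<dots> = 1" using s by (simp flip: powr_add)
    finally have half: "c' * (M * ?s powr (\<alpha> - 1)) \<le> 1 / 2" by simp
    define f where "f w = map_prod B B (R w)" for w
    have fb: "norm (f w) \<le> c' * norm (Y w)" for w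
    proof -
      have "norm (B (J v)) \<le> c' * norm v" if "J v \<in> D" for v
        using order_trans[OF B(2)[OF that] mult_right_mono[of c c' "norm v"]] by (simp add: c'_def)
      thus ?thesis unfolding f_def RY(2)
        using resolvD(2,3)[OF RY(1), of w] pos unfolding RY(2) by (intro norm_map_prod_le) auto
    qed
    have bl: "bounded_linear f"
    proof (rule bounded_linear_intro[where K = "c' * norm Y"])
      show "f (x + y) = f x + f y" for x y unfolding f_def blinfun.add_right
        by (rule cx_linear(5)[OF B(1) resolvD(1)[OF RY(1)] resolvD(1)[OF RY(1)]])
      show "f (a *\<^sub>R x) = a *\<^sub>R f x" for a x unfolding f_def blinfun.scaleR_right
        by (rule cx_linear(8)[OF B(1) resolvD(1)[OF RY(1)]])
      show "norm (f x) \<le> norm x * (c' * norm Y)" for x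
        using order_trans[OF fb mult_left_mono[OF norm_blinfun]] pos by (simp add: algebra_simps)
    qed
    define T where "T = Blinfun f"
    have T: "blinfun_apply T w = f w" for w using bl by (simp add: T_def bounded_linear_Blinfun_apply)
    have nT: "norm T \<le> 1 / 2"
    proof (rule norm_blinfun_bound)
      fix w
      have "norm (T w) \<le> c' * (norm Y * norm w)" unfolding T
        by (rule order_trans[OF fb mult_left_mono[OF norm_blinfun]]) (use pos in simp)
      also have "\<dots> \<le> c' * (M * ?s powr (\<alpha> - 1) * norm w)"
        using pos nY by (intro mult_left_mono mult_right_mono) auto
      also have "\<dots> \<le> 1 / 2 * norm w" using mult_right_mono[OF half, of "norm w"] by (simp add: mult.assoc)
      finally show "norm (T w) \<le> 1 / 2 * norm w" .
    qed simp
    have surj: "\<exists>v. w = R v" if "w \<in> D \<times> D" for w using resolvD(6)[OF RY(1) that] by metis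
    have LR: "cscale \<zeta> (R w) + map_prod L L (R w) = w + T w" for w
    proof -
      have "map_prod L L v = map_prod A A v + map_prod B B v" if "v \<in> D \<times> D" for v using that L by auto
      from this[OF resolvD(1)[OF RY(1)]] show ?thesis using resolvD(5)[OF RY(1), of w] by (simp add: T f_def)
    qed
    obtain V :: "'x cop"
      where V: "resolv D L \<zeta> (R o\<^sub>L V)" "\<And>x. V x + V (T x) = x" "norm V \<le> 2"
      using resolv_neumann[OF resolvD(1)[OF RY(1)] surj LR nT] by metis
    let ?Y = "Y o\<^sub>L V"
    have 1: "R o\<^sub>L V = dg J o\<^sub>L ?Y" unfolding RY(2) by (simp add: blinfun_compose_assoc)
    have 2: "norm (R o\<^sub>L V) \<le> 2 * M / ?s"
      using norm_blinfun_compose_mult[OF nR V(3)] by (simp add: mult.commute)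
    have 3: "norm ?Y \<le> 2 * M * ?s powr (\<alpha> - 1)"
      using norm_blinfun_compose_mult[OF nY V(3)] by (simp add: mult_ac)
    \<comment> \<open>Bounding Y V J factor by factor would give only |\<zeta>|^(\<alpha>-1).
      Writing V = 1 - V T brings out T J, which is controlled by Y J and so is of order
      1/|\<zeta>|.\<close>
    have eq: "?Y o\<^sub>L dg J = (Y o\<^sub>L dg J) - ((Y o\<^sub>L V) o\<^sub>L (T o\<^sub>L dg J))"
    proof (rule blinfun_eqI)
      fix w
      have "V (dg J w) = dg J w - V (T (dg J w))" using V(2)[of "dg J w"] by (simp add: algebra_simps)
      thus "(?Y o\<^sub>L dg J) w = ((Y o\<^sub>L dg J) - ((Y o\<^sub>L V) o\<^sub>L (T o\<^sub>L dg J))) w"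
        by (simp add: blinfun.diff_left blinfun.diff_right del: dg_apply)
    qed
    have TJ: "norm (T o\<^sub>L dg J) \<le> c' * (M / ?s)"
    proof (rule norm_blinfun_bound)
      fix w
      have "norm ((T o\<^sub>L dg J) w) \<le> c' * norm ((Y o\<^sub>L dg J) w)" using fb[of "dg J w"] T by simp
      also have "\<dots> \<le> c' * (M / ?s * norm w)"
        using pos order_trans[OF norm_blinfun mult_right_mono[OF nYJ norm_ge_zero]] by (intro mult_left_mono) auto
      finally show "norm ((T o\<^sub>L dg J) w) \<le> c' * (M / ?s) * norm w" by (simp add: mult.assoc)
    qed (use pos s in simp)
    have "norm (?Y o\<^sub>L dg J) \<le> M / ?s + 2 * M * ?s powr (\<alpha> - 1) * (c' * (M / ?s))"
      unfolding eq by (intro order_trans[OF norm_triangle_ineq4] add_mono nYJ norm_blinfun_compose_mult 3 TJ)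
    also have "\<dots> = M / ?s + 2 * (c' * (M * ?s powr (\<alpha> - 1))) * (M / ?s)" by (simp add: mult_ac)
    also have "\<dots> \<le> M / ?s + 2 * (1 / 2) * (M / ?s)"
      using half pos s by (intro add_left_mono mult_right_mono mult_left_mono) auto
    finally have 4: "norm (?Y o\<^sub>L dg J) \<le> 2 * M / ?s" by simp
    show ?thesis unfolding res_bd_def using V(1) 1 2 3 4 by (intro exI[of _ "R o\<^sub>L V"] exI[of _ ?Y]) auto
  qed
  hence "\<forall>\<zeta>. r \<le> cmod \<zeta> \<and> - d * \<bar>Im \<zeta>\<bar> \<le> Re \<zeta> \<longrightarrow> res_bd D L J \<alpha> (2 * M) \<zeta> (cmod \<zeta>)" by simp
  thus ?thesis unfolding ares_def using d pos(3) by metis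
qed

subsection \<open>Fractional powers\<close>

interpretation bc: bounded_bilinear "(o\<^sub>L)" by (rule bounded_bilinear_blinfun_compose)

text \<open>This takes the place of differentiation under the integral sign: resolvent identities
  give remainders with the factor \<open>(y - t)\<^sup>2\<close> and an integrable bound.\<close>

lemma has_vector_derivative_quadratic:
  fixes f :: "real \<Rightarrow> 'a::real_normed_vector"
  assumes "e > 0" and q: "\<And>y. \<bar>y - t\<bar> < e \<Longrightarrow> norm (f y - f t - (y - t) *\<^sub>R D) \<le> C * (y - t)\<^sup>2"
  shows "(f has_vector_derivative D) (at t)"
  unfolding has_vector_derivative_def
proof (rule has_derivativeI_sandwich[where e = e and H = "\<lambda>y. \<bar>C\<bar> * \<bar>y - t\<bar>"])
  show "norm (f y - f t - (y - t) *\<^sub>R D) / norm (y - t) \<le> \<bar>C\<bar> * \<bar>y - t\<bar>" if "y \<noteq> t" "dist y t < e" for y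
  proof -
    have "norm (f y - f t - (y - t) *\<^sub>R D) \<le> \<bar>C\<bar> * (y - t)\<^sup>2"
      by (rule order_trans[OF q mult_right_mono]) (use that(2) in \<open>auto simp: dist_real_def\<close>)
    also have "\<dots> = (\<bar>C\<bar> * \<bar>y - t\<bar>) * norm (y - t)" by (simp add: power2_eq_square abs_mult_self_eq mult.assoc)
    finally show ?thesis using that by (simp add: pos_divide_le_eq)
  qed
  have "((\<lambda>y. \<bar>C\<bar> * \<bar>y - t\<bar>) \<longlongrightarrow> \<bar>C\<bar> * \<bar>t - t\<bar>) (at t)" by (intro tendsto_intros)
  thus "((\<lambda>y. \<bar>C\<bar> * \<bar>y - t\<bar>) \<longlongrightarrow> 0) (at t)" by simp
qed (use assms in \<open>auto intro: bounded_linear_scaleR_left\<close>)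

text \<open>The integrand is s^(-b) min (1/a) (1/s), the common majorant of the two bounds in
  \<open>frac_integral\<close>.\<close>

lemma has_integral_frac_kernel:
  fixes a b :: real
  assumes "0 < a" "0 < b" "b < 1"
  shows "((\<lambda>s. if s \<le> a then s powr (- b) / a else s powr (- b - 1)) has_integral
    a powr (- b) * (1 / (1 - b) + 1 / b)) {0<..}"
    (is "(?g has_integral _) _")
proof -
  have "((\<lambda>s. s powr (- b) * (1 / a)) has_integral (a powr (- b + 1) / (- b + 1)) * (1 / a)) {0..a}"
    by (rule has_integral_mult_left[OF has_integral_powr_from_0]) (use assms in auto)
  moreover have "(a powr (- b + 1) / (- b + 1)) * (1 / a) = a powr (- b) * (1 / (1 - b))"
    unfolding powr_add using assms by simp
  ultimately have 1: "(?g has_integral a powr (- b) * (1 / (1 - b))) {0..a}"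
    by (subst has_integral_cong[where g = "\<lambda>s. s powr (- b) * (1 / a)"]) auto
  have "((\<lambda>s. s powr (- b - 1)) has_integral - (a powr (- b - 1 + 1)) / (- b - 1 + 1)) {a..}"
    by (rule has_integral_powr_to_inf) (use assms in auto)
  hence "((\<lambda>s. s powr (- b - 1)) has_integral a powr (- b) * (1 / b)) {a..}" by simp
  hence 2: "(?g has_integral a powr (- b) * (1 / b)) {a..}"
    by (rule has_integral_spike_finite[of "{a}", rotated 2]) auto
  have "(?g has_integral a powr (- b) * (1 / (1 - b)) + a powr (- b) * (1 / b)) ({0..a} \<union> {a..})"
    by (rule has_integral_Un[OF 1 2]) (use assms in \<open>auto intro: negligible_subset[of "{a}"]\<close>)
  moreover have "{0..a} \<union> {a..} = {0..}" using assms by auto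
  ultimately have "(?g has_integral a powr (- b) * (1 / (1 - b) + 1 / b)) {0..}" by (simp add: distrib_left)
  moreover have "{s \<in> {0..} - {0<..}. ?g s \<noteq> 0} = {}" "{s \<in> {0<..} - {0..}. ?g s \<noteq> 0} = {}"
    using assms by (auto split: if_splits)
  ultimately show ?thesis
    using has_integral_spike_set_eq[of "{0..}" "{0<..}" ?g] by (simp only: negligible_empty)
qed

text \<open>The two bounds on \<open>F\<close> balance at s = a, which produces the power a^(-b).
  With a = |\<zeta>| and b = 1 - \<alpha> this is the origin of the rate
  |\<zeta>|^(\<alpha>-1).\<close>

lemma frac_integral:
  fixes F :: "real \<Rightarrow> 'a::banach"
  assumes a: "0 < a" and b: "0 < b" "b < 1" and cont: "continuous_on {0<..} F"
    and le: "\<And>s. 0 < s \<Longrightarrow> norm (F s) \<le> C / a" "\<And>s. 0 < s \<Longrightarrow> norm (F s) \<le> C / s"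
  shows "(\<lambda>s. s powr (- b) *\<^sub>R F s) integrable_on {0<..}"
    "norm (integral {0<..} (\<lambda>s. s powr (- b) *\<^sub>R F s)) \<le> C * (a powr (- b) * (1 / (1 - b) + 1 / b))"
proof -
  let ?g = "\<lambda>s. if s \<le> a then s powr (- b) / a else s powr (- b - 1)"
  have g: "((\<lambda>s. C * ?g s) has_integral C * (a powr (- b) * (1 / (1 - b) + 1 / b))) {0<..}"
    by (rule has_integral_mult_right[OF has_integral_frac_kernel[OF a b]])
  have le': "norm (s powr (- b) *\<^sub>R F s) \<le> C * ?g s" if "s > 0" for s
  proof -
    have "norm (s powr (- b) *\<^sub>R F s) \<le> s powr (- b) * (if s \<le> a then C / a else C / s)"
      unfolding norm_scaleR using le[OF that] by (intro mult_mono) auto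
    also have "\<dots> = C * ?g s" using that by (simp add: powr_diff)
    finally show ?thesis .
  qed
  show int: "(\<lambda>s. s powr (- b) *\<^sub>R F s) integrable_on {0<..}"
    by (rule integrable_Ioi_dominated[OF _ has_integral_integrable[OF g] le'])
      (auto intro!: continuous_intros cont)
  have "norm (integral {0<..} (\<lambda>s. s powr (- b) *\<^sub>R F s)) \<le> integral {0<..} (\<lambda>s. C * ?g s)"
    by (rule integral_norm_bound_integral[OF int has_integral_integrable[OF g]]) (use le' in auto)
  thus "norm (integral {0<..} (\<lambda>s. s powr (- b) *\<^sub>R F s)) \<le> C * (a powr (- b) * (1 / (1 - b) + 1 / b))"
    unfolding integral_unique[OF g] .
qed

text \<open>A family \<open>r s\<close> that behaves like \<open>(s + A)\<^sup>-\<^sup>1\<close> for \<open>s > 0\<close>; \<open>frac_int b l\<close> is then, up to a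
  constant, \<open>(l + A)\<^sup>-\<^sup>b\<close>.\<close>

locale real_resolvent =
  fixes r :: "real \<Rightarrow> 'x::banach \<Rightarrow>\<^sub>L 'x" and M :: real
  assumes res_id: "\<And>s t. 0 < s \<Longrightarrow> 0 < t \<Longrightarrow> r s - r t = (t - s) *\<^sub>R (r s o\<^sub>L r t)"
    and res_norm: "\<And>s. 0 < s \<Longrightarrow> norm (r s) \<le> M / s"
begin

definition frac_int :: "real \<Rightarrow> real \<Rightarrow> 'x \<Rightarrow>\<^sub>L 'x" where
  "frac_int b l = integral {0<..} (\<lambda>s. s powr (- b) *\<^sub>R r (s + l))"

lemma M_nonneg: "0 \<le> M"
  using order_trans[OF norm_ge_zero res_norm[of 1]] by simp

lemma res_commute: "0 < s \<Longrightarrow> 0 < t \<Longrightarrow> r s o\<^sub>L r t = r t o\<^sub>L r s"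
proof (cases "s = t")
  case False
  assume "0 < s" "0 < t"
  hence "(t - s) *\<^sub>R (r s o\<^sub>L r t) = - ((s - t) *\<^sub>R (r t o\<^sub>L r s))"
    using res_id[of s t] res_id[of t s] by (metis minus_diff_eq)
  hence "(t - s) *\<^sub>R (r s o\<^sub>L r t) = (t - s) *\<^sub>R (r t o\<^sub>L r s)" by (simp add: scaleR_minus_left[symmetric])
  thus ?thesis using False by simp
qed simp

lemma res_taylor:
  assumes "0 < s" "0 < t"
  shows "r s - r t + (s - t) *\<^sub>R (r t o\<^sub>L r t) = (s - t)\<^sup>2 *\<^sub>R (r s o\<^sub>L (r t o\<^sub>L r t))"
proof -
  have "r s - r t + (s - t) *\<^sub>R (r t o\<^sub>L r t) = (s - t) *\<^sub>R ((r t - r s) o\<^sub>L r t)"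
    using res_id[OF assms] by (simp add: bc.diff_left algebra_simps)
  also have "\<dots> = (s - t) *\<^sub>R ((s - t) *\<^sub>R (r t o\<^sub>L r s) o\<^sub>L r t)" using res_id[OF assms(2,1)] by simp
  also have "\<dots> = (s - t)\<^sup>2 *\<^sub>R (r s o\<^sub>L (r t o\<^sub>L r t))"
    by (simp add: bc.scaleR_left power2_eq_square blinfun_compose_assoc res_commute[OF assms(2,1)])
  finally show ?thesis .
qed

lemma res_derivative:
  assumes t: "0 < t"
  shows "(r has_vector_derivative - (r t o\<^sub>L r t)) (at t)"
proof (rule has_vector_derivative_quadratic[of "t / 2"])
  fix s assume "\<bar>s - t\<bar> < t / 2"
  hence s: "t / 2 < s" by linarith
  have "norm (r s) \<le> M / (t / 2)" by (rule order_trans[OF res_norm divide_left_mono]) (use s t M_nonneg in auto)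
  hence "norm (r s o\<^sub>L (r t o\<^sub>L r t)) \<le> M / (t / 2) * (M / t * (M / t))"
    by (intro norm_blinfun_compose_mult res_norm t)
  hence "(s - t)\<^sup>2 * norm (r s o\<^sub>L (r t o\<^sub>L r t)) \<le> (s - t)\<^sup>2 * (M / (t / 2) * (M / t * (M / t)))"
    by (intro mult_left_mono) auto
  moreover have "norm (r s - r t - (s - t) *\<^sub>R - (r t o\<^sub>L r t)) = (s - t)\<^sup>2 * norm (r s o\<^sub>L (r t o\<^sub>L r t))"
    using res_taylor[of s t] s t by simp
  ultimately show "norm (r s - r t - (s - t) *\<^sub>R - (r t o\<^sub>L r t)) \<le> (M / (t / 2) * (M / t * (M / t))) * (s - t)\<^sup>2"
    by (simp add: mult.commute)
qed (use t in simp)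

lemma res_continuous: "continuous_on {0<..} r"
  by (intro continuous_at_imp_continuous_on ballI has_vector_derivative_continuous)
    (auto intro: res_derivative)

lemma res_shift_continuous: "0 < l \<Longrightarrow> continuous_on {0..} (\<lambda>s. r (s + l))"
  by (rule continuous_on_compose2[OF res_continuous]) (auto intro!: continuous_intros)

lemma res_shift_bound:
  assumes "0 < l" "0 \<le> s"
  shows "norm (r (s + l)) \<le> M / l" "0 < s \<Longrightarrow> norm (r (s + l)) \<le> M / s"
  by (rule order_trans[OF res_norm divide_left_mono], use assms M_nonneg in auto)+

lemma frac_int_integrable:
  assumes "0 < l" "0 < b" "b < 1"
  shows "(\<lambda>s. s powr (- b) *\<^sub>R r (s + l)) integrable_on {0<..}"
  by (rule frac_integral(1)[OF assms(1-3), of _ M])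
    (use assms res_shift_bound in \<open>auto intro: continuous_on_subset[OF res_shift_continuous]\<close>)

lemma res2_integrable:
  assumes "0 < l" "0 < b" "b < 1"
  shows "(\<lambda>s. s powr (- b) *\<^sub>R (r (s + l) o\<^sub>L r (s + l))) integrable_on {0<..}"
proof (rule frac_integral(1)[OF assms(1-3), of _ "M * (M / l)"])
  show "continuous_on {0<..} (\<lambda>s. r (s + l) o\<^sub>L r (s + l))"
    by (intro continuous_intros continuous_on_subset[OF res_shift_continuous[OF assms(1)]]) auto
  show "norm (r (s + l) o\<^sub>L r (s + l)) \<le> M * (M / l) / l" if "0 < s" for s
    using norm_blinfun_compose_mult[OF res_shift_bound(1) res_shift_bound(1), of l s l s] that assms
    by (simp add: mult.commute)
  show "norm (r (s + l) o\<^sub>L r (s + l)) \<le> M * (M / l) / s" if "0 < s" for s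
    using norm_blinfun_compose_mult[OF res_shift_bound(2) res_shift_bound(1), of l s l s] that assms
    by (simp add: mult.commute)
qed

lemma integral_compose_left:
  fixes F :: "real \<Rightarrow> 'x \<Rightarrow>\<^sub>L 'x"
  shows "F integrable_on S \<Longrightarrow> integral S (\<lambda>s. G o\<^sub>L F s) = G o\<^sub>L integral S F"
  using integral_linear[OF _ bc.bounded_linear_right[of G], of F S] by (simp add: o_def)

lemma integral_compose_right:
  fixes F :: "real \<Rightarrow> 'x \<Rightarrow>\<^sub>L 'x"
  shows "F integrable_on S \<Longrightarrow> integral S (\<lambda>s. F s o\<^sub>L G) = integral S F o\<^sub>L G"
  using integral_linear[OF _ bc.bounded_linear_left[of G], of F S] by (simp add: o_def)

lemma frac_int_commute:
  assumes "0 < l" "0 < b" "b < 1" and G: "\<And>s. 0 < s \<Longrightarrow> G o\<^sub>L r s = r s o\<^sub>L G"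
  shows "G o\<^sub>L frac_int b l = frac_int b l o\<^sub>L G"
proof -
  note int = frac_int_integrable[OF assms(1-3)]
  have "G o\<^sub>L frac_int b l = integral {0<..} (\<lambda>s. G o\<^sub>L (s powr (- b) *\<^sub>R r (s + l)))"
    unfolding frac_int_def by (rule integral_compose_left[OF int, symmetric])
  also have "\<dots> = integral {0<..} (\<lambda>s. (s powr (- b) *\<^sub>R r (s + l)) o\<^sub>L G)"
    by (rule integral_cong) (use G assms(1) in \<open>auto simp: bc.scaleR_left bc.scaleR_right\<close>)
  also have "\<dots> = frac_int b l o\<^sub>L G" unfolding frac_int_def by (rule integral_compose_right[OF int])
  finally show ?thesis .
qed

text \<open>Integration by parts: \<open>H\<close> vanishes at 0 because b < 1 and decays like
  s^(-b), and its derivative is the difference of the two integrands. In terms of A this is (l +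
  A)^(-b-1) = (l + A)^(-1) (l + A)^(-b), which closes the differential equation for
  \<open>frac_int\<close>.\<close>

lemma res2_integral:
  assumes t: "0 < l" and b: "0 < b" "b < 1"
  shows "integral {0<..} (\<lambda>s. s powr (- b) *\<^sub>R (r (s + l) o\<^sub>L r (s + l))) = b *\<^sub>R (r l o\<^sub>L frac_int b l)"
proof -
  let ?r = "\<lambda>s. r (s + l)"
  define H where "H s = s powr (1 - b) *\<^sub>R (r l o\<^sub>L ?r s)" for s
  define h where "h s = s powr (- b) *\<^sub>R (?r s o\<^sub>L ?r s) - b *\<^sub>R (r l o\<^sub>L (s powr (- b) *\<^sub>R ?r s))" for s
  note int1 = res2_integrable[OF assms] and int2 = frac_int_integrable[OF assms]
  have int2': "(\<lambda>s. r l o\<^sub>L (s powr (- b) *\<^sub>R ?r s)) integrable_on {0<..}"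
    using integrable_linear[OF int2 bc.bounded_linear_right[of "r l"]] by (simp add: o_def)
  have inth: "h integrable_on {0<..}" unfolding h_def by (intro integrable_diff int1 integrable_cmul int2')
  have der: "(H has_vector_derivative h s) (at s)" if s: "0 < s" for s
  proof -
    have d1: "((\<lambda>s. s powr (1 - b)) has_real_derivative (1 - b) * s powr (- b)) (at s)"
      using s by (auto intro!: derivative_eq_intros)
    have d2: "((\<lambda>s. r l o\<^sub>L ?r s) has_vector_derivative r l o\<^sub>L - (?r s o\<^sub>L ?r s)) (at s)"
    proof (rule bounded_linear.has_vector_derivative[OF bc.bounded_linear_right])
      have "((\<lambda>s. s + l) has_vector_derivative 1) (at s)" by (auto intro!: derivative_eq_intros)
      from vector_diff_chain_at[OF this, of r "- (?r s o\<^sub>L ?r s)"] res_derivative[of "s + l"] s t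
      show "((\<lambda>s. ?r s) has_vector_derivative - (?r s o\<^sub>L ?r s)) (at s)" by (simp add: o_def)
    qed
    have "(H has_vector_derivative (s powr (1 - b) *\<^sub>R (r l o\<^sub>L - (?r s o\<^sub>L ?r s)) +
        ((1 - b) * s powr (- b)) *\<^sub>R (r l o\<^sub>L ?r s))) (at s)"
      unfolding H_def by (rule has_vector_derivative_scaleR[OF d1 d2])
    moreover have "s powr (1 - b) *\<^sub>R (r l o\<^sub>L - (?r s o\<^sub>L ?r s)) +
        ((1 - b) * s powr (- b)) *\<^sub>R (r l o\<^sub>L ?r s) = h s"
    proof -
      have "r l = ?r s + s *\<^sub>R (r l o\<^sub>L ?r s)" using res_id[of l "s + l"] s t by (simp add: algebra_simps)
      hence "r l o\<^sub>L ?r s = (?r s + s *\<^sub>R (r l o\<^sub>L ?r s)) o\<^sub>L ?r s" by metis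
      hence *: "r l o\<^sub>L ?r s = (?r s o\<^sub>L ?r s) + s *\<^sub>R (r l o\<^sub>L (?r s o\<^sub>L ?r s))"
        by (simp add: bc.add_left bc.scaleR_left blinfun_compose_assoc)
      have p: "s powr (1 - b) = s powr (- b) * s" using s by (simp add: powr_diff powr_minus divide_inverse)
      have "?r s o\<^sub>L ?r s = (r l o\<^sub>L ?r s) - s *\<^sub>R (r l o\<^sub>L (?r s o\<^sub>L ?r s))" by (subst *) simp
      hence "h s = s powr (- b) *\<^sub>R ((r l o\<^sub>L ?r s) - s *\<^sub>R (r l o\<^sub>L (?r s o\<^sub>L ?r s))) -
          b *\<^sub>R s powr (- b) *\<^sub>R (r l o\<^sub>L ?r s)" unfolding h_def by (simp add: bc.scaleR_right)
      thus ?thesis by (simp add: p bc.minus_right scaleR_diff_right scaleR_diff_left left_diff_distrib)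
    qed
    ultimately show ?thesis by simp
  qed
  have lim: "(H \<longlongrightarrow> 0) at_top"
  proof (rule Lim_null_comparison)
    have "norm (H s) \<le> norm (r l) * M * s powr (- b)" if "s \<ge> 1" for s
    proof -
      have "norm (H s) \<le> s powr (1 - b) * (norm (r l) * (M / s))" unfolding H_def norm_scaleR using that t
        by (intro mult_mono norm_blinfun_compose_mult res_shift_bound order_refl) auto
      also have "\<dots> = norm (r l) * M * s powr (- b)"
        using that by (simp add: powr_diff powr_minus divide_inverse)
      finally show ?thesis .
    qed
    thus "\<forall>\<^sub>F s in at_top. norm (H s) \<le> norm (r l) * M * s powr (- b)"
      unfolding eventually_at_top_linorder by blast
    have "((\<lambda>s. s powr (- b)) \<longlongrightarrow> 0) at_top" using b by (intro tendsto_neg_powr filterlim_ident) auto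
    thus "((\<lambda>s. norm (r l) * M * s powr (- b)) \<longlongrightarrow> 0) at_top" by (rule tendsto_mult_right_zero)
  qed
  have contH: "continuous_on {0..} H" unfolding H_def
    by (intro continuous_intros res_shift_continuous[OF t] continuous_on_powr') (use b in auto)
  have "integral {0<..} h = 0" using integral_derivative_Ioi[OF der inth lim contH] b by (simp add: H_def)
  moreover have "integral {0<..} h = integral {0<..} (\<lambda>s. s powr (- b) *\<^sub>R (?r s o\<^sub>L ?r s)) -
      b *\<^sub>R (r l o\<^sub>L frac_int b l)" unfolding h_def frac_int_def
    by (simp add: integral_diff[OF int1 integrable_cmul[OF int2']] integral_compose_left[OF int2])
  ultimately show ?thesis by simp
qed

text \<open>\<open>res_taylor\<close> under the integral leaves a remainder with the factor
  \<open>(m - l)\<^sup>2\<close>, and \<open>res2_integral\<close> evaluates the linear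
  term.\<close>

lemma frac_int_derivative:
  assumes t: "0 < l" and b: "0 < b" "b < 1"
  shows "(frac_int b has_vector_derivative - b *\<^sub>R (r l o\<^sub>L frac_int b l)) (at l)"
proof -
  define C where "C = (M / (l / 2) * (M / l * M)) * (l powr (- b) * (1 / (1 - b) + 1 / b))"
  show ?thesis
  proof (rule has_vector_derivative_quadratic[of "l / 2" _ _ _ C])
    fix m assume "\<bar>m - l\<bar> < l / 2"
    hence sg: "l / 2 < m" by linarith
    hence sg0: "0 < m" using t by linarith
    define F where "F s = r (s + m) o\<^sub>L (r (s + l) o\<^sub>L r (s + l))" for s
    have eq: "s powr (- b) *\<^sub>R r (s + m) - s powr (- b) *\<^sub>R r (s + l) +
        (m - l) *\<^sub>R (s powr (- b) *\<^sub>R (r (s + l) o\<^sub>L r (s + l))) = (m - l)\<^sup>2 *\<^sub>R (s powr (- b) *\<^sub>R F s)"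
      if "0 < s" for s
    proof -
      have "s powr (- b) *\<^sub>R r (s + m) - s powr (- b) *\<^sub>R r (s + l) +
        (m - l) *\<^sub>R (s powr (- b) *\<^sub>R (r (s + l) o\<^sub>L r (s + l))) =
        s powr (- b) *\<^sub>R (r (s + m) - r (s + l) + ((s + m) - (s + l)) *\<^sub>R (r (s + l) o\<^sub>L r (s + l)))"
        by (simp add: algebra_simps)
      also have "\<dots> = s powr (- b) *\<^sub>R ((m - l)\<^sup>2 *\<^sub>R F s)"
        using res_taylor[of "s + m" "s + l"] that t sg0 by (simp add: F_def)
      finally show ?thesis by simp
    qed
    have b1: "norm (r (s + m)) \<le> M / (l / 2)" if "0 < s" for s
      by (rule order_trans[OF res_shift_bound(1)[OF sg0] divide_left_mono])
        (use sg t M_nonneg that in auto)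
    have F: "norm (F s) \<le> (M / (l / 2) * (M / l * M)) / l" "norm (F s) \<le> (M / (l / 2) * (M / l * M)) / s"
      if "0 < s" for s
      using norm_blinfun_compose_mult[OF b1[OF that] norm_blinfun_compose_mult[OF res_shift_bound(1)[OF t] res_shift_bound(1)[OF t]], of s s]
         norm_blinfun_compose_mult[OF b1[OF that] norm_blinfun_compose_mult[OF res_shift_bound(1)[OF t] res_shift_bound(2)[OF t]], of s s]
         that by (auto simp: F_def)
    have cF: "continuous_on {0<..} F" unfolding F_def
      by (intro continuous_intros continuous_on_subset[OF res_shift_continuous[OF t]]
          continuous_on_subset[OF res_shift_continuous[OF sg0]]) auto
    note iF = frac_integral[OF t b cF F]
    note i1 = frac_int_integrable[OF sg0 b] and i2 = frac_int_integrable[OF t b] and i3 = res2_integrable[OF t b]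
    have "frac_int b m - frac_int b l - (m - l) *\<^sub>R - b *\<^sub>R (r l o\<^sub>L frac_int b l) =
       integral {0<..} (\<lambda>s. s powr (- b) *\<^sub>R r (s + m) - s powr (- b) *\<^sub>R r (s + l) +
        (m - l) *\<^sub>R (s powr (- b) *\<^sub>R (r (s + l) o\<^sub>L r (s + l))))"
      using integral_unique[OF has_integral_add[OF has_integral_diff[OF integrable_integral[OF i1]
          integrable_integral[OF i2]] has_integral_cmul[OF integrable_integral[OF i3], of "m - l"]]]
      by (simp add: res2_integral[OF t b] frac_int_def)
    also have "\<dots> = integral {0<..} (\<lambda>s. (m - l)\<^sup>2 *\<^sub>R (s powr (- b) *\<^sub>R F s))"
      by (rule integral_cong, rule eq) simp
    also have "\<dots> = (m - l)\<^sup>2 *\<^sub>R integral {0<..} (\<lambda>s. s powr (- b) *\<^sub>R F s)" by (rule integral_cmul)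
    finally have "norm (frac_int b m - frac_int b l - (m - l) *\<^sub>R - b *\<^sub>R (r l o\<^sub>L frac_int b l)) =
      (m - l)\<^sup>2 * norm (integral {0<..} (\<lambda>s. s powr (- b) *\<^sub>R F s))" by simp
    also have "\<dots> \<le> (m - l)\<^sup>2 * C" unfolding C_def by (intro mult_left_mono iF(2)) auto
    finally show "norm (frac_int b m - frac_int b l - (m - l) *\<^sub>R (- b *\<^sub>R (r l o\<^sub>L frac_int b l))) \<le> C * (m - l)\<^sup>2"
      by (simp add: mult.commute)
  qed (use t in simp)
qed

text \<open>\<open>(l + A)\<close> times the product of the two fractional integrals does not depend on \<open>l\<close>.\<close>

lemma frac_int_product_constant:
  assumes t: "0 < l" "0 < m" and b: "0 < b" "b < 1"
  shows "(id_blinfun + (m - l) *\<^sub>R r l) o\<^sub>L (frac_int b m o\<^sub>L frac_int (1 - b) m) =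
    frac_int b l o\<^sub>L frac_int (1 - b) l"
proof -
  define P where "P m = frac_int b m o\<^sub>L frac_int (1 - b) m" for m
  define Z where "Z m = (id_blinfun + (m - l) *\<^sub>R r l) o\<^sub>L P m" for m
  have b': "0 < 1 - b" "1 - b < 1" using b by auto
  have dP: "(P has_vector_derivative - (r s o\<^sub>L P s)) (at s)" if s: "0 < s" for s
  proof -
    have com: "frac_int b s o\<^sub>L r s = r s o\<^sub>L frac_int b s"
      using frac_int_commute[OF s b, of "r s"] res_commute[OF s] by simp
    have "(P has_vector_derivative (frac_int b s o\<^sub>L (- (1 - b) *\<^sub>R (r s o\<^sub>L frac_int (1 - b) s))) +
       ((- b *\<^sub>R (r s o\<^sub>L frac_int b s)) o\<^sub>L frac_int (1 - b) s)) (at s)" unfolding P_def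
      by (rule bc.has_vector_derivative[OF frac_int_derivative[OF s b] frac_int_derivative[OF s b']])
    moreover have "(frac_int b s o\<^sub>L (- (1 - b) *\<^sub>R (r s o\<^sub>L frac_int (1 - b) s))) +
       ((- b *\<^sub>R (r s o\<^sub>L frac_int b s)) o\<^sub>L frac_int (1 - b) s) = - (r s o\<^sub>L P s)"
    proof -
      have "frac_int b s o\<^sub>L (r s o\<^sub>L frac_int (1 - b) s) = r s o\<^sub>L P s"
        unfolding P_def by (simp add: blinfun_compose_assoc[symmetric] com)
      thus ?thesis unfolding bc.scaleR_right bc.scaleR_left blinfun_compose_assoc[of "r s"] P_def[symmetric]
        by (simp add: algebra_simps)
    qed
    ultimately show ?thesis by simp
  qed
  have dZ: "(Z has_vector_derivative 0) (at s)" if s: "0 < s" for s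
  proof -
    have "((\<lambda>m. id_blinfun + (m - l) *\<^sub>R r l) has_vector_derivative r l) (at s)"
      by (auto intro!: derivative_eq_intros)
    from bc.has_vector_derivative[OF this dP[OF s]]
    have "(Z has_vector_derivative ((id_blinfun + (s - l) *\<^sub>R r l) o\<^sub>L - (r s o\<^sub>L P s)) + (r l o\<^sub>L P s)) (at s)"
      unfolding Z_def by simp
    \<comment> \<open>By the resolvent identity the first factor times \<open>r s\<close> is
      \<open>r l\<close>, so the two terms of the derivative cancel.\<close>
    moreover have "(id_blinfun + (s - l) *\<^sub>R r l) o\<^sub>L r s = r l"
      using res_id[OF t(1) s] unfolding bc.add_left bc.scaleR_left by simp (metis add_diff_cancel_left' diff_add_cancel)
    hence "((id_blinfun + (s - l) *\<^sub>R r l) o\<^sub>L - (r s o\<^sub>L P s)) + (r l o\<^sub>L P s) = 0"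
      by (simp add: bc.minus_right blinfun_compose_assoc[symmetric])
    ultimately show ?thesis by simp
  qed
  obtain c where c: "\<And>s. s \<in> {0<..} \<Longrightarrow> Z s = c" by (rule has_vector_derivative_zero_constant[of "{0<..}" Z])
      (use dZ in \<open>auto intro: has_vector_derivative_at_within\<close>)
  have "Z m = Z l" using c t by simp
  thus ?thesis by (simp add: Z_def P_def)
qed

end

text \<open>The Beta integral \<pi> l^(-b) / sin (\<pi> b), the value of \<open>frac_int\<close> for
  the resolvent 1/s on the real line.\<close>

definition scal_kernel :: "real \<Rightarrow> real \<Rightarrow> real" where
  "scal_kernel b l = integral {0<..} (\<lambda>s. s powr (- b) / (s + l))"

lemma scal_kernel_integrable:
  fixes l b :: real
  assumes "0 < l" "0 < b" "b < 1"
  shows "(\<lambda>s. s powr (- b) / (s + l)) integrable_on {0<..}"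
proof -
  have "(\<lambda>s. s powr (- b) *\<^sub>R (1 / (s + l))) integrable_on {0<..}" by (rule frac_integral(1)[OF assms, of _ 1])
      (use assms in \<open>auto intro!: continuous_intros simp: frac_le\<close>)
  thus ?thesis by simp
qed

lemma scal_kernel_pos:
  fixes l b :: real
  assumes "0 < l" "0 < b" "b < 1"
  shows "0 < scal_kernel b l"
proof -
  let ?f = "\<lambda>s::real. s powr (- b) / (s + l)"
  have int: "?f integrable_on {1..2}"
    by (rule integrable_continuous_interval) (use assms in \<open>auto intro!: continuous_intros\<close>)
  have "0 < 2 powr (- b) / (2 + l)" using assms by simp
  also have "\<dots> = integral {1..2::real} (\<lambda>s. 2 powr (- b) / (2 + l))" by simp
  also have "\<dots> \<le> integral {1..2} ?f"
    by (rule integral_le[OF _ int]) (use assms in \<open>auto intro!: frac_le powr_mono2'\<close>)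
  also have "\<dots> \<le> integral {0<..} ?f"
    by (rule integral_subset_le[OF _ int scal_kernel_integrable[OF assms]]) (use assms in auto)
  finally show ?thesis by (simp add: scal_kernel_def)
qed

text \<open>The case of the zero operator on the real line in
  \<open>frac_int_product_constant\<close>: for the resolvent 1/s, \<open>frac_int\<close> is
  multiplication by \<open>scal_kernel\<close>.\<close>

lemma scal_kernel_product:
  assumes t: "0 < l" "0 < m" and b: "0 < b" "b < 1"
  shows "m * (scal_kernel b m * scal_kernel (1 - b) m) = l * (scal_kernel b l * scal_kernel (1 - b) l)"
proof -
  let ?r = "\<lambda>s. (1 / s) *\<^sub>R (id_blinfun :: real \<Rightarrow>\<^sub>L real)"
  interpret sc: real_resolvent ?r 1
  proof
    show "?r s - ?r t = (t - s) *\<^sub>R (?r s o\<^sub>L ?r t)" if "0 < s" "0 < t" for s t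
      by (rule blinfun_eqI) (use that in \<open>simp add: blinfun.bilinear_simps field_simps\<close>)
    show "norm (?r s) \<le> 1 / s" if "0 < s" for s using that by simp
  qed
  have k: "blinfun_apply (sc.frac_int \<gamma> \<rho>) x = scal_kernel \<gamma> \<rho> * x" if "0 < \<rho>" "0 < \<gamma>" "\<gamma> < 1" for \<rho> \<gamma> x
  proof -
    have "integral {0<..} ((\<lambda>f. blinfun_apply f x) \<circ> (\<lambda>s. s powr (- \<gamma>) *\<^sub>R ?r (s + \<rho>))) = blinfun_apply (sc.frac_int \<gamma> \<rho>) x"
      unfolding sc.frac_int_def
      by (rule integral_linear[OF sc.frac_int_integrable[OF that] blinfun.bounded_linear_left])
    hence "blinfun_apply (sc.frac_int \<gamma> \<rho>) x = integral {0<..} (\<lambda>s. (s powr (- \<gamma>) / (s + \<rho>)) * x)"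
      by (simp add: o_def blinfun.scaleR_left)
    also have "\<dots> = scal_kernel \<gamma> \<rho> * x" unfolding scal_kernel_def by (rule integral_mult_left)
    finally show ?thesis .
  qed
  have b': "0 < 1 - b" "1 - b < 1" using b by auto
  have "(1 + (m - l) * (1 / l)) * (scal_kernel b m * scal_kernel (1 - b) m) = scal_kernel b l * scal_kernel (1 - b) l"
    using arg_cong[OF sc.frac_int_product_constant[OF t b], of "\<lambda>f. blinfun_apply f 1"] b b' t
    by (simp add: k blinfun.add_left blinfun.scaleR_left algebra_simps)
  thus ?thesis using t by (simp add: field_simps)
qed

context real_resolvent
begin

lemma frac_int_apply:
  assumes "0 < l" "0 < b" "b < 1"
  shows "((\<lambda>s. s powr (- b) *\<^sub>R r (s + l) x) has_integral frac_int b l x) {0<..}"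
  using has_integral_linear[OF integrable_integral[OF frac_int_integrable[OF assms]] blinfun.bounded_linear_left[of x]]
  by (simp add: o_def blinfun.scaleR_left frac_int_def)

lemma norm_frac_int:
  assumes "0 < l" "0 < b" "b < 1"
  shows "norm (frac_int b l) \<le> M * scal_kernel b l"
proof -
  have "norm (frac_int b l) \<le> integral {0<..} (\<lambda>s. M * (s powr (- b) / (s + l)))" unfolding frac_int_def
  proof (rule integral_norm_bound_integral[OF frac_int_integrable[OF assms]])
    show "(\<lambda>s. M * (s powr (- b) / (s + l))) integrable_on {0<..}"
      using integrable_on_cmult_left[OF scal_kernel_integrable[OF assms], of M] by simp
    show "norm (s powr (- b) *\<^sub>R r (s + l)) \<le> M * (s powr (- b) / (s + l))" if "s \<in> {0<..}" for s
      using mult_left_mono[OF res_norm[of "s + l"], of "s powr (- b)"] that assms by (simp add: mult_ac)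
  qed
  also have "\<dots> = M * scal_kernel b l" unfolding scal_kernel_def by (rule integral_mult_right)
  finally show ?thesis .
qed

text \<open>On vectors with r(s) x = x/s + O(1/s^2), as in the domain, (l + A)^(-b) acts for large l
  like l^(-b) up to a relative error 1/l.\<close>

lemma frac_int_asymp:
  assumes t: "0 < l" and b: "0 < b" "b < 1"
    and x: "\<And>s. 0 < s \<Longrightarrow> norm (r s x - (1 / s) *\<^sub>R x) \<le> C / s\<^sup>2"
  shows "norm (frac_int b l x - scal_kernel b l *\<^sub>R x) \<le> C / l * scal_kernel b l"
proof -
  have C: "0 \<le> C" using order_trans[OF norm_ge_zero x[of 1]] by simp
  have 1: "((\<lambda>s. s powr (- b) *\<^sub>R r (s + l) x - (s powr (- b) / (s + l)) *\<^sub>R x) has_integral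
      (frac_int b l x - scal_kernel b l *\<^sub>R x)) {0<..}" (is "(?f has_integral _) _") unfolding scal_kernel_def
    by (intro has_integral_diff frac_int_apply[OF assms(1-3)] has_integral_scaleR_left integrable_integral
        scal_kernel_integrable[OF assms(1-3)])
  have 2: "((\<lambda>s. C / l * (s powr (- b) / (s + l))) has_integral C / l * scal_kernel b l) {0<..}"
    unfolding scal_kernel_def
    by (intro has_integral_mult_right integrable_integral scal_kernel_integrable[OF assms(1-3)])
  have "norm (?f s) \<le> C / l * (s powr (- b) / (s + l))" if "s \<in> {0<..}" for s
  proof -
    have s: "0 < s" using that by simp
    have "?f s = s powr (- b) *\<^sub>R (r (s + l) x - (1 / (s + l)) *\<^sub>R x)" by (simp add: algebra_simps)
    hence "norm (?f s) \<le> s powr (- b) * (C / (s + l)\<^sup>2)"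
      using mult_left_mono[OF x[of "s + l"], of "s powr (- b)"] s t by simp
    also have "\<dots> \<le> s powr (- b) * (C / (l * (s + l)))"
      using C s t by (intro mult_left_mono divide_left_mono) (auto simp: power2_eq_square)
    finally show ?thesis by (simp add: mult_ac)
  qed
  thus ?thesis
    using integral_norm_bound_integral[OF has_integral_integrable[OF 1] has_integral_integrable[OF 2]]
    unfolding integral_unique[OF 1] integral_unique[OF 2] by blast
qed

text \<open>\<open>frac_int_product_constant\<close> allows m to tend to infinity. On the dense set
  the product at m behaves like (c/m) x, so 1 + (m - l) r(l) applied to it tends to c r(l) x. This
  is the law of exponents for b + (1 - b) = 1.\<close>

lemma frac_int_product:
  assumes t: "0 < l" and b: "0 < b" "b < 1"
    and dense: "closure {x. \<exists>C. \<forall>s>0. norm (r s x - (1 / s) *\<^sub>R x) \<le> C / s\<^sup>2} = UNIV"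
  shows "frac_int b l o\<^sub>L frac_int (1 - b) l = (l * (scal_kernel b l * scal_kernel (1 - b) l)) *\<^sub>R r l"
    (is "?P = ?c *\<^sub>R _")
proof -
  have b': "0 < 1 - b" "1 - b < 1" using b by auto
  have "?P x = ?c *\<^sub>R r l x" if x: "\<forall>s>0. norm (r s x - (1 / s) *\<^sub>R x) \<le> C / s\<^sup>2" for x C
  proof -
    let ?Q = "\<lambda>m. frac_int b m (frac_int (1 - b) m x)"
    have C: "0 \<le> C" using order_trans[OF norm_ge_zero x[rule_format, of 1]] by simp
    have Q: "norm (?Q m - (?c / m) *\<^sub>R x) \<le> (M + 1) * C * ?c / m\<^sup>2" if s: "0 < m" for m
    proof -
      let ?k = "scal_kernel b m" and ?k' = "scal_kernel (1 - b) m"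
      have kp: "0 < ?k" "0 < ?k'" using scal_kernel_pos s b b' by auto
      have c: "?c = m * (?k * ?k')" by (rule scal_kernel_product[OF s t b])
      have "?Q m - (?k * ?k') *\<^sub>R x =
          frac_int b m (frac_int (1 - b) m x - ?k' *\<^sub>R x) + ?k' *\<^sub>R (frac_int b m x - ?k *\<^sub>R x)"
        by (simp add: blinfun.diff_right blinfun.scaleR_right algebra_simps)
      also have "norm \<dots> \<le> M * ?k * (C / m * ?k') + ?k' * (C / m * ?k)"
      proof (intro order_trans[OF norm_triangle_ineq] add_mono)
        show "norm (frac_int b m (frac_int (1 - b) m x - ?k' *\<^sub>R x)) \<le> M * ?k * (C / m * ?k')"
          by (intro order_trans[OF norm_blinfun] mult_mono norm_frac_int frac_int_asymp s b b')
            (use x kp M_nonneg in auto)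
        show "norm (?k' *\<^sub>R (frac_int b m x - ?k *\<^sub>R x)) \<le> ?k' * (C / m * ?k)"
          unfolding norm_scaleR using kp x by (intro mult_mono frac_int_asymp s b b') auto
      qed
      also have "\<dots> = (M + 1) * C * ?c / m\<^sup>2" using s by (simp add: c field_simps power2_eq_square)
      finally show ?thesis using s c by simp
    qed
    have i: "((\<lambda>m::real. 1 / m) \<longlongrightarrow> 0) at_top"
      using tendsto_inverse_0_at_top[OF filterlim_ident] by (simp add: inverse_eq_divide)
    have lim: "((\<lambda>m. m *\<^sub>R ?Q m) \<longlongrightarrow> ?c *\<^sub>R x) at_top"
    proof (rule Lim_null[THEN iffD2], rule Lim_null_comparison)
      show "\<forall>\<^sub>F m in at_top. norm (m *\<^sub>R ?Q m - ?c *\<^sub>R x) \<le> (M + 1) * C * ?c * (1 / m)"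
        using eventually_gt_at_top[of 0]
      proof eventually_elim
        case (elim m)
        have "m *\<^sub>R ?Q m - ?c *\<^sub>R x = m *\<^sub>R (?Q m - (?c / m) *\<^sub>R x)" using elim by (simp add: scaleR_diff_right)
        thus ?case using mult_left_mono[OF Q[OF elim], of m] elim by (simp add: power2_eq_square)
      qed
      show "((\<lambda>m. (M + 1) * C * ?c * (1 / m)) \<longlongrightarrow> 0) at_top" by (rule tendsto_mult_right_zero[OF i])
    qed
    from tendsto_scaleR[OF i lim] have lim0: "((\<lambda>m. (1 / m) *\<^sub>R (m *\<^sub>R ?Q m)) \<longlongrightarrow> 0) at_top" by simp
    \<comment> \<open>The operator 1 + (m - l) r(l) is regrouped so that only m Q(m), which
      converges, and (1/m) (m Q(m)), which tends to 0, occur.\<close>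
    have "((\<lambda>m. (1 / m) *\<^sub>R (m *\<^sub>R ?Q m) + (r l (m *\<^sub>R ?Q m) - l *\<^sub>R r l ((1 / m) *\<^sub>R (m *\<^sub>R ?Q m)))) \<longlongrightarrow>
        0 + (r l (?c *\<^sub>R x) - l *\<^sub>R r l 0)) at_top"
      by (intro tendsto_add tendsto_diff tendsto_scaleR[OF tendsto_const] bounded_linear.tendsto[OF blinfun.bounded_linear_right] lim lim0)
    moreover have "\<forall>\<^sub>F m in at_top. (1 / m) *\<^sub>R (m *\<^sub>R ?Q m) + (r l (m *\<^sub>R ?Q m) - l *\<^sub>R r l ((1 / m) *\<^sub>R (m *\<^sub>R ?Q m))) = ?P x"
      using eventually_gt_at_top[of 0]
    proof eventually_elim
      case (elim m)
      thus ?case using arg_cong[OF frac_int_product_constant[OF t elim b], of "\<lambda>f. blinfun_apply f x"]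
        by (simp add: blinfun.add_left blinfun.scaleR_left blinfun.scaleR_right blinfun.diff_left scaleR_diff_left)
    qed
    ultimately have "((\<lambda>m::real. ?P x) \<longlongrightarrow> 0 + (r l (?c *\<^sub>R x) - l *\<^sub>R r l 0)) at_top"
      by (rule Lim_transform_eventually)
    thus ?thesis by (simp add: tendsto_const_iff blinfun.scaleR_right)
  qed
  hence "{x. \<exists>C. \<forall>s>0. norm (r s x - (1 / s) *\<^sub>R x) \<le> C / s\<^sup>2} \<subseteq> {x. ?P x = (?c *\<^sub>R r l) x}"
    by (auto simp: blinfun.scaleR_left)
  moreover have "closed {x. ?P x = (?c *\<^sub>R r l) x}" by (intro closed_Collect_eq continuous_intros)
  ultimately have "closure {x. \<exists>C. \<forall>s>0. norm (r s x - (1 / s) *\<^sub>R x) \<le> C / s\<^sup>2} \<subseteq> {x. ?P x = (?c *\<^sub>R r l) x}"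
    by (rule closure_minimal)
  thus ?thesis using dense by (intro blinfun_eqI) auto
qed

end

section \<open>Resolvents at real points and the operator A^(-\<alpha>)\<close>

definition rresolv :: "'x::real_normed_vector set \<Rightarrow> ('x \<Rightarrow> 'x) \<Rightarrow> real \<Rightarrow> ('x \<Rightarrow>\<^sub>L 'x) \<Rightarrow> bool" where
  "rresolv D L s r \<longleftrightarrow> (\<forall>x. r x \<in> D \<and> s *\<^sub>R r x + L (r x) = x) \<and> (\<forall>u\<in>D. r (s *\<^sub>R u + L u) = u)"

lemma rresolvD:
  assumes "rresolv D L s r"
  shows "r x \<in> D" "s *\<^sub>R r x + L (r x) = x" "u \<in> D \<Longrightarrow> r (s *\<^sub>R u + L u) = u"
  using assms by (auto simp: rresolv_def)

lemma resolv_of_rresolv: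
  assumes "rresolv D L s r"
  shows "resolv D L (of_real s) (dg r)"
  unfolding resolv_def cscale_of_real
  using rresolvD[OF assms] by (auto simp: mem_Times_iff scaleR_prod_def prod_eq_iff)

lemma bounded_linear_inl: "bounded_linear (\<lambda>x::'x::real_normed_vector. (x, 0 :: 'x))"
  by (rule bounded_linear_intro[where K = 1]) (auto simp: norm_prod_def)

definition inl :: "'x::real_normed_vector \<Rightarrow>\<^sub>L ('x \<times> 'x)" where
  "inl = Blinfun (\<lambda>x. (x, 0))"

lemma inl_apply [simp]: "blinfun_apply inl x = (x, 0)"
  by (simp add: inl_def bounded_linear_Blinfun_apply bounded_linear_inl)

lemma norm_inl: "norm inl \<le> 1"
  by (rule norm_blinfun_bound) (auto simp: norm_prod_def)

lemma norm_fst_blinfun_le: "norm fst_blinfun \<le> 1"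
  by (rule norm_blinfun_bound) (auto simp: norm_fst_le)

text \<open>The real part of an operator of the complexification, restricted to X. It brings contour
  integrals, divided by 2 \<pi> i, back to X.\<close>

definition re_part :: "('x::real_normed_vector \<times> 'x) \<Rightarrow>\<^sub>L ('x \<times> 'x) \<Rightarrow> 'x \<Rightarrow>\<^sub>L 'x" where
  "re_part T = (fst_blinfun o\<^sub>L T) o\<^sub>L inl"

lemma re_part_apply: "re_part T x = fst (T (x, 0))"
  by (simp add: re_part_def)

lemma norm_re_part: "norm (re_part T) \<le> norm T"
  using norm_blinfun_compose_mult[OF norm_blinfun_compose_mult[OF norm_fst_blinfun_le order_refl] norm_inl, of T]
  by (simp add: re_part_def)

lemma bounded_linear_re_part: "bounded_linear re_part"
  by (rule bounded_linear_intro[where K = 1])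
    (auto intro!: blinfun_eqI simp: re_part_apply blinfun.bilinear_simps norm_re_part)

lemma rresolv_of_resolv:
  assumes lin: "linear_op D L" and R: "resolv D L (of_real s) R"
  shows "rresolv D L s (re_part R)" "R = dg (re_part R)"
proof -
  have D0: "0 \<in> D" "L 0 = 0" using linear_opD[OF lin] by auto
  have R': "s *\<^sub>R fst (R w) + L (fst (R w)) = fst w" "s *\<^sub>R snd (R w) + L (snd (R w)) = snd w" for w
    using resolvD(4)[OF R, of w] by (auto simp: cscale_of_real prod_eq_iff)
  have inv: "u \<in> D \<Longrightarrow> v \<in> D \<Longrightarrow> R (s *\<^sub>R u + L u, s *\<^sub>R v + L v) = (u, v)" for u v
    using resolvD(6)[OF R, of "(u, v)"] by (simp add: cscale_of_real)
  show 1: "rresolv D L s (re_part R)" unfolding rresolv_def re_part_apply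
    using R'(1) resolvD(2)[OF R] inv[OF _ D0(1)] D0(2) by auto
  show "R = dg (re_part R)" by (rule resolv_unique[OF lin R resolv_of_rresolv[OF 1]])
qed

lemma resolv_commute:
  fixes G :: "'x::real_normed_vector \<Rightarrow>\<^sub>L 'x"
  assumes lin: "linear_op D L" and R: "resolv D L \<zeta> R"
    and G: "\<And>u. u \<in> D \<Longrightarrow> G u \<in> D" "\<And>u. u \<in> D \<Longrightarrow> L (G u) = G (L u)"
  shows "R o\<^sub>L dg G = dg G o\<^sub>L R"
proof (rule blinfun_eqI)
  fix w
  have GD: "dg G (R w) \<in> D \<times> D" using G(1) resolvD(2,3)[OF R, of w] by (simp add: mem_Times_iff)
  have "map_prod L L (dg G (R w)) = dg G (map_prod L L (R w))"
    using G(2) resolvD(2,3)[OF R, of w] by (simp add: prod_eq_iff)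
  hence "cscale \<zeta> (dg G (R w)) + map_prod L L (dg G (R w)) = dg G (cscale \<zeta> (R w) + map_prod L L (R w))"
    by (simp only: blinfun.add_right) (simp add: map_prod_cscale)
  also have "\<dots> = dg G w" using resolvD(4)[OF R] by simp
  finally have "R (dg G w) = dg G (R w)" using resolvD(6)[OF R GD] by simp
  thus "(R o\<^sub>L dg G) w = (dg G o\<^sub>L R) w" by simp
qed

lemma bounded_linear_dg: "bounded_linear dg"
  by (rule bounded_linear_intro[where K = 1])
    (auto intro!: blinfun_eqI simp: blinfun.bilinear_simps norm_dg scaleR_prod_def prod_eq_iff)

lemma dg_compose: "dg f o\<^sub>L dg g = dg (f o\<^sub>L g)"
  by (rule blinfun_eqI) (simp add: prod_eq_iff)

lemma dg_scaleR: "dg (c *\<^sub>R f) = c *\<^sub>R dg f"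
  by (rule linear_simps(5)[OF bounded_linear_dg])

text \<open>\<open>r s\<close> inverts s - \<omega> + A, so that (s + A)^(-1) = r(s + \<omega>)
  stays bounded down to s = 0, as Balakrishnan's integral requires. For x in \<open>D\<close> the
  identity s r(s) x = x - r(s) (A - \<omega>) x gives the expansion of r(s) x on a dense
  set.\<close>

lemma sectorial_shifted_resolvent:
  fixes D :: "'x::banach set"
  assumes sec: "sectorial D A" and sp: "\<forall>z\<in>spectrum UNIV D A. 0 < Re z"
  obtains \<omega> r M where "0 < \<omega>" "real_resolvent r M" "\<And>s. 0 < s \<Longrightarrow> rresolv D A (s - \<omega>) (r s)"
    "closure {x. \<exists>C. \<forall>s>0. norm (r s x - (1 / s) *\<^sub>R x) \<le> C / s\<^sup>2} = UNIV"
proof -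
  have lin: "linear_op D A" and dense: "closure D = UNIV" using sec by (auto simp: sectorial_def)
  obtain \<omega> \<delta> M where p: "0 < \<omega>" "0 < \<delta>" "\<delta> \<le> 1" "0 < M" and reg: "region D A id_blinfun 0 \<omega> \<delta> M"
    by (rule region_of_ares[OF lin ares_of_sectorial[OF sec]]) (use sp in auto)
  have "\<exists>r. rresolv D A (s - \<omega>) r \<and> norm r \<le> M / s" if s: "0 < s" for s
  proof -
    obtain R where R: "resolv D A (of_real (s - \<omega>)) R" "norm R \<le> M / s"
      using reg[unfolded region_def, rule_format, of "of_real (s - \<omega>)"] s by (auto simp: res_bd_def)
    thus ?thesis using rresolv_of_resolv(1)[OF lin R(1)] order_trans[OF norm_re_part R(2)] by blast
  qed
  then obtain r where r: "\<And>s. 0 < s \<Longrightarrow> rresolv D A (s - \<omega>) (r s)" "\<And>s. 0 < s \<Longrightarrow> norm (r s) \<le> M / s" by metis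
  have rr: "real_resolvent r M"
  proof
    show "r s - r t = (t - s) *\<^sub>R (r s o\<^sub>L r t)" if s: "0 < s" "0 < t" for s t
    proof (rule blinfun_eqI)
      fix x
      have "(s - \<omega>) *\<^sub>R r t x + A (r t x) = x + (s - t) *\<^sub>R r t x"
        using rresolvD(2)[OF r(1)[OF s(2)], of x] by (simp add: algebra_simps)
      hence "r t x = r s (x + (s - t) *\<^sub>R r t x)"
        using rresolvD(3)[OF r(1)[OF s(1)] rresolvD(1)[OF r(1)[OF s(2)]], of x] by simp
      hence "r t x = r s x + (s - t) *\<^sub>R r s (r t x)" by (simp only: blinfun.add_right blinfun.scaleR_right)
      hence "r s x - r t x = - ((s - t) *\<^sub>R r s (r t x))" by (metis diff_add_cancel add_diff_cancel_left' minus_diff_eq)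
      thus "(r s - r t) x = ((t - s) *\<^sub>R (r s o\<^sub>L r t)) x"
        by (simp add: blinfun.bilinear_simps scaleR_left_diff_distrib)
    qed
  qed (rule r(2))
  have "D \<subseteq> {x. \<exists>C. \<forall>s>0. norm (r s x - (1 / s) *\<^sub>R x) \<le> C / s\<^sup>2}"
  proof clarify
    fix x assume x: "x \<in> D"
    have "norm (r s x - (1 / s) *\<^sub>R x) \<le> M * norm (A x - \<omega> *\<^sub>R x) / s\<^sup>2" if s: "0 < s" for s
    proof -
      have "r s (s *\<^sub>R x + (A x - \<omega> *\<^sub>R x)) = x" using rresolvD(3)[OF r(1)[OF s] x] by (simp add: algebra_simps)
      hence "s *\<^sub>R r s x + r s (A x - \<omega> *\<^sub>R x) = x" by (simp only: blinfun.add_right blinfun.scaleR_right)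
      hence "s *\<^sub>R (r s x - (1 / s) *\<^sub>R x) = - r s (A x - \<omega> *\<^sub>R x)"
        using s by (simp add: scaleR_diff_right algebra_simps)
      hence "s * norm (r s x - (1 / s) *\<^sub>R x) = norm (r s (A x - \<omega> *\<^sub>R x))"
        using s by (metis abs_of_pos norm_minus_cancel norm_scaleR)
      also have "\<dots> \<le> M / s * norm (A x - \<omega> *\<^sub>R x)"
        by (rule order_trans[OF norm_blinfun mult_right_mono[OF r(2)[OF s]]]) simp
      finally show ?thesis using s by (simp add: field_simps power2_eq_square)
    qed
    thus "\<exists>C. \<forall>s>0. norm (r s x - (1 / s) *\<^sub>R x) \<le> C / s\<^sup>2" by blast
  qed
  hence "closure {x. \<exists>C. \<forall>s>0. norm (r s x - (1 / s) *\<^sub>R x) \<le> C / s\<^sup>2} = UNIV" using dense closure_mono by blast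
  with p(1) rr r(1) show ?thesis by (rule that)
qed

text \<open>Up to a constant \<open>frac_int (1 - \<alpha>) \<omega>\<close> is A^(\<alpha>-1), so Y
  = A^\<alpha> R is a multiple of A^(\<alpha>-1) A R, an integral over (s + A)^(-1) A R. The latter
  is of order 1/s because A R is bounded, and of order 1/|\<zeta>| because it equals R - s (s +
  A)^(-1) R; these are the two bounds of \<open>frac_integral\<close>.\<close>

lemma ares_frac:
  fixes D :: "'x::banach set" and J :: "'x \<Rightarrow>\<^sub>L 'x"
  assumes lin: "linear_op D A" and ares: "ares D A id_blinfun 0" and al: "0 < \<alpha>" "\<alpha> < 1"
    and rr: "real_resolvent r M" and r: "\<And>s. 0 < s \<Longrightarrow> rresolv D A (s - \<omega>) (r s)" and w: "0 < \<omega>"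
    and J: "inj J" "\<And>u. u \<in> D \<Longrightarrow> J u \<in> D" "\<And>u. u \<in> D \<Longrightarrow> A (J u) = J (A u)"
    and JW: "J o\<^sub>L real_resolvent.frac_int r (1 - \<alpha>) \<omega> = c *\<^sub>R r \<omega>" and c: "0 < c"
  shows "ares D A J \<alpha>"
proof -
  interpret real_resolvent r M by (rule rr)
  define W where "W = frac_int (1 - \<alpha>) \<omega>"
  have al': "0 < 1 - \<alpha>" "1 - \<alpha> < 1" using al by auto
  obtain \<delta> r0 M0 where d: "\<delta> > 0" and r0: "r0 > 0"
    and M0: "\<And>\<zeta>. r0 \<le> cmod \<zeta> \<Longrightarrow> - \<delta> * \<bar>Im \<zeta>\<bar> \<le> Re \<zeta> \<Longrightarrow> res_bd D A id_blinfun 0 M0 \<zeta> (cmod \<zeta>)"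
    using ares unfolding ares_def by blast
  define K0 where "K0 = (1 + M) * (1 + 2 * \<bar>M0\<bar>)"
  define K1 where "K1 = K0 * (1 / (1 - (1 - \<alpha>)) + 1 / (1 - \<alpha>)) / c"
  define M1 where "M1 = max \<bar>M0\<bar> K1"
  have "res_bd D A J \<alpha> M1 \<zeta> (cmod \<zeta>)" if z: "r0 \<le> cmod \<zeta>" "- \<delta> * \<bar>Im \<zeta>\<bar> \<le> Re \<zeta>" for \<zeta>
  proof -
    let ?s = "cmod \<zeta>"
    have sp: "0 < ?s" using z r0 by linarith
    obtain R where R: "resolv D A \<zeta> R" "norm R \<le> M0 / ?s" using M0[OF z] unfolding res_bd_def by blast
    have nR: "norm R \<le> \<bar>M0\<bar> / ?s" using R(2) sp by (meson abs_ge_self divide_right_mono order_trans less_imp_le)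
    define K where "K = id_blinfun - (cblin \<zeta> o\<^sub>L R)"
    have K: "K w = map_prod A A (R w)" for w
      using resolvD(5)[OF R(1), of w] by (simp add: K_def blinfun.diff_left)
    have nK: "norm K \<le> 1 + 2 * \<bar>M0\<bar>"
    proof -
      have "norm K \<le> 1 + 2 * ?s * (\<bar>M0\<bar> / ?s)" unfolding K_def
        by (intro order_trans[OF norm_triangle_ineq4] add_mono norm_blinfun_id_le norm_blinfun_compose_mult norm_cblin nR)
      thus ?thesis using sp by simp
    qed
    define F where "F s = dg (r (s + \<omega>)) o\<^sub>L K" for s
    have cont: "continuous_on {0<..} F" unfolding F_def
      by (intro continuous_intros bounded_linear.continuous_on[OF bounded_linear_dg]
        continuous_on_subset[OF res_shift_continuous[OF w]]) auto
    have F1: "norm (F s) \<le> K0 / s" if s: "0 < s" for s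
    proof -
      have "norm (F s) \<le> M / s * (1 + 2 * \<bar>M0\<bar>)" unfolding F_def
        by (intro norm_blinfun_compose_mult nK order_trans[OF norm_dg res_shift_bound(2)] w s less_imp_le)
      also have "\<dots> \<le> (1 + M) / s * (1 + 2 * \<bar>M0\<bar>)" using s by (intro mult_right_mono divide_right_mono) auto
      finally show ?thesis by (simp add: K0_def)
    qed
    have F2: "norm (F s) \<le> K0 / ?s" if s: "0 < s" for s
    proof -
      have rs: "rresolv D A s (r (s + \<omega>))" using r[of "s + \<omega>"] s w by simp
      have "F s = R - s *\<^sub>R (dg (r (s + \<omega>)) o\<^sub>L R)"
      proof (rule blinfun_eqI)
        fix x
        have "dg (r (s + \<omega>)) (s *\<^sub>R R x + map_prod A A (R x)) = R x"
          using resolvD(6)[OF resolv_of_rresolv[OF rs] resolvD(1)[OF R(1)], of x] by (simp add: cscale_of_real)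
        hence "s *\<^sub>R dg (r (s + \<omega>)) (R x) + dg (r (s + \<omega>)) (map_prod A A (R x)) = R x"
          by (simp only: blinfun.add_right blinfun.scaleR_right)
        thus "F s x = (R - s *\<^sub>R (dg (r (s + \<omega>)) o\<^sub>L R)) x"
          by (simp only: F_def blinfun_apply_blinfun_compose K blinfun.diff_left blinfun.scaleR_left)
            (simp add: algebra_simps)
      qed
      also have "norm \<dots> \<le> \<bar>M0\<bar> / ?s + s * (M / s * (\<bar>M0\<bar> / ?s))"
      proof (intro order_trans[OF norm_triangle_ineq4] add_mono nR)
        have "norm (dg (r (s + \<omega>)) o\<^sub>L R) \<le> M / s * (\<bar>M0\<bar> / ?s)"
          by (intro norm_blinfun_compose_mult nR order_trans[OF norm_dg res_shift_bound(2)] w s less_imp_le)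
        thus "norm (s *\<^sub>R (dg (r (s + \<omega>)) o\<^sub>L R)) \<le> s * (M / s * (\<bar>M0\<bar> / ?s))"
          unfolding norm_scaleR using s by (intro mult_mono) auto
      qed
      also have "\<dots> = (1 + M) * \<bar>M0\<bar> / ?s" using s by (simp add: add_divide_distrib[symmetric] algebra_simps)
      also have "\<dots> \<le> K0 / ?s"
        unfolding K0_def using M_nonneg sp by (intro divide_right_mono mult_left_mono) auto
      finally show ?thesis .
    qed
    note fi = frac_integral[OF sp al' cont F2 F1]
    have WK: "dg W o\<^sub>L K = integral {0<..} (\<lambda>s. s powr (- (1 - \<alpha>)) *\<^sub>R F s)"
    proof -
      have "bounded_linear (\<lambda>f. dg f o\<^sub>L K)"
        by (rule bounded_linear_compose[OF bc.bounded_linear_left bounded_linear_dg])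
      from integral_linear[OF frac_int_integrable[OF w al'] this]
      show ?thesis unfolding W_def frac_int_def F_def by (simp add: o_def dg_scaleR bc.scaleR_left)
    qed
    define Y where "Y = (1 / c) *\<^sub>R (dg W o\<^sub>L K)"
    have nY: "norm Y \<le> K1 * ?s powr (\<alpha> - 1)"
    proof -
      have "norm Y \<le> (1 / c) * (K0 * (?s powr (- (1 - \<alpha>)) * (1 / (1 - (1 - \<alpha>)) + 1 / (1 - \<alpha>))))"
        unfolding Y_def norm_scaleR WK using c fi(2) by (intro mult_mono) auto
      thus ?thesis by (simp add: K1_def mult_ac)
    qed
    have RY: "R = dg J o\<^sub>L Y"
    proof -
      have "dg J o\<^sub>L Y = (1 / c) *\<^sub>R (dg (J o\<^sub>L W) o\<^sub>L K)"
        by (simp add: Y_def bc.scaleR_right blinfun_compose_assoc[symmetric] dg_compose)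
      also have "\<dots> = dg (r \<omega>) o\<^sub>L K" using c by (simp add: JW[folded W_def] dg_scaleR bc.scaleR_left)
      also have "\<dots> = R"
      proof (rule blinfun_eqI)
        have r0: "rresolv D A 0 (r \<omega>)" using r[OF w] by simp
        show "(dg (r \<omega>) o\<^sub>L K) x = R x" for x
          using resolvD(6)[OF resolv_of_rresolv[OF r0] resolvD(1)[OF R(1)], of x] K by simp
      qed
      finally show ?thesis by simp
    qed
    \<comment> \<open>A^\<alpha> R A^(-\<alpha>) = R, because \<open>J\<close> is injective and
      commutes with the resolvent; so the bound in X_\<alpha> is the bound in X.\<close>
    have YJ: "Y o\<^sub>L dg J = R"
    proof (rule blinfun_eqI)
      fix x
      have "R o\<^sub>L dg J = dg J o\<^sub>L R" by (rule resolv_commute[OF lin R(1)]) (use J in auto)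
      hence "(R o\<^sub>L dg J) x = (dg J o\<^sub>L R) x" by (rule arg_cong)
      hence "(dg J o\<^sub>L Y) (dg J x) = dg J (R x)" unfolding RY[symmetric] blinfun_apply_blinfun_compose .
      hence "map_prod J J ((Y o\<^sub>L dg J) x) = map_prod J J (R x)"
        unfolding blinfun_apply_blinfun_compose dg_apply .
      thus "(Y o\<^sub>L dg J) x = R x" by (rule injD[OF inj_map_prod[OF J(1)]])
    qed
    have "M0 / ?s \<le> M1 / ?s" using sp by (intro divide_right_mono) (auto simp: M1_def)
    moreover have "K1 * ?s powr (\<alpha> - 1) \<le> M1 * ?s powr (\<alpha> - 1)" by (intro mult_right_mono) (auto simp: M1_def)
    ultimately show ?thesis unfolding res_bd_def
      using R(1) RY YJ R(2) nY by (intro exI[of _ R] exI[of _ Y]) auto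
  qed
  hence "\<forall>\<zeta>. r0 \<le> cmod \<zeta> \<and> - \<delta> * \<bar>Im \<zeta>\<bar> \<le> Re \<zeta> \<longrightarrow> res_bd D A J \<alpha> M1 \<zeta> (cmod \<zeta>)" by simp
  thus ?thesis unfolding ares_def using d r0 by metis
qed

text \<open>\<open>J\<close> is \<open>A\<^sup>-\<^sup>\<alpha>\<close>.\<close>

lemma frac_space:
  fixes D :: "'x::banach set"
  assumes sec: "sectorial D A" and sp: "\<forall>z\<in>spectrum UNIV D A. 0 < Re z" and al: "0 \<le> \<alpha>" "\<alpha> < 1"
  obtains J :: "'x \<Rightarrow>\<^sub>L 'x" where "inj J" "frac_dom D A \<alpha> = range J" "\<And>v. frac_power D A \<alpha> (J v) = v"
    "ares D A J \<alpha>" "\<And>u. u \<in> D \<Longrightarrow> J u \<in> D"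
proof (cases "\<alpha> = 0")
  case True
  show ?thesis
  proof (rule that[of id_blinfun])
    show "ares D A id_blinfun \<alpha>" using True ares_of_sectorial[OF sec] by simp
  qed (use True in \<open>auto simp: frac_dom_def frac_power_def inj_def\<close>)
next
  case False
  hence al': "0 < \<alpha>" "\<alpha> < 1" "0 < 1 - \<alpha>" "1 - \<alpha> < 1" using al by auto
  have lin: "linear_op D A" using sec by (auto simp: sectorial_def)
  obtain \<omega> r M where w: "0 < \<omega>" and rr: "real_resolvent r M" and r: "\<And>s. 0 < s \<Longrightarrow> rresolv D A (s - \<omega>) (r s)"
    and dense: "closure {x. \<exists>C. \<forall>s>0. norm (r s x - (1 / s) *\<^sub>R x) \<le> C / s\<^sup>2} = UNIV"
    by (rule sectorial_shifted_resolvent[OF sec sp]) (rule that)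
  interpret real_resolvent r M by (rule rr)
  define k where "k = sin (pi * \<alpha>) / pi"
  have k: "0 < k" unfolding k_def using al' by (intro divide_pos_pos sin_gt_zero) auto
  define J where "J = k *\<^sub>R frac_int \<alpha> \<omega>"
  define c where "c = k * (\<omega> * (scal_kernel \<alpha> \<omega> * scal_kernel (1 - \<alpha>) \<omega>))"
  have c: "0 < c" unfolding c_def using k w scal_kernel_pos al' by simp
  have JW: "J o\<^sub>L frac_int (1 - \<alpha>) \<omega> = c *\<^sub>R r \<omega>"
    unfolding J_def bc.scaleR_left frac_int_product[OF w al'(1,2) dense] c_def by simp
  have com: "r s o\<^sub>L frac_int b \<omega> = frac_int b \<omega> o\<^sub>L r s" if "0 < s" "0 < b" "b < 1" for s b
    using frac_int_commute[OF w that(2,3), of "r s"] res_commute[OF that(1)] by simp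
  have JW': "frac_int (1 - \<alpha>) \<omega> o\<^sub>L J = c *\<^sub>R r \<omega>" unfolding JW[symmetric] J_def bc.scaleR_left bc.scaleR_right
    using frac_int_commute[OF w al'(1,2), of "frac_int (1 - \<alpha>) \<omega>"] com al' by simp
  have r0: "rresolv D A 0 (r \<omega>)" using r[OF w] by simp
  have Jr: "J (r \<omega> x) = r \<omega> (J x)" for x using arg_cong[OF com[OF w al'(1,2)], of "\<lambda>f. blinfun_apply f x"]
    by (simp add: J_def blinfun.scaleR_left blinfun.scaleR_right)
  have JD: "J u \<in> D" "A (J u) = J (A u)" if u: "u \<in> D" for u
  proof -
    have "J u = r \<omega> (J (A u))" using rresolvD(3)[OF r0 u] Jr[of "A u"] by simp
    thus "J u \<in> D" "A (J u) = J (A u)" using rresolvD(1,2)[OF r0, of "J (A u)"] by auto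
  qed
  have injr: "x = y" if "r \<omega> x = r \<omega> y" for x y
    using rresolvD(2)[OF r0, of x] rresolvD(2)[OF r0, of y] that by simp
  \<comment> \<open>Up to a constant, A^(\<alpha>-1) A^(-\<alpha>) is A^(-1), which is
    injective.\<close>
  have inj: "inj J"
  proof (rule injI)
    fix x y assume "J x = J y"
    hence "c *\<^sub>R r \<omega> x = c *\<^sub>R r \<omega> y"
      using arg_cong[OF JW', of "\<lambda>f. blinfun_apply f x"] arg_cong[OF JW', of "\<lambda>f. blinfun_apply f y"]
      by (simp add: blinfun.scaleR_left)
    thus "x = y" using c injr by simp
  qed
  have neg: "neg_frac_power D A \<alpha> v = J v" for v
  proof -
    have iv: "inv_into D (\<lambda>u. s *\<^sub>R u + A u) v = r (s + \<omega>) v" if s: "0 < s" for s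
    proof (rule inv_into_f_eq)
      have rs: "rresolv D A s (r (s + \<omega>))" using r[of "s + \<omega>"] s w by simp
      show "inj_on (\<lambda>u. s *\<^sub>R u + A u) D" by (rule inj_on_inverseI[of _ "r (s + \<omega>)"]) (rule rresolvD(3)[OF rs])
      show "r (s + \<omega>) v \<in> D" "s *\<^sub>R r (s + \<omega>) v + A (r (s + \<omega>) v) = v" using rresolvD[OF rs] by auto
    qed
    have "integral {0<..} (\<lambda>s. s powr (- \<alpha>) *\<^sub>R inv_into D (\<lambda>u. s *\<^sub>R u + A u) v) =
        integral {0<..} (\<lambda>s. s powr (- \<alpha>) *\<^sub>R r (s + \<omega>) v)" by (rule integral_cong) (simp add: iv)
    also have "\<dots> = frac_int \<alpha> \<omega> v" by (rule integral_unique[OF frac_int_apply[OF w al'(1,2)]])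
    finally show ?thesis by (simp add: neg_frac_power_def J_def k_def blinfun.scaleR_left)
  qed
  hence neg': "neg_frac_power D A \<alpha> = blinfun_apply J" by (rule ext)
  show ?thesis
  proof (rule that[OF inj])
    show "frac_dom D A \<alpha> = range J" using al' by (simp add: frac_dom_def neg')
    show "frac_power D A \<alpha> (J v) = v" for v using al' inj by (simp add: frac_power_def neg')
    show "ares D A J \<alpha>" by (rule ares_frac[OF lin ares_of_sectorial[OF sec] al'(1,2) rr r w inj JD JW c])
  qed (rule JD)
qed

subsection \<open>Semigroups as contour integrals\<close>

lemma has_vector_derivative_iff_quotient:
  fixes f :: "real \<Rightarrow> 'a::real_normed_vector"
  shows "(f has_vector_derivative D) (at t) \<longleftrightarrow> ((\<lambda>y. (1 / (y - t)) *\<^sub>R (f y - f t)) \<longlongrightarrow> D) (at t)"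
proof -
  have eq: "norm ((f y - f t) - (y - t) *\<^sub>R D) / norm (y - t) = norm ((1 / (y - t)) *\<^sub>R (f y - f t) - D)"
    if "y \<noteq> t" for y
  proof -
    have "(1 / (y - t)) *\<^sub>R (f y - f t) - D = (1 / (y - t)) *\<^sub>R ((f y - f t) - (y - t) *\<^sub>R D)"
      using that by (simp add: scaleR_diff_right)
    thus ?thesis by (simp add: divide_inverse mult.commute)
  qed
  have "(f has_vector_derivative D) (at t) \<longleftrightarrow>
    ((\<lambda>y. norm ((f y - f t) - (y - t) *\<^sub>R D) / norm (y - t)) \<longlongrightarrow> 0) (at t)"
    unfolding has_vector_derivative_def has_derivative_iff_norm by (simp add: bounded_linear_scaleR_left)
  also have "\<dots> \<longleftrightarrow> ((\<lambda>y. norm ((1 / (y - t)) *\<^sub>R (f y - f t) - D)) \<longlongrightarrow> 0) (at t)"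
    by (rule tendsto_cong) (use eq in \<open>auto simp: eventually_at_filter\<close>)
  also have "\<dots> \<longleftrightarrow> ((\<lambda>y. (1 / (y - t)) *\<^sub>R (f y - f t)) \<longlongrightarrow> D) (at t)"
    unfolding tendsto_norm_zero_iff by (rule Lim_null[symmetric])
  finally show ?thesis .
qed

lemma integrable_reflect_UNIV:
  fixes f :: "real \<Rightarrow> 'a::banach"
  assumes "f integrable_on UNIV"
  shows "(\<lambda>x. f (- x)) integrable_on UNIV"
proof -
  obtain i where i: "(f has_integral i) UNIV" using assms by blast
  note * = i[unfolded has_integral_alt'[of f]]
  have "((\<lambda>x. f (- x)) has_integral i) UNIV"
  proof (rule iffD2[OF has_integral_alt'], intro conjI allI impI)
    show "(\<lambda>x. if x \<in> UNIV then f (- x) else 0) integrable_on cbox a b" for a b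
      using conjunct1[OF *, rule_format, of "- b" "- a"] integrable_reflect[of f "- a" "- b"] by simp
    fix e :: real assume "e > 0"
    from conjunct2[OF *, rule_format, OF this] obtain B where B: "B > 0 \<and> (\<forall>a b. ball 0 B \<subseteq> cbox a b \<longrightarrow>
      norm (integral (cbox a b) (\<lambda>x. if x \<in> UNIV then f x else 0) - i) < e)" ..
    have "norm (integral (cbox a b) (\<lambda>x. if x \<in> UNIV then f (- x) else 0) - i) < e"
      if ab: "ball 0 B \<subseteq> cbox a b" for a b :: real
    proof -
      have "ball 0 B \<subseteq> cbox (- b) (- a)"
      proof
        fix x :: real assume "x \<in> ball 0 B"
        hence "- x \<in> cbox a b" using subsetD[OF ab, of "- x"] by simp
        thus "x \<in> cbox (- b) (- a)" by auto
      qed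
      with B have "norm (integral (cbox (- b) (- a)) (\<lambda>x. if x \<in> UNIV then f x else 0) - i) < e" by blast
      thus ?thesis using integral_reflect[of "- a" "- b" f] by simp
    qed
    thus "\<exists>B>0. \<forall>a b. ball 0 B \<subseteq> cbox a b \<longrightarrow>
        norm (integral (cbox a b) (\<lambda>x. if x \<in> UNIV then f (- x) else 0) - i) < e"
      using B by (intro exI[of _ B]) simp
  qed
  thus ?thesis by blast
qed

lemma integrable_exp_abs:
  assumes "0 < (k::real)"
  shows "(\<lambda>x. exp (- k * \<bar>x\<bar>)) integrable_on UNIV"
proof -
  let ?f = "\<lambda>x. if x \<in> {0..} then exp (- k * x) else 0"
  have f: "?f integrable_on UNIV"
    using integrable_on_exp_minus_to_infinity[OF assms, of 0] by (simp only: integrable_restrict_UNIV)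
  have "(\<lambda>x. ?f x + ?f (- x)) integrable_on UNIV" by (rule integrable_add[OF f integrable_reflect_UNIV[OF f]])
  thus ?thesis by (rule integrable_spike_finite[of "{0}", rotated 2]) (auto simp: abs_if)
qed

text \<open>A branch of a hyperbola through 1 with asymptotes Re z = 1 + d - d |Im z|. For d \<le> 1
  it passes the vertex 0 of the sector on the right at distance at least 1/2; being smooth, it
  allows integration by parts in one integral over the real line.\<close>

definition hyp :: "real \<Rightarrow> real \<Rightarrow> complex" where
  "hyp d l = Complex (1 + d - d * sqrt (1 + l\<^sup>2)) l"

definition hyp' :: "real \<Rightarrow> real \<Rightarrow> complex" where
  "hyp' d l = Complex (- d * l / sqrt (1 + l\<^sup>2)) 1"

text \<open>The differential e^z dz along the path.\<close>

definition wt :: "real \<Rightarrow> real \<Rightarrow> complex" where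
  "wt d l = exp (hyp d l) * hyp' d l"

definition Sec :: "real \<Rightarrow> complex set" where
  "Sec d = {\<zeta>. \<zeta> \<noteq> 0 \<and> - d * \<bar>Im \<zeta>\<bar> \<le> Re \<zeta>}"

lemma one_plus_square_pos: "0 < 1 + (l::real)\<^sup>2"
  by (simp add: add_pos_nonneg)

lemma hyp_derivative: "(hyp d has_vector_derivative hyp' d l) (at l)"
proof -
  have "((\<lambda>l. of_real (1 + d - d * sqrt (1 + l\<^sup>2)) + \<i> * of_real l) has_vector_derivative
      of_real (- d * l / sqrt (1 + l\<^sup>2)) + \<i> * of_real 1) (at l)" using one_plus_square_pos[of l]
    by (intro has_vector_derivative_add has_vector_derivative_mult_right has_vector_derivative_of_real)
      (auto intro!: derivative_eq_intros simp flip: has_real_derivative_iff_has_vector_derivative simp: field_simps)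
  moreover have "hyp d = (\<lambda>l. of_real (1 + d - d * sqrt (1 + l\<^sup>2)) + \<i> * of_real l)"
    by (auto simp: hyp_def complex_eq_iff)
  moreover have "hyp' d l = of_real (- d * l / sqrt (1 + l\<^sup>2)) + \<i> * of_real 1"
    by (simp add: hyp'_def complex_eq_iff)
  ultimately show ?thesis by simp
qed

lemma continuous_hyp [continuous_intros]: "continuous_on S (hyp d)"
  by (intro continuous_at_imp_continuous_on ballI has_vector_derivative_continuous[OF hyp_derivative])

lemma continuous_hyp' [continuous_intros]: "continuous_on S (hyp' d)"
proof -
  have eq: "hyp' d = (\<lambda>l. of_real (- d * l / sqrt (1 + l\<^sup>2)) + \<i>)"
    by (rule ext) (simp add: hyp'_def complex_eq_iff)
  have "sqrt (1 + l\<^sup>2) \<noteq> 0" for l :: real using one_plus_square_pos[of l] by simp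
  thus ?thesis unfolding eq by (intro continuous_intros) auto
qed

lemma continuous_wt [continuous_intros]: "continuous_on S (wt d)"
  unfolding wt_def by (intro continuous_intros)

lemma exp_hyp_derivative: "((\<lambda>l. exp (hyp d l)) has_vector_derivative wt d l) (at l)"
  unfolding wt_def
  using field_vector_diff_chain_at[OF hyp_derivative DERIV_exp] by (simp add: o_def mult.commute)

context
  fixes d :: real
  assumes d: "0 < d" "d \<le> 1"
begin

lemma Re_hyp: "Re (hyp d l) \<le> 1" "1 - d * \<bar>l\<bar> \<le> Re (hyp d l)" "Re (hyp d l) \<le> 1 + d - d * \<bar>l\<bar>"
proof -
  have "1 \<le> sqrt (1 + l\<^sup>2)" by simp
  hence "d * 1 \<le> d * sqrt (1 + l\<^sup>2)" using d by (intro mult_left_mono) auto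
  thus "Re (hyp d l) \<le> 1" by (simp add: hyp_def)
  have "sqrt (1 + l\<^sup>2) \<le> 1 + \<bar>l\<bar>" by (rule real_le_lsqrt) (auto simp: power2_sum)
  hence "d * sqrt (1 + l\<^sup>2) \<le> d * (1 + \<bar>l\<bar>)" using d by (intro mult_left_mono) auto
  thus "1 - d * \<bar>l\<bar> \<le> Re (hyp d l)" by (simp add: hyp_def algebra_simps)
  have "\<bar>l\<bar> \<le> sqrt (1 + l\<^sup>2)" by (rule real_le_rsqrt) auto
  hence "d * \<bar>l\<bar> \<le> d * sqrt (1 + l\<^sup>2)" using d by (intro mult_left_mono) auto
  thus "Re (hyp d l) \<le> 1 + d - d * \<bar>l\<bar>" by (simp add: hyp_def)
qed

lemma cmod_hyp_ge: "1 / 2 \<le> cmod (hyp d l)"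
proof (cases "\<bar>l\<bar> \<le> 1 / 2")
  case True
  have "d * \<bar>l\<bar> \<le> 1 * (1 / 2)" using d True by (intro mult_mono) auto
  hence "1 / 2 \<le> Re (hyp d l)" using Re_hyp(2)[of l] by linarith
  thus ?thesis using complex_Re_le_cmod[of "hyp d l"] by linarith
next
  case False
  thus ?thesis using abs_Im_le_cmod[of "hyp d l"] by (simp add: hyp_def)
qed

lemma hyp_nonzero: "hyp d l \<noteq> 0"
  using cmod_hyp_ge[of l] by auto

lemma cmod_hyp_le: "cmod (hyp d l) \<le> 1 + 2 * \<bar>l\<bar>"
proof -
  have "d * \<bar>l\<bar> \<le> 1 * \<bar>l\<bar>" using d by (intro mult_right_mono) auto
  hence "\<bar>Re (hyp d l)\<bar> \<le> 1 + \<bar>l\<bar>" using Re_hyp[of l] by (auto simp: abs_le_iff)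
  thus ?thesis using cmod_le[of "hyp d l"] by (simp add: hyp_def)
qed

lemma hyp_in_Sec: "0 < m \<Longrightarrow> of_real m * hyp d l \<in> Sec d"
proof -
  assume m: "0 < m"
  have "- d * \<bar>Im (hyp d l)\<bar> \<le> Re (hyp d l)" using Re_hyp(2)[of l] by (simp add: hyp_def)
  hence "m * (- d * \<bar>Im (hyp d l)\<bar>) \<le> m * Re (hyp d l)" using m by (intro mult_left_mono) auto
  thus ?thesis using m hyp_nonzero by (simp add: Sec_def abs_mult mult_ac)
qed

lemma cmod_hyp'_le: "cmod (hyp' d l) \<le> 2"
proof -
  have "\<bar>l\<bar> \<le> sqrt (1 + l\<^sup>2)" by (rule real_le_rsqrt) auto
  hence "d * \<bar>l\<bar> \<le> 1 * sqrt (1 + l\<^sup>2)" using d by (intro mult_mono) auto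
  hence "\<bar>Re (hyp' d l)\<bar> \<le> 1" using d one_plus_square_pos[of l] by (simp add: hyp'_def abs_mult divide_le_eq)
  thus ?thesis using cmod_le[of "hyp' d l"] by (simp add: hyp'_def)
qed

lemma cmod_exp_hyp_le_wt: "cmod (exp (hyp d l)) \<le> cmod (wt d l)"
proof -
  have "1 \<le> cmod (hyp' d l)" using abs_Im_le_cmod[of "hyp' d l"] by (simp add: hyp'_def)
  hence "cmod (exp (hyp d l)) * 1 \<le> cmod (exp (hyp d l)) * cmod (hyp' d l)" by (intro mult_left_mono) auto
  thus ?thesis by (simp add: wt_def norm_mult)
qed

text \<open>\<open>1 + 2 * \<bar>l\<bar>\<close> bounds the path variable, so the decay of the
  weight survives several additional factors \<open>hyp d l\<close>. Half of the rate d is spent on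
  the polynomial, through (1 + x/4)^4 \<le> e^x.\<close>

lemma wt_bound: "\<exists>C>0. \<forall>l. cmod (wt d l) * (1 + 2 * \<bar>l\<bar>) ^ 4 \<le> C * exp (- (d / 2) * \<bar>l\<bar>)"
proof (intro exI conjI allI)
  define k where "k = d / 2"
  have k: "0 < k" using d by (simp add: k_def)
  let ?C = "exp 2 * 2 * (1 + 8 / k) ^ 4"
  have "0 < 1 + 8 / k" using k by (simp add: add_pos_pos)
  thus "0 < ?C" by simp
  fix l :: real
  let ?s = "\<bar>l\<bar>"
  have "1 + 2 * ?s \<le> (1 + 8 / k) * (1 + k * ?s / 4)" using k by (simp add: field_simps)
  hence "(1 + 2 * ?s) ^ 4 \<le> (1 + 8 / k) ^ 4 * (1 + k * ?s / 4) ^ 4"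
    unfolding power_mult_distrib[symmetric] by (intro power_mono) auto
  also have "\<dots> \<le> (1 + 8 / k) ^ 4 * exp (k * ?s)"
  proof (rule mult_left_mono)
    have "0 \<le> k * ?s" using k by simp
    hence "- 4 \<le> k * ?s" by linarith
    thus "(1 + k * ?s / 4) ^ 4 \<le> exp (k * ?s)" using exp_ge_one_plus_x_over_n_power_n[of 4 "k * ?s"] by simp
  qed (use k in simp)
  finally have 1: "(1 + 2 * ?s) ^ 4 \<le> (1 + 8 / k) ^ 4 * exp (k * ?s)" .
  have "Re (hyp d l) \<le> 2 - 2 * k * ?s" using Re_hyp(3)[of l] d by (simp add: k_def)
  hence "cmod (exp (hyp d l)) \<le> exp (2 - 2 * k * ?s)" by simp
  hence 2: "cmod (wt d l) \<le> exp (2 - 2 * k * ?s) * 2"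
    unfolding wt_def norm_mult using cmod_hyp'_le by (intro mult_mono) auto
  have "cmod (wt d l) * (1 + 2 * ?s) ^ 4 \<le> (exp (2 - 2 * k * ?s) * 2) * ((1 + 8 / k) ^ 4 * exp (k * ?s))"
    by (intro mult_mono 1 2) auto
  also have "\<dots> = ?C * (exp (- 2 * k * ?s) * exp (k * ?s))" by (simp add: exp_diff exp_minus divide_inverse mult_ac)
  also have "exp (- 2 * k * ?s) * exp (k * ?s) = exp (- k * ?s)" by (simp flip: exp_add)
  finally show "cmod (wt d l) * (1 + 2 * \<bar>l\<bar>) ^ 4 \<le> ?C * exp (- (d / 2) * \<bar>l\<bar>)" by (simp add: k_def)
qed

definition wtn :: "real \<Rightarrow> real" where "wtn l = cmod (wt d l) * (1 + 2 * \<bar>l\<bar>) ^ 4"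

lemma wtn_integrable: "wtn integrable_on UNIV"
proof -
  obtain C where C: "\<forall>l. wtn l \<le> C * exp (- (d / 2) * \<bar>l\<bar>)" using wt_bound unfolding wtn_def by blast
  show ?thesis
  proof (rule integrable_UNIV_dominated)
    show "continuous_on UNIV wtn" unfolding wtn_def by (intro continuous_intros)
    show "(\<lambda>l. C * exp (- (d / 2) * \<bar>l\<bar>)) integrable_on UNIV"
      by (rule integrable_on_mult_right) (rule integrable_exp_abs, use d in simp)
    show "norm (wtn l) \<le> C * exp (- (d / 2) * \<bar>l\<bar>)" for l using C by (simp add: wtn_def)
  qed
qed

lemma wtn_tendsto: "(wtn \<longlongrightarrow> 0) at_top" "(wtn \<longlongrightarrow> 0) at_bot"
proof -
  obtain C where C: "\<And>l. wtn l \<le> C * exp (- (d / 2) * \<bar>l\<bar>)" using wt_bound unfolding wtn_def by blast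
  have d2: "0 < d / 2" using d by simp
  have *: "norm (wtn l) \<le> C * exp (- (d / 2) * \<bar>l\<bar>)" for l using C by (simp add: wtn_def)
  have "((\<lambda>l. C * exp (- (d / 2) * \<bar>l\<bar>)) \<longlongrightarrow> 0) at_top" using d2 by real_asymp
  thus "(wtn \<longlongrightarrow> 0) at_top" by (rule Lim_null_comparison[rotated]) (use * in simp)
  have "((\<lambda>l. C * exp (- (d / 2) * \<bar>l\<bar>)) \<longlongrightarrow> 0) at_bot" using d2 by real_asymp
  thus "(wtn \<longlongrightarrow> 0) at_bot" by (rule Lim_null_comparison[rotated]) (use * in simp)
qed

lemma wtn_nonneg: "0 \<le> wtn l" by (simp add: wtn_def)

lemma wt_le_wtn: "cmod (wt d l) \<le> wtn l"
  using mult_left_mono[OF one_le_power[of "1 + 2 * \<bar>l\<bar>" 4], of "cmod (wt d l)"] by (simp add: wtn_def)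

definition cint :: "(real \<Rightarrow> complex) \<Rightarrow> (complex \<Rightarrow> ('x::banach \<times> 'x) \<Rightarrow>\<^sub>L ('x \<times> 'x)) \<Rightarrow> real \<Rightarrow> 'x cop" where
  "cint q F m = integral UNIV (\<lambda>l. cblin (wt d l * q l) o\<^sub>L F (of_real m * hyp d l))"

text \<open>\<open>cint (\<lambda>_. 1) R m\<close> is, up to the factor \<open>m\<close>, the Dunford integral of \<open>e\<^sup>\<zeta>\<^sup>t R(\<zeta>)\<close> with \<open>t = 1 / m\<close>
  along the hyperbola scaled by \<open>m\<close>.  Scaling the path with \<open>t\<close> gives the bounds on the semigroup
  at once and makes the independence of the path unnecessary.\<close>

lemma cint_bound:
  assumes q: "continuous_on UNIV q" "\<And>l. cmod (q l) \<le> 2 * (1 + 2 * \<bar>l\<bar>) ^ 3"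
    and F: "continuous_on (Sec d) F" "\<And>\<zeta>. \<zeta> \<in> Sec d \<Longrightarrow> norm (F \<zeta>) \<le> M * cmod \<zeta> powr (a - 1)"
    and a: "0 \<le> a" "a < 1" and m: "0 < m" and M: "0 \<le> M"
  shows "(\<lambda>l. cblin (wt d l * q l) o\<^sub>L F (of_real m * hyp d l)) integrable_on UNIV" (is "?f integrable_on _")
    "norm (cint q F m) \<le> 8 * integral UNIV wtn * M * m powr (a - 1)"
proof -
  have bd: "norm (?f l) \<le> (8 * M * m powr (a - 1)) * wtn l" for l
  proof -
    let ?p = "cmod (hyp d l)"
    have "?p powr (a - 1) \<le> (1 / 2) powr (a - 1)" using cmod_hyp_ge[of l] a by (intro powr_mono2') auto
    also have "\<dots> = 2 powr (1 - a)" using powr_minus_divide[of "2::real" "a - 1"] by (simp add: powr_divide)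
    also have "\<dots> \<le> 2" using powr_mono[of "1 - a" 1 "2::real"] a by simp
    finally have p: "?p powr (a - 1) \<le> 2" .
    have "norm (F (of_real m * hyp d l)) \<le> M * (m powr (a - 1) * ?p powr (a - 1))"
      using F(2)[OF hyp_in_Sec[OF m, of l]] m by (simp add: norm_mult powr_mult)
    also have "\<dots> \<le> M * (m powr (a - 1) * 2)" using M p by (intro mult_left_mono) auto
    finally have nF: "norm (F (of_real m * hyp d l)) \<le> M * (m powr (a - 1) * 2)" .
    have "cmod (wt d l * q l) \<le> cmod (wt d l) * (2 * (1 + 2 * \<bar>l\<bar>) ^ 3)"
      unfolding norm_mult using q(2)[of l] by (intro mult_left_mono) auto
    also have "\<dots> \<le> cmod (wt d l) * (2 * (1 + 2 * \<bar>l\<bar>) ^ 4)" by (intro mult_left_mono power_increasing) auto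
    finally have "2 * cmod (wt d l * q l) \<le> 4 * wtn l" by (simp add: wtn_def)
    hence "norm (cblin (wt d l * q l) :: ('a \<times> 'a) \<Rightarrow>\<^sub>L _) \<le> 4 * wtn l" by (intro order_trans[OF norm_cblin])
    from norm_blinfun_compose_mult[OF this nF] show ?thesis by (simp add: mult_ac)
  qed
  have ig: "(\<lambda>l. (8 * M * m powr (a - 1)) * wtn l) integrable_on UNIV"
    by (rule integrable_on_mult_right[OF wtn_integrable])
  show int: "?f integrable_on UNIV"
  proof (rule integrable_UNIV_dominated[OF _ ig bd])
    show "continuous_on UNIV ?f"
      by (intro continuous_intros bounded_linear.continuous_on[OF bounded_linear_cblin] q(1)
          continuous_on_compose2[OF F(1)]) (use hyp_in_Sec[OF m] in auto)
  qed
  have "norm (integral UNIV ?f) \<le> integral UNIV (\<lambda>l. (8 * M * m powr (a - 1)) * wtn l)"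
    by (rule integral_norm_bound_integral[OF int ig bd])
  also have "\<dots> = (8 * M * m powr (a - 1)) * integral UNIV wtn" by (rule integral_mult_right)
  finally show "norm (cint q F m) \<le> 8 * integral UNIV wtn * M * m powr (a - 1)" by (simp add: cint_def mult_ac)
qed

lemma cmod_inverse_hyp: "cmod (1 / hyp d l) \<le> 2"
  using cmod_hyp_ge[of l] by (simp add: norm_divide divide_simps)

text \<open>e^z is a primitive along the path and vanishes at both ends. Hence a constant operator
  may be subtracted from a resolvent under the contour integral.\<close>

lemma integral_wt: "wt d integrable_on UNIV" "integral UNIV (wt d) = 0"
proof -
  show i: "wt d integrable_on UNIV"
    by (rule integrable_UNIV_dominated[OF _ wtn_integrable]) (auto intro: continuous_intros wt_le_wtn)
  have *: "norm (exp (hyp d l)) \<le> wtn l" for l using order_trans[OF cmod_exp_hyp_le_wt wt_le_wtn] .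
  have "integral UNIV (wt d) = 0 - 0" by (rule integral_derivative_UNIV[OF exp_hyp_derivative i])
      (rule Lim_null_comparison[OF _ wtn_tendsto(1)], use * in simp,
       rule Lim_null_comparison[OF _ wtn_tendsto(2)], use * in simp)
  thus "integral UNIV (wt d) = 0" by simp
qed

lemma wt_hyp_integrable: "(\<lambda>l. wt d l / hyp d l) integrable_on UNIV"
proof (rule integrable_UNIV_dominated)
  show "continuous_on UNIV (\<lambda>l. wt d l / hyp d l)" by (intro continuous_intros) (auto simp: hyp_nonzero)
  show "(\<lambda>l. 2 * wtn l) integrable_on UNIV" by (rule integrable_on_mult_right[OF wtn_integrable])
  show "norm (wt d l / hyp d l) \<le> 2 * wtn l" for l
    using mult_mono[OF wt_le_wtn cmod_inverse_hyp, of l l] wtn_nonneg[of l]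
    by (simp add: norm_mult[symmetric] mult.commute)
qed

end

text \<open>A primitive of \<open>(e\<^sup>z - 1) / z\<close>.\<close>

definition exp_prim :: "complex \<Rightarrow> complex" where
  "exp_prim z = (\<Sum>n. (1 / (of_nat n * fact n)) * z ^ n)"

lemma exp_prim_derivative:
  assumes "z \<noteq> 0"
  shows "(exp_prim has_field_derivative (exp z - 1) / z) (at z)"
proof -
  let ?c = "\<lambda>n. 1 / (of_nat n * fact n) :: complex"
  have sm: "summable (\<lambda>n. ?c n * y ^ n)" for y
  proof (rule summable_comparison_test'[OF summable_norm_exp[of y], of 1])
    fix n :: nat assume n: "1 \<le> n"
    have "norm (?c n * y ^ n) = norm (y ^ n) / fact n / real n" by (simp add: norm_mult norm_divide)
    also have "\<dots> \<le> norm (y ^ n) / fact n / 1" using n by (intro divide_left_mono) auto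
    finally show "norm (?c n * y ^ n) \<le> norm (y ^ n /\<^sub>R fact n)" by (simp add: divide_inverse mult.commute)
  qed
  have "(exp_prim has_field_derivative (\<Sum>n. diffs ?c n * z ^ n)) (at z)"
    unfolding exp_prim_def by (rule termdiffs_strong_converges_everywhere[OF sm])
  moreover have "(\<Sum>n. diffs ?c n * z ^ n) = (exp z - 1) / z"
  proof -
    have "(\<lambda>n. z ^ n /\<^sub>R fact n) sums exp z" by (rule exp_converges)
    hence "(\<lambda>n. z ^ Suc n /\<^sub>R fact (Suc n)) sums (exp z - 1)"
      using sums_Suc_iff[of "\<lambda>n. z ^ n /\<^sub>R fact n" "exp z - 1"] by simp
    hence "(\<lambda>n. (z ^ Suc n /\<^sub>R fact (Suc n)) / z) sums ((exp z - 1) / z)" by (rule sums_divide)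
    moreover have "(z ^ Suc n /\<^sub>R fact (Suc n)) / z = diffs ?c n * z ^ n" for n
    proof -
      have "diffs ?c n = 1 / fact (Suc n)" unfolding diffs_def by (simp del: of_nat_Suc fact_Suc)
      moreover have "(z ^ Suc n /\<^sub>R fact (Suc n)) / z = z ^ n / fact (Suc n)"
        using assms by (simp add: scaleR_conv_of_real del: fact_Suc) (simp add: divide_inverse mult.commute)
      ultimately show ?thesis by simp
    qed
    ultimately show ?thesis by (simp add: sums_iff)
  qed
  ultimately show ?thesis by simp
qed

context
  fixes d :: real
  assumes d: "0 < d" "d \<le> 1"
begin

lemma hyp_not_nonpos: "hyp d l \<notin> \<real>\<^sub>\<le>\<^sub>0"
  using Re_hyp(2)[OF d, of l] by (auto simp: complex_nonpos_Reals_iff hyp_def)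

text \<open>The primitive \<open>exp_prim z + Ln z\<close> of e^z / z is evaluated at the two ends
  of a finite piece of the path. The ends are compared along the vertical segment joining them in
  the left half-plane, where \<open>Ln (- z)\<close> is holomorphic and e^z / z is exponentially
  small. The two branches differ by i \<pi> above and by - i \<pi> below the real axis, which adds
  up to 2 \<pi> i.\<close>

lemma integral_wt_hyp: "integral UNIV (\<lambda>l. wt d l / hyp d l) = 2 * of_real pi * \<i>"
proof -
  let ?f = "\<lambda>l. wt d l / hyp d l"
  let ?p = "hyp d"
  have 1: "integral {-n..n} (\<lambda>l. if l \<in> UNIV then ?f l else 0) =
     (exp_prim (?p n) + Ln (?p n)) - (exp_prim (?p (-n)) + Ln (?p (-n)))" if "0 \<le> n" for n
  proof (rule integral_unique, simp, rule fundamental_theorem_of_calculus)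
    fix l
    have "((\<lambda>z. exp_prim z + Ln z) has_field_derivative ((exp (?p l) - 1) / ?p l + inverse (?p l))) (at (?p l))"
      by (intro DERIV_add exp_prim_derivative hyp_nonzero[OF d] has_field_derivative_Ln hyp_not_nonpos)
    from field_vector_diff_chain_at[OF hyp_derivative this]
    have "((\<lambda>l. exp_prim (?p l) + Ln (?p l)) has_vector_derivative
        hyp' d l * ((exp (?p l) - 1) / ?p l + inverse (?p l))) (at l)" by (simp add: o_def)
    moreover have "hyp' d l * ((exp (?p l) - 1) / ?p l + inverse (?p l)) = ?f l"
      using hyp_nonzero[OF d, of l] by (simp add: wt_def field_simps)
    ultimately show "((\<lambda>l. exp_prim (?p l) + Ln (?p l)) has_vector_derivative ?f l) (at l within {-n..n})"
      by (simp add: has_vector_derivative_at_within)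
  qed (use that in simp)
  have 2: "norm ((exp_prim (?p n) + Ln (?p n)) - (exp_prim (?p (-n)) + Ln (?p (-n))) - 2 * of_real pi * \<i>)
      \<le> exp (2 - d * n) * (2 * n)" if n: "4 / d \<le> n" for n
  proof -
    have n0: "0 < n" using n d by (meson divide_pos_pos less_le_trans zero_less_numeral)
    define x where "x = Re (?p n)"
    have "4 \<le> d * n" using n d by (simp add: pos_divide_le_eq mult.commute)
    moreover have x: "x \<le> 2 - d * n" using Re_hyp(3)[OF d, of n] d n0 by (simp add: x_def)
    ultimately have x2: "x \<le> - 2" by linarith
    have pn: "?p n = Complex x n" "?p (-n) = Complex x (-n)" by (simp_all add: x_def hyp_def)
    let ?K = "\<lambda>y. exp_prim (Complex x y) + Ln (- Complex x y)"
    let ?k = "\<lambda>y. \<i> * (exp (Complex x y) / Complex x y)"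
    have dK: "(?K has_vector_derivative ?k y) (at y)" for y
    proof -
      have ne: "Complex x y \<noteq> 0" using x2 by (simp add: complex_eq_iff)
      have "((\<lambda>z. exp_prim z + Ln (- z)) has_field_derivative ((exp (Complex x y) - 1) / Complex x y + inverse (Complex x y))) (at (Complex x y))"
        using x2 ne by (auto intro!: derivative_eq_intros exp_prim_derivative simp: complex_nonpos_Reals_iff field_simps)
      moreover have "((\<lambda>y. Complex x y) has_vector_derivative \<i>) (at y)"
      proof -
        have "((\<lambda>y. of_real x + \<i> * of_real y) has_vector_derivative 0 + \<i> * of_real 1) (at y)"
          by (intro has_vector_derivative_add has_vector_derivative_mult_right has_vector_derivative_of_real)
            (auto intro!: derivative_eq_intros)
        moreover have "(\<lambda>y. Complex x y) = (\<lambda>y. of_real x + \<i> * of_real y)" by (auto simp: complex_eq_iff)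
        ultimately show ?thesis by simp
      qed
      ultimately have "(?K has_vector_derivative \<i> * ((exp (Complex x y) - 1) / Complex x y + inverse (Complex x y))) (at y)"
        using field_vector_diff_chain_at[of "\<lambda>y. Complex x y" \<i> y "\<lambda>z. exp_prim z + Ln (- z)"] by (simp add: o_def)
      moreover have "\<i> * ((exp (Complex x y) - 1) / Complex x y + inverse (Complex x y)) = ?k y"
        using ne by (simp add: field_simps)
      ultimately show ?thesis by simp
    qed
    have hK: "(?k has_integral ?K n - ?K (-n)) {-n..n}"
      by (rule fundamental_theorem_of_calculus) (use n0 dK in \<open>auto intro: has_vector_derivative_at_within\<close>)
    have small: "norm (?K n - ?K (-n)) \<le> exp (2 - d * n) * (n - (-n))"
    proof (rule order_trans[OF has_integral_bound_real[OF _ finite.emptyI hK]])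
      show "norm (?k y) \<le> exp (2 - d * n)" for y
      proof -
        have "1 \<le> cmod (Complex x y)" using abs_Re_le_cmod[of "Complex x y"] x2 by simp
        hence "exp x / cmod (Complex x y) \<le> exp x / 1" by (intro divide_left_mono) auto
        also have "\<dots> \<le> exp (2 - d * n)" using x by simp
        finally show ?thesis by (simp add: norm_mult norm_divide)
      qed
    qed (use n0 in simp_all)
    have L1: "Ln (- Complex x n) = Ln (?p n) - \<i> * of_real pi"
      using Ln_minus[of "Complex x n"] n0 unfolding pn by (simp add: complex_eq_iff[of _ 0])
    have L2: "Ln (- Complex x (-n)) = Ln (?p (-n)) + \<i> * of_real pi"
      using Ln_minus[of "Complex x (-n)"] n0 unfolding pn by (simp add: complex_eq_iff[of _ 0])
    have "(exp_prim (?p n) + Ln (?p n)) - (exp_prim (?p (-n)) + Ln (?p (-n))) - 2 * of_real pi * \<i> = ?K n - ?K (-n)"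
      unfolding L1 L2 pn by (simp add: algebra_simps)
    thus ?thesis using small by (simp only:) simp
  qed
  have "((\<lambda>n. integral {-n..n} (\<lambda>l. if l \<in> UNIV then ?f l else 0) - 2 * of_real pi * \<i>) \<longlongrightarrow> 0) at_top"
  proof (rule Lim_null_comparison)
    show "\<forall>\<^sub>F n in at_top. norm (integral {-n..n} (\<lambda>l. if l \<in> UNIV then ?f l else 0) - 2 * of_real pi * \<i>)
        \<le> exp (2 - d * n) * (2 * n)" using eventually_ge_at_top[of "4 / d"]
    proof eventually_elim
      case (elim n)
      have "0 \<le> 4 / d" using d by simp
      hence n0: "0 \<le> n" using elim by linarith
      show ?case unfolding 1[OF n0] by (rule 2[OF elim])
    qed
    show "((\<lambda>n. exp (2 - d * n) * (2 * n)) \<longlongrightarrow> 0) at_top" using d by real_asymp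
  qed
  hence "((\<lambda>n. integral {-n..n} (\<lambda>l. if l \<in> UNIV then ?f l else 0)) \<longlongrightarrow> 2 * of_real pi * \<i>) at_top"
    by (rule LIM_zero_cancel)
  from tendsto_unique[OF _ tendsto_integral_symmetric[OF wt_hyp_integrable[OF d]] this] show ?thesis by simp
qed

end

section \<open>Contour integrals of operator families on a sector\<close>

lemma sector_continuous:
  assumes F_id: "\<And>\<zeta> \<eta>. \<zeta> \<in> Sec d \<Longrightarrow> \<eta> \<in> Sec d \<Longrightarrow> F \<eta> - F \<zeta> = cblin (\<zeta> - \<eta>) o\<^sub>L (F \<eta> o\<^sub>L R \<zeta>)"
    and nF: "\<And>\<zeta>. \<zeta> \<in> Sec d \<Longrightarrow> norm (F \<zeta>) \<le> M * cmod \<zeta> powr (a - 1)"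
    and nR: "\<And>\<zeta>. \<zeta> \<in> Sec d \<Longrightarrow> norm (R \<zeta>) \<le> M / cmod \<zeta>"
  shows "continuous_on (Sec d) F"
  unfolding continuous_on_def
proof
  fix \<zeta> assume z: "\<zeta> \<in> Sec d"
  hence nz: "\<zeta> \<noteq> 0" by (simp add: Sec_def)
  have nb: "norm (F \<eta> - F \<zeta>) \<le> 2 * cmod (\<zeta> - \<eta>) * (M * cmod \<eta> powr (a - 1) * (M / cmod \<zeta>))"
    if "\<eta> \<in> Sec d" for \<eta> unfolding F_id[OF z that] by (intro norm_blinfun_compose_mult norm_cblin nF nR z that)
  have "((\<lambda>\<eta>. F \<eta> - F \<zeta>) \<longlongrightarrow> 0) (at \<zeta> within Sec d)"
  proof (rule Lim_null_comparison)
    show "\<forall>\<^sub>F \<eta> in at \<zeta> within Sec d. norm (F \<eta> - F \<zeta>) \<le>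
        2 * cmod (\<zeta> - \<eta>) * (M * cmod \<eta> powr (a - 1) * (M / cmod \<zeta>))"
      unfolding eventually_at_filter by (rule always_eventually) (use nb in blast)
    have "((\<lambda>\<eta>. 2 * cmod (\<zeta> - \<eta>) * (M * cmod \<eta> powr (a - 1) * (M / cmod \<zeta>))) \<longlongrightarrow>
      2 * cmod (\<zeta> - \<zeta>) * (M * cmod \<zeta> powr (a - 1) * (M / cmod \<zeta>))) (at \<zeta> within Sec d)"
      by (intro tendsto_intros) (use nz in auto)
    thus "((\<lambda>\<eta>. 2 * cmod (\<zeta> - \<eta>) * (M * cmod \<eta> powr (a - 1) * (M / cmod \<zeta>))) \<longlongrightarrow> 0) (at \<zeta> within Sec d)" by simp
  qed
  thus "(F \<longlongrightarrow> F \<zeta>) (at \<zeta> within Sec d)" by (rule LIM_zero_cancel)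
qed

text \<open>\<open>F\<close> is either the resolvent R itself, with a = 0, or Y = J^(-1) R, with a =
  \<alpha>. Both satisfy the same mixed resolvent identity, so their contour integrals are treated
  once.\<close>

locale sector_family =
  fixes d a M :: real and F R :: "complex \<Rightarrow> ('x::banach \<times> 'x) \<Rightarrow>\<^sub>L ('x \<times> 'x)"
  assumes d: "0 < d" "d \<le> 1" and a: "0 \<le> a" "a < 1" and M: "0 \<le> M"
    and F_id: "\<And>\<zeta> \<eta>. \<zeta> \<in> Sec d \<Longrightarrow> \<eta> \<in> Sec d \<Longrightarrow> F \<eta> - F \<zeta> = cblin (\<zeta> - \<eta>) o\<^sub>L (F \<eta> o\<^sub>L R \<zeta>)"
    and nF: "\<And>\<zeta>. \<zeta> \<in> Sec d \<Longrightarrow> norm (F \<zeta>) \<le> M * cmod \<zeta> powr (a - 1)"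
    and nR: "\<And>\<zeta>. \<zeta> \<in> Sec d \<Longrightarrow> norm (R \<zeta>) \<le> M / cmod \<zeta>"
    and contR: "continuous_on (Sec d) R"
begin

lemma F_continuous: "continuous_on (Sec d) F"
  by (rule sector_continuous) (erule (1) F_id, erule nF, erule nR)

lemma curve_continuous: "0 < m \<Longrightarrow> continuous_on S (\<lambda>l. F (of_real m * hyp d l))"
  by (rule continuous_on_compose2[OF F_continuous])
    (use hyp_in_Sec[OF d] in \<open>auto intro!: continuous_intros\<close>)

lemma curve_derivative:
  assumes m: "0 < m"
  shows "((\<lambda>l. F (of_real m * hyp d l)) has_vector_derivative
    - (cblin (of_real m * hyp' d l) o\<^sub>L (F (of_real m * hyp d l) o\<^sub>L R (of_real m * hyp d l)))) (at l)"
  unfolding has_vector_derivative_iff_quotient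
proof -
  let ?z = "\<lambda>l. of_real m * hyp d l"
  let ?q = "\<lambda>y. (1 / (y - l)) *\<^sub>R (hyp d y - hyp d l)"
  have "((\<lambda>y. cblin (- (of_real m * ?q y)) o\<^sub>L (F (?z y) o\<^sub>L R (?z l))) \<longlongrightarrow>
     cblin (- (of_real m * hyp' d l)) o\<^sub>L (F (?z l) o\<^sub>L R (?z l))) (at l)"
  proof (intro bc.tendsto tendsto_const bounded_linear.tendsto[OF bounded_linear_cblin] tendsto_intros)
    show "(?q \<longlongrightarrow> hyp' d l) (at l)" using hyp_derivative unfolding has_vector_derivative_iff_quotient .
    show "((\<lambda>y. F (?z y)) \<longlongrightarrow> F (?z l)) (at l)"
      using curve_continuous[OF m, of UNIV] by (simp add: continuous_on_def)
  qed
  moreover have "cblin (- (of_real m * ?q y)) o\<^sub>L (F (?z y) o\<^sub>L R (?z l)) = (1 / (y - l)) *\<^sub>R (F (?z y) - F (?z l))"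
    for y
  proof -
    have "F (?z y) - F (?z l) = cblin (?z l - ?z y) o\<^sub>L (F (?z y) o\<^sub>L R (?z l))"
      by (rule F_id) (intro hyp_in_Sec[OF d] m)+
    moreover have "- (of_real m * ?q y) = (1 / (y - l)) *\<^sub>R (?z l - ?z y)"
      by (simp only: mult_scaleR_right scaleR_minus_right[symmetric] right_diff_distrib minus_diff_eq)
    ultimately show ?thesis by (simp only: bc.scaleR_left linear_simps(5)[OF bounded_linear_cblin])
  qed
  ultimately have "((\<lambda>y. (1 / (y - l)) *\<^sub>R (F (?z y) - F (?z l))) \<longlongrightarrow>
      cblin (- (of_real m * hyp' d l)) o\<^sub>L (F (?z l) o\<^sub>L R (?z l))) (at l)" by (simp only:)
  moreover have "cblin (- (of_real m * hyp' d l)) o\<^sub>L (F (?z l) o\<^sub>L R (?z l)) =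
      - (cblin (of_real m * hyp' d l) o\<^sub>L (F (?z l) o\<^sub>L R (?z l)))"
    unfolding linear_simps(4)[OF bounded_linear_cblin] by (rule bc.minus_left)
  ultimately show "((\<lambda>y. (1 / (y - l)) *\<^sub>R (F (?z y) - F (?z l))) \<longlongrightarrow>
      - (cblin (of_real m * hyp' d l) o\<^sub>L (F (?z l) o\<^sub>L R (?z l)))) (at l)" by (simp only:)
qed

definition E :: "real \<Rightarrow> 'x cop" where
  "E m = m *\<^sub>R cint d (\<lambda>_. 1) F m"

definition G :: "real \<Rightarrow> 'x cop" where
  "G m = cint d (hyp d) F m"

text \<open>This is - \<zeta> F'(\<zeta>), so that d/dm (m F(m z)) = F(m z) - F2(m z).\<close>

definition F2 :: "complex \<Rightarrow> 'x cop" where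
  "F2 \<zeta> = cblin \<zeta> o\<^sub>L (F \<zeta> o\<^sub>L R \<zeta>)"

lemma F2_bound: "\<zeta> \<in> Sec d \<Longrightarrow> norm (F2 \<zeta>) \<le> 2 * M\<^sup>2 * cmod \<zeta> powr (a - 1)"
proof -
  assume z: "\<zeta> \<in> Sec d"
  have "norm (F2 \<zeta>) \<le> 2 * cmod \<zeta> * (M * cmod \<zeta> powr (a - 1) * (M / cmod \<zeta>))"
    unfolding F2_def by (intro norm_blinfun_compose_mult norm_cblin nF nR z)
  also have "\<dots> = 2 * M\<^sup>2 * cmod \<zeta> powr (a - 1)" using z by (simp add: Sec_def power2_eq_square)
  finally show ?thesis .
qed

lemma F2_continuous: "continuous_on (Sec d) F2"
  unfolding F2_def
  by (intro continuous_intros F_continuous contR bounded_linear.continuous_on[OF bounded_linear_cblin])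

lemma coeff_le: "cmod 1 \<le> 2 * (1 + 2 * \<bar>l\<bar>) ^ 3" "cmod (hyp d l) \<le> 2 * (1 + 2 * \<bar>l\<bar>) ^ 3"
  "cmod (1 / hyp d l) \<le> 2 * (1 + 2 * \<bar>l\<bar>) ^ 3"
proof -
  have 1: "1 \<le> (1 + 2 * \<bar>l\<bar>) ^ 3" by (rule one_le_power) simp
  thus "cmod 1 \<le> 2 * (1 + 2 * \<bar>l\<bar>) ^ 3" unfolding norm_one by linarith
  show "cmod (1 / hyp d l) \<le> 2 * (1 + 2 * \<bar>l\<bar>) ^ 3" using cmod_inverse_hyp[OF d, of l] 1 by linarith
  have "(1 + 2 * \<bar>l\<bar>) ^ 1 \<le> (1 + 2 * \<bar>l\<bar>) ^ 3" by (rule power_increasing) auto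
  thus "cmod (hyp d l) \<le> 2 * (1 + 2 * \<bar>l\<bar>) ^ 3" using cmod_hyp_le[OF d, of l] by simp
qed

lemma cint_F:
  assumes "continuous_on UNIV q" "\<And>l. cmod (q l) \<le> 2 * (1 + 2 * \<bar>l\<bar>) ^ 3" "0 < m"
  shows "(\<lambda>l. cblin (wt d l * q l) o\<^sub>L F (of_real m * hyp d l)) integrable_on UNIV"
    "norm (cint d q F m) \<le> 8 * integral UNIV (wtn d) * M * m powr (a - 1)"
  by (rule cint_bound[OF d assms(1,2) F_continuous _ a assms(3) M], rule nF, assumption)+

lemma continuous_inverse_hyp: "continuous_on S (\<lambda>l. 1 / hyp d l)"
  by (intro continuous_intros) (auto simp: hyp_nonzero[OF d])

lemmas cint1 = cint_F[OF continuous_on_const coeff_le(1)]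
lemmas cint_hyp = cint_F[OF continuous_hyp coeff_le(2)]
lemmas cint_inverse = cint_F[OF continuous_inverse_hyp coeff_le(3)]

lemma cint1_F2:
  "0 < m \<Longrightarrow> (\<lambda>l. cblin (wt d l * 1) o\<^sub>L F2 (of_real m * hyp d l)) integrable_on UNIV"
  by (rule cint_bound(1)[OF d continuous_on_const coeff_le(1) F2_continuous _ a, of "2 * M\<^sup>2"], rule F2_bound) auto

lemma norm_E: "0 < m \<Longrightarrow> norm (E m) \<le> 8 * integral UNIV (wtn d) * M * m powr a"
proof -
  assume m: "0 < m"
  have "norm (E m) \<le> m * (8 * integral UNIV (wtn d) * M * m powr (a - 1))"
    unfolding E_def norm_scaleR using m cint1(2)[OF m] by (intro mult_mono) auto
  also have "\<dots> = 8 * integral UNIV (wtn d) * M * m powr a" using m by (simp add: powr_diff)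
  finally show ?thesis .
qed

lemma norm_G: "0 < m \<Longrightarrow> norm (G m) \<le> 8 * integral UNIV (wtn d) * M * m powr (a - 1)"
  unfolding G_def by (rule cint_hyp(2))

lemma norm_curve_F:
  assumes "0 < m"
  shows "norm (F (of_real m * hyp d l)) \<le> 2 * M * m powr (a - 1)"
proof -
  let ?p = "cmod (hyp d l)"
  have "?p powr (a - 1) \<le> (1 / 2) powr (a - 1)" using cmod_hyp_ge[OF d, of l] a by (intro powr_mono2') auto
  also have "\<dots> = 2 powr (1 - a)" using powr_minus_divide[of "2::real" "a - 1"] by (simp add: powr_divide)
  also have "\<dots> \<le> 2" using powr_mono[of "1 - a" 1 "2::real"] a by simp
  finally have p: "?p powr (a - 1) \<le> 2" .
  have "norm (F (of_real m * hyp d l)) \<le> M * (m powr (a - 1) * ?p powr (a - 1))"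
    using nF[OF hyp_in_Sec[OF d assms, of l]] assms by (simp add: norm_mult powr_mult)
  also have "\<dots> \<le> M * (m powr (a - 1) * 2)" using M p by (intro mult_left_mono) auto
  finally show ?thesis by (simp add: mult_ac)
qed

lemma norm_curve_R:
  assumes "0 < m"
  shows "norm (R (of_real m * hyp d l)) \<le> 2 * M / m"
proof -
  have "norm (R (of_real m * hyp d l)) \<le> M / (m * cmod (hyp d l))"
    using nR[OF hyp_in_Sec[OF d assms, of l]] assms by (simp add: norm_mult)
  also have "\<dots> \<le> M / (m * (1 / 2))"
    using cmod_hyp_ge[OF d, of l] assms M by (intro divide_left_mono mult_left_mono mult_pos_pos) auto
  finally show ?thesis by (simp add: mult.commute)
qed

text \<open>The total derivative of e^z z F(m z) along the path integrates to 0. Thus the term F -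
  F2, where the derivative in m falls on \<open>F\<close>, is replaced by - G, where it falls on the
  exponential.\<close>

lemma cint_identity:
  assumes m: "0 < m"
  shows "cint d (\<lambda>_. 1) F m + G m - cint d (\<lambda>_. 1) F2 m = 0"
proof -
  let ?p = "hyp d"
  let ?z = "\<lambda>l. of_real m * ?p l"
  define H where "H l = cblin (exp (?p l) * ?p l) o\<^sub>L F (?z l)" for l
  define h where "h l = (cblin (wt d l * 1) o\<^sub>L F (?z l)) + (cblin (wt d l * ?p l) o\<^sub>L F (?z l))
     - (cblin (wt d l * 1) o\<^sub>L F2 (?z l))" for l
  have hi: "(h has_integral (cint d (\<lambda>_. 1) F m + G m - cint d (\<lambda>_. 1) F2 m)) UNIV"
    unfolding h_def G_def cint_def[OF d]
    by (intro has_integral_add has_integral_diff integrable_integral cint1 cint_hyp cint1_F2 m)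
  have der: "(H has_vector_derivative h l) (at l)" for l
  proof -
    have "((\<lambda>l. exp (?p l) * ?p l) has_vector_derivative exp (?p l) * hyp' d l + wt d l * ?p l) (at l)"
      by (rule has_vector_derivative_mult[OF exp_hyp_derivative hyp_derivative])
    from bounded_linear.has_vector_derivative[OF bounded_linear_cblin this]
    have "((\<lambda>l. cblin (exp (?p l) * ?p l)) has_vector_derivative cblin (wt d l + wt d l * ?p l)) (at l)"
      by (simp add: wt_def)
    from bc.has_vector_derivative[OF this curve_derivative[OF m]]
    have "(H has_vector_derivative
       (cblin (exp (?p l) * ?p l) o\<^sub>L - (cblin (of_real m * hyp' d l) o\<^sub>L (F (?z l) o\<^sub>L R (?z l)))) +
       (cblin (wt d l + wt d l * ?p l) o\<^sub>L F (?z l))) (at l)" unfolding H_def .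
    moreover have "cblin (exp (?p l) * ?p l) o\<^sub>L (cblin (of_real m * hyp' d l) o\<^sub>L (F (?z l) o\<^sub>L R (?z l)))
       = cblin (wt d l * 1) o\<^sub>L F2 (?z l)"
    proof -
      have "exp (?p l) * ?p l * (of_real m * hyp' d l) = (wt d l * 1) * ?z l" by (simp add: wt_def mult_ac)
      thus ?thesis unfolding F2_def blinfun_compose_assoc[symmetric] cblin_mult[symmetric] by (simp only:)
    qed
    ultimately show ?thesis by (simp add: h_def bc.minus_right cblin_add bc.add_left algebra_simps)
  qed
  have bd: "norm (H l) \<le> (4 * M * m powr (a - 1)) * wtn d l" for l
  proof -
    have "cmod (exp (?p l) * ?p l) \<le> cmod (wt d l) * (1 + 2 * \<bar>l\<bar>) ^ 1"
      unfolding norm_mult using cmod_exp_hyp_le_wt[OF d] cmod_hyp_le[OF d] by (intro mult_mono) auto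
    also have "\<dots> \<le> wtn d l" unfolding wtn_def[OF d] by (intro mult_left_mono power_increasing) auto
    finally have "norm (cblin (exp (?p l) * ?p l) :: ('x \<times> 'x) \<Rightarrow>\<^sub>L _) \<le> 2 * wtn d l"
      by (intro order_trans[OF norm_cblin]) simp
    from norm_blinfun_compose_mult[OF this norm_curve_F[OF m]] show ?thesis by (simp add: H_def mult_ac)
  qed
  have "integral UNIV h = 0 - 0"
  proof (rule integral_derivative_UNIV[OF der has_integral_integrable[OF hi]])
    show "(H \<longlongrightarrow> 0) at_top"
      by (rule Lim_null_comparison[OF _ tendsto_mult_right_zero[OF wtn_tendsto(1)[OF d], of "4 * M * m powr (a - 1)"]])
        (use bd in simp)
    show "(H \<longlongrightarrow> 0) at_bot"
      by (rule Lim_null_comparison[OF _ tendsto_mult_right_zero[OF wtn_tendsto(2)[OF d], of "4 * M * m powr (a - 1)"]])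
        (use bd in simp)
  qed
  thus ?thesis using integral_unique[OF hi] by simp
qed

text \<open>The identity \<open>F_id\<close> is used twice, once for the linear term and once more
  inside the remainder, which gives the second order expansion of m F(m p) in m.\<close>

lemma F_taylor:
  fixes p :: complex
  assumes "0 < m" "0 < n" and z: "of_real m * p \<in> Sec d" "of_real n * p \<in> Sec d"
  shows "n *\<^sub>R F (of_real n * p) - m *\<^sub>R F (of_real m * p) - (n - m) *\<^sub>R (F (of_real m * p) - F2 (of_real m * p)) =
    (n - m)\<^sup>2 *\<^sub>R (n *\<^sub>R (cblin (p * p) o\<^sub>L ((F (of_real n * p) o\<^sub>L R (of_real m * p)) o\<^sub>L R (of_real m * p)))
      - (cblin p o\<^sub>L (F (of_real m * p) o\<^sub>L R (of_real m * p))))"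
proof -
  define f f' r where "f = F (of_real m * p)" and "f' = F (of_real n * p)" and "r = R (of_real m * p)"
  define h where "h = n - m"
  have 1: "f' = f - h *\<^sub>R (cblin p o\<^sub>L (f' o\<^sub>L r))"
  proof -
    have "f' - f = cblin (of_real m * p - of_real n * p) o\<^sub>L (f' o\<^sub>L r)"
      unfolding f_def f'_def r_def by (rule F_id[OF z])
    also have "of_real m * p - of_real n * p = (- h) *\<^sub>R p" by (simp add: h_def scaleR_conv_of_real algebra_simps)
    finally have "f' - f = - (h *\<^sub>R (cblin p o\<^sub>L (f' o\<^sub>L r)))"
      by (simp only: linear_simps(5)[OF bounded_linear_cblin] bc.scaleR_left) simp
    thus ?thesis by (simp add: algebra_simps)
  qed
  have 2: "f' = f - h *\<^sub>R (cblin p o\<^sub>L (f o\<^sub>L r)) + (h * h) *\<^sub>R (cblin (p * p) o\<^sub>L ((f' o\<^sub>L r) o\<^sub>L r))"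
  proof -
    have "f' o\<^sub>L r = (f o\<^sub>L r) - h *\<^sub>R (cblin p o\<^sub>L ((f' o\<^sub>L r) o\<^sub>L r))"
      by (subst 1) (simp add: bc.diff_left bc.scaleR_left blinfun_compose_assoc)
    hence "cblin p o\<^sub>L (f' o\<^sub>L r) = cblin p o\<^sub>L ((f o\<^sub>L r) - h *\<^sub>R (cblin p o\<^sub>L ((f' o\<^sub>L r) o\<^sub>L r)))"
      by (rule arg_cong)
    also have "\<dots> = (cblin p o\<^sub>L (f o\<^sub>L r)) - h *\<^sub>R (cblin (p * p) o\<^sub>L ((f' o\<^sub>L r) o\<^sub>L r))"
      by (simp only: bc.diff_right bc.scaleR_right cblin_mult blinfun_compose_assoc)
    finally have e: "cblin p o\<^sub>L (f' o\<^sub>L r) = (cblin p o\<^sub>L (f o\<^sub>L r)) - h *\<^sub>R (cblin (p * p) o\<^sub>L ((f' o\<^sub>L r) o\<^sub>L r))" .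
    have "f' = f - h *\<^sub>R ((cblin p o\<^sub>L (f o\<^sub>L r)) - h *\<^sub>R (cblin (p * p) o\<^sub>L ((f' o\<^sub>L r) o\<^sub>L r)))"
      unfolding e[symmetric] by (rule 1)
    thus ?thesis by (simp only: scaleR_diff_right scaleR_scaleR diff_diff_eq2 diff_add_eq)
  qed
  have 3: "F2 (of_real m * p) = m *\<^sub>R (cblin p o\<^sub>L (f o\<^sub>L r))"
  proof -
    have "of_real m * p = m *\<^sub>R p" by (simp add: scaleR_conv_of_real)
    thus ?thesis unfolding F2_def f_def r_def
      by (simp only: linear_simps(5)[OF bounded_linear_cblin] bc.scaleR_left)
  qed
  have nu: "n = m + h" by (simp add: h_def)
  let ?X = "cblin p o\<^sub>L (f o\<^sub>L r)" and ?Z = "cblin (p * p) o\<^sub>L ((f' o\<^sub>L r) o\<^sub>L r)"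
  have "n *\<^sub>R f' - m *\<^sub>R f - h *\<^sub>R (f - m *\<^sub>R ?X) = (h * h) *\<^sub>R (n *\<^sub>R ?Z - ?X)"
  proof -
    have "n *\<^sub>R f' = n *\<^sub>R f - (n * h) *\<^sub>R ?X + (n * (h * h)) *\<^sub>R ?Z"
      by (subst 2) (simp add: scaleR_diff_right scaleR_add_right)
    thus ?thesis unfolding nu by (simp add: algebra_simps)
  qed
  thus ?thesis unfolding 3 f_def[symmetric] f'_def[symmetric] r_def[symmetric] h_def[symmetric]
    by (simp add: power2_eq_square)
qed

text \<open>The remainder of \<open>F_taylor\<close>, whose coefficients grow at most quadratically
  along the path, is integrable against the weight; \<open>cint_identity\<close> identifies the
  linear term.\<close>

lemma E_derivative:
  assumes m: "0 < m"
  shows "(E has_vector_derivative - G m) (at m)"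
proof -
  let ?p = "hyp d"
  let ?r = "2 * M / m" and ?f = "2 * M * (m / 2) powr (a - 1)"
  define K where "K = 2 * ((2 * m) * (2 * (?f * ?r * ?r)) + 2 * (?f * ?r))"
  have K: "0 \<le> ?f" "0 \<le> ?r" using M m by auto
  have K0: "0 \<le> K" unfolding K_def using K M m by (intro mult_nonneg_nonneg add_nonneg_nonneg) auto
  define C where "C = K * integral UNIV (wtn d)"
  have D: "cint d (\<lambda>_. 1) F m - cint d (\<lambda>_. 1) F2 m = - G m"
    using cint_identity[OF m] by (simp add: algebra_simps eq_neg_iff_add_eq_0)
  show ?thesis
  proof (rule has_vector_derivative_quadratic[of "m / 2" _ _ _ C])
    fix n assume "\<bar>n - m\<bar> < m / 2"
    hence n: "m / 2 \<le> n" "n \<le> 2 * m" "0 < n" using m by linarith+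
    let ?g = "\<lambda>l. n *\<^sub>R (cblin (wt d l * 1) o\<^sub>L F (of_real n * ?p l)) - m *\<^sub>R (cblin (wt d l * 1) o\<^sub>L F (of_real m * ?p l))
       - (n - m) *\<^sub>R ((cblin (wt d l * 1) o\<^sub>L F (of_real m * ?p l)) - (cblin (wt d l * 1) o\<^sub>L F2 (of_real m * ?p l)))"
    have hg: "(?g has_integral (E n - E m - (n - m) *\<^sub>R (cint d (\<lambda>_. 1) F m - cint d (\<lambda>_. 1) F2 m))) UNIV"
      unfolding E_def cint_def[OF d]
      by (intro has_integral_diff has_integral_cmul integrable_integral cint1 cint1_F2 m n)
    have bd: "norm (?g l) \<le> ((n - m)\<^sup>2 * K) * wtn d l" for l
    proof -
      let ?s = "1 + 2 * \<bar>l\<bar>"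
      define X where "X = n *\<^sub>R (cblin (?p l * ?p l) o\<^sub>L ((F (of_real n * ?p l) o\<^sub>L R (of_real m * ?p l)) o\<^sub>L R (of_real m * ?p l)))
          - (cblin (?p l) o\<^sub>L (F (of_real m * ?p l) o\<^sub>L R (of_real m * ?p l)))"
      have "?g l = cblin (wt d l) o\<^sub>L (n *\<^sub>R F (of_real n * ?p l) - m *\<^sub>R F (of_real m * ?p l)
           - (n - m) *\<^sub>R (F (of_real m * ?p l) - F2 (of_real m * ?p l)))"
        by (simp add: bc.diff_right bc.scaleR_right)
      also have "\<dots> = (n - m)\<^sup>2 *\<^sub>R (cblin (wt d l) o\<^sub>L X)"
        unfolding F_taylor[OF m n(3) hyp_in_Sec[OF d m] hyp_in_Sec[OF d n(3)]] X_def by (rule bc.scaleR_right)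
      finally have eq: "?g l = (n - m)\<^sup>2 *\<^sub>R (cblin (wt d l) o\<^sub>L X)" .
      have F': "norm (F (of_real n * ?p l)) \<le> ?f" "norm (F (of_real m * ?p l)) \<le> ?f"
        by (rule order_trans[OF norm_curve_F mult_left_mono]; use n m a M in \<open>auto intro!: powr_mono2'\<close>)+
      note r = norm_curve_R[OF m, of l]
      have s1: "1 \<le> ?s ^ 2" by (rule one_le_power) simp
      have p2: "cmod (?p l * ?p l) \<le> ?s ^ 2" unfolding norm_mult power2_eq_square
        using cmod_hyp_le[OF d] by (intro mult_mono) auto
      have p1: "cmod (?p l) \<le> ?s ^ 2" using cmod_hyp_le[OF d, of l] power_increasing[of 1 2 ?s] by simp
      have c2: "norm (cblin (?p l * ?p l) :: ('x \<times> 'x) \<Rightarrow>\<^sub>L _) \<le> 2 * ?s ^ 2"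
        by (rule order_trans[OF norm_cblin]) (use p2 in simp)
      have c1: "norm (cblin (?p l) :: ('x \<times> 'x) \<Rightarrow>\<^sub>L _) \<le> 2 * ?s ^ 2"
        by (rule order_trans[OF norm_cblin]) (use p1 in simp)
      have "norm X \<le> (2 * m) * (2 * ?s ^ 2 * (?f * ?r * ?r)) + 2 * ?s ^ 2 * (?f * ?r)" unfolding X_def
      proof (intro order_trans[OF norm_triangle_ineq4] add_mono)
        show "norm (n *\<^sub>R (cblin (?p l * ?p l) o\<^sub>L ((F (of_real n * ?p l) o\<^sub>L R (of_real m * ?p l)) o\<^sub>L R (of_real m * ?p l))))
            \<le> (2 * m) * (2 * ?s ^ 2 * (?f * ?r * ?r))" unfolding norm_scaleR using n
          by (intro mult_mono norm_blinfun_compose_mult c2 F' r) auto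
        show "norm (cblin (?p l) o\<^sub>L (F (of_real m * ?p l) o\<^sub>L R (of_real m * ?p l))) \<le> 2 * ?s ^ 2 * (?f * ?r)"
          by (intro norm_blinfun_compose_mult c1 F' r)
      qed
      hence "2 * norm X \<le> 2 * ((2 * m) * (2 * ?s ^ 2 * (?f * ?r * ?r)) + 2 * ?s ^ 2 * (?f * ?r))"
        by (rule mult_left_mono) simp
      also have "\<dots> = K * ?s ^ 2"
      proof -
        have "2 * ((2 * m) * (2 * t * A) + 2 * t * B) = 2 * ((2 * m) * (2 * A) + 2 * B) * t" for A B t :: real
          by (simp add: algebra_simps)
        thus ?thesis unfolding K_def .
      qed
      finally have "2 * norm X \<le> K * ?s ^ 2" .
      hence "2 * cmod (wt d l) * norm X \<le> cmod (wt d l) * (K * ?s ^ 2)"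
        using mult_left_mono[of "2 * norm X" "K * ?s ^ 2" "cmod (wt d l)"] by (simp add: mult_ac)
      also have "\<dots> \<le> cmod (wt d l) * (K * ?s ^ 4)" using K0 by (intro mult_left_mono power_increasing) auto
      finally have "2 * cmod (wt d l) * norm X \<le> K * wtn d l" by (simp add: wtn_def[OF d] mult_ac)
      hence "norm (cblin (wt d l) o\<^sub>L X) \<le> K * wtn d l"
        using norm_blinfun_compose_mult[OF norm_cblin order_refl, of "wt d l" X] by linarith
      thus ?thesis unfolding eq using mult_left_mono[of _ _ "(n - m)\<^sup>2"] by (simp add: mult.assoc)
    qed
    have "norm (integral UNIV ?g) \<le> integral UNIV (\<lambda>l. ((n - m)\<^sup>2 * K) * wtn d l)"
      by (rule integral_norm_bound_integral[OF has_integral_integrable[OF hg] _ bd])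
        (rule integrable_on_mult_right[OF wtn_integrable[OF d]])
    also have "\<dots> = ((n - m)\<^sup>2 * K) * integral UNIV (wtn d)" by (rule integral_mult_right)
    finally show "norm (E n - E m - (n - m) *\<^sub>R - G m) \<le> C * (n - m)\<^sup>2"
      unfolding integral_unique[OF hg] D C_def by (simp add: mult_ac)
  qed (use m in simp)
qed

text \<open>Large m is small time. The term w / \<zeta> contributes the integral of e^z / z, which
  is 2 \<pi> i, and the term F(\<zeta>) z / \<zeta> is of order m^(a-1). This yields the initial
  condition of the semigroup.\<close>

lemma E_limit:
  assumes v: "\<And>\<zeta>. \<zeta> \<in> Sec d \<Longrightarrow> F \<zeta> v = cscale (1 / \<zeta>) (w - F \<zeta> z)"
  shows "((\<lambda>m. E m v) \<longlongrightarrow> cscale (2 * of_real pi * \<i>) w) at_top"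
proof -
  let ?p = "hyp d"
  have eq: "E m v = cscale (2 * of_real pi * \<i>) w - cint d (\<lambda>l. 1 / ?p l) F m z" if m: "0 < m" for m
  proof -
    have bl: "bounded_linear (\<lambda>c. cscale c w)"
      using bounded_linear_compose[OF blinfun.bounded_linear_left bounded_linear_cblin, of w] by simp
    have 1: "((\<lambda>l. m *\<^sub>R blinfun_apply (cblin (wt d l * 1) o\<^sub>L F (of_real m * ?p l)) v) has_integral E m v) UNIV"
      unfolding E_def cint_def[OF d] blinfun.scaleR_left
      using has_integral_linear[OF integrable_integral[OF cint1(1)[OF m]] blinfun.bounded_linear_left[of v]]
      by (intro has_integral_cmul) (simp add: o_def)
    have "((\<lambda>l. cscale (wt d l / ?p l) w - blinfun_apply (cblin (wt d l * (1 / ?p l)) o\<^sub>L F (of_real m * ?p l)) z)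
       has_integral (cscale (2 * of_real pi * \<i>) w - cint d (\<lambda>l. 1 / ?p l) F m z)) UNIV"
      unfolding cint_def[OF d] integral_wt_hyp[OF d, symmetric]
      using has_integral_linear[OF integrable_integral[OF cint_inverse(1)[OF m]] blinfun.bounded_linear_left[of z]]
        has_integral_linear[OF integrable_integral[OF wt_hyp_integrable[OF d]] bl]
      by (intro has_integral_diff) (simp_all add: o_def)
    moreover have "cscale (wt d l / ?p l) w - blinfun_apply (cblin (wt d l * (1 / ?p l)) o\<^sub>L F (of_real m * ?p l)) z =
       m *\<^sub>R blinfun_apply (cblin (wt d l * 1) o\<^sub>L F (of_real m * ?p l)) v" for l
    proof -
      have c: "of_real m * (wt d l * (1 / (of_real m * ?p l))) = wt d l / ?p l"
        using m hyp_nonzero[OF d, of l] by simp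
      have "m *\<^sub>R blinfun_apply (cblin (wt d l * 1) o\<^sub>L F (of_real m * ?p l)) v =
        cscale (of_real m * (wt d l * (1 / (of_real m * ?p l)))) (w - F (of_real m * ?p l) z)"
        by (simp only: cscale_mult cscale_of_real) (simp add: v[OF hyp_in_Sec[OF d m]])
      thus ?thesis unfolding c by (simp add: cscale_diff_right)
    qed
    ultimately show ?thesis using has_integral_unique[OF 1] by simp
  qed
  have "((\<lambda>m. cint d (\<lambda>l. 1 / ?p l) F m z) \<longlongrightarrow> 0) at_top"
  proof (rule Lim_null_comparison)
    show "\<forall>\<^sub>F m in at_top. norm (cint d (\<lambda>l. 1 / ?p l) F m z) \<le>
        8 * integral UNIV (wtn d) * M * m powr (a - 1) * norm z" using eventually_gt_at_top[of 0]
      by eventually_elim (rule order_trans[OF norm_blinfun mult_right_mono[OF cint_inverse(2)]], auto)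
    have "((\<lambda>m. m powr (a - 1)) \<longlongrightarrow> 0) at_top" using a by (intro tendsto_neg_powr filterlim_ident) auto
    thus "((\<lambda>m. 8 * integral UNIV (wtn d) * M * m powr (a - 1) * norm z) \<longlongrightarrow> 0) at_top"
      by (intro tendsto_mult_left_zero tendsto_mult_right_zero)
  qed
  hence "((\<lambda>m. cscale (2 * of_real pi * \<i>) w - cint d (\<lambda>l. 1 / ?p l) F m z) \<longlongrightarrow>
      cscale (2 * of_real pi * \<i>) w - 0) at_top" by (intro tendsto_intros)
  moreover have "\<forall>\<^sub>F m in at_top. cscale (2 * of_real pi * \<i>) w - cint d (\<lambda>l. 1 / ?p l) F m z = E m v"
    using eventually_gt_at_top[of 0] by eventually_elim (simp add: eq)
  ultimately have "((\<lambda>m. E m v) \<longlongrightarrow> cscale (2 * of_real pi * \<i>) w - 0) at_top" by (rule Lim_transform_eventually)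
  thus ?thesis by simp
qed

end

text \<open>\<open>S t\<close> stands for e^(-tL), \<open>Y t\<close> for A^\<alpha> e^(-tL) and
  \<open>Y t o\<^sub>L J\<close> for the semigroup in X_\<alpha> read in the coordinate of X;
  \<open>Li\<close> is the inverse of \<open>L\<close>. These are the facts that the contour
  integrals yield directly; the semigroup law is derived from them in
  \<open>S_semigroup\<close>.\<close>

locale analytic_semigroup =
  fixes D :: "'x::banach set" and L :: "'x \<Rightarrow> 'x" and J Li :: "'x \<Rightarrow>\<^sub>L 'x"
    and S Y S' Y' :: "real \<Rightarrow> 'x \<Rightarrow>\<^sub>L 'x" and \<alpha> \<omega> C :: real
  assumes lin: "linear_op D L" and al: "0 \<le> \<alpha>" "\<alpha> < 1" and pos: "0 < \<omega>" "0 < C"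
    and injJ: "inj J" and Li: "rresolv D L 0 Li"
    and SY: "\<And>t. 0 < t \<Longrightarrow> J o\<^sub>L Y t = S t"
    and nS: "\<And>t. 0 < t \<Longrightarrow> norm (S t) \<le> C * exp (- \<omega> * t)"
    and nY: "\<And>t. 0 < t \<Longrightarrow> norm (Y t) \<le> C * t powr (- \<alpha>) * exp (- \<omega> * t)"
    and nYJ: "\<And>t. 0 < t \<Longrightarrow> norm (Y t o\<^sub>L J) \<le> C * exp (- \<omega> * t)"
    and dS: "\<And>t. 0 < t \<Longrightarrow> (S has_vector_derivative S' t) (at t)"
    and nS': "\<And>t. 0 < t \<Longrightarrow> norm (S' t) \<le> C / t * exp (- \<omega> * t)"
    and dY: "\<And>t. 0 < t \<Longrightarrow> (Y has_vector_derivative Y' t) (at t)"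
    and nY': "\<And>t. 0 < t \<Longrightarrow> norm (Y' t) \<le> C * t powr (- 1 - \<alpha>) * exp (- \<omega> * t)"
    and SD: "\<And>t x. 0 < t \<Longrightarrow> S t x \<in> D"
    and S'L: "\<And>t x. 0 < t \<Longrightarrow> S' t x = - L (S t x)"
    and comm: "\<And>t x. 0 < t \<Longrightarrow> x \<in> D \<Longrightarrow> S t (L x) = L (S t x)"
    and S0: "\<And>x. ((\<lambda>t. S t x) \<longlongrightarrow> x) (at_right 0)"
    and Y0: "\<And>v. ((\<lambda>t. Y t (J v)) \<longlongrightarrow> v) (at_right 0)"

lemma tendsto_on_dense:
  fixes T :: "real \<Rightarrow> 'x::banach \<Rightarrow>\<^sub>L 'x"
  assumes T: "\<And>t. 0 < t \<Longrightarrow> norm (T t) \<le> C" and dense: "closure V = UNIV"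
    and lim: "\<And>x. x \<in> V \<Longrightarrow> ((\<lambda>t. T t x) \<longlongrightarrow> x) (at_right 0)"
  shows "((\<lambda>t. T t x) \<longlongrightarrow> x) (at_right 0)"
proof (rule tendstoI)
  fix e :: real assume e: "0 < e"
  have C: "0 \<le> C" using order_trans[OF norm_ge_zero T[of 1]] by simp
  define d where "d = e / (2 * (C + 1))"
  have d: "0 < d" using e C by (simp add: d_def)
  obtain v where v: "v \<in> V" "dist v x < d" using dense d closure_approachable[of x V] by auto
  have "\<forall>\<^sub>F t in at_right 0. dist (T t v) v < e / 2" using tendstoD[OF lim[OF v(1)], of "e / 2"] e by simp
  moreover have "\<forall>\<^sub>F t in at_right (0::real). 0 < t" by (simp add: eventually_at_right_less)
  ultimately show "\<forall>\<^sub>F t in at_right 0. dist (T t x) x < e"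
  proof eventually_elim
    case (elim t)
    have "norm (T t x - T t v) \<le> C * norm (x - v)" unfolding blinfun.diff_right[symmetric]
      by (rule order_trans[OF norm_blinfun mult_right_mono[OF T]]) (use elim in auto)
    also have "\<dots> \<le> C * d" using v(2) C by (intro mult_left_mono) (auto simp: dist_norm norm_minus_commute)
    finally have "dist (T t x) x \<le> C * d + dist (T t v) v + d"
      using dist_triangle[of "T t x" x v] dist_triangle[of "T t x" v "T t v"] v(2) by (simp add: dist_norm)
    also have "\<dots> < (C + 1) * d + e / 2" using elim by (simp add: algebra_simps)
    also have "\<dots> = e" using C by (simp add: d_def field_simps)
    finally show ?case .
  qed
qed

text \<open>Differentiating the factor e^(-\<omega> t) adds a term larger by \<omega> t than the
  main one; half of the decay rate absorbs it.\<close>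

lemma exp_decay_absorb:
  assumes "0 < \<omega>" "0 < (t::real)"
  shows "(1 + \<omega> * t) * exp (- \<omega> * t) \<le> 2 * exp (- (\<omega> / 2) * t)"
proof -
  have "1 + \<omega> * t / 2 \<le> exp (\<omega> * t / 2)" by (rule exp_ge_add_one_self)
  hence "1 + \<omega> * t \<le> 2 * exp (\<omega> * t / 2)" using assms by linarith
  hence "(1 + \<omega> * t) * exp (- \<omega> * t) \<le> (2 * exp (\<omega> * t / 2)) * exp (- \<omega> * t)" by (intro mult_right_mono) auto
  also have "\<dots> = 2 * exp (- (\<omega> / 2) * t)" by (simp flip: exp_add)
  finally show ?thesis .
qed

lemma region_obtain:
  assumes reg: "region D L J \<alpha> \<omega> d M"
  obtains R Y where "\<And>\<zeta>. \<zeta> \<in> Sec d \<Longrightarrow> resolv D L (\<zeta> - of_real \<omega>) (R \<zeta>)"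
    "\<And>\<zeta>. \<zeta> \<in> Sec d \<Longrightarrow> R \<zeta> = dg J o\<^sub>L Y \<zeta>"
    "\<And>\<zeta>. \<zeta> \<in> Sec d \<Longrightarrow> norm (R \<zeta>) \<le> M / cmod \<zeta>"
    "\<And>\<zeta>. \<zeta> \<in> Sec d \<Longrightarrow> norm (Y \<zeta>) \<le> M * cmod \<zeta> powr (\<alpha> - 1)"
    "\<And>\<zeta>. \<zeta> \<in> Sec d \<Longrightarrow> norm (Y \<zeta> o\<^sub>L dg J) \<le> M / cmod \<zeta>"
proof -
  have "\<exists>R Y. \<zeta> \<in> Sec d \<longrightarrow> resolv D L (\<zeta> - of_real \<omega>) R \<and> R = dg J o\<^sub>L Y \<and> norm R \<le> M / cmod \<zeta> \<and>
      norm Y \<le> M * cmod \<zeta> powr (\<alpha> - 1) \<and> norm (Y o\<^sub>L dg J) \<le> M / cmod \<zeta>" for \<zeta>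
    using reg[unfolded region_def, rule_format, of "\<zeta> - of_real \<omega>"] unfolding res_bd_def Sec_def by auto
  thus ?thesis using that by metis
qed

text \<open>The semigroup is e^(-\<omega> t) times the Dunford integral of the shifted resolvents,
  whose sector has its vertex at 0. The same integral over R and over Y = J^(-1) R gives the
  semigroup and A^\<alpha> times it.\<close>

lemma semigroup_exists:
  fixes D :: "'x::banach set" and J :: "'x \<Rightarrow>\<^sub>L 'x"
  assumes lin: "linear_op D L" and dense: "closure D = UNIV" and al: "0 \<le> \<alpha>" "\<alpha> < 1"
    and J: "inj J" "\<And>u. u \<in> D \<Longrightarrow> J u \<in> D" and ares: "ares D L J \<alpha>"
    and sp: "\<And>z. z \<in> spectrum UNIV D L \<Longrightarrow> 0 < Re z"
  obtains Li S Y S' Y' \<omega> C where "analytic_semigroup D L J Li S Y S' Y' \<alpha> \<omega> C"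
proof -
  obtain \<omega> d M where w: "0 < \<omega>" and d: "0 < d" "d \<le> 1" and M: "0 < M" and reg: "region D L J \<alpha> \<omega> d M"
    by (rule region_of_ares[OF lin ares al]) (erule sp, rule that)
  obtain R Y where R: "\<And>\<zeta>. \<zeta> \<in> Sec d \<Longrightarrow> resolv D L (\<zeta> - of_real \<omega>) (R \<zeta>)"
    and RY: "\<And>\<zeta>. \<zeta> \<in> Sec d \<Longrightarrow> R \<zeta> = dg J o\<^sub>L Y \<zeta>"
    and nR: "\<And>\<zeta>. \<zeta> \<in> Sec d \<Longrightarrow> norm (R \<zeta>) \<le> M / cmod \<zeta>"
    and nY: "\<And>\<zeta>. \<zeta> \<in> Sec d \<Longrightarrow> norm (Y \<zeta>) \<le> M * cmod \<zeta> powr (\<alpha> - 1)"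
    and nYJ: "\<And>\<zeta>. \<zeta> \<in> Sec d \<Longrightarrow> norm (Y \<zeta> o\<^sub>L dg J) \<le> M / cmod \<zeta>" by (rule region_obtain[OF reg]) (rule that)
  have pw: "M / cmod \<zeta> = M * cmod \<zeta> powr (0 - 1)" if "\<zeta> \<in> Sec d" for \<zeta>
    using that by (simp add: Sec_def powr_minus divide_inverse)
  have R_id: "R \<eta> - R \<zeta> = cblin (\<zeta> - \<eta>) o\<^sub>L (R \<eta> o\<^sub>L R \<zeta>)" if "\<zeta> \<in> Sec d" "\<eta> \<in> Sec d" for \<zeta> \<eta>
    using resolvent_identity[OF lin R[OF that(2)] R[OF that(1)]] by simp
  have dgJ: "x = y" if "dg J x = dg J y" for x y using that inj_map_prod[OF J(1)] by (simp add: inj_eq)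
  \<comment> \<open>The identity for R with the injective \<open>J\<close> cancelled from the
    left.\<close>
  have Y_id: "Y \<eta> - Y \<zeta> = cblin (\<zeta> - \<eta>) o\<^sub>L (Y \<eta> o\<^sub>L R \<zeta>)" if z: "\<zeta> \<in> Sec d" "\<eta> \<in> Sec d" for \<zeta> \<eta>
  proof (rule blinfun_eqI, rule dgJ)
    fix w
    have "dg J ((Y \<eta> - Y \<zeta>) w) = (R \<eta> - R \<zeta>) w"
      unfolding RY[OF z(1)] RY[OF z(2)] by (simp only: blinfun.diff_left blinfun_apply_blinfun_compose blinfun.diff_right)
    also have "\<dots> = cscale (\<zeta> - \<eta>) (R \<eta> (R \<zeta> w))" unfolding R_id[OF z] by simp
    also have "\<dots> = dg J ((cblin (\<zeta> - \<eta>) o\<^sub>L (Y \<eta> o\<^sub>L R \<zeta>)) w)"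
      unfolding RY[OF z(2)] by (simp add: map_prod_cscale)
    finally show "dg J ((Y \<eta> - Y \<zeta>) w) = dg J ((cblin (\<zeta> - \<eta>) o\<^sub>L (Y \<eta> o\<^sub>L R \<zeta>)) w)" .
  qed
  have nR0: "norm (R \<zeta>) \<le> M * cmod \<zeta> powr (0 - 1)" if "\<zeta> \<in> Sec d" for \<zeta>
    using nR[OF that] unfolding pw[OF that] .
  have contR: "continuous_on (Sec d) R" by (rule sector_continuous) (erule (1) R_id, erule nR0, erule nR)
  interpret r: sector_family d 0 M R R by unfold_locales (use d M R_id nR0 nR contR in auto)
  interpret y: sector_family d \<alpha> M Y R by unfold_locales (use d al M Y_id nY nR contR in auto)
  define c1 where "c1 = 1 / (2 * of_real pi * \<i>)"
  \<comment> \<open>Division by 2 \<pi> i and return to the real space. The norm does not grow,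
    since the factor 2 of \<open>norm_cblin\<close> is outweighed by 2 \<pi>.\<close>
  define \<Phi> where "\<Phi> W = re_part (cblin c1 o\<^sub>L W)" for W :: "'x cop"
  have c1n: "2 * cmod c1 \<le> 1" using pi_gt3 by (simp add: c1_def norm_mult norm_divide)
  have bl\<Phi>: "bounded_linear \<Phi>"
    unfolding \<Phi>_def by (rule bounded_linear_compose[OF bounded_linear_re_part bc.bounded_linear_right])
  have n\<Phi>: "norm (\<Phi> W) \<le> norm W" for W
  proof -
    have "norm (\<Phi> W) \<le> norm (cblin c1 o\<^sub>L W)" unfolding \<Phi>_def by (rule norm_re_part)
    also have "\<dots> \<le> 2 * cmod c1 * norm W" by (intro norm_blinfun_compose_mult norm_cblin order_refl)
    also have "\<dots> \<le> 1 * norm W" using c1n by (intro mult_right_mono) auto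
    finally show ?thesis by simp
  qed
  have \<Phi>_apply: "\<Phi> W x = fst (cscale c1 (W (x, 0)))" for W x by (simp add: \<Phi>_def re_part_apply)
  define S where "S t = exp (- \<omega> * t) *\<^sub>R \<Phi> (r.E (1 / t))" for t
  define T where "T t = exp (- \<omega> * t) *\<^sub>R \<Phi> (y.E (1 / t))" for t
  define S' where "S' t = exp (- \<omega> * t) *\<^sub>R (\<Phi> ((1 / t\<^sup>2) *\<^sub>R r.G (1 / t)) - \<omega> *\<^sub>R \<Phi> (r.E (1 / t)))" for t
  define T' where "T' t = exp (- \<omega> * t) *\<^sub>R (\<Phi> ((1 / t\<^sup>2) *\<^sub>R y.G (1 / t)) - \<omega> *\<^sub>R \<Phi> (y.E (1 / t)))" for t
  define K where "K = 8 * integral UNIV (wtn d) * M"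
  have K: "0 \<le> K" unfolding K_def using M wtn_nonneg[OF d]
    by (intro mult_nonneg_nonneg integral_nonneg[OF wtn_integrable[OF d]]) auto
  have chain: "((\<lambda>t. exp (- \<omega> * t) *\<^sub>R \<Phi> (E (1 / t))) has_vector_derivative
      exp (- \<omega> * t) *\<^sub>R (\<Phi> ((1 / t\<^sup>2) *\<^sub>R G (1 / t)) - \<omega> *\<^sub>R \<Phi> (E (1 / t)))) (at t)"
    if t: "0 < t" and E: "\<And>m. 0 < m \<Longrightarrow> (E has_vector_derivative - G m) (at m)" for t E G
  proof -
    have "((\<lambda>t. 1 / t) has_vector_derivative - (1 / t\<^sup>2)) (at t)"
      using t by (auto intro!: derivative_eq_intros simp: power2_eq_square simp flip: has_real_derivative_iff_has_vector_derivative)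
    from vector_diff_chain_at[OF this E[of "1 / t"]] t
    have "((\<lambda>t. E (1 / t)) has_vector_derivative (1 / t\<^sup>2) *\<^sub>R G (1 / t)) (at t)" by (simp add: o_def)
    from bounded_linear.has_vector_derivative[OF bl\<Phi> this]
    have 1: "((\<lambda>t. \<Phi> (E (1 / t))) has_vector_derivative \<Phi> ((1 / t\<^sup>2) *\<^sub>R G (1 / t))) (at t)" .
    have 2: "((\<lambda>t. exp (- \<omega> * t)) has_real_derivative - \<omega> * exp (- \<omega> * t)) (at t)"
      by (auto intro!: derivative_eq_intros)
    from has_vector_derivative_scaleR[OF 2 1] show ?thesis by (simp add: scaleR_diff_right mult.commute)
  qed
  have nE: "norm (exp (- \<omega> * t) *\<^sub>R \<Phi> (W)) \<le> (2 * K + 1) * t powr (- a) * exp (- (\<omega> / 2) * t)"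
    if t: "0 < t" and E: "norm (W) \<le> K * (1 / t) powr a" for t a and W :: "'x cop"
  proof -
    have "norm (exp (- \<omega> * t) *\<^sub>R \<Phi> (W)) \<le> exp (- \<omega> * t) * (K * (1 / t) powr a)"
      unfolding norm_scaleR using order_trans[OF n\<Phi> E] by (intro mult_mono) auto
    also have "(1 / t) powr a = t powr (- a)" using t by (simp add: powr_divide powr_minus_divide)
    also have "exp (- \<omega> * t) * (K * t powr (- a)) \<le> exp (- (\<omega> / 2) * t) * ((2 * K + 1) * t powr (- a))"
      using t w K by (intro mult_mono) auto
    finally show ?thesis by (simp add: mult_ac)
  qed
  have nE': "norm (exp (- \<omega> * t) *\<^sub>R (\<Phi> ((1 / t\<^sup>2) *\<^sub>R V) - \<omega> *\<^sub>R \<Phi> (W)))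
      \<le> (2 * K + 1) * t powr (- 1 - a) * exp (- (\<omega> / 2) * t)"
    if t: "0 < t" and E: "norm (W) \<le> K * (1 / t) powr a" "norm (V) \<le> K * (1 / t) powr (a - 1)"
    for t a and W V :: "'x cop"
  proof -
    have p: "(1 / t) powr a = t powr (- 1 - a) * t" "1 / t\<^sup>2 * (1 / t) powr (a - 1) = t powr (- 1 - a)"
      using t by (simp_all add: powr_divide powr_minus_divide powr_diff powr_minus divide_simps power2_eq_square)
    have "norm (\<Phi> ((1 / t\<^sup>2) *\<^sub>R V) - \<omega> *\<^sub>R \<Phi> (W)) \<le>
        1 / t\<^sup>2 * (K * (1 / t) powr (a - 1)) + \<omega> * (K * (1 / t) powr a)"
    proof (intro order_trans[OF norm_triangle_ineq4] add_mono)
      show "norm (\<Phi> ((1 / t\<^sup>2) *\<^sub>R V)) \<le> 1 / t\<^sup>2 * (K * (1 / t) powr (a - 1))"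
        by (rule order_trans[OF n\<Phi>], unfold norm_scaleR, intro mult_mono E) auto
      show "norm (\<omega> *\<^sub>R \<Phi> (W)) \<le> \<omega> * (K * (1 / t) powr a)"
        unfolding norm_scaleR using w order_trans[OF n\<Phi> E(1)] by (intro mult_mono) auto
    qed
    also have "\<dots> = K * (1 / t\<^sup>2 * (1 / t) powr (a - 1)) + \<omega> * (K * (1 / t) powr a)" by (simp add: mult_ac)
    also have "\<dots> = K * t powr (- 1 - a) * (1 + \<omega> * t)" unfolding p by (simp add: algebra_simps)
    finally have "norm (exp (- \<omega> * t) *\<^sub>R (\<Phi> ((1 / t\<^sup>2) *\<^sub>R V) - \<omega> *\<^sub>R \<Phi> (W))) \<le>
        exp (- \<omega> * t) * (K * t powr (- 1 - a) * (1 + \<omega> * t))" unfolding norm_scaleR by (intro mult_mono) auto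
    also have "\<dots> = K * t powr (- 1 - a) * ((1 + \<omega> * t) * exp (- \<omega> * t))" by (simp add: mult_ac)
    also have "\<dots> \<le> K * t powr (- 1 - a) * (2 * exp (- (\<omega> / 2) * t))"
      using K t by (intro mult_left_mono exp_decay_absorb w) auto
    also have "\<dots> \<le> (2 * K + 1) * t powr (- 1 - a) * exp (- (\<omega> / 2) * t)" by (simp add: algebra_simps)
    finally show ?thesis .
  qed
  have R_comm: "R 1 o\<^sub>L R \<zeta> = R \<zeta> o\<^sub>L R 1" if z: "\<zeta> \<in> Sec d" for \<zeta>
  proof (cases "\<zeta> = 1")
    case False
    have one: "1 \<in> Sec d" by (simp add: Sec_def)
    have "cblin (\<zeta> - 1) o\<^sub>L (R 1 o\<^sub>L R \<zeta>) = cblin (\<zeta> - 1) o\<^sub>L (R \<zeta> o\<^sub>L R 1)"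
    proof -
      have c: "(cblin (1 - \<zeta>) :: ('x \<times> 'x) \<Rightarrow>\<^sub>L _) = - cblin (\<zeta> - 1)"
        using linear_simps(4)[OF bounded_linear_cblin, of "\<zeta> - 1"] by simp
      have "R \<zeta> - R 1 = - (cblin (\<zeta> - 1) o\<^sub>L (R \<zeta> o\<^sub>L R 1))" unfolding R_id[OF one z] c by (rule bc.minus_left)
      hence "R 1 - R \<zeta> = cblin (\<zeta> - 1) o\<^sub>L (R \<zeta> o\<^sub>L R 1)" by (metis minus_diff_eq minus_minus)
      thus ?thesis using R_id[OF z one] by simp
    qed
    hence "cblin (1 / (\<zeta> - 1)) o\<^sub>L (cblin (\<zeta> - 1) o\<^sub>L (R 1 o\<^sub>L R \<zeta>)) = cblin (1 / (\<zeta> - 1)) o\<^sub>L (cblin (\<zeta> - 1) o\<^sub>L (R \<zeta> o\<^sub>L R 1))"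
      by (rule arg_cong)
    thus ?thesis using False by (simp add: blinfun_compose_assoc[symmetric] cblin_mult[symmetric] cblin_one)
  qed simp
  have one: "1 \<in> Sec d" by (simp add: Sec_def)
  note R1 = R[OF one]
  have cR1: "R 1 o\<^sub>L (cblin z o\<^sub>L W) = cblin z o\<^sub>L (R 1 o\<^sub>L W)" for z W
    by (rule blinfun_eqI) (simp add: resolv_cscale[OF lin R1])
  \<comment> \<open>From (1 - \<zeta>) R(1) R(\<zeta>) = R(\<zeta>) - R(1) and the vanishing
    integral of e^z dz one gets E = R(1) (E - m^2 G). Hence E maps into the domain, and L E can be
    read off.\<close>
  have E_R1: "R 1 o\<^sub>L (r.E m - m\<^sup>2 *\<^sub>R r.G m) = r.E m" and E_comm: "R 1 o\<^sub>L r.E m = r.E m o\<^sub>L R 1"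
    if m: "0 < m" for m
  proof -
    let ?z = "\<lambda>l. of_real m * hyp d l"
    have zS: "?z l \<in> Sec d" for l by (rule hyp_in_Sec[OF d m])
    note iE = integrable_integral[OF r.cint1(1)[OF m]] and iG = integrable_integral[OF r.cint_hyp(1)[OF m]]
    have E: "((\<lambda>l. m *\<^sub>R (cblin (wt d l * 1) o\<^sub>L R (?z l))) has_integral r.E m) UNIV"
      unfolding r.E_def cint_def[OF d] by (intro has_integral_cmul iE)
    have G: "((\<lambda>l. m\<^sup>2 *\<^sub>R (cblin (wt d l * hyp d l) o\<^sub>L R (?z l))) has_integral m\<^sup>2 *\<^sub>R r.G m) UNIV"
      unfolding r.G_def cint_def[OF d] by (intro has_integral_cmul iG)
    have W: "((\<lambda>l. m *\<^sub>R (cblin (wt d l) o\<^sub>L R 1)) has_integral m *\<^sub>R (cblin 0 o\<^sub>L R 1)) UNIV"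
      using has_integral_linear[OF has_integral_linear[OF integrable_integral[OF integral_wt(1)[OF d]] bounded_linear_cblin]
         bc.bounded_linear_left[of "R 1"]] integral_wt(2)[OF d] by (intro has_integral_cmul) (simp add: o_def)
    have c0: "cblin 0 = 0" by (rule linear_simps(3)[OF bounded_linear_cblin])
    have "((\<lambda>l. R 1 o\<^sub>L (m *\<^sub>R (cblin (wt d l * 1) o\<^sub>L R (?z l)) - m\<^sup>2 *\<^sub>R (cblin (wt d l * hyp d l) o\<^sub>L R (?z l))))
        has_integral R 1 o\<^sub>L (r.E m - m\<^sup>2 *\<^sub>R r.G m)) UNIV"
      using has_integral_linear[OF has_integral_diff[OF E G] bc.bounded_linear_right[of "R 1"]] by (simp add: o_def)
    moreover have "R 1 o\<^sub>L (m *\<^sub>R (cblin (wt d l * 1) o\<^sub>L R (?z l)) - m\<^sup>2 *\<^sub>R (cblin (wt d l * hyp d l) o\<^sub>L R (?z l))) =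
       m *\<^sub>R (cblin (wt d l * 1) o\<^sub>L R (?z l)) - m *\<^sub>R (cblin (wt d l) o\<^sub>L R 1)" for l
    proof -
      have 1: "m *\<^sub>R (cblin (wt d l * 1) o\<^sub>L R (?z l)) - m\<^sup>2 *\<^sub>R (cblin (wt d l * hyp d l) o\<^sub>L R (?z l)) =
         m *\<^sub>R (cblin (wt d l) o\<^sub>L (cblin (1 - ?z l) o\<^sub>L R (?z l)))"
        by (rule blinfun_eqI) (simp add: blinfun.diff_left blinfun.scaleR_left cscale_diff_left cscale_diff_right
            cscale_mult cscale_of_real cscale_scaleR_right scaleR_diff_right power2_eq_square)
      have 2: "cblin (1 - ?z l) o\<^sub>L (R 1 o\<^sub>L R (?z l)) = R (?z l) - R 1"
        using R_id[OF one zS] R_comm[OF zS] by simp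
      have "R 1 o\<^sub>L (m *\<^sub>R (cblin (wt d l) o\<^sub>L (cblin (1 - ?z l) o\<^sub>L R (?z l)))) =
          m *\<^sub>R (cblin (wt d l) o\<^sub>L (R (?z l) - R 1))" unfolding bc.scaleR_right cR1 2 ..
      thus ?thesis unfolding 1 by (simp add: bc.diff_right scaleR_diff_right)
    qed
    ultimately have "((\<lambda>l. m *\<^sub>R (cblin (wt d l * 1) o\<^sub>L R (?z l)) - m *\<^sub>R (cblin (wt d l) o\<^sub>L R 1))
        has_integral R 1 o\<^sub>L (r.E m - m\<^sup>2 *\<^sub>R r.G m)) UNIV" by (simp only:)
    from has_integral_unique[OF this has_integral_diff[OF E W]]
    show "R 1 o\<^sub>L (r.E m - m\<^sup>2 *\<^sub>R r.G m) = r.E m" by (simp add: c0)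
    have "((\<lambda>l. R 1 o\<^sub>L (m *\<^sub>R (cblin (wt d l * 1) o\<^sub>L R (?z l)))) has_integral R 1 o\<^sub>L r.E m) UNIV"
      using has_integral_linear[OF E bc.bounded_linear_right[of "R 1"]] by (simp add: o_def)
    moreover have "((\<lambda>l. (m *\<^sub>R (cblin (wt d l * 1) o\<^sub>L R (?z l))) o\<^sub>L R 1) has_integral r.E m o\<^sub>L R 1) UNIV"
      using has_integral_linear[OF E bc.bounded_linear_left[of "R 1"]] by (simp add: o_def)
    moreover have "R 1 o\<^sub>L (m *\<^sub>R (cblin (wt d l * 1) o\<^sub>L R (?z l))) = (m *\<^sub>R (cblin (wt d l * 1) o\<^sub>L R (?z l))) o\<^sub>L R 1" for l
      unfolding bc.scaleR_right bc.scaleR_left cR1 R_comm[OF zS] blinfun_compose_assoc ..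
    ultimately show "R 1 o\<^sub>L r.E m = r.E m o\<^sub>L R 1" using has_integral_unique by (simp only:) blast
  qed
  have ED: "r.E m w \<in> D \<times> D" and LE: "map_prod L L (r.E m w) = \<omega> *\<^sub>R r.E m w - m\<^sup>2 *\<^sub>R r.G m w" if m: "0 < m" for m w
  proof -
    have eq: "r.E m w = R 1 ((r.E m - m\<^sup>2 *\<^sub>R r.G m) w)"
      using arg_cong[OF E_R1[OF m], of "\<lambda>W. blinfun_apply W w"] by simp
    show "r.E m w \<in> D \<times> D" unfolding eq by (rule resolvD(1)[OF R1])
    have "cscale (1 - of_real \<omega>) (r.E m w) + map_prod L L (r.E m w) = r.E m w - m\<^sup>2 *\<^sub>R r.G m w"
      using resolvD(4)[OF R1, of "(r.E m - m\<^sup>2 *\<^sub>R r.G m) w"] unfolding eq[symmetric]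
      by (simp add: blinfun.diff_left blinfun.scaleR_left)
    moreover have "cscale (1 - of_real \<omega>) (r.E m w) = r.E m w - \<omega> *\<^sub>R r.E m w"
      by (simp add: cscale_diff_left cscale_of_real)
    ultimately show "map_prod L L (r.E m w) = \<omega> *\<^sub>R r.E m w - m\<^sup>2 *\<^sub>R r.G m w" by (simp add: algebra_simps)
  qed
  have LE_comm: "r.E m (map_prod L L w) = map_prod L L (r.E m w)" if m: "0 < m" and wD: "w \<in> D \<times> D" for m w
  proof -
    define v where "v = cscale (1 - of_real \<omega>) w + map_prod L L w"
    have wv: "w = R 1 v" using resolvD(6)[OF R1 wD] by (simp add: v_def)
    have "r.E m w = R 1 (r.E m v)"
      unfolding wv using arg_cong[OF E_comm[OF m], of "\<lambda>W. blinfun_apply W v"] by simp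
    hence "cscale (1 - of_real \<omega>) (r.E m w) + map_prod L L (r.E m w) = r.E m v"
      using resolvD(4)[OF R1, of "r.E m v"] by simp
    moreover have "cscale (1 - of_real \<omega>) u = u - \<omega> *\<^sub>R u" for u :: "'x \<times> 'x"
      by (simp add: cscale_diff_left cscale_of_real)
    ultimately show ?thesis by (simp add: v_def blinfun.add_right blinfun.diff_right blinfun.scaleR_right)
  qed
  have fstcL: "fst (cscale c1 (map_prod L L w)) = L (fst (cscale c1 w))" if "w \<in> D \<times> D" for w
    using arg_cong[OF cx_linear(7)[OF lin that, of c1], of fst] by simp
  have cD: "cscale c1 w \<in> D \<times> D" if "w \<in> D \<times> D" for w using cx_linear(3)[OF lin that] .
  have fD: "fst w \<in> D" if "w \<in> D \<times> D" for w :: "'x \<times> 'x" using that by (auto simp: mem_Times_iff)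
  have inv: "filterlim (\<lambda>t::real. 1 / t) at_top (at_right 0)"
    using filterlim_inverse_at_top_right by (simp add: inverse_eq_divide)
  have lim0: "((\<lambda>t. exp (- \<omega> * t) *\<^sub>R \<Phi> (E (1 / t)) x) \<longlongrightarrow> v) (at_right 0)"
    if "((\<lambda>m. E m (x, 0)) \<longlongrightarrow> cscale (2 * of_real pi * \<i>) (v, 0)) at_top" for E :: "real \<Rightarrow> 'x cop" and x v
  proof -
    have "((\<lambda>t. E (1 / t) (x, 0)) \<longlongrightarrow> cscale (2 * of_real pi * \<i>) (v, 0)) (at_right 0)"
      by (rule filterlim_compose[OF that inv])
    hence "((\<lambda>t. cblin c1 (E (1 / t) (x, 0))) \<longlongrightarrow> cblin c1 (cscale (2 * of_real pi * \<i>) (v, 0))) (at_right 0)"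
      by (intro tendsto_intros)
    hence "((\<lambda>t. fst (cblin c1 (E (1 / t) (x, 0)))) \<longlongrightarrow> fst (cblin c1 (cscale (2 * of_real pi * \<i>) (v, 0)))) (at_right 0)"
      by (rule tendsto_fst)
    moreover have "fst (cblin c1 (cscale (2 * of_real pi * \<i>) (v, 0))) = v"
      by (simp add: cscale_mult[symmetric] c1_def)
    ultimately have "((\<lambda>t. \<Phi> (E (1 / t)) x) \<longlongrightarrow> v) (at_right 0)" by (simp add: \<Phi>_apply)
    moreover have "((\<lambda>t. exp (- \<omega> * t)) \<longlongrightarrow> exp (- \<omega> * 0)) (at_right 0)" by (intro tendsto_intros)
    ultimately show ?thesis using tendsto_scaleR[of "\<lambda>t. exp (- \<omega> * t)" 1] by simp
  qed
  \<comment> \<open>The form required by \<open>E_limit\<close>; the vector in the remainder is (L -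
    \<omega>) u, because the resolvents are those of the shifted operator.\<close>
  have Rz: "R \<zeta> u = cscale (1 / \<zeta>) (u - R \<zeta> (map_prod L L u - \<omega> *\<^sub>R u))" if z: "\<zeta> \<in> Sec d" and u: "u \<in> D \<times> D" for \<zeta> u
  proof -
    have nz: "\<zeta> \<noteq> 0" using z by (simp add: Sec_def)
    have "u = R \<zeta> (cscale \<zeta> u + (map_prod L L u - \<omega> *\<^sub>R u))"
      using resolvD(6)[OF R[OF z] u] by (simp add: cscale_diff_left cscale_of_real algebra_simps)
    hence "u = cscale \<zeta> (R \<zeta> u) + R \<zeta> (map_prod L L u - \<omega> *\<^sub>R u)"
      by (simp only: blinfun.add_right resolv_cscale[OF lin R[OF z]])
    hence "u - R \<zeta> (map_prod L L u - \<omega> *\<^sub>R u) = cscale \<zeta> (R \<zeta> u)" by (metis add_diff_cancel_right')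
    thus ?thesis using nz by (simp add: cscale_mult[symmetric])
  qed
  have D0: "0 \<in> D" "L 0 = 0" using linear_opD[OF lin] by auto
  have S0D: "((\<lambda>t. S t x) \<longlongrightarrow> x) (at_right 0)" if x: "x \<in> D" for x unfolding S_def blinfun.scaleR_left
  proof (rule lim0, rule r.E_limit)
    show "R \<zeta> (x, 0) = cscale (1 / \<zeta>) ((x, 0) - R \<zeta> (map_prod L L (x, 0) - \<omega> *\<^sub>R (x, 0)))" if "\<zeta> \<in> Sec d" for \<zeta>
      by (rule Rz[OF that]) (use x D0 in auto)
  qed
  have T0D: "((\<lambda>t. (T t o\<^sub>L J) x) \<longlongrightarrow> x) (at_right 0)" if x: "x \<in> D" for x
    unfolding T_def blinfun_apply_blinfun_compose blinfun.scaleR_left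
  proof (rule lim0, rule y.E_limit)
    fix \<zeta> assume z: "\<zeta> \<in> Sec d"
    let ?u = "(J x, 0) :: 'x \<times> 'x"
    show "Y \<zeta> ?u = cscale (1 / \<zeta>) ((x, 0) - Y \<zeta> (map_prod L L ?u - \<omega> *\<^sub>R ?u))"
    proof (rule dgJ)
      have "?u \<in> D \<times> D" using x J(2) D0 by auto
      from Rz[OF z this] have "dg J (Y \<zeta> ?u) = cscale (1 / \<zeta>) (?u - dg J (Y \<zeta> (map_prod L L ?u - \<omega> *\<^sub>R ?u)))"
        unfolding RY[OF z] by (simp only: blinfun_apply_blinfun_compose)
      also have "?u = dg J (x, 0)" by simp
      finally show "dg J (Y \<zeta> ?u) = dg J (cscale (1 / \<zeta>) ((x, 0) - Y \<zeta> (map_prod L L ?u - \<omega> *\<^sub>R ?u)))"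
        by (simp only: blinfun.diff_right[symmetric]) (simp add: map_prod_cscale)
    qed
  qed
  have K1: "0 < 2 * K + 1" using K by simp
  have "r.E m = dg J o\<^sub>L y.E m" if m: "0 < m" for m
  proof -
    have "cint d (\<lambda>_. 1) R m = dg J o\<^sub>L cint d (\<lambda>_. 1) Y m"
    proof -
      have "cblin z o\<^sub>L (dg J o\<^sub>L W) = dg J o\<^sub>L (cblin z o\<^sub>L W)" for z and W :: "'x cop"
        by (rule blinfun_eqI) (simp add: map_prod_cscale)
      thus ?thesis using integral_linear[OF y.cint1(1)[OF m] bc.bounded_linear_right[of "dg J"]]
        by (simp add: cint_def[OF d] o_def RY[OF hyp_in_Sec[OF d m]])
    qed
    thus ?thesis by (simp add: r.E_def y.E_def bc.scaleR_right)
  qed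
  hence JT: "J o\<^sub>L T t = S t" if "0 < t" for t
    using that by (intro blinfun_eqI) (simp add: S_def T_def \<Phi>_apply blinfun.scaleR_left blinfun.scaleR_right map_prod_cscale[symmetric])
  have YJc: "continuous_on (Sec d) (\<lambda>\<zeta>. Y \<zeta> o\<^sub>L dg J)" by (intro continuous_intros y.F_continuous)
  have YJb: "norm (Y \<zeta> o\<^sub>L dg J) \<le> M * cmod \<zeta> powr (0 - 1)" if "\<zeta> \<in> Sec d" for \<zeta>
    using nYJ[OF that] unfolding pw[OF that] .
  have nYJE: "norm (y.E m o\<^sub>L dg J) \<le> K * m powr 0" if m: "0 < m" for m
  proof -
    have "cint d (\<lambda>_. 1) Y m o\<^sub>L dg J = cint d (\<lambda>_. 1) (\<lambda>\<zeta>. Y \<zeta> o\<^sub>L dg J) m"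
      using integral_linear[OF y.cint1(1)[OF m] bc.bounded_linear_left[of "dg J"]]
      by (simp add: cint_def[OF d] o_def blinfun_compose_assoc)
    moreover have "norm (cint d (\<lambda>_. 1) (\<lambda>\<zeta>. Y \<zeta> o\<^sub>L dg J) m) \<le> K * m powr (0 - 1)" unfolding K_def
      by (rule cint_bound(2)[OF d continuous_on_const y.coeff_le(1) YJc YJb]) (use m M in auto)
    ultimately have "norm (y.E m o\<^sub>L dg J) \<le> m * (K * m powr (0 - 1))"
      unfolding y.E_def bc.scaleR_left norm_scaleR using m by (intro mult_mono) auto
    thus ?thesis using m by (simp add: powr_minus field_simps)
  qed
  have TJ: "T t o\<^sub>L J = exp (- \<omega> * t) *\<^sub>R \<Phi> (y.E (1 / t) o\<^sub>L dg J)" for t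
    by (rule blinfun_eqI) (simp add: T_def \<Phi>_apply blinfun.scaleR_left)
  have rE: "norm (r.E (1 / t)) \<le> K * (1 / t) powr 0" "norm (r.G (1 / t)) \<le> K * (1 / t) powr (0 - 1)"
    "norm (y.E (1 / t)) \<le> K * (1 / t) powr \<alpha>" "norm (y.G (1 / t)) \<le> K * (1 / t) powr (\<alpha> - 1)" if "0 < t" for t
    using r.norm_E[of "1 / t"] r.norm_G[of "1 / t"] y.norm_E[of "1 / t"] y.norm_G[of "1 / t"] that
    by (auto simp: K_def)
  have nS: "norm (S t) \<le> (2 * K + 1) * exp (- (\<omega> / 2) * t)" if t: "0 < t" for t
    using nE[OF t rE(1)[OF t]] t by (simp add: S_def)
  have nTJ: "norm (T t o\<^sub>L J) \<le> (2 * K + 1) * exp (- (\<omega> / 2) * t)" if t: "0 < t" for t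
    using nE[of t "y.E (1 / t) o\<^sub>L dg J" 0] nYJE[of "1 / t"] t by (simp add: TJ)
  have bdd: "(2 * K + 1) * exp (- (\<omega> / 2) * t) \<le> 2 * K + 1" if "0 < t" for t
    using K1 w that mult_left_mono[of "exp (- (\<omega> / 2) * t)" 1 "2 * K + 1"] by simp
  have "0 \<le> \<omega>" using w by simp
  hence wS: "of_real \<omega> \<in> Sec d" using w by (simp add: Sec_def)
  define Q where "Q = R (of_real \<omega>)"
  have Q: "resolv D L 0 Q" using R[OF wS] by (simp add: Q_def)
  \<comment> \<open>The rate is \<omega> / 2 because \<open>exp_decay_absorb\<close> spends half of
    \<omega>. \<open>Q\<close> is the resolvent at the point \<omega> of the shifted sector, that
    is, the inverse of \<open>L\<close>.\<close>
  have "analytic_semigroup D L J (re_part Q) S T S' T' \<alpha> (\<omega> / 2) (2 * K + 1)"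
  proof
    show "linear_op D L" "0 \<le> \<alpha>" "\<alpha> < 1" "inj J" by (rule lin al J(1))+
    show "0 < \<omega> / 2" "0 < 2 * K + 1" using w K1 by auto
    show "rresolv D L 0 (re_part Q)" using rresolv_of_resolv(1)[OF lin, of 0 Q] Q by simp
    fix t :: real assume t: "0 < t"
    have it: "0 < 1 / t" using t by simp
    show "J o\<^sub>L T t = S t" by (rule JT[OF t])
    show "norm (S t) \<le> (2 * K + 1) * exp (- (\<omega> / 2) * t)" by (rule nS[OF t])
    show "norm (T t) \<le> (2 * K + 1) * t powr (- \<alpha>) * exp (- (\<omega> / 2) * t)"
      unfolding T_def by (rule nE[OF t rE(3)[OF t]])
    show "norm (T t o\<^sub>L J) \<le> (2 * K + 1) * exp (- (\<omega> / 2) * t)" by (rule nTJ[OF t])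
    show "(S has_vector_derivative S' t) (at t)"
      using chain[OF t r.E_derivative] by (simp only: S_def[abs_def] S'_def)
    show "(T has_vector_derivative T' t) (at t)"
      using chain[OF t y.E_derivative] by (simp only: T_def[abs_def] T'_def)
    have "norm (S' t) \<le> (2 * K + 1) * t powr (- 1 - 0) * exp (- (\<omega> / 2) * t)"
      unfolding S'_def by (rule nE'[OF t rE(1,2)[OF t]])
    moreover have "t powr (- 1 - 0) = 1 / t" using powr_neg_one[OF t] by simp
    ultimately show "norm (S' t) \<le> (2 * K + 1) / t * exp (- (\<omega> / 2) * t)"
      by (simp only: times_divide_eq_right mult_1_right)
    show "norm (T' t) \<le> (2 * K + 1) * t powr (- 1 - \<alpha>) * exp (- (\<omega> / 2) * t)"
      unfolding T'_def by (rule nE'[OF t rE(3,4)[OF t]])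
    fix x
    have SL: "S t x = exp (- \<omega> * t) *\<^sub>R fst (cscale c1 (r.E (1 / t) (x, 0)))" for x
      by (simp add: S_def \<Phi>_apply blinfun.scaleR_left)
    show SD: "S t x \<in> D" for x unfolding SL by (intro linear_opD(4)[OF lin] fD cD ED it)
    have LS: "L (S t x) = exp (- \<omega> * t) *\<^sub>R fst (cscale c1 (map_prod L L (r.E (1 / t) (x, 0))))" for x
      unfolding SL fstcL[OF ED[OF it]] by (rule linear_opD(8)[OF lin fD[OF cD[OF ED[OF it]]]])
    show "S' t x = - L (S t x)" unfolding LS LE[OF it]
      by (simp add: S'_def \<Phi>_apply blinfun.scaleR_left blinfun.diff_left cscale_diff_right cscale_scaleR_right
          scaleR_diff_right power_one_over)
    show "S t (L x) = L (S t x)" if x: "x \<in> D"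
    proof -
      have "(x, 0) \<in> D \<times> D" using x D0 by simp
      from LE_comm[OF it this] show ?thesis unfolding LS SL[of "L x"] using D0 by simp
    qed
  next
    show "((\<lambda>t. S t x) \<longlongrightarrow> x) (at_right 0)" for x by (rule tendsto_on_dense[OF order_trans[OF nS bdd] dense S0D])
    have "((\<lambda>t. (T t o\<^sub>L J) v) \<longlongrightarrow> v) (at_right 0)" for v
      by (rule tendsto_on_dense[OF order_trans[OF nTJ bdd] dense T0D])
    thus "((\<lambda>t. T t (J v)) \<longlongrightarrow> v) (at_right 0)" for v by simp
  qed
  thus ?thesis by (rule that)
qed

subsection \<open>Mild solutions and their regularity\<close>

lemma has_integral_kernel:
  fixes t :: real
  assumes b: "b < 1" and at: "a \<le> t"
  shows "((\<lambda>s. (t - s) powr (- b)) has_integral (t - a) powr (1 - b) / (1 - b)) {a..t}"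
proof -
  let ?F = "\<lambda>s. - ((t - s) powr (1 - b) / (1 - b))"
  have "((\<lambda>s. (t - s) powr (- b)) has_integral ?F t - ?F a) {a..t}"
  proof (rule fundamental_theorem_of_calculus_interior[OF at])
    show "continuous_on {a..t} ?F" using b by (intro continuous_intros continuous_on_powr') auto
    show "(?F has_vector_derivative (t - s) powr (- b)) (at s)" if "s \<in> {a<..<t}" for s
      unfolding has_real_derivative_iff_has_vector_derivative[symmetric]
      using that b by (auto intro!: derivative_eq_intros)
  qed
  thus ?thesis by simp
qed

text \<open>The integral is split at distance 1/l from t: nearer, the exponential is dropped and the
  singularity integrated; farther away, the power is frozen at its value at 1/l. Both parts scale
  like l^(b-1), which is small for large l.\<close>

lemma kernel_exp_bound:
  fixes t :: real
  assumes b: "0 \<le> b" "b < 1" and l: "0 < l" and t: "0 \<le> t"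
  shows "(\<lambda>s. (t - s) powr (- b) * exp (- l * (t - s))) integrable_on {0..t}" (is "?f integrable_on _")
    "integral {0..t} (\<lambda>s. (t - s) powr (- b) * exp (- l * (t - s))) \<le> l powr (b - 1) * (1 / (1 - b) + 1)"
proof -
  have le: "?f s \<le> (t - s) powr (- b)" if "s \<le> t" for s using that l by (simp add: mult_left_le)
  have int: "?f integrable_on {a..t}" if "a \<le> t" for a
  proof (rule integrable_right_dominated[OF _ has_integral_integrable[OF has_integral_kernel[OF b(2) that]]])
    show "continuous_on {a..<t} ?f" by (intro continuous_intros) auto
  qed (use le in \<open>auto simp: abs_mult\<close>)
  show "?f integrable_on {0..t}" by (rule int[OF t])
  have near: "integral {a..t} ?f \<le> (t - a) powr (1 - b) / (1 - b)" if "a \<le> t" for a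
    using integral_le[OF int[OF that] has_integral_integrable[OF has_integral_kernel[OF b(2) that]]] le
    by (simp add: integral_unique[OF has_integral_kernel[OF b(2) that]])
  define h where "h = 1 / l"
  have h: "0 < h" using l by (simp add: h_def)
  have hp: "h powr (1 - b) = l powr (b - 1)"
    using l powr_minus_divide[of l "1 - b"] by (simp add: h_def powr_divide)
  show "integral {0..t} ?f \<le> l powr (b - 1) * (1 / (1 - b) + 1)"
  proof (cases "t \<le> h")
    case True
    have "integral {0..t} ?f \<le> (t - 0) powr (1 - b) / (1 - b)" by (rule near[OF t])
    also have "\<dots> \<le> h powr (1 - b) / (1 - b)" using True t b by (intro divide_right_mono powr_mono2) auto
    also have "\<dots> \<le> l powr (b - 1) * (1 / (1 - b) + 1)" unfolding hp by (simp add: distrib_left)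
    finally show ?thesis .
  next
    case False
    have "integral {0..t} ?f = integral {0..t - h} ?f + integral {t - h..t} ?f"
      using integral_split[of 0 "t - h" t ?f] False h int[OF t] by simp
    moreover have "integral {t - h..t} ?f \<le> h powr (1 - b) / (1 - b)" using near[of "t - h"] h by simp
    moreover have "integral {0..t - h} ?f \<le> h powr (1 - b)"
    proof -
      have i1: "?f integrable_on {0..t - h}" by (rule integrable_subinterval_real[OF int[OF t]]) (use h in auto)
      have i2: "((\<lambda>s. h powr (- b) * exp (- l * (t - s))) has_integral
          h powr (- b) * exp (- l * (t - (t - h))) / l - h powr (- b) * exp (- l * (t - 0)) / l) {0..t - h}"
        by (rule fundamental_theorem_of_calculus)
          (use False l in \<open>auto intro!: derivative_eq_intros simp flip: has_real_derivative_iff_has_vector_derivative\<close>)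
      have "integral {0..t - h} ?f \<le> h powr (- b) * exp (- l * (t - (t - h))) / l - h powr (- b) * exp (- l * (t - 0)) / l"
        unfolding integral_unique[OF i2, symmetric] by (rule integral_le[OF i1 has_integral_integrable[OF i2]])
          (use b h in \<open>auto intro!: mult_right_mono powr_mono2'\<close>)
      also have "\<dots> \<le> h powr (- b) * exp (- l * (t - (t - h))) / l" using l by simp
      also have "\<dots> \<le> h powr (- b) * 1 / l" using l h by (intro divide_right_mono mult_left_mono) auto
      also have "\<dots> = h powr (1 - b)" using l h by (simp add: powr_diff powr_minus h_def divide_inverse)
      finally show ?thesis .
    qed
    ultimately show ?thesis unfolding hp by (simp add: distrib_left)
  qed
qed

lemma conv_integrable:
  fixes k :: "real \<Rightarrow> 'x::banach \<Rightarrow>\<^sub>L 'x" and g :: "real \<Rightarrow> 'x"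
  assumes k: "continuous_on {0<..} k" "\<And>\<sigma>. 0 < \<sigma> \<Longrightarrow> norm (k \<sigma>) \<le> c * \<sigma> powr (- b)" and b: "b < 1" and c: "0 \<le> c"
    and g: "continuous_on {a..t} g" "\<And>s. s \<in> {a..t} \<Longrightarrow> norm (g s) \<le> K" and at: "a \<le> t"
  shows "(\<lambda>s. k (t - s) (g s)) integrable_on {a..t}"
    "norm (integral {a..t} (\<lambda>s. k (t - s) (g s))) \<le> c * K * ((t - a) powr (1 - b) / (1 - b))"
proof -
  have K: "0 \<le> K" using order_trans[OF norm_ge_zero g(2)[of a]] at by simp
  have bd: "norm (k (t - s) (g s)) \<le> c * K * (t - s) powr (- b)" if "s \<in> {a..<t}" for s
    using order_trans[OF norm_blinfun mult_mono[OF k(2) g(2)], of "t - s" s] that c by (simp add: mult_ac)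
  have i: "((\<lambda>s. c * K * (t - s) powr (- b)) has_integral c * K * ((t - a) powr (1 - b) / (1 - b))) {a..t}"
    by (intro has_integral_mult_right has_integral_kernel b at)
  show int: "(\<lambda>s. k (t - s) (g s)) integrable_on {a..t}"
  proof (rule integrable_right_dominated[OF _ has_integral_integrable[OF i] bd])
    show "continuous_on {a..<t} (\<lambda>s. k (t - s) (g s))"
      by (intro continuous_intros continuous_on_compose2[OF k(1)] continuous_on_subset[OF g(1)]) auto
  qed auto
  have "norm (integral {a..t} (\<lambda>s. k (t - s) (g s))) = norm (integral {a..t} (\<lambda>s. if s = t then 0 else k (t - s) (g s)))"
    by (rule arg_cong[of _ _ norm], rule integral_spike[of "{t}"]) auto
  also have "\<dots> \<le> integral {a..t} (\<lambda>s. c * K * (t - s) powr (- b))"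
    by (rule integral_norm_bound_integral[OF integrable_spike[OF int, of "{t}"] has_integral_integrable[OF i]])
      (use bd c K in auto)
  finally show "norm (integral {a..t} (\<lambda>s. k (t - s) (g s))) \<le> c * K * ((t - a) powr (1 - b) / (1 - b))"
    unfolding integral_unique[OF i] .
qed

context analytic_semigroup
begin

lemma JY: "0 < t \<Longrightarrow> J (Y t x) = S t x"
  unfolding SY[symmetric] by simp

lemma Li_D: "Li x \<in> D" and L_Li: "L (Li x) = x" and Li_L: "x \<in> D \<Longrightarrow> Li (L x) = x"
  using rresolvD[OF Li] by auto

lemma S_continuous: "continuous_on {0<..} S" and Y_continuous: "continuous_on {0<..} Y"
  by (intro continuous_at_imp_continuous_on ballI has_vector_derivative_continuous; (rule dS dY); simp)+

lemma exp_le_1: "0 < t \<Longrightarrow> exp (- \<omega> * t) \<le> 1"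
  using pos by simp

lemma nS1: "0 < t \<Longrightarrow> norm (S t) \<le> C"
  using order_trans[OF nS mult_left_mono[OF exp_le_1]] pos by simp

lemma nY1: "0 < t \<Longrightarrow> norm (Y t) \<le> C * t powr (- \<alpha>)"
  using order_trans[OF nY mult_left_mono[OF exp_le_1]] pos by simp

lemma nS'1: "0 < t \<Longrightarrow> norm (S' t) \<le> C / t"
  using order_trans[OF nS' mult_left_mono[OF exp_le_1]] pos by simp

lemma nY'1: "0 < t \<Longrightarrow> norm (Y' t) \<le> C * t powr (- 1 - \<alpha>)"
  using order_trans[OF nY' mult_left_mono[OF exp_le_1]] pos by simp

lemma nS1': "0 < t \<Longrightarrow> norm (S t) \<le> C * t powr (- 0)"
  using nS1 by simp

lemma C_nonneg: "0 \<le> C" using pos by simp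

text \<open>J (V g) is the Duhamel integral; the kernel \<open>Y\<close> instead of \<open>S\<close>
  keeps it in the coordinate v = J^(-1) u.\<close>

definition V :: "(real \<Rightarrow> 'x) \<Rightarrow> real \<Rightarrow> 'x" where
  "V g t = integral {0..t} (\<lambda>s. Y (t - s) (g s))"

lemmas Y_conv = conv_integrable[OF Y_continuous nY1 al(2) C_nonneg]
lemmas S_conv = conv_integrable[OF S_continuous nS1' zero_less_one C_nonneg]

lemma continuous_bounded_norm:
  fixes g :: "real \<Rightarrow> 'x"
  assumes "continuous_on {a..t} g"
  obtains K where "\<And>s. s \<in> {a..t} \<Longrightarrow> norm (g s) \<le> K"
proof -
  have "compact (g ` {a..t})" by (rule compact_continuous_image[OF assms compact_Icc])
  hence "bounded (g ` {a..t})" by (rule compact_imp_bounded)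
  then obtain K where "\<forall>x\<in>g ` {a..t}. norm x \<le> K" unfolding bounded_iff ..
  thus ?thesis using that by blast
qed

lemma JV:
  assumes t: "0 \<le> t" and g: "continuous_on {0..t} g"
  shows "J (V g t) = integral {0..t} (\<lambda>s. S (t - s) (g s))"
proof -
  obtain K where K: "\<And>s. s \<in> {0..t} \<Longrightarrow> norm (g s) \<le> K" by (rule continuous_bounded_norm[OF g]) (rule that)
  have "(\<lambda>s. Y (t - s) (g s)) integrable_on {0..t}" by (rule Y_conv(1)[where K = K]) (use K t g in auto)
  from integral_linear[OF this blinfun.bounded_linear_right[of J]]
  have "J (V g t) = integral {0..t} (\<lambda>s. J (Y (t - s) (g s)))" by (simp add: V_def o_def)
  also have "\<dots> = integral {0..t} (\<lambda>s. S (t - s) (g s))" by (rule integral_spike[of "{t}"]) (auto simp: JY)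
  finally show ?thesis .
qed

text \<open>In the derivative of S(t - s) u(s) the terms with L cancel, because S commutes with L.
  The endpoint s = t is reached by strong continuity of S at 0.\<close>

lemma variation_of_constants:
  assumes t: "a < t" and u: "continuous_on {a..t} u"
    and uD: "\<And>s. a < s \<Longrightarrow> s < t \<Longrightarrow> u s \<in> D"
    and du: "\<And>s. a < s \<Longrightarrow> s < t \<Longrightarrow> (u has_vector_derivative (f s - L (u s))) (at s)"
  shows "((\<lambda>s. S (t - s) (f s)) has_integral (u t - S (t - a) (u a))) {a..t}"
proof -
  \<comment> \<open>The locale says nothing about \<open>S 0\<close>, so the value at s = t is put
    in by hand.\<close>
  define g where "g s = (if s = t then u t else S (t - s) (u s))" for s
  have "((\<lambda>s. S (t - s) (f s)) has_integral (g t - g a)) {a..t}"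
  proof (rule fundamental_theorem_of_calculus_interior)
    show "(g has_vector_derivative S (t - s) (f s)) (at s)" if "s \<in> {a<..<t}" for s
    proof -
      have s: "a < s" "s < t" using that by auto
      have "((\<lambda>s. t - s) has_vector_derivative - 1) (at s)" by (auto intro!: derivative_eq_intros)
      from vector_diff_chain_at[OF this, of S "S' (t - s)"] dS[of "t - s"] s
      have "((\<lambda>s. S (t - s)) has_vector_derivative - S' (t - s)) (at s)" by (simp add: o_def)
      from blinfun.has_vector_derivative[OF this du[OF s]]
      have "((\<lambda>s. S (t - s) (u s)) has_vector_derivative
         (S (t - s) (f s - L (u s)) + (- S' (t - s)) (u s))) (at s)" .
      moreover have "S (t - s) (f s - L (u s)) + (- S' (t - s)) (u s) = S (t - s) (f s)"
        using s comm[of "t - s" "u s"] uD[OF s] by (simp add: blinfun.diff_right blinfun.minus_left S'L)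
      ultimately have "((\<lambda>s. S (t - s) (u s)) has_vector_derivative S (t - s) (f s)) (at s)" by simp
      thus ?thesis
        by (rule has_vector_derivative_transform_within_open[of _ _ _ "{a<..<t}"]) (use s in \<open>auto simp: g_def\<close>)
    qed
    show "continuous_on {a..t} g" unfolding continuous_on_eq_continuous_within
    proof
      fix s assume s: "s \<in> {a..t}"
      show "continuous (at s within {a..t}) g"
      proof (cases "s = t")
        case False
        have "continuous_on {a..<t} (\<lambda>s. S (t - s) (u s))"
          by (intro continuous_intros continuous_on_compose2[OF S_continuous] continuous_on_subset[OF u]) auto
        hence "continuous_on {a..<t} g" by (rule continuous_on_eq) (auto simp: g_def)
        hence "continuous (at s within {a..<t}) g" using s False by (auto simp: continuous_on_eq_continuous_within)
        moreover have "at s within {a..<t} = at s within {a..t}"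
          by (rule at_within_nhd[of _ "{..<t}"]) (use s False in auto)
        ultimately show ?thesis by simp
      next
        case True
        have "(g \<longlongrightarrow> u t) (at t within {a..t})"
        proof -
          have l1: "((\<lambda>s. S (t - s) (u t)) \<longlongrightarrow> u t) (at t within {a..t})"
          proof (rule filterlim_compose[OF S0[of "u t"]])
            show "filterlim (\<lambda>s. t - s) (at_right 0) (at t within {a..t})" unfolding filterlim_at
            proof
              show "\<forall>\<^sub>F s in at t within {a..t}. t - s \<in> {0<..} \<and> t - s \<noteq> 0"
                by (auto simp: eventually_at_filter)
              have "((\<lambda>s. t - s) \<longlongrightarrow> t - t) (at t within {a..t})" by (intro tendsto_intros)
              thus "((\<lambda>s. t - s) \<longlongrightarrow> 0) (at t within {a..t})" by simp
            qed
          qed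
          \<comment> \<open>S is only strongly continuous at 0, so u(s) is compared with the fixed
            vector u(t).\<close>
          have l2: "((\<lambda>s. S (t - s) (u s - u t)) \<longlongrightarrow> 0) (at t within {a..t})"
          proof (rule Lim_null_comparison)
            show "\<forall>\<^sub>F s in at t within {a..t}. norm (S (t - s) (u s - u t)) \<le> C * norm (u s - u t)"
              unfolding eventually_at_filter
              by (rule always_eventually) (auto intro!: order_trans[OF norm_blinfun mult_right_mono[OF nS1]])
            have "((\<lambda>s. u s) \<longlongrightarrow> u t) (at t within {a..t})" using u t by (auto simp: continuous_on_def)
            hence "((\<lambda>s. C * norm (u s - u t)) \<longlongrightarrow> C * norm (u t - u t)) (at t within {a..t})"
              by (intro tendsto_intros)
            thus "((\<lambda>s. C * norm (u s - u t)) \<longlongrightarrow> 0) (at t within {a..t})" by simp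
          qed
          have "((\<lambda>s. S (t - s) (u s - u t) + S (t - s) (u t)) \<longlongrightarrow> 0 + u t) (at t within {a..t})"
            by (rule tendsto_add[OF l2 l1])
          hence "((\<lambda>s. S (t - s) (u s)) \<longlongrightarrow> u t) (at t within {a..t})" by (simp add: blinfun.diff_right)
          thus ?thesis by (rule Lim_transform_eventually) (auto simp: eventually_at_filter g_def)
        qed
        thus ?thesis using True by (simp add: continuous_within g_def)
      qed
    qed
  qed (use t in simp)
  thus ?thesis using t by (simp add: g_def)
qed

lemma mild_of_solution:
  assumes t: "0 < t" and v: "continuous_on {0..t} v" and f: "continuous_on {0..t} f"
    and uD: "\<And>s. 0 < s \<Longrightarrow> s < t \<Longrightarrow> J (v s) \<in> D"
    and du: "\<And>s. 0 < s \<Longrightarrow> s < t \<Longrightarrow> ((\<lambda>s. J (v s)) has_vector_derivative (f s - L (J (v s)))) (at s)"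
  shows "v t = Y t (J (v 0)) + V f t"
proof (rule injD[OF injJ])
  have "J (V f t) = J (v t) - S t (J (v 0))" unfolding JV[OF less_imp_le[OF t] f]
    using integral_unique[OF variation_of_constants[OF t _ uD du]] v by (simp add: continuous_intros)
  thus "J (v t) = J (Y t (J (v 0)) + V f t)" using t by (simp add: blinfun.add_right JY)
qed

lemma Y_diff:
  assumes s: "0 < s" "0 \<le> h"
  shows "norm (Y (s + h) - Y s) \<le> C * h * s powr (- 1 - \<alpha>)"
proof -
  have "norm (Y (s + h) - Y s) \<le> (C * s powr (- 1 - \<alpha>)) * norm ((s + h) - s)"
  proof (rule differentiable_bound[of "{s..s + h}" Y "\<lambda>t h. h *\<^sub>R Y' t"])
    show "(Y has_derivative (\<lambda>h. h *\<^sub>R Y' t)) (at t within {s..s + h})" if "t \<in> {s..s + h}" for t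
      using dY[of t] that s by (auto simp: has_vector_derivative_def intro: has_derivative_at_withinI)
    show "onorm (\<lambda>h. h *\<^sub>R Y' t) \<le> C * s powr (- 1 - \<alpha>)" if "t \<in> {s..s + h}" for t
    proof (rule onorm_le)
      fix x :: real
      have "norm (Y' t) \<le> C * t powr (- 1 - \<alpha>)" using nY'1 that s by auto
      also have "\<dots> \<le> C * s powr (- 1 - \<alpha>)" using that s al C_nonneg by (intro mult_left_mono powr_mono2') auto
      finally show "norm (x *\<^sub>R Y' t) \<le> C * s powr (- 1 - \<alpha>) * norm x"
        by (simp add: mult.commute mult_left_mono)
    qed
  qed (use s in auto)
  thus ?thesis using s by (simp add: mult_ac)
qed

text \<open>Hoelder exponent in time: half of the available 1 - \<alpha>, so that the kernel
  \<sigma>^(-\<alpha>-q) is still integrable.\<close>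

definition q :: real where "q = (1 - \<alpha>) / 2"

lemma theta: "0 < q" "q \<le> 1" "1 - (\<alpha> + q) = q" "\<alpha> + q < 1" "1 - \<alpha> = 2 * q"
  using al by (auto simp: q_def field_simps)

text \<open>Interpolation between the derivative bound h s^(-1-\<alpha>), used for h \<le> s, and
  the plain bound s^(-\<alpha>), used for h > s.\<close>

lemma Y_diff_holder:
  assumes s: "0 < s" "0 \<le> h"
  shows "norm (Y (s + h) - Y s) \<le> 2 * C * h powr q * s powr (- (\<alpha> + q))"
proof (cases "h = 0")
  case False
  hence h: "0 < h" using s by simp
  have eq: "2 * C * h powr q * s powr (- (\<alpha> + q)) = 2 * C * s powr (- \<alpha>) * (h / s) powr q"
  proof -
    have "s powr (- (\<alpha> + q)) = s powr (- \<alpha>) / s powr q"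
      using powr_diff[of s "- \<alpha>" q] by (simp add: algebra_simps)
    thus ?thesis using s h by (simp add: powr_divide)
  qed
  show ?thesis
  proof (cases "h \<le> s")
    case True
    have "norm (Y (s + h) - Y s) \<le> C * h * s powr (- 1 - \<alpha>)" by (rule Y_diff[OF s])
    also have "\<dots> = C * s powr (- \<alpha>) * (h / s)" using s by (simp add: powr_diff powr_minus divide_inverse mult_ac)
    also have "\<dots> \<le> 2 * C * s powr (- \<alpha>) * (h / s) powr q"
    proof -
      have "(h / s) powr 1 \<le> (h / s) powr q" using True h s theta by (intro powr_mono') auto
      hence "C * s powr (- \<alpha>) * (h / s) \<le> C * s powr (- \<alpha>) * (h / s) powr q"
        using h s C_nonneg by (intro mult_left_mono) auto
      also have "\<dots> \<le> 2 * C * s powr (- \<alpha>) * (h / s) powr q" using C_nonneg by (intro mult_right_mono) auto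
      finally show ?thesis .
    qed
    finally show ?thesis unfolding eq .
  next
    case False
    have "norm (Y (s + h) - Y s) \<le> norm (Y (s + h)) + norm (Y s)" by (rule norm_triangle_ineq4)
    also have "\<dots> \<le> C * (s + h) powr (- \<alpha>) + C * s powr (- \<alpha>)" using s h by (intro add_mono nY1) auto
    also have "\<dots> \<le> C * s powr (- \<alpha>) + C * s powr (- \<alpha>)"
      using s h al C_nonneg by (intro add_mono mult_left_mono powr_mono2') auto
    also have "\<dots> = 2 * C * s powr (- \<alpha>) * 1" by simp
    also have "\<dots> \<le> 2 * C * s powr (- \<alpha>) * (h / s) powr q"
      using False s theta C_nonneg by (intro mult_left_mono ge_one_powr_ge_zero) auto
    finally show ?thesis unfolding eq .
  qed
qed simp

text \<open>The increment consists of the integral over the new piece from t to t + h and of the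
  change of the kernel on the old interval, which \<open>Y_diff_holder\<close> controls.\<close>

lemma V_diff:
  assumes t: "0 \<le> t" "0 \<le> h" and g: "continuous_on {0..t + h} g" and b: "\<And>s. s \<in> {0..t + h} \<Longrightarrow> norm (g s) \<le> b"
  shows "norm (V g (t + h) - V g t) \<le> C * b * (h powr (2 * q) / (2 * q)) + 2 * C * h powr q * b * (t powr q / q)"
proof -
  let ?f = "\<lambda>s. Y (t + h - s) (g s)"
  have i: "?f integrable_on {0..t + h}" by (rule Y_conv(1)[where K = b]) (use t g b in auto)
  have i0: "(\<lambda>s. Y (t - s) (g s)) integrable_on {0..t}"
    by (rule Y_conv(1)[where K = b]) (use t b in \<open>auto intro: continuous_on_subset[OF g]\<close>)
  have i1: "?f integrable_on {0..t}" by (rule integrable_subinterval_real[OF i]) (use t in auto)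
  have "V g (t + h) = integral {0..t} ?f + integral {t..t + h} ?f"
    unfolding V_def using integral_split[of 0 t "t + h" ?f] i t by simp
  hence e: "V g (t + h) - V g t = integral {t..t + h} ?f + integral {0..t} (\<lambda>s. ?f s - Y (t - s) (g s))"
    unfolding V_def by (simp add: integral_diff[OF i1 i0])
  have 1: "norm (integral {t..t + h} ?f) \<le> C * b * (h powr (2 * q) / (2 * q))"
    using Y_conv(2)[where a = t and t = "t + h" and g = g and K = b] t b theta(5) continuous_on_subset[OF g, of "{t..t + h}"] by auto
  have 2: "norm (integral {0..t} (\<lambda>s. ?f s - Y (t - s) (g s))) \<le> 2 * C * h powr q * b * (t powr q / q)"
  proof -
    have eq: "?f s - Y (t - s) (g s) = (Y ((t - s) + h) - Y (t - s)) (g s)" for s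
      by (simp add: blinfun.diff_left algebra_simps)
    have "norm (integral {0..t} (\<lambda>s. (Y ((t - s) + h) - Y (t - s)) (g s)))
        \<le> (2 * C * h powr q) * b * ((t - 0) powr (1 - (\<alpha> + q)) / (1 - (\<alpha> + q)))"
    proof (rule conv_integrable(2)[where k = "\<lambda>\<sigma>. Y (\<sigma> + h) - Y \<sigma>"])
      show "continuous_on {0<..} (\<lambda>\<sigma>. Y (\<sigma> + h) - Y \<sigma>)"
        by (intro continuous_intros Y_continuous continuous_on_compose2[OF Y_continuous]) (use t in auto)
      show "norm (Y (\<sigma> + h) - Y \<sigma>) \<le> 2 * C * h powr q * \<sigma> powr (- (\<alpha> + q))" if "0 < \<sigma>" for \<sigma>
        by (rule Y_diff_holder[OF that t(2)])
      show "continuous_on {0..t} g" by (rule continuous_on_subset[OF g]) (use t in auto)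
    qed (use theta t b C_nonneg in auto)
    thus ?thesis unfolding eq theta(3) by simp
  qed
  show ?thesis unfolding e by (rule order_trans[OF norm_triangle_ineq add_mono[OF 1 2]])
qed

lemma V_continuous:
  assumes g: "continuous_on {0..T} g"
  shows "continuous_on {0..T} (V g)"
proof (cases "0 \<le> T")
  case T: True
  obtain b where b: "\<And>s. s \<in> {0..T} \<Longrightarrow> norm (g s) \<le> b" by (rule continuous_bounded_norm[OF g]) (rule that)
  have b0: "0 \<le> b" using order_trans[OF norm_ge_zero b[of 0]] T by simp
  let ?e = "\<lambda>h. C * b * (\<bar>h\<bar> powr (2 * q) / (2 * q)) + 2 * C * \<bar>h\<bar> powr q * b * (T powr q / q)"
  have 1: "norm (V g (t + h) - V g t) \<le> ?e h" if "0 \<le> t" "0 \<le> h" "t + h \<le> T" for t h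
  proof -
    have "norm (V g (t + h) - V g t) \<le> C * b * (h powr (2 * q) / (2 * q)) + 2 * C * h powr q * b * (t powr q / q)"
      by (rule V_diff) (use that b in \<open>auto intro: continuous_on_subset[OF g]\<close>)
    also have "\<dots> \<le> ?e h"
    proof (rule add_mono)
      have "t powr q / q \<le> T powr q / q" using that theta(1) by (intro divide_right_mono powr_mono2) auto
      hence "2 * C * h powr q * b * (t powr q / q) \<le> 2 * C * h powr q * b * (T powr q / q)"
        using b0 C_nonneg by (intro mult_left_mono mult_nonneg_nonneg) auto
      thus "2 * C * h powr q * b * (t powr q / q) \<le> 2 * C * \<bar>h\<bar> powr q * b * (T powr q / q)" using that by simp
    qed (use that in simp)
    finally show ?thesis .
  qed
  have 2: "norm (V g s - V g t) \<le> ?e (s - t)" if "s \<in> {0..T}" "t \<in> {0..T}" for s t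
  proof (cases "t \<le> s")
    case True thus ?thesis using 1[of t "s - t"] that by simp
  next
    case False thus ?thesis using 1[of s "t - s"] that by (simp add: norm_minus_commute abs_minus_commute)
  qed
  show ?thesis unfolding continuous_on_def
  proof
    fix t assume t: "t \<in> {0..T}"
    have "((\<lambda>s. V g s - V g t) \<longlongrightarrow> 0) (at t within {0..T})"
    proof (rule Lim_null_comparison)
      show "\<forall>\<^sub>F s in at t within {0..T}. norm (V g s - V g t) \<le> ?e (s - t)"
        unfolding eventually_at_filter by (rule always_eventually) (use 2 t in blast)
      have "((\<lambda>s. \<bar>s - t\<bar>) \<longlongrightarrow> \<bar>t - t\<bar>) (at t within {0..T})" by (intro tendsto_intros)
      hence "((\<lambda>s. \<bar>s - t\<bar> powr c) \<longlongrightarrow> 0) (at t within {0..T})" if "0 < c" for c :: real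
        using that by (intro tendsto_zero_powrI[where b = c]) auto
      hence "((\<lambda>s. ?e (s - t)) \<longlongrightarrow> C * b * (0 / (2 * q)) + 2 * C * 0 * b * (T powr q / q)) (at t within {0..T})"
        using theta(1) by (intro tendsto_intros) auto
      thus "((\<lambda>s. ?e (s - t)) \<longlongrightarrow> 0) (at t within {0..T})" by simp
    qed
    thus "(V g \<longlongrightarrow> V g t) (at t within {0..T})" by (rule LIM_zero_cancel)
  qed
qed simp

end

text \<open>A semigroup describes increments forward from the left end of an interval; intervals
  around t with moving left end make a two-sided derivative out of this.\<close>

lemma has_vector_derivative_straddle:
  fixes f :: "real \<Rightarrow> 'a::real_normed_vector"
  assumes "\<And>e. 0 < e \<Longrightarrow> \<exists>d>0. \<forall>x y. x \<le> t \<and> t \<le> y \<and> y - x < d \<longrightarrow> norm (f y - f x - (y - x) *\<^sub>R D) \<le> e * (y - x)"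
  shows "(f has_vector_derivative D) (at t)"
  unfolding has_vector_derivative_def has_derivative_at_alt
proof (intro conjI allI impI)
  fix e :: real assume "0 < e"
  then obtain d where d: "d > 0"
    "\<And>x y. x \<le> t \<Longrightarrow> t \<le> y \<Longrightarrow> y - x < d \<Longrightarrow> norm (f y - f x - (y - x) *\<^sub>R D) \<le> e * (y - x)" using assms by metis
  have "norm (f y - f t - (y - t) *\<^sub>R D) \<le> e * norm (y - t)" if "norm (y - t) < d" for y
  proof (cases "t \<le> y")
    case True
    thus ?thesis using d(2)[of t y] that by simp
  next
    case False
    have "f y - f t - (y - t) *\<^sub>R D = - (f t - f y - (t - y) *\<^sub>R D)" by (simp add: algebra_simps)
    thus ?thesis using d(2)[of y t] that False by (simp only: norm_minus_cancel) simp
  qed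
  thus "\<exists>d>0. \<forall>y. norm (y - t) < d \<longrightarrow> norm (f y - f t - (y - t) *\<^sub>R D) \<le> e * norm (y - t)" using d(1) by blast
qed (rule bounded_linear_scaleR_left)

context analytic_semigroup
begin

definition kap :: real where "kap = 1 / (1 - \<alpha>) + 1"

lemma kap_pos: "0 < kap"
  using al by (simp add: kap_def add_pos_pos)

text \<open>One estimate for three uses: large \<nu> gives a contraction, negative \<nu> above -
  \<omega> gives decay, and \<nu> adapted to the growth of the data gives the error bound in the
  unstable case.\<close>

lemma norm_V_weighted:
  assumes t: "0 \<le> t" and g: "continuous_on {0..t} g" "\<And>s. s \<in> {0..t} \<Longrightarrow> norm (g s) \<le> K * exp (\<nu> * s)"
    and l: "0 < \<nu> + \<omega>"
  shows "norm (V g t) \<le> C * K * exp (\<nu> * t) * ((\<nu> + \<omega>) powr (\<alpha> - 1) * kap)"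
proof -
  have K: "0 \<le> K" using order_trans[OF norm_ge_zero g(2)[of 0]] t by simp
  obtain b where b: "\<And>s. s \<in> {0..t} \<Longrightarrow> norm (g s) \<le> b" by (rule continuous_bounded_norm[OF g(1)]) (rule that)
  let ?k = "\<lambda>s. (t - s) powr (- \<alpha>) * exp (- (\<nu> + \<omega>) * (t - s))"
  have int: "(\<lambda>s. Y (t - s) (g s)) integrable_on {0..t}" by (rule Y_conv(1)[where K = b]) (use b g t in auto)
  have bd: "norm (Y (t - s) (g s)) \<le> C * K * exp (\<nu> * t) * ?k s" if "s \<in> {0..t} - {t}" for s
  proof -
    have s: "0 \<le> s" "s < t" using that by auto
    have "norm (Y (t - s) (g s)) \<le> C * (t - s) powr (- \<alpha>) * exp (- \<omega> * (t - s)) * (K * exp (\<nu> * s))"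
      using s C_nonneg by (intro order_trans[OF norm_blinfun] mult_mono nY g(2)) auto
    also have "\<dots> = C * K * (t - s) powr (- \<alpha>) * (exp (- \<omega> * (t - s)) * exp (\<nu> * s))" by (simp add: mult_ac)
    also have "exp (- \<omega> * (t - s)) * exp (\<nu> * s) = exp (\<nu> * t) * exp (- (\<nu> + \<omega>) * (t - s))"
      by (simp add: exp_add[symmetric] algebra_simps)
    finally show ?thesis by (simp add: mult_ac)
  qed
  have i: "(\<lambda>s. C * K * exp (\<nu> * t) * ?k s) integrable_on {0..t}"
    by (rule integrable_on_mult_right[OF kernel_exp_bound(1)[OF al l t]])
  have "V g t = integral {0..t} (\<lambda>s. if s = t then 0 else Y (t - s) (g s))"
    unfolding V_def by (rule integral_spike[of "{t}"]) auto
  also have "norm \<dots> \<le> integral {0..t} (\<lambda>s. C * K * exp (\<nu> * t) * ?k s)"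
    by (rule integral_norm_bound_integral[OF integrable_spike[OF int, of "{t}"] i])
      (use bd C_nonneg K in auto)
  also have "\<dots> = C * K * exp (\<nu> * t) * integral {0..t} ?k" by (rule integral_mult_right)
  also have "\<dots> \<le> C * K * exp (\<nu> * t) * ((\<nu> + \<omega>) powr (\<alpha> - 1) * kap)"
    unfolding kap_def using C_nonneg K by (intro mult_left_mono kernel_exp_bound(2)[OF al l t]) auto
  finally show ?thesis .
qed

lemma V_minus:
  assumes t: "0 \<le> t" and g: "continuous_on {0..t} g" "continuous_on {0..t} h"
  shows "V g t - V h t = V (\<lambda>s. g s - h s) t"
proof -
  obtain b where b: "\<And>s. s \<in> {0..t} \<Longrightarrow> norm (g s) \<le> b" by (rule continuous_bounded_norm[OF g(1)]) (rule that)
  obtain c where c: "\<And>s. s \<in> {0..t} \<Longrightarrow> norm (h s) \<le> c" by (rule continuous_bounded_norm[OF g(2)]) (rule that)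
  have "(\<lambda>s. Y (t - s) (g s)) integrable_on {0..t}" by (rule Y_conv(1)[where K = b]) (use b g t in auto)
  moreover have "(\<lambda>s. Y (t - s) (h s)) integrable_on {0..t}" by (rule Y_conv(1)[where K = c]) (use c g t in auto)
  ultimately show ?thesis unfolding V_def by (simp add: integral_diff[symmetric] blinfun.diff_right)
qed

lemma continuous_on_atLeast_local:
  fixes f :: "real \<Rightarrow> 'b::topological_space"
  assumes "\<And>T. continuous_on {0..T} f"
  shows "continuous_on {0..} f"
  unfolding continuous_on_eq_continuous_within
proof
  fix t :: real assume t: "t \<in> {0..}"
  have "continuous (at t within {0..t + 1}) f"
    using assms[of "t + 1"] t by (auto simp: continuous_on_eq_continuous_within)
  moreover have "at t within {0..t + 1} = at t within {0..}" by (rule at_within_nhd[of _ "{..<t + 1}"]) auto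
  ultimately show "continuous (at t within {0..}) f" by simp
qed

lemma V_continuous_atLeast: "continuous_on {0..} g \<Longrightarrow> continuous_on {0..} (V g)"
  by (rule continuous_on_atLeast_local, rule V_continuous, erule continuous_on_subset) auto

text \<open>The linear solution with initial value \<open>v0\<close>, continued by a constant to
  negative times so that it is a continuous function on the whole line.\<close>

definition hom :: "'x \<Rightarrow> real \<Rightarrow> 'x" where
  "hom v0 t = (if t \<le> 0 then v0 else Y t (J v0))"

lemma hom_continuous: "continuous_on UNIV (hom v0)"
  unfolding continuous_on_eq_continuous_at[OF open_UNIV]
proof
  fix t :: real
  consider "t < 0" | "t = 0" | "0 < t" by linarith
  thus "isCont (hom v0) t"
  proof cases
    case 1
    have "\<forall>\<^sub>F s in nhds t. hom v0 s = v0"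
      using eventually_nhds_in_open[of "{..<0}" t] 1 by (auto elim!: eventually_mono simp: hom_def)
    thus ?thesis using isCont_cong[of "hom v0" "\<lambda>_. v0" t] by simp
  next
    case 3
    have "isCont (\<lambda>t. Y t (J v0)) t"
      using Y_continuous 3 by (intro continuous_intros) (simp add: continuous_on_eq_continuous_at)
    moreover have "\<forall>\<^sub>F s in nhds t. hom v0 s = Y s (J v0)"
      using eventually_nhds_in_open[of "{0<..}" t] 3 by (auto elim!: eventually_mono simp: hom_def)
    ultimately show ?thesis using isCont_cong[of "hom v0" "\<lambda>t. Y t (J v0)" t] by simp
  next
    case 2
    have "(hom v0 \<longlongrightarrow> v0) (at_left 0)"
      by (rule Lim_transform_eventually[OF tendsto_const]) (auto simp: eventually_at_filter hom_def)
    moreover have "(hom v0 \<longlongrightarrow> v0) (at_right 0)"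
      by (rule Lim_transform_eventually[OF Y0]) (auto simp: eventually_at_filter hom_def)
    ultimately have "(hom v0 \<longlongrightarrow> v0) (at 0)" by (simp add: filterlim_at_split)
    thus ?thesis unfolding 2 isCont_def by (simp add: hom_def)
  qed
qed

lemma norm_hom: "norm (hom v0 t) \<le> (C + 1) * norm v0"
proof (cases "t \<le> 0")
  case True thus ?thesis using C_nonneg by (simp add: hom_def algebra_simps)
next
  case False
  hence "norm ((Y t o\<^sub>L J) v0) \<le> C * norm v0" using order_trans[OF nYJ mult_left_mono[OF exp_le_1]] pos
    by (intro order_trans[OF norm_blinfun] mult_right_mono) auto
  also have "\<dots> \<le> (C + 1) * norm v0" by (intro mult_right_mono) auto
  finally show ?thesis using False by (simp add: hom_def)
qed

text \<open>A contraction argument in the space of bounded continuous functions, with the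
  exponential weight e^(lt); it gives existence for all times at once.\<close>

lemma mild_exists:
  assumes lip: "\<And>v w. norm (f v - f w) \<le> lc * norm (v - w)" and bdd: "\<And>v. norm (f v) \<le> b"
  obtains v where "continuous_on {0..} v" "v 0 = v0" "\<And>t. 0 < t \<Longrightarrow> v t = Y t (J v0) + V (\<lambda>s. f (v s)) t"
proof -
  define lc' where "lc' = \<bar>lc\<bar> + 1"
  have lip': "norm (f v - f w) \<le> lc' * norm (v - w)" for v w
    by (rule order_trans[OF lip mult_right_mono]) (auto simp: lc'_def)
  have l'0: "0 < lc'" by (simp add: lc'_def)
  have fc: "continuous_on S f" for S
  proof (rule lipschitz_on_continuous_on[of lc'], rule lipschitz_onI)
    show "dist (f x) (f y) \<le> lc' * dist x y" for x y using lip' by (simp add: dist_norm)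
  qed (use l'0 in simp)
  have b0: "0 \<le> b" using order_trans[OF norm_ge_zero bdd] .
  define B where "B = 2 * C * lc' * kap"
  have B: "0 < B" using pos l'0 kap_pos by (simp add: B_def)
  \<comment> \<open>Makes the Lipschitz constant C lc' kap l^(\<alpha>-1) of the fixed point map
    equal to 1/2.\<close>
  define l where "l = B powr (1 / (1 - \<alpha>))"
  have l: "0 < l" using B by (simp add: l_def)
  have lB: "l powr (\<alpha> - 1) = 1 / B"
  proof -
    have "l powr (1 - \<alpha>) = B" using B al by (simp add: l_def powr_powr)
    thus ?thesis using powr_minus_divide[of l "1 - \<alpha>"] by simp
  qed
  \<comment> \<open>The unknown of the fixed point problem is the bounded function \<open>w\<close>;
    the solution is e^(lt) w(t).\<close>
  define v where "v w t = exp (l * t) *\<^sub>R apply_bcontfun w t" for w :: "real \<Rightarrow>\<^sub>C 'x" and t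
  have vc: "continuous_on S (\<lambda>s. f (v w s))" for w S
    unfolding v_def by (intro continuous_on_compose2[OF fc[of UNIV]] continuous_intros) auto
  \<comment> \<open>\<open>max 0 t\<close> freezes everything at negative times, as bounded
    continuous functions live on the whole line.\<close>
  define M where "M w t = hom v0 t + V (\<lambda>s. f (v w s)) (max 0 t)" for w t
  have Mc: "continuous_on UNIV (M w)" for w unfolding M_def
    by (intro continuous_intros hom_continuous continuous_on_compose2[OF V_continuous_atLeast[OF vc]]) auto
  define P where "P w t = exp (- l * max 0 t) *\<^sub>R M w t" for w t
  have P: "P w \<in> bcontfun" for w unfolding bcontfun_def
  proof (intro CollectI conjI)
    show "continuous_on UNIV (P w)" unfolding P_def by (intro continuous_intros Mc)
    have "norm (P w t) \<le> (C + 1) * norm v0 + C * b * exp (0 * max 0 t) * ((0 + \<omega>) powr (\<alpha> - 1) * kap)" for t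
    proof -
      have "norm (V (\<lambda>s. f (v w s)) (max 0 t)) \<le> C * b * exp (0 * max 0 t) * ((0 + \<omega>) powr (\<alpha> - 1) * kap)"
        by (rule norm_V_weighted[OF _ vc]) (use bdd pos in auto)
      hence "norm (M w t) \<le> (C + 1) * norm v0 + C * b * exp (0 * max 0 t) * ((0 + \<omega>) powr (\<alpha> - 1) * kap)"
        unfolding M_def by (intro order_trans[OF norm_triangle_ineq] add_mono norm_hom)
      moreover have "norm (P w t) \<le> 1 * norm (M w t)"
        unfolding P_def norm_scaleR using l by (intro mult_right_mono) auto
      ultimately show ?thesis by simp
    qed
    thus "bounded (range (P w))" unfolding bounded_iff by auto
  qed
  define \<Phi> where "\<Phi> w = Bcontfun (P w)" for w
  have app: "apply_bcontfun (\<Phi> w) = P w" for w unfolding \<Phi>_def using P by (rule Bcontfun_inverse)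
  have contr: "dist (\<Phi> w) (\<Phi> w') \<le> 1 / 2 * dist w w'" for w w'
  proof (rule dist_bound, unfold app)
    fix t :: real
    let ?t = "max 0 t" and ?d = "dist w w'"
    have "norm (V (\<lambda>s. f (v w s) - f (v w' s)) ?t) \<le> C * (lc' * ?d) * exp (l * ?t) * ((l + \<omega>) powr (\<alpha> - 1) * kap)"
    proof (rule norm_V_weighted)
      show "continuous_on {0..?t} (\<lambda>s. f (v w s) - f (v w' s))" by (intro continuous_intros vc)
      show "norm (f (v w s) - f (v w' s)) \<le> lc' * ?d * exp (l * s)" for s
      proof -
        have "norm (v w s - v w' s) = exp (l * s) * dist (apply_bcontfun w s) (apply_bcontfun w' s)"
          unfolding v_def scaleR_diff_right[symmetric] norm_scaleR dist_norm by simp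
        also have "\<dots> \<le> exp (l * s) * ?d" by (intro mult_left_mono dist_bounded) auto
        finally have "lc' * norm (v w s - v w' s) \<le> lc' * (exp (l * s) * ?d)" using l'0 by (intro mult_left_mono) auto
        thus ?thesis using lip'[of "v w s" "v w' s"] by (simp add: mult_ac)
      qed
    qed (use l pos in auto)
    also have "\<dots> \<le> C * (lc' * ?d) * exp (l * ?t) * (l powr (\<alpha> - 1) * kap)"
      using C_nonneg l'0 kap_pos l pos al by (intro mult_left_mono mult_right_mono powr_mono2') auto
    also have "\<dots> = exp (l * ?t) * (1 / 2 * ?d)"
    proof -
      have "C * (lc' * ?d) * exp (l * ?t) * (l powr (\<alpha> - 1) * kap) = exp (l * ?t) * ((C * lc' * kap) * (1 / B) * ?d)"
        unfolding lB by (simp add: mult_ac)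
      also have "(C * lc' * kap) * (1 / B) = 1 / 2" using B unfolding B_def by auto
      finally show ?thesis .
    qed
    finally have V: "norm (V (\<lambda>s. f (v w s) - f (v w' s)) ?t) \<le> exp (l * ?t) * (1 / 2 * ?d)" .
    have "M w t - M w' t = V (\<lambda>s. f (v w s) - f (v w' s)) ?t"
      unfolding M_def using V_minus[OF _ vc vc, of ?t w w'] by simp
    hence "dist (P w t) (P w' t) = exp (- l * ?t) * norm (V (\<lambda>s. f (v w s) - f (v w' s)) ?t)"
      unfolding P_def dist_norm scaleR_diff_right[symmetric] norm_scaleR by simp
    also have "\<dots> \<le> exp (- l * ?t) * (exp (l * ?t) * (1 / 2 * ?d))" by (intro mult_left_mono V) auto
    also have "\<dots> = 1 / 2 * ?d" by (simp add: exp_minus)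
    finally show "dist (P w t) (P w' t) \<le> 1 / 2 * ?d" .
  qed
  then obtain w where w: "\<Phi> w = w" using banach_fix_type[of "1 / 2" \<Phi>] by auto
  have vM: "v w t = M w t" if "0 \<le> t" for t
  proof -
    have "apply_bcontfun w t = P w t" using app[of w] w by simp
    hence "v w t = exp (l * t) *\<^sub>R (exp (- l * t) *\<^sub>R M w t)" using that by (simp add: v_def P_def)
    thus ?thesis by (simp add: exp_minus)
  qed
  show ?thesis
  proof
    show "continuous_on {0..} (v w)"
      by (rule continuous_on_eq[OF continuous_on_subset[OF Mc[of w]]]) (use vM in auto)
    show "v w 0 = v0" using vM[of 0] by (simp add: M_def hom_def V_def)
    show "v w t = Y t (J v0) + V (\<lambda>s. f (v w s)) t" if "0 < t" for t
      using vM[of t] that by (simp add: M_def hom_def)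
  qed
qed

text \<open>S(s + r) x solves the linear equation in r, so variation of constants with right-hand
  side 0 gives the claim.\<close>

lemma S_semigroup:
  assumes "0 < s" "0 < t"
  shows "S (s + t) = S t o\<^sub>L S s"
proof (rule blinfun_eqI)
  fix x
  have "((\<lambda>r. S (t - r) 0) has_integral (S (s + t) x - S (t - 0) (S (s + 0) x))) {0..t}"
  proof (rule variation_of_constants[OF assms(2), where u = "\<lambda>r. S (s + r) x" and f = "\<lambda>_. 0"])
    have d: "((\<lambda>r. S (s + r) x) has_vector_derivative 0 - L (S (s + r) x)) (at r)" if "0 \<le> r" for r
    proof -
      have "((\<lambda>r. s + r) has_vector_derivative 1) (at r)" by (auto intro!: derivative_eq_intros)
      from vector_diff_chain_at[OF this, of S "S' (s + r)"] dS[of "s + r"] that assms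
      have "((\<lambda>r. S (s + r)) has_vector_derivative S' (s + r)) (at r)" by (simp add: o_def)
      from bounded_linear.has_vector_derivative[OF blinfun.bounded_linear_left this, of x]
      show ?thesis using S'L[of "s + r" x] that assms by simp
    qed
    show "continuous_on {0..t} (\<lambda>r. S (s + r) x)"
      by (intro continuous_at_imp_continuous_on ballI has_vector_derivative_continuous[OF d]) auto
    show "((\<lambda>r. S (s + r) x) has_vector_derivative 0 - L (S (s + r) x)) (at r)" if "0 < r" for r
      using d that by simp
  qed (use SD assms in auto)
  hence "S (s + t) x - S (t - 0) (S (s + 0) x) = 0" by (simp add: has_integral_0_eq)
  thus "S (s + t) x = (S t o\<^sub>L S s) x" by simp
qed

lemma S'_eq: "0 < e \<Longrightarrow> e < t \<Longrightarrow> S' t = S (t - e) o\<^sub>L S' e"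
proof (rule blinfun_eqI)
  fix x assume e: "0 < e" "e < t"
  have "S t x = S (t - e) (S e x)" using S_semigroup[of e "t - e"] e by simp
  thus "S' t x = (S (t - e) o\<^sub>L S' e) x"
    using comm[OF _ SD[OF e(1)], of "t - e" x] e S'L[of t x] S'L[of e x] by (simp add: blinfun.minus_right)
qed

text \<open>\<open>S'_eq\<close> with a fixed intermediate time reduces this to the continuity of
  \<open>S\<close>.\<close>

lemma S'_continuous: "continuous_on {0<..} S'"
  unfolding continuous_on_eq_continuous_at[OF open_greaterThan]
proof
  fix t :: real assume "t \<in> {0<..}"
  hence t: "0 < t / 2" "t / 2 < t" by auto
  have "continuous_on {t / 2<..} (\<lambda>s. S (s - t / 2) o\<^sub>L S' (t / 2))"
    by (intro continuous_intros continuous_on_compose2[OF S_continuous]) auto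
  hence "continuous_on {t / 2<..} S'" by (rule continuous_on_eq) (use S'_eq[OF t(1)] in auto)
  thus "isCont S' t" using t by (simp add: continuous_on_eq_continuous_at)
qed

text \<open>Variation of constants for the stationary solution \<open>Li x\<close>, whose right-hand
  side is \<open>x\<close>.\<close>

lemma S_integral:
  assumes "a < t"
  shows "((\<lambda>s. S (t - s) x) has_integral (Li x - S (t - a) (Li x))) {a..t}"
  by (rule variation_of_constants[OF assms, where u = "\<lambda>_. Li x" and f = "\<lambda>_. x"])
    (auto simp: Li_D L_Li)

lemma S_Li: "0 < t \<Longrightarrow> S t (Li x) = Li (S t x)"
  using comm[OF _ Li_D, of t x] SD[of t "Li x"] by (metis L_Li Li_L)

section \<open>Differentiability of the Duhamel integral for Hoelder continuous data\<close>

definition V0 :: "(real \<Rightarrow> 'x) \<Rightarrow> real \<Rightarrow> 'x" where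
  "V0 g t = integral {0..t} (\<lambda>s. S (t - s) (g s))"

text \<open>\<open>LV g\<close> is \<open>L (V0 g)\<close>; the singularity of \<open>L S\<close> is compensated by the Hoelder continuity of \<open>g\<close>.\<close>

definition LV :: "(real \<Rightarrow> 'x) \<Rightarrow> real \<Rightarrow> 'x" where
  "LV g t = g t - S t (g t) - integral {0..t} (\<lambda>s. S' (t - s) (g s - g t))"

context
  fixes g :: "real \<Rightarrow> 'x"
  assumes g: "continuous_on {0..} g"
    and holder: "\<And>a b. 0 < a \<Longrightarrow> \<exists>H. \<forall>s\<in>{a..b}. \<forall>t\<in>{a..b}. norm (g s - g t) \<le> H * \<bar>s - t\<bar> powr q"
begin

lemma g_sub: "0 \<le> a \<Longrightarrow> continuous_on {a..b} g"
  by (rule continuous_on_subset[OF g]) auto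

text \<open>For s below a/2 the distance t - s is at least a/2, so boundedness of \<open>g\<close>
  serves as a Hoelder bound down to s = 0.\<close>

lemma holder':
  assumes a: "0 < a"
  obtains H where "0 \<le> H" "\<And>s t. t \<in> {a..b} \<Longrightarrow> s \<in> {0..t} \<Longrightarrow> norm (g s - g t) \<le> H * (t - s) powr q"
proof -
  obtain H where H: "\<And>s t. s \<in> {a / 2..b} \<Longrightarrow> t \<in> {a / 2..b} \<Longrightarrow> norm (g s - g t) \<le> H * \<bar>s - t\<bar> powr q"
    using holder[of "a / 2" b] a by (metis half_gt_zero)
  obtain K where K: "\<And>s. s \<in> {0..b} \<Longrightarrow> norm (g s) \<le> K" by (rule continuous_bounded_norm[OF g_sub[of 0 b]]) (auto intro: that)
  define H' where "H' = \<bar>H\<bar> + 2 * \<bar>K\<bar> / (a / 2) powr q"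
  have H'1: "\<bar>H\<bar> \<le> H'" "2 * \<bar>K\<bar> / (a / 2) powr q \<le> H'" by (auto simp: H'_def)
  have "norm (g s - g t) \<le> H' * (t - s) powr q" if "t \<in> {a..b}" "s \<in> {0..t}" for s t
  proof (cases "a / 2 \<le> s")
    case True
    have "norm (g s - g t) \<le> H * \<bar>s - t\<bar> powr q" by (rule H) (use True that a in auto)
    also have "\<dots> \<le> H' * (t - s) powr q" using that H'1 by (intro mult_mono) auto
    finally show ?thesis .
  next
    case False
    have "norm (g s - g t) \<le> K + K" using that by (intro order_trans[OF norm_triangle_ineq4] add_mono K) auto
    also have "\<dots> \<le> 2 * \<bar>K\<bar>" by simp
    also have "\<dots> = 2 * \<bar>K\<bar> / (a / 2) powr q * (a / 2) powr q" using a by simp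
    also have "\<dots> \<le> H' * (t - s) powr q" using that False a theta H'1 by (intro mult_mono powr_mono2) auto
    finally show ?thesis .
  qed
  moreover have "0 \<le> H'" using H'1 by linarith
  ultimately show ?thesis using that by blast
qed

lemma S'_kernel:
  assumes H: "0 \<le> H" "\<And>s. s \<in> {0..t} \<Longrightarrow> norm (g s - g t) \<le> H * (t - s) powr q" and ab: "0 \<le> a" "a \<le> t"
  shows "(\<lambda>s. S' (t - s) (g s - g t)) integrable_on {a..t}"
    "norm (integral {a..t} (\<lambda>s. S' (t - s) (g s - g t))) \<le> C * H * ((t - a) powr q / q)"
proof -
  have i: "((\<lambda>s. C * H * (t - s) powr (- (1 - q))) has_integral C * H * ((t - a) powr q / q)) {a..t}"
    using has_integral_kernel[of "1 - q" a t] theta ab by (intro has_integral_mult_right) simp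
  have bd: "norm (S' (t - s) (g s - g t)) \<le> C * H * (t - s) powr (- (1 - q))" if "s \<in> {a..<t}" for s
  proof -
    have "norm (S' (t - s) (g s - g t)) \<le> C / (t - s) * (H * (t - s) powr q)"
      using that ab C_nonneg by (intro order_trans[OF norm_blinfun] mult_mono nS'1 H(2)) auto
    also have "\<dots> = C * H * (t - s) powr (- (1 - q))" using that by (simp add: powr_diff)
    finally show ?thesis .
  qed
  show int: "(\<lambda>s. S' (t - s) (g s - g t)) integrable_on {a..t}"
    by (rule integrable_right_dominated[OF _ has_integral_integrable[OF i] bd])
      (use ab in \<open>auto intro!: continuous_intros continuous_on_compose2[OF S'_continuous] continuous_on_subset[OF g]\<close>)
  have "integral {a..t} (\<lambda>s. S' (t - s) (g s - g t)) = integral {a..t} (\<lambda>s. if s = t then 0 else S' (t - s) (g s - g t))"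
    by (rule integral_spike[of "{t}"]) auto
  also have "norm \<dots> \<le> integral {a..t} (\<lambda>s. C * H * (t - s) powr (- (1 - q)))"
    by (rule integral_norm_bound_integral[OF integrable_spike[OF int, of "{t}"] has_integral_integrable[OF i]])
      (use bd H C_nonneg in auto)
  finally show "norm (integral {a..t} (\<lambda>s. S' (t - s) (g s - g t))) \<le> C * H * ((t - a) powr q / q)"
    unfolding integral_unique[OF i] .
qed

lemma S_g_integrable: "0 \<le> a \<Longrightarrow> a \<le> t \<Longrightarrow> (\<lambda>s. S (t - s) (g s)) integrable_on {a..t}"
proof -
  assume a: "0 \<le> a" "a \<le> t"
  obtain b where "\<And>s. s \<in> {a..t} \<Longrightarrow> norm (g s) \<le> b" by (rule continuous_bounded_norm[OF g_sub[OF a(1)]]) (auto intro: that)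
  thus ?thesis using a g_sub by (intro S_conv(1)[where K = b]) auto
qed

text \<open>Since L^(-1) S' = - S, applying \<open>Li\<close> to the singular integral leaves the
  integral of S(t - s) (g t - g s), whose part with the constant \<open>g t\<close> is known from
  \<open>S_integral\<close>. So the Duhamel integral lies in the domain, and \<open>LV g\<close> is
  its image under L.\<close>

lemma Li_LV:
  assumes t: "0 < t"
  shows "V0 g t = Li (LV g t)"
proof -
  obtain H where H: "0 \<le> H" "\<And>s t'. t' \<in> {t..t} \<Longrightarrow> s \<in> {0..t'} \<Longrightarrow> norm (g s - g t') \<le> H * (t' - s) powr q"
    by (rule holder'[OF t, of t]) (rule that)
  have i1: "(\<lambda>s. S' (t - s) (g s - g t)) integrable_on {0..t}" by (rule S'_kernel(1)[of H]) (use H t in auto)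
  have i2: "(\<lambda>s. S (t - s) (g s)) integrable_on {0..t}" by (rule S_g_integrable) (use t in auto)
  have Lis: "Li (S' r x) = - S r x" if "0 < r" for r x
    using S'L[OF that, of x] Li_L[OF SD[OF that, of x]] by (simp add: blinfun.minus_right)
  have "Li (integral {0..t} (\<lambda>s. S' (t - s) (g s - g t))) = integral {0..t} (\<lambda>s. Li (S' (t - s) (g s - g t)))"
    using integral_linear[OF i1 blinfun.bounded_linear_right[of Li]] by (simp add: o_def)
  also have "\<dots> = integral {0..t} (\<lambda>s. S (t - s) (g t) - S (t - s) (g s))"
    by (rule integral_spike[of "{t}"]) (auto simp: Lis blinfun.diff_right)
  also have "\<dots> = (Li (g t) - S t (Li (g t))) - V0 g t"
    unfolding V0_def using integral_diff[OF has_integral_integrable[OF S_integral[OF t]] i2]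
    by (simp add: integral_unique[OF S_integral[OF t]])
  finally show ?thesis using t by (simp add: LV_def blinfun.diff_right S_Li)
qed

text \<open>The integrals cut off at t - e are continuous in t and converge uniformly as e tends to
  0, the error being of order e^q by \<open>S'_kernel\<close>.\<close>

lemma LV_continuous: "continuous_on {0<..} (LV g)"
  unfolding continuous_on_eq_continuous_at[OF open_greaterThan]
proof
  fix t0 :: real assume "t0 \<in> {0<..}"
  hence t0: "0 < t0" by simp
  define a b where "a = t0 / 2" and "b = t0 + 1"
  have ab: "0 < a" "a < t0" "t0 < b" using t0 by (auto simp: a_def b_def)
  obtain H where H: "0 \<le> H" "\<And>s t. t \<in> {a..b} \<Longrightarrow> s \<in> {0..t} \<Longrightarrow> norm (g s - g t) \<le> H * (t - s) powr q"
    by (rule holder'[OF ab(1)]) (rule that)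
  define Q where "Q e t = integral {0..t - e} (\<lambda>s. S' (t - s) (g s - g t))" for e t
  have Qc: "continuous_on {a..b} (Q e)" if e: "0 < e" "e < a" for e
  proof -
    \<comment> \<open>Freezing the kernel at \<sigma> = e makes it continuous on the whole line, so
      the integral may run over the fixed interval from 0 to b. The surplus over
      \<open>{t - e..b}\<close> has the constant kernel \<open>S' e\<close> and is explicit.\<close>
    define k where "k \<sigma> = S' (max e \<sigma>)" for \<sigma>
    have kc: "continuous_on UNIV k" unfolding k_def
      by (intro continuous_on_compose2[OF S'_continuous] continuous_intros) (use e in auto)
    have g2: "continuous_on ({a..b} \<times> {0..b}) (\<lambda>p. g (fst p))" "continuous_on ({a..b} \<times> {0..b}) (\<lambda>p. g (snd p))"
      by (rule continuous_on_compose2[OF g]; use ab in \<open>auto intro!: continuous_intros\<close>)+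
    have "continuous_on ({a..b} \<times> cbox 0 b) (\<lambda>(t, s). k (t - s) (g s - g t))" unfolding split_beta using g2
      by (intro continuous_intros continuous_on_compose2[OF kc]) auto
    hence 1: "continuous_on {a..b} (\<lambda>t. integral (cbox 0 b) (\<lambda>s. k (t - s) (g s - g t)))"
      by (rule integral_continuous_on_param)
    have gi: "continuous_on {0..b} (\<lambda>t. integral {0..t} g)"
      by (rule indefinite_integral_continuous_1[OF integrable_continuous_interval[OF g_sub]]) simp
    have 2: "continuous_on {a..b} (\<lambda>t. S' e ((integral {0..b} g - integral {0..t - e} g) - (b - (t - e)) *\<^sub>R g t))"
      by (intro continuous_intros continuous_on_compose2[OF gi] g_sub) (use ab e in auto)
    have "Q e t = integral (cbox 0 b) (\<lambda>s. k (t - s) (g s - g t)) -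
        S' e ((integral {0..b} g - integral {0..t - e} g) - (b - (t - e)) *\<^sub>R g t)" if t: "t \<in> {a..b}" for t
    proof -
      have te: "0 \<le> t - e" "t - e \<le> b" using t e ab by auto
      have ki: "(\<lambda>s. k (t - s) (g s - g t)) integrable_on {0..b}"
        by (rule integrable_continuous_interval) (intro continuous_intros continuous_on_compose2[OF kc] g_sub; auto)
      have gI: "g integrable_on {0..b}" by (rule integrable_continuous_interval[OF g_sub]) simp
      have gI': "g integrable_on {t - e..b}" by (rule integrable_continuous_interval[OF g_sub]) (use te in simp)
      have "integral {0..b} (\<lambda>s. k (t - s) (g s - g t)) = integral {0..t - e} (\<lambda>s. k (t - s) (g s - g t)) +
          integral {t - e..b} (\<lambda>s. k (t - s) (g s - g t))" using integral_split[OF te ki] by simp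
      moreover have "integral {0..t - e} (\<lambda>s. k (t - s) (g s - g t)) = Q e t"
        unfolding Q_def by (rule integral_cong) (auto simp: k_def max_def)
      moreover have "integral {t - e..b} (\<lambda>s. k (t - s) (g s - g t)) =
          S' e ((integral {0..b} g - integral {0..t - e} g) - (b - (t - e)) *\<^sub>R g t)"
      proof -
        have "integral {t - e..b} (\<lambda>s. k (t - s) (g s - g t)) = integral {t - e..b} (\<lambda>s. S' e (g s - g t))"
          by (rule integral_cong) (simp add: k_def max_absorb1)
        also have "\<dots> = S' e (integral {t - e..b} (\<lambda>s. g s - g t))"
          using integral_linear[OF integrable_diff[OF gI' integrable_const_ivl] blinfun.bounded_linear_right[of "S' e"], of "g t"]
          by (simp add: o_def)
        also have "integral {t - e..b} (\<lambda>s. g s - g t) = integral {t - e..b} g - (b - (t - e)) *\<^sub>R g t"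
          using te by (simp add: integral_diff[OF gI' integrable_const_ivl])
        also have "integral {t - e..b} g = integral {0..b} g - integral {0..t - e} g"
          using integral_split[OF te gI] by (simp add: algebra_simps)
        finally show ?thesis .
      qed
      ultimately show ?thesis by simp
    qed
    thus ?thesis by (intro continuous_on_eq[OF continuous_on_diff[OF 1 2]]) simp
  qed
  define Q0 where "Q0 t = integral {0..t} (\<lambda>s. S' (t - s) (g s - g t))" for t
  have Qd: "norm (Q e t - Q0 t) \<le> C * H * (e powr q / q)" if e: "0 < e" "e < a" and t: "t \<in> {a..b}" for e t
  proof -
    have te: "0 \<le> t - e" "t - e \<le> t" using t e ab by auto
    note k = S'_kernel[OF H(1) H(2)[OF t]]
    have "Q0 t = Q e t + integral {t - e..t} (\<lambda>s. S' (t - s) (g s - g t))"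
      unfolding Q0_def Q_def using integral_split[OF te k(1)] te by simp
    hence "norm (Q e t - Q0 t) = norm (integral {t - e..t} (\<lambda>s. S' (t - s) (g s - g t)))" by simp
    also have "\<dots> \<le> C * H * ((t - (t - e)) powr q / q)" by (rule k(2)) (use te in auto)
    finally show ?thesis by simp
  qed
  have "uniform_limit {a..b} Q Q0 (at_right 0)"
  proof (rule uniform_limitI)
    fix \<epsilon> :: real assume eps: "0 < \<epsilon>"
    have id0: "((\<lambda>e::real. e) \<longlongrightarrow> 0) (at_right 0)" by (rule tendsto_ident_at)
    have "((\<lambda>e. e powr q) \<longlongrightarrow> 0) (at_right 0)"
      by (rule tendsto_zero_powrI[OF id0 tendsto_const]) (use theta in \<open>auto simp: eventually_at_filter\<close>)
    hence "((\<lambda>e. C * H * (e powr q / q)) \<longlongrightarrow> C * H * (0 / q)) (at_right 0)"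
      using theta by (intro tendsto_intros) auto
    hence "\<forall>\<^sub>F e in at_right 0. C * H * (e powr q / q) < \<epsilon>" using eps by (intro order_tendstoD(2)) auto
    moreover have "\<forall>\<^sub>F e in at_right 0. e < a" by (rule order_tendstoD(2)[OF id0 ab(1)])
    moreover have "\<forall>\<^sub>F e in at_right (0::real). 0 < e" by (simp add: eventually_at_right_less)
    ultimately show "\<forall>\<^sub>F e in at_right 0. \<forall>t\<in>{a..b}. dist (Q e t) (Q0 t) < \<epsilon>"
      unfolding dist_norm by eventually_elim (intro ballI le_less_trans[OF Qd]; simp)
  qed
  moreover have "\<forall>\<^sub>F e in at_right 0. continuous_on {a..b} (Q e)"
  proof -
    have "\<forall>\<^sub>F e in at_right 0. e < a" by (rule order_tendstoD(2)[OF tendsto_ident_at ab(1)])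
    moreover have "\<forall>\<^sub>F e in at_right (0::real). 0 < e" by (simp add: eventually_at_right_less)
    ultimately show ?thesis by eventually_elim (rule Qc)
  qed
  ultimately have "continuous_on {a..b} Q0"
    by (intro uniform_limit_theorem[where F = "at_right (0::real)"]) (auto simp: trivial_limit_at_right_real)
  moreover have "continuous_on {a..b} (\<lambda>t. g t - S t (g t))"
    by (intro continuous_intros g_sub continuous_on_subset[OF S_continuous]) (use ab in auto)
  ultimately have "continuous_on {a..b} (\<lambda>t. (g t - S t (g t)) - Q0 t)" by (rule continuous_on_diff[rotated])
  hence "continuous_on {a..b} (LV g)" by (simp add: LV_def[abs_def] Q0_def)
  thus "isCont (LV g) t0"
    using continuous_on_interior[of "{a..b}" "LV g" t0] ab by (simp add: interior_atLeastAtMost_real)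
qed

text \<open>By the semigroup law V0 at time t is S(t - a) applied to V0 at time a, plus the integral
  over \<open>{a..t}\<close>; the loss V0(a) - S(t - a) V0(a) is an integral as well, by
  \<open>S_integral\<close> and \<open>Li_LV\<close>.\<close>

lemma V0_increment:
  assumes t: "0 < a" "a < t"
  shows "((\<lambda>s. S (t - s) (g s - LV g a)) has_integral (V0 g t - V0 g a)) {a..t}"
proof -
  define h where "h = t - a"
  have h: "0 < h" using t by (simp add: h_def)
  note i = S_g_integrable
  have "V0 g t = integral {0..a} (\<lambda>s. S (t - s) (g s)) + integral {a..t} (\<lambda>s. S (t - s) (g s))"
    unfolding V0_def using integral_split[of 0 a t "\<lambda>s. S (t - s) (g s)"] i[of 0 t] t by simp
  also have "integral {0..a} (\<lambda>s. S (t - s) (g s)) = integral {0..a} (\<lambda>s. S h (S (a - s) (g s)))"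
  proof (rule integral_spike[of "{a}"])
    show "S h (S (a - s) (g s)) = S (t - s) (g s)" if "s \<in> {0..a} - {a}" for s
      using S_semigroup[of "a - s" h] that h by (simp add: h_def)
  qed auto
  also have "\<dots> = S h (V0 g a)"
    unfolding V0_def using integral_linear[OF i[of 0 a] blinfun.bounded_linear_right[of "S h"]] t by (simp add: o_def)
  finally have 1: "V0 g t - V0 g a = integral {a..t} (\<lambda>s. S (t - s) (g s)) - (V0 g a - S h (V0 g a))" by simp
  have 2: "((\<lambda>s. S (t - s) (LV g a)) has_integral (V0 g a - S h (V0 g a))) {a..t}"
    using S_integral[OF t(2), of "LV g a"] Li_LV[OF t(1)] by (simp add: h_def)
  show ?thesis
    unfolding 1 blinfun.diff_right by (intro has_integral_diff 2 integrable_integral i) (use t in auto)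
qed

lemma V0_derivative:
  assumes t: "0 < t"
  shows "(V0 g has_vector_derivative g t - LV g t) (at t)"
proof (rule has_vector_derivative_straddle)
  fix e :: real assume e: "0 < e"
  define D0 where "D0 = g t - LV g t"
  \<comment> \<open>S costs the factor C on the two continuity errors of \<open>g\<close> and
    \<open>LV g\<close>; one more \<epsilon> comes from the strong continuity of S.\<close>
  define \<epsilon> where "\<epsilon> = e / (2 * C + 1)"
  have eps: "0 < \<epsilon>" using e C_nonneg by (simp add: \<epsilon>_def)
  have "isCont g t" using continuous_on_interior[OF g, of t] t by (simp add: interior_Ici[of "-1"])
  then obtain d1 where d1: "d1 > 0" "\<And>s. dist s t < d1 \<Longrightarrow> dist (g s) (g t) < \<epsilon>"
    unfolding continuous_at_eps_delta using eps by metis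
  have "isCont (LV g) t" using LV_continuous t by (simp add: continuous_on_eq_continuous_at)
  then obtain d2 where d2: "d2 > 0" "\<And>s. dist s t < d2 \<Longrightarrow> dist (LV g s) (LV g t) < \<epsilon>"
    unfolding continuous_at_eps_delta using eps by metis
  obtain d3 where d3: "d3 > 0" "\<And>r. 0 < r \<Longrightarrow> r < d3 \<Longrightarrow> dist (S r D0) D0 < \<epsilon>"
    using tendstoD[OF S0[of D0] eps] unfolding eventually_at_right_field by auto
  define d where "d = Min {d1, d2, d3, t}"
  have d: "0 < d" "d \<le> d1" "d \<le> d2" "d \<le> d3" "d \<le> t" using d1 d2 d3 t by (auto simp: d_def)
  have "norm (V0 g y - V0 g x - (y - x) *\<^sub>R D0) \<le> e * (y - x)" if xy: "x \<le> t" "t \<le> y" "y - x < d" for x y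
  proof (cases "x = y")
    case False
    have x: "0 < x" "x < y" using xy False d by auto
    have i: "((\<lambda>s. S (y - s) (g s - LV g x) - D0) has_integral (V0 g y - V0 g x - (y - x) *\<^sub>R D0)) {x..y}"
      using has_integral_diff[OF V0_increment[OF x] has_integral_const_real[of D0 x y]] x by simp
    have "norm (V0 g y - V0 g x - (y - x) *\<^sub>R D0) \<le> e * measure lborel {x..y}"
    proof (rule has_integral_bound_real[OF _ _ i, of e "{y}"])
      show "norm (S (y - s) (g s - LV g x) - D0) \<le> e" if s: "s \<in> {x..y} - {y}" for s
      proof -
        have "dist s t < d" "dist x t < d" using s xy by (auto simp: dist_real_def)
        hence "norm (g s - g t) \<le> \<epsilon>" "norm (LV g x - LV g t) \<le> \<epsilon>"
          using d1(2)[of s] d2(2)[of x] d by (auto simp: dist_norm)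
        hence "norm ((g s - LV g x) - D0) \<le> \<epsilon> + \<epsilon>"
          unfolding D0_def using norm_triangle_ineq4[of "g s - g t" "LV g x - LV g t"] by (simp add: algebra_simps)
        hence 1: "norm (S (y - s) ((g s - LV g x) - D0)) \<le> C * (\<epsilon> + \<epsilon>)"
          using s C_nonneg by (intro order_trans[OF norm_blinfun] mult_mono nS1) auto
        have 2: "norm (S (y - s) D0 - D0) \<le> \<epsilon>" using d3(2)[of "y - s"] s xy d by (auto simp: dist_norm)
        have "S (y - s) (g s - LV g x) - D0 = S (y - s) ((g s - LV g x) - D0) + (S (y - s) D0 - D0)"
          by (simp add: blinfun.diff_right)
        hence "norm (S (y - s) (g s - LV g x) - D0) \<le> C * (\<epsilon> + \<epsilon>) + \<epsilon>"
          using norm_triangle_mono[OF 1 2] by (simp add: algebra_simps)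
        also have "\<dots> = (2 * C + 1) * \<epsilon>" by (simp add: algebra_simps)
        also have "\<dots> = e" using C_nonneg by (simp add: \<epsilon>_def)
        finally show ?thesis .
      qed
    qed (use e in auto)
    thus ?thesis using x by simp
  qed simp
  thus "\<exists>d>0. \<forall>x y. x \<le> t \<and> t \<le> y \<and> y - x < d \<longrightarrow>
      norm (V0 g y - V0 g x - (y - x) *\<^sub>R (g t - LV g t)) \<le> e * (y - x)"
    unfolding D0_def[symmetric] using d(1) by blast
qed

end

text \<open>Away from t = 0 the Hoelder constant t^(-\<alpha>-q) of the linear part is bounded, and
  \<open>V_diff\<close> treats the Duhamel part. This provides the Hoelder condition under which
  \<open>V0\<close> is differentiable.\<close>

lemma mild_holder:
  assumes g: "continuous_on {0..} g" and v: "\<And>t. 0 < t \<Longrightarrow> v t = Y t x + V g t" and a: "0 < a"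
  shows "\<exists>H. \<forall>s\<in>{a..b}. \<forall>t\<in>{a..b}. norm (v s - v t) \<le> H * \<bar>s - t\<bar> powr q"
proof -
  have gs: "continuous_on {0..T} g" for T by (rule continuous_on_subset[OF g]) auto
  obtain K where K: "\<And>s. s \<in> {0..b} \<Longrightarrow> norm (g s) \<le> K" by (rule continuous_bounded_norm[OF gs]) (rule that)
  define H where "H = 2 * C * a powr (- (\<alpha> + q)) * norm x + C * K * (b powr q / (2 * q)) + 2 * C * K * (b powr q / q)"
  have 1: "norm (v (t + h) - v t) \<le> H * h powr q" if t: "a \<le> t" "0 \<le> h" "t + h \<le> b" for t h
  proof -
    have K0: "0 \<le> K" using order_trans[OF norm_ge_zero K[of t]] t a by simp
    have "norm ((Y (t + h) - Y t) x) \<le> (2 * C * h powr q * t powr (- (\<alpha> + q))) * norm x"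
      by (intro order_trans[OF norm_blinfun] mult_right_mono Y_diff_holder) (use t a in auto)
    also have "\<dots> \<le> (2 * C * h powr q * a powr (- (\<alpha> + q))) * norm x"
      using t a al theta C_nonneg by (intro mult_right_mono mult_left_mono powr_mono2') auto
    finally have n1: "norm ((Y (t + h) - Y t) x) \<le> (2 * C * a powr (- (\<alpha> + q)) * norm x) * h powr q" by (simp add: mult_ac)
    have "norm (V g (t + h) - V g t) \<le> C * K * (h powr (2 * q) / (2 * q)) + 2 * C * h powr q * K * (t powr q / q)"
      by (rule V_diff) (use t a gs K in auto)
    also have "\<dots> \<le> C * K * (b powr q / (2 * q)) * h powr q + 2 * C * K * (b powr q / q) * h powr q"
    proof (rule add_mono)
      have "h powr (2 * q) = h powr q * h powr q" by (simp flip: powr_add)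
      also have "\<dots> \<le> b powr q * h powr q" using t a theta by (intro mult_right_mono powr_mono2) auto
      finally have "C * K * (h powr (2 * q) / (2 * q)) \<le> C * K * (b powr q * h powr q / (2 * q))"
        using C_nonneg K0 theta by (intro mult_left_mono divide_right_mono) auto
      thus "C * K * (h powr (2 * q) / (2 * q)) \<le> C * K * (b powr q / (2 * q)) * h powr q" by simp
      have "t powr q / q \<le> b powr q / q" using t a theta by (intro divide_right_mono powr_mono2) auto
      hence "2 * C * h powr q * K * (t powr q / q) \<le> 2 * C * h powr q * K * (b powr q / q)"
        using C_nonneg K0 by (intro mult_left_mono mult_nonneg_nonneg) auto
      thus "2 * C * h powr q * K * (t powr q / q) \<le> 2 * C * K * (b powr q / q) * h powr q" by (simp add: mult_ac)
    qed
    finally have n2: "norm (V g (t + h) - V g t) \<le> (C * K * (b powr q / (2 * q)) + 2 * C * K * (b powr q / q)) * h powr q"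
      by (simp only: distrib_right)
    have "v (t + h) - v t = (Y (t + h) - Y t) x + (V g (t + h) - V g t)"
      using t a by (simp add: v blinfun.diff_left)
    thus ?thesis using norm_triangle_mono[OF n1 n2] by (simp only: H_def distrib_right)
  qed
  have "norm (v s - v t) \<le> H * \<bar>s - t\<bar> powr q" if "s \<in> {a..b}" "t \<in> {a..b}" for s t
  proof (cases "t \<le> s")
    case True thus ?thesis using 1[of t "s - t"] that by simp
  next
    case False thus ?thesis using 1[of s "t - s"] that by (simp add: norm_minus_commute abs_minus_commute)
  qed
  thus ?thesis by blast
qed

text \<open>For Lipschitz \<open>f\<close> the function f(v(s)) inherits the Hoelder continuity of
  \<open>v\<close>, so the Duhamel integral is differentiable with values in the domain.\<close>

lemma mild_regular:
  assumes v: "continuous_on {0..} v" "\<And>t. 0 < t \<Longrightarrow> v t = Y t (J (v 0)) + V (\<lambda>s. f (v s)) t"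
    and lip: "\<And>v w. norm (f v - f w) \<le> lc * norm (v - w)"
  shows "0 < t \<Longrightarrow> J (v t) \<in> D"
    "0 < t \<Longrightarrow> ((\<lambda>t. J (v t)) has_vector_derivative f (v t) - L (J (v t))) (at t)"
    "continuous_on {0<..} (\<lambda>t. L (J (v t)))"
proof -
  define g where "g s = f (v s)" for s
  define lc' where "lc' = \<bar>lc\<bar> + 1"
  have lip': "norm (f v - f w) \<le> lc' * norm (v - w)" for v w
    by (rule order_trans[OF lip mult_right_mono]) (auto simp: lc'_def)
  have l'0: "0 < lc'" by (simp add: lc'_def)
  have fc: "continuous_on S f" for S
  proof (rule lipschitz_on_continuous_on[of lc'], rule lipschitz_onI)
    show "dist (f x) (f y) \<le> lc' * dist x y" for x y using lip' by (simp add: dist_norm)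
  qed (use l'0 in simp)
  have gc: "continuous_on {0..} g" unfolding g_def by (rule continuous_on_compose2[OF fc[of UNIV] v(1)]) simp
  have gh: "\<exists>H. \<forall>s\<in>{a..b}. \<forall>t\<in>{a..b}. norm (g s - g t) \<le> H * \<bar>s - t\<bar> powr q" if a: "0 < a" for a b
  proof -
    obtain H where H: "\<And>s t. s \<in> {a..b} \<Longrightarrow> t \<in> {a..b} \<Longrightarrow> norm (v s - v t) \<le> H * \<bar>s - t\<bar> powr q"
      using mild_holder[OF gc _ a, of v "J (v 0)" b] v(2) unfolding g_def by blast
    have "norm (g s - g t) \<le> (lc' * H) * \<bar>s - t\<bar> powr q" if "s \<in> {a..b}" "t \<in> {a..b}" for s t
      using order_trans[OF lip' mult_left_mono[OF H[OF that]]] l'0 unfolding g_def by (simp add: mult_ac)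
    thus ?thesis by blast
  qed
  have gs: "continuous_on {0..T} g" for T by (rule continuous_on_subset[OF gc]) auto
  have eq: "J (v t) = S t (J (v 0)) + V0 g t" if "0 < t" for t
    using v(2)[OF that] JV[OF _ gs, of t] that unfolding g_def V0_def by (simp add: blinfun.add_right JY)
  have V0D: "V0 g t \<in> D" "L (V0 g t) = LV g t" if "0 < t" for t using Li_LV[OF gc gh that] Li_D L_Li by auto
  show D: "J (v t) \<in> D" if "0 < t" for t
    unfolding eq[OF that] by (rule linear_opD(2)[OF lin SD[OF that] V0D(1)[OF that]])
  have Leq: "L (J (v t)) = - S' t (J (v 0)) + LV g t" if t: "0 < t" for t
    unfolding eq[OF t] linear_opD(6)[OF lin SD[OF t] V0D(1)[OF t]] V0D(2)[OF t] by (simp add: S'L[OF t])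
  show "((\<lambda>t. J (v t)) has_vector_derivative f (v t) - L (J (v t))) (at t)" if t: "0 < t" for t
  proof -
    have "((\<lambda>t. S t (J (v 0)) + V0 g t) has_vector_derivative S' t (J (v 0)) + (g t - LV g t)) (at t)"
      by (rule has_vector_derivative_add[OF bounded_linear.has_vector_derivative[OF blinfun.bounded_linear_left dS[OF t]]
        V0_derivative[OF gc gh t]])
    hence "((\<lambda>t. S t (J (v 0)) + V0 g t) has_vector_derivative f (v t) - L (J (v t))) (at t)"
      unfolding Leq[OF t] g_def by (simp add: algebra_simps)
    thus ?thesis by (rule has_vector_derivative_transform_within_open[of _ _ _ "{0<..}"]) (use t eq in auto)
  qed
  have "continuous_on {0<..} (\<lambda>t. - S' t (J (v 0)) + LV g t)"
    by (intro continuous_intros S'_continuous LV_continuous[OF gc gh])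
  thus "continuous_on {0<..} (\<lambda>t. L (J (v t)))" by (rule continuous_on_eq) (use Leq in auto)
qed

end

subsection \<open>Compact perturbations of the identity\<close>

definition compact_op :: "('a::real_normed_vector \<Rightarrow>\<^sub>L 'b::real_normed_vector) \<Rightarrow> bool" where
  "compact_op K \<longleftrightarrow> (\<forall>s::nat \<Rightarrow> 'a. (\<forall>n. norm (s n) \<le> 1) \<longrightarrow> (\<exists>l r. strict_mono r \<and> (\<lambda>n. K (s (r n))) \<longlonglongrightarrow> l))"

lemma compact_op_bounded:
  assumes K: "compact_op K" and s: "\<And>n::nat. norm (s n) \<le> b"
  obtains l r where "strict_mono r" "(\<lambda>n. K (s (r n))) \<longlonglongrightarrow> l"
proof -
  define b' where "b' = \<bar>b\<bar> + 1"
  have b': "0 < b'" "norm (s n) \<le> b'" for n using s[of n] by (auto simp: b'_def)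
  have "\<forall>n. norm (s n /\<^sub>R b') \<le> 1" using b' by (simp add: divide_simps)
  then obtain l r where r: "strict_mono r" and l: "(\<lambda>n. K (s (r n) /\<^sub>R b')) \<longlonglongrightarrow> l"
    using K[unfolded compact_op_def, rule_format, of "\<lambda>n. s n /\<^sub>R b'"] by auto
  have "(\<lambda>n. b' *\<^sub>R K (s (r n) /\<^sub>R b')) \<longlonglongrightarrow> b' *\<^sub>R l" using l by (intro tendsto_intros)
  thus ?thesis using that[OF r, of "b' *\<^sub>R l"] b' by (simp add: blinfun.scaleR_right)
qed

lemma compact_op_compose_left:
  assumes "compact_op K" shows "compact_op (M o\<^sub>L K)"
  unfolding compact_op_def
proof (intro allI impI)
  fix s :: "nat \<Rightarrow> 'a" assume "\<forall>n. norm (s n) \<le> 1"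
  then obtain l r where "strict_mono r" "(\<lambda>n. K (s (r n))) \<longlonglongrightarrow> l" by (metis compact_op_bounded[OF assms, of s 1])
  thus "\<exists>l r. strict_mono r \<and> (\<lambda>n. (M o\<^sub>L K) (s (r n))) \<longlonglongrightarrow> l"
    by (auto intro!: exI[of _ "M l"] exI[of _ r] tendsto_intros)
qed

lemma compact_op_dg:
  assumes "compact_op K" shows "compact_op (dg K)"
  unfolding compact_op_def
proof (intro allI impI)
  fix s :: "nat \<Rightarrow> 'a \<times> 'a" assume s: "\<forall>n. norm (s n) \<le> 1"
  have n: "norm (fst (s n)) \<le> 1" "norm (snd (s n)) \<le> 1" for n
    using s order_trans[OF norm_fst_le[of "fst (s n)" "snd (s n)"]] order_trans[OF norm_snd_le[of "snd (s n)" "fst (s n)"]] by auto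
  obtain l r where l: "strict_mono r" "(\<lambda>n. K (fst (s (r n)))) \<longlonglongrightarrow> l" by (rule compact_op_bounded[OF assms n(1)])
  obtain l' r' where l': "strict_mono r'" "(\<lambda>n. K (snd (s (r (r' n))))) \<longlonglongrightarrow> l'"
    by (rule compact_op_bounded[OF assms n(2)[of "r _"]])
  have "(\<lambda>n. K (fst (s (r (r' n))))) \<longlonglongrightarrow> l" using LIMSEQ_subseq_LIMSEQ[OF l(2) l'(1)] by (simp add: o_def)
  hence "(\<lambda>n. dg K (s (r (r' n)))) \<longlonglongrightarrow> (l, l')"
    using l'(2) by (auto simp: dg_apply map_prod_def split_beta intro!: tendsto_Pair)
  thus "\<exists>l r. strict_mono r \<and> (\<lambda>n. dg K (s (r n))) \<longlonglongrightarrow> l"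
    using strict_mono_o[OF l(1) l'(1)] by (auto simp: o_def intro!: exI[of _ "(l, l')"] exI[of _ "\<lambda>n. r (r' n)"])
qed

text \<open>Riesz's lemma with the constant 1/2: \<open>m\<close> nearly realises the distance of
  \<open>x\<close> from \<open>M\<close>. The formula for \<open>y\<close> is kept in the conclusion
  so that an operator can be evaluated on it.\<close>

lemma riesz_almost_orthogonal:
  fixes M N :: "'a::real_normed_vector set"
  assumes M: "closed M" "subspace M" and N: "subspace N" "M \<subseteq> N" and x: "x \<in> N" "x \<notin> M"
  obtains m y where "m \<in> M" "0 < norm (x - m)" "y = (x - m) /\<^sub>R norm (x - m)" "y \<in> N" "norm y = 1"
    "\<And>n. n \<in> M \<Longrightarrow> 1 \<le> 2 * norm (y - n)"
proof -
  have ne: "M \<noteq> {}" using M(2) subspace_0 by blast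
  have "0 < infdist x M" using in_closed_iff_infdist_zero[OF M(1) ne, of x] x(2) infdist_nonneg[of x M] by auto
  hence "Inf (dist x ` M) < 2 * infdist x M" using infdist_notempty[OF ne, of x] by simp
  then obtain m where m: "m \<in> M" "dist x m < 2 * infdist x M" using ne cInf_lessD[of "dist x ` M"] by auto
  have p: "0 < norm (x - m)" using m(1) x(2) by auto
  define y where "y = (x - m) /\<^sub>R norm (x - m)"
  have "y \<in> N" unfolding y_def using x(1) m(1) N by (auto intro!: subspace_scale subspace_diff)
  moreover have "norm y = 1" using p by (simp add: y_def)
  moreover have "1 \<le> 2 * norm (y - n)" if "n \<in> M" for n
  proof -
    have e: "y - n = (x - (m + norm (x - m) *\<^sub>R n)) /\<^sub>R norm (x - m)" using p by (simp add: y_def algebra_simps)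
    have "m + norm (x - m) *\<^sub>R n \<in> M" using m(1) that M(2) by (intro subspace_add subspace_scale)
    from infdist_le[OF this, of x] show ?thesis using m(2) p unfolding e by (simp add: divide_simps dist_norm)
  qed
  ultimately show ?thesis using that m(1) p y_def by blast
qed

locale compact_perturbation =
  fixes K T :: "'a::banach \<Rightarrow>\<^sub>L 'a"
  assumes K: "compact_op K" and T: "\<And>x. T x = x - K x"
begin

lemma subspace_ker: "subspace {x. T x = 0}" "closed {x. T x = 0}"
proof -
  show "subspace {x. T x = 0}" by (auto simp: subspace_def blinfun.add_right blinfun.scaleR_right)
  show "closed {x. T x = 0}" by (intro closed_Collect_eq continuous_intros)
qed

text \<open>Since y = T y + K y, convergence of T y along a bounded sequence and compactness of
  \<open>K\<close> make a subsequence converge.\<close>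

lemma almost_kernel:
  assumes y: "\<And>k::nat. norm (y k) \<le> b" and T0: "(\<lambda>k. T (y k)) \<longlonglongrightarrow> t"
  obtains l r where "strict_mono r" "(\<lambda>k. y (r k)) \<longlonglongrightarrow> l" "T l = t"
proof -
  obtain l r where r: "strict_mono r" "(\<lambda>n. K (y (r n))) \<longlonglongrightarrow> l" by (rule compact_op_bounded[OF K y])
  have Tr: "(\<lambda>n. T (y (r n))) \<longlonglongrightarrow> t" using LIMSEQ_subseq_LIMSEQ[OF T0 r(1)] by (simp add: o_def)
  have "(\<lambda>n. T (y (r n)) + K (y (r n))) \<longlonglongrightarrow> t + l" by (rule tendsto_add[OF Tr r(2)])
  hence yl: "(\<lambda>n. y (r n)) \<longlonglongrightarrow> t + l" by (simp add: T)
  have "(\<lambda>n. T (y (r n))) \<longlonglongrightarrow> T (t + l)" by (intro tendsto_intros yl)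
  hence "T (t + l) = t" using Tr LIMSEQ_unique by blast
  with r(1) yl show ?thesis by (rule that)
qed

text \<open>Otherwise there are unit vectors in \<open>M\<close> at distance at least 1/2 from the
  kernel in \<open>M\<close>, with images tending to 0; by \<open>almost_kernel\<close> a
  subsequence converges to an element of that kernel.\<close>

lemma kernel_bound:
  assumes M: "closed M" "subspace M"
  obtains c where "0 \<le> c" "\<And>x. x \<in> M \<Longrightarrow> \<exists>n\<in>M. T n = 0 \<and> norm (x - n) \<le> c * norm (T x)"
proof (rule ccontr)
  note t = that
  assume False: "\<not> thesis"
  define Z where "Z = M \<inter> {x. T x = 0}"
  have Z: "closed Z" "subspace Z" unfolding Z_def using M subspace_ker by (auto intro: subspace_inter)
  have "\<exists>y\<in>M. norm y = 1 \<and> norm (T y) \<le> inverse (real (Suc k)) \<and> (\<forall>n\<in>Z. 1 \<le> 2 * norm (y - n))" for k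
  proof -
    obtain x where x: "x \<in> M" "\<And>n. n \<in> Z \<Longrightarrow> real (Suc k) * norm (T x) < norm (x - n)"
      using t[of "real (Suc k)"] False by (force simp: Z_def not_le)
    hence xZ: "x \<notin> Z" by (metis Z_def IntE diff_self mem_Collect_eq mult_zero_right norm_zero order_less_irrefl)
    have ZM: "Z \<subseteq> M" by (simp add: Z_def)
    obtain m y where m: "m \<in> Z" "0 < norm (x - m)" "y = (x - m) /\<^sub>R norm (x - m)"
      and y: "y \<in> M" "norm y = 1" "\<And>n. n \<in> Z \<Longrightarrow> 1 \<le> 2 * norm (y - n)"
      by (rule riesz_almost_orthogonal[OF Z M(2) ZM x(1) xZ]) (rule that)
    have "T y = T x /\<^sub>R norm (x - m)" using m(1,3) by (simp add: Z_def blinfun.scaleR_right blinfun.diff_right)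
    hence "norm (T y) \<le> inverse (real (Suc k))" using x(2)[OF m(1)] m(2) by (simp add: divide_simps mult.commute)
    with y show ?thesis by blast
  qed
  then obtain y where y: "\<And>k. y k \<in> M" "\<And>k. norm (y k) = 1" "\<And>k. norm (T (y k)) \<le> inverse (real (Suc k))"
    "\<And>k n. n \<in> Z \<Longrightarrow> 1 \<le> 2 * norm (y k - n)" by metis
  have "(\<lambda>k. T (y k)) \<longlonglongrightarrow> 0"
    by (rule Lim_null_comparison[OF always_eventually LIMSEQ_inverse_real_of_nat]) (use y(3) in simp)
  then obtain l r where l: "strict_mono r" "(\<lambda>k. y (r k)) \<longlonglongrightarrow> l" "T l = 0"
    by (rule almost_kernel[of y 1, rotated]) (use y(2) in auto)
  have "l \<in> M" by (rule closed_sequentially[OF M(1) _ l(2)]) (rule y(1))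
  hence "l \<in> Z" using l(3) by (simp add: Z_def)
  have lim: "(\<lambda>k. 2 * norm (y (r k) - l)) \<longlonglongrightarrow> 2 * norm (l - l)" by (intro tendsto_intros l)
  have "1 \<le> 2 * norm (l - l)" by (rule LIMSEQ_le_const[OF lim]) (use y(4) \<open>l \<in> Z\<close> in blast)
  thus False by simp
qed

text \<open>By \<open>kernel_bound\<close> a convergent sequence of images has bounded preimages, to
  which \<open>almost_kernel\<close> applies.\<close>

lemma closed_image:
  assumes M: "closed M" "subspace M"
  shows "closed (T ` M)"
  unfolding closed_sequential_limits
proof (intro allI impI)
  fix z t assume z: "(\<forall>n. z n \<in> T ` M) \<and> z \<longlonglongrightarrow> t"
  obtain c where c: "0 \<le> c" "\<And>x. x \<in> M \<Longrightarrow> \<exists>n\<in>M. T n = 0 \<and> norm (x - n) \<le> c * norm (T x)" by (rule kernel_bound[OF M]) (rule that)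
  obtain b where b: "\<And>n. norm (z n) \<le> b" using convergent_imp_Bseq[OF convergentI] z by (metis BseqE)
  have "\<exists>y\<in>M. T y = z n \<and> norm y \<le> c * b" for n
  proof -
    obtain x where x: "x \<in> M" "T x = z n" using z by (metis imageE)
    then obtain m where "m \<in> M" "T m = 0" "norm (x - m) \<le> c * norm (z n)" using c(2)[of x] by auto
    moreover have "c * norm (z n) \<le> c * b" using b c by (intro mult_left_mono)
    ultimately show ?thesis using x M(2) by (intro bexI[of _ "x - m"]) (auto simp: blinfun.diff_right subspace_diff)
  qed
  then obtain y where y: "\<And>n. y n \<in> M" "\<And>n. T (y n) = z n" "\<And>n. norm (y n) \<le> c * b" by metis
  have "(\<lambda>n. T (y n)) \<longlonglongrightarrow> t" using z by (simp add: y(2))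
  then obtain l r where l: "strict_mono r" "(\<lambda>k. y (r k)) \<longlonglongrightarrow> l" "T l = t" by (rule almost_kernel[OF y(3)])
  thus "t \<in> T ` M" using closed_sequentially[OF M(1) _ l(2)] y(1) by auto
qed

text \<open>The decreasing ranges of the powers of \<open>T\<close> become stationary by
  compactness. As the kernel meets the range only in 0, stationarity descends to the range of T^2
  being that of T, so T x = T (T y) for some y.\<close>

lemma kernel_plus_range:
  assumes inj: "\<And>x. T (T x) = 0 \<Longrightarrow> T x = 0"
  obtains y where "T (x - T y) = 0"
proof -
  define R where "R n = ((`) T ^^ n) UNIV" for n
  have RS: "R (Suc n) = T ` R n" "R 0 = UNIV" for n by (auto simp: R_def)
  have cl: "closed (R n) \<and> subspace (R n)" for n
  proof (induction n)
    case (Suc n)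
    thus ?case using closed_image[of "R n"] by (auto simp: RS intro!: linear_subspace_image bounded_linear.linear blinfun.bounded_linear_right)
  qed (auto simp: RS)
  have dec1: "R (Suc n) \<subseteq> R n" for n by (induction n) (auto simp: RS)
  have dec: "n \<le> m \<Longrightarrow> R m \<subseteq> R n" for n m by (rule lift_Suc_antimono_le[of R, OF dec1])
  have "\<exists>n. R (Suc n) = R n"
  proof (rule ccontr)
    assume neq: "\<not> ?thesis"
    have "\<exists>x\<in>R n. norm x = 1 \<and> (\<forall>m\<in>R (Suc n). 1 \<le> 2 * norm (x - m))" for n
    proof -
      obtain x where x: "x \<in> R n" "x \<notin> R (Suc n)" using neq dec1[of n] by blast
      have c: "closed (R (Suc n))" "subspace (R (Suc n))" "subspace (R n)" using cl by auto
      obtain y where "y \<in> R n" "norm y = 1" "\<And>m. m \<in> R (Suc n) \<Longrightarrow> 1 \<le> 2 * norm (y - m)"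
        by (rule riesz_almost_orthogonal[OF c dec1 x]) (rule that)
      thus ?thesis by blast
    qed
    then obtain x where x: "\<And>n. x n \<in> R n" "\<And>n. norm (x n) = 1" "\<And>n m. m \<in> R (Suc n) \<Longrightarrow> 1 \<le> 2 * norm (x n - m)" by metis
    obtain l r where r: "strict_mono r" "(\<lambda>n. K (x (r n))) \<longlonglongrightarrow> l" by (rule compact_op_bounded[OF K, of x 1]) (simp add: x(2))
    \<comment> \<open>K x_n - K x_m equals x_n minus an element of the next range, so Riesz's choice
      of x_n keeps the images apart.\<close>
    have sep: "1 \<le> 2 * norm (K (x n) - K (x m))" if "n < m" for n m
    proof -
      have "x m \<in> R (Suc n)" "T (x m) \<in> R (Suc n)" "T (x n) \<in> R (Suc n)"
        using x(1)[of m] x(1)[of n] dec[of "Suc n" m] dec[of n m] that by (auto simp: RS)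
      hence "T (x n) + (x m - T (x m)) \<in> R (Suc n)" using cl[of "Suc n"] by (intro subspace_add subspace_diff) auto
      from x(3)[OF this] show ?thesis by (simp add: T algebra_simps)
    qed
    have "Cauchy (\<lambda>n. K (x (r n)))" using r(2) by (rule LIMSEQ_imp_Cauchy)
    then obtain n0 where "\<And>m n. m \<ge> n0 \<Longrightarrow> n \<ge> n0 \<Longrightarrow> dist (K (x (r m))) (K (x (r n))) < 1 / 2"
      using half_gt_zero[OF zero_less_one] unfolding Cauchy_def by metis
    hence "dist (K (x (r n0))) (K (x (r (Suc n0)))) < 1 / 2" by simp
    thus False using sep[of "r n0" "r (Suc n0)"] strict_monoD[OF r(1), of n0 "Suc n0"] by (simp add: dist_norm)
  qed
  then obtain n where n: "R (Suc n) = R n" ..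
  \<comment> \<open>Descent: equality one level up yields u - s in the kernel for u in R n, and for
    n \<ge> 1 this difference also lies in the range, so it is 0. The descent stops at level
    1.\<close>
  have "R 2 = R 1" using n
  proof (induction n)
    case 0 thus ?case by (simp add: RS numeral_2_eq_2)
  next
    case (Suc n)
    show ?case
    proof (cases n)
      case 0 thus ?thesis using Suc.prems by (simp add: numeral_2_eq_2)
    next
      case (Suc n')
      have "R n \<subseteq> R (Suc n)"
      proof
        fix u assume u: "u \<in> R n"
        hence "T u \<in> R (Suc (Suc n))" using \<open>R (Suc (Suc n)) = R (Suc n)\<close> by (auto simp: RS)
        then obtain s where s: "s \<in> R (Suc n)" "T u = T s" unfolding RS(1)[of "Suc n"] by auto
        have "u - s \<in> R 1" using dec[of 1 n] dec[of 1 "Suc n"] u s cl[of 1] Suc by (intro subspace_diff) auto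
        then obtain w where w: "u - s = T w" by (auto simp: RS)
        have "T (u - s) = 0" using s(2) by (simp add: blinfun.diff_right)
        hence "u - s = 0" unfolding w by (rule inj)
        thus "u \<in> R (Suc n)" using s by simp
      qed
      thus ?thesis using Suc.IH dec1[of n] by blast
    qed
  qed
  hence "T x \<in> R 2" by (simp add: RS)
  then obtain y where "T x = T (T y)" by (auto simp: RS numeral_2_eq_2)
  thus ?thesis using that[of y] by (simp add: blinfun.diff_right)
qed

text \<open>Kernel and range are complementary by \<open>kernel_plus_range\<close>. If the
  projection were unbounded, there would be unit vectors of the kernel approximated by elements of
  the closed range, and their limit would be a nonzero element of both.\<close>

lemma kernel_projection:
  assumes inj: "\<And>x. T (T x) = 0 \<Longrightarrow> T x = 0"
  obtains Q :: "'a \<Rightarrow>\<^sub>L 'a" where "\<And>x. T (Q x) = 0" "\<And>x. x - Q x \<in> range T" "\<And>x. T x = 0 \<Longrightarrow> Q x = x" "\<And>x. Q (T x) = 0"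
proof -
  have ex: "\<exists>q. T q = 0 \<and> x - q \<in> range T" for x
  proof -
    obtain y where "T (x - T y) = 0" by (rule kernel_plus_range[OF inj])
    thus ?thesis by (intro exI[of _ "x - T y"]) auto
  qed
  define q where "q x = (SOME q. T q = 0 \<and> x - q \<in> range T)" for x
  have q: "T (q x) = 0" "x - q x \<in> range T" for x using someI_ex[OF ex[of x]] by (auto simp: q_def)
  have sr: "subspace (range T)" by (intro linear_subspace_image subspace_UNIV bounded_linear.linear blinfun.bounded_linear_right)
  have uniq: "q x = p" if "T p = 0" "x - p \<in> range T" for x p
  proof -
    have "(x - p) - (x - q x) \<in> range T" using subspace_diff[OF sr that(2) q(2)] .
    then obtain w where w: "q x - p = T w" by auto
    have "T (q x - p) = 0" using q(1) that(1) by (simp add: blinfun.diff_right)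
    hence "q x - p = 0" unfolding w by (rule inj)
    thus ?thesis by simp
  qed
  have "\<exists>c. \<forall>x. norm (q x) \<le> c * norm x"
  proof (rule ccontr)
    assume "\<not> ?thesis"
    hence "\<forall>k. \<exists>x. real (Suc k) * norm x < norm (q x)" by (metis not_le)
    then obtain x where x: "\<And>k. real (Suc k) * norm (x k) < norm (q (x k))" by metis
    have p: "0 < norm (q (x k))" for k by (rule le_less_trans[OF _ x]) simp
    define y where "y k = q (x k) /\<^sub>R norm (q (x k))" for k
    have ny: "norm (y k) = 1" for k using p[of k] by (simp add: y_def)
    have "(\<lambda>k. T (y k)) \<longlonglongrightarrow> 0" by (simp add: y_def blinfun.scaleR_right q)
    then obtain l r where l: "strict_mono r" "(\<lambda>k. y (r k)) \<longlonglongrightarrow> l" "T l = 0"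
      by (rule almost_kernel[of y 1, rotated]) (simp_all add: ny)
    have "(\<lambda>k. x k /\<^sub>R norm (q (x k))) \<longlonglongrightarrow> 0"
    proof (rule Lim_null_comparison[OF always_eventually LIMSEQ_inverse_real_of_nat], rule)
      show "norm (x k /\<^sub>R norm (q (x k))) \<le> inverse (real (Suc k))" for k
        using x[of k] p[of k] by (simp add: divide_simps mult.commute)
    qed
    from LIMSEQ_subseq_LIMSEQ[OF this l(1)] have x0: "(\<lambda>k. x (r k) /\<^sub>R norm (q (x (r k)))) \<longlonglongrightarrow> 0" by (simp add: o_def)
    have lr: "(\<lambda>k. y (r k) - x (r k) /\<^sub>R norm (q (x (r k)))) \<longlonglongrightarrow> l - 0" by (rule tendsto_diff[OF l(2) x0])
    have "y k - x k /\<^sub>R norm (q (x k)) \<in> range T" for k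
    proof -
      have "y k - x k /\<^sub>R norm (q (x k)) = (- inverse (norm (q (x k)))) *\<^sub>R (x k - q (x k))" by (simp add: y_def algebra_simps)
      thus ?thesis by (simp only: subspace_scale[OF sr q(2)])
    qed
    hence "l - 0 \<in> range T" by (intro closed_sequentially[OF closed_image[OF closed_UNIV subspace_UNIV] _ lr])
    then obtain w where "l = T w" by auto
    hence "l = 0" using inj[of w] l(3) by simp
    moreover have "(\<lambda>k. norm (y (r k))) \<longlonglongrightarrow> norm l" by (intro tendsto_intros l)
    ultimately show False by (simp add: ny LIMSEQ_const_iff)
  qed
  then obtain c where c: "norm (q x) \<le> c * norm x" for x by blast
  have bl: "bounded_linear q"
  proof (rule bounded_linear_intro[where K = c])
    show "q (x + y) = q x + q y" for x y
      by (rule uniq) (use subspace_add[OF sr q(2)[of x] q(2)[of y]] in \<open>auto simp: blinfun.add_right q algebra_simps\<close>)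
    show "q (a *\<^sub>R x) = a *\<^sub>R q x" for a x
      by (rule uniq) (use subspace_scale[OF sr q(2)[of x], of a] in \<open>auto simp: blinfun.scaleR_right q algebra_simps\<close>)
    show "norm (q x) \<le> norm x * c" for x using c by (simp add: mult.commute)
  qed
  show ?thesis
  proof (rule that[of "Blinfun q"]; simp add: bounded_linear_Blinfun_apply[OF bl])
    show "q x = x" if "T x = 0" for x by (rule uniq[OF that]) (use subspace_0[OF sr] in simp)
    show "q (T x) = 0" for x by (rule uniq) auto
  qed (use q in auto)
qed

text \<open>The Fredholm alternative: with trivial kernel, \<open>kernel_plus_range\<close> says
  that every x is some T y, and \<open>kernel_bound\<close> gives the estimate.\<close>

lemma inverse_of_injective:
  assumes inj: "\<And>x. T x = 0 \<Longrightarrow> x = 0"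
  obtains c where "bij T" "\<And>x. norm x \<le> c * norm (T x)"
proof -
  obtain c where c: "\<And>x. \<exists>n. T n = 0 \<and> norm (x - n) \<le> c * norm (T x)"
    using kernel_bound[OF closed_UNIV subspace_UNIV] by (metis UNIV_I)
  have b: "norm x \<le> c * norm (T x)" for x using c[of x] inj by force
  have "inj T" by (rule injI) (metis inj blinfun.diff_right right_minus_eq)
  moreover have "surj T" unfolding surj_def
  proof
    show "\<exists>y. x = T y" for x
    proof -
      obtain y where "T (x - T y) = 0" by (rule kernel_plus_range) (rule inj)
      thus ?thesis using inj[of "x - T y"] by (auto intro!: exI[of _ y])
    qed
  qed
  ultimately show ?thesis using that b by (auto simp: bij_def)
qed

end

subsection \<open>Stability and instability of the transformed equation\<close>

text \<open>The least admissible E is attained on the compact interval, and the hypothesis at that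
  point gives E \<le> a + E/2. This takes the place of a Gronwall inequality; the bound does not
  depend on T.\<close>

lemma weighted_absorb:
  fixes \<phi> :: "real \<Rightarrow> real"
  assumes c: "continuous_on {0..T} \<phi>" and nonneg: "\<And>t. 0 \<le> \<phi> t"
    and step: "\<And>E t. t \<in> {0..T} \<Longrightarrow> 0 \<le> E \<Longrightarrow> (\<And>s. s \<in> {0..T} \<Longrightarrow> \<phi> s \<le> E * exp (\<nu> * s)) \<Longrightarrow> \<phi> t \<le> (a + E / 2) * exp (\<nu> * t)"
    and t: "t \<in> {0..T}"
  shows "\<phi> t \<le> 2 * a * exp (\<nu> * t)"
proof -
  have "continuous_on {0..T} (\<lambda>s. \<phi> s * exp (- \<nu> * s))" by (intro continuous_intros c)
  hence "\<exists>m\<in>{0..T}. \<forall>s\<in>{0..T}. \<phi> s * exp (- \<nu> * s) \<le> \<phi> m * exp (- \<nu> * m)"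
    using t by (intro continuous_attains_sup) auto
  then obtain m where m: "m \<in> {0..T}" "\<And>s. s \<in> {0..T} \<Longrightarrow> \<phi> s * exp (- \<nu> * s) \<le> \<phi> m * exp (- \<nu> * m)" by blast
  define E where "E = \<phi> m * exp (- \<nu> * m)"
  have E: "\<phi> s \<le> E * exp (\<nu> * s)" if "s \<in> {0..T}" for s
    using m(2)[OF that] by (simp add: E_def exp_minus divide_simps)
  have "\<phi> m \<le> (a + E / 2) * exp (\<nu> * m)" by (rule step[OF m(1)]) (use E nonneg in \<open>auto simp: E_def\<close>)
  hence "E \<le> a + E / 2" by (simp add: E_def exp_minus divide_simps)
  hence "E \<le> 2 * a" by simp
  thus ?thesis using E[OF t] by (meson exp_ge_zero mult_right_mono order_trans)
qed

text \<open>If the threshold were reached, there would be a first such time, and up to it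
  \<open>step\<close> applies and gives strict inequality.\<close>

lemma bootstrap:
  fixes \<phi> :: "real \<Rightarrow> real"
  assumes c: "continuous_on {0..T} \<phi>" and 0: "\<phi> 0 < k"
    and step: "\<And>t. t \<in> {0..T} \<Longrightarrow> (\<And>s. s \<in> {0..t} \<Longrightarrow> \<phi> s \<le> k) \<Longrightarrow> \<phi> t < k" and t: "t \<in> {0..T}"
  shows "\<phi> t < k"
proof (rule ccontr)
  have hit: "\<exists>x\<in>{0..s}. \<phi> x = k" if "s \<in> {0..T}" "\<not> \<phi> s < k" for s
    using IVT'[of \<phi> 0 k s] continuous_on_subset[OF c, of "{0..s}"] that 0 by force
  define S where "S = {s \<in> {0..T}. \<phi> s = k}"
  assume "\<not> \<phi> t < k"
  from hit[OF t this] obtain x where "x \<in> {0..t}" "\<phi> x = k" ..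
  hence "x \<in> S" using t by (simp add: S_def)
  hence "S \<noteq> {}" by blast
  moreover have "compact S" unfolding S_def compact_eq_bounded_closed
    by (intro conjI bounded_subset[OF bounded_closed_interval[of 0 T]] continuous_closed_preimage_constant c) auto
  ultimately have "\<exists>m\<in>S. \<forall>s\<in>S. m \<le> s" by (intro compact_attains_inf)
  then obtain m where m: "m \<in> S" "\<And>s. s \<in> S \<Longrightarrow> m \<le> s" by blast
  have "\<phi> s \<le> k" if "s \<in> {0..m}" for s
  proof (rule ccontr)
    assume "\<not> \<phi> s \<le> k"
    moreover have sT: "s \<in> {0..T}" using that m(1) by (simp add: S_def)
    ultimately obtain x where x: "x \<in> {0..s}" "\<phi> x = k" using hit[OF sT] by auto
    hence "x \<in> S" using sT by (simp add: S_def)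
    hence "s = m" using m(2) x(1) that by fastforce
    thus False using m(1) \<open>\<not> \<phi> s \<le> k\<close> by (simp add: S_def)
  qed
  thus False using step[of m] m(1) by (auto simp: S_def)
qed

text \<open>The radial retraction onto the ball of radius \<rho>; in every normed space it is
  Lipschitz with constant 2.\<close>

definition ret :: "real \<Rightarrow> 'a::real_normed_vector \<Rightarrow> 'a" where
  "ret \<rho> v = (if norm v \<le> \<rho> then v else (\<rho> / norm v) *\<^sub>R v)"

lemma ret:
  assumes "0 < \<rho>"
  shows "norm (ret \<rho> v) \<le> \<rho>" "norm v \<le> \<rho> \<Longrightarrow> ret \<rho> v = v" "norm (ret \<rho> v - ret \<rho> w) \<le> 2 * norm (v - w)"
proof -
  show "norm (ret \<rho> v) \<le> \<rho>" "norm v \<le> \<rho> \<Longrightarrow> ret \<rho> v = v" using assms by (auto simp: ret_def)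
  have *: "norm (ret \<rho> v - ret \<rho> w) \<le> 2 * norm (v - w)" if "norm v \<le> norm w" for v w :: 'a
  proof (cases "norm w \<le> \<rho>")
    case False
    \<comment> \<open>With this s the retraction of v is (\<rho> / s) v on both sides of the sphere,
      so one computation covers both.\<close>
    define s where "s = max \<rho> (norm v)"
    have s: "0 < s" "\<rho> \<le> s" "norm v \<le> s" "s \<le> norm w" using False assms that by (auto simp: s_def)
    have v: "ret \<rho> v = (\<rho> / s) *\<^sub>R v" using assms by (cases "norm v \<le> \<rho>") (auto simp: ret_def s_def max_absorb1 max_absorb2)
    have "ret \<rho> v - ret \<rho> w = (\<rho> / s) *\<^sub>R (v - w) + (\<rho> / s - \<rho> / norm w) *\<^sub>R w"
      unfolding v using False by (simp add: ret_def algebra_simps)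
    hence "norm (ret \<rho> v - ret \<rho> w) \<le> norm ((\<rho> / s) *\<^sub>R (v - w)) + norm ((\<rho> / s - \<rho> / norm w) *\<^sub>R w)"
      by (metis norm_triangle_ineq)
    also have "norm ((\<rho> / s) *\<^sub>R (v - w)) \<le> 1 * norm (v - w)"
      unfolding norm_scaleR using s assms by (intro mult_right_mono) auto
    also have "norm ((\<rho> / s - \<rho> / norm w) *\<^sub>R w) = (\<rho> / s) * (norm w - s)"
    proof -
      have "\<rho> / norm w \<le> \<rho> / s"
        using s assms by (intro divide_left_mono mult_pos_pos less_le_trans[OF s(1) s(4)]) auto
      thus ?thesis using s less_le_trans[OF s(1) s(4)] by (simp add: field_simps)
    qed
    also have "\<dots> \<le> 1 * norm (v - w)"
    proof (rule mult_mono)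
      have "norm w - norm v \<le> norm (v - w)" by (metis norm_minus_commute norm_triangle_ineq2)
      thus "norm w - s \<le> norm (v - w)" by (simp add: s_def)
    qed (use s assms in auto)
    finally show ?thesis by simp
  qed (use that in \<open>simp add: ret_def\<close>)
  show "norm (ret \<rho> v - ret \<rho> w) \<le> 2 * norm (v - w)"
    using *[of v w] *[of w v] by (cases "norm v \<le> norm w") (auto simp: norm_minus_commute)
qed

text \<open>The equation \<open>u' + L u + N(u) = 0\<close> in the coordinate \<open>u = J v\<close>, where \<open>J = A\<^sup>-\<^sup>\<alpha>\<close> and
  \<open>n v = N (J v)\<close>; \<open>J o Z\<close> is the projection onto the null space of \<open>L\<close> along its range.\<close>

locale evolution =
  fixes D :: "'x::banach set" and L n :: "'x \<Rightarrow> 'x" and J Z :: "'x \<Rightarrow>\<^sub>L 'x" and \<alpha> \<rho> lc K p :: real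
  assumes lin: "linear_op D L" and dense: "closure D = UNIV" and al: "0 \<le> \<alpha>" "\<alpha> < 1"
    and injJ: "inj J" and JD: "\<And>u. u \<in> D \<Longrightarrow> J u \<in> D" and ares: "ares D L J \<alpha>"
    and Z: "\<And>x. J (Z x) \<in> D" "\<And>x. L (J (Z x)) = 0" "\<And>u. u \<in> D \<Longrightarrow> L u = 0 \<Longrightarrow> J (Z u) = u"
      "\<And>u. u \<in> D \<Longrightarrow> Z (L u) = 0"
    and pos: "0 < \<rho>" "0 < K" "1 < p" "0 < lc"
    and n_lip: "\<And>v w. norm v \<le> \<rho> \<Longrightarrow> norm w \<le> \<rho> \<Longrightarrow> norm (n v - n w) \<le> lc * norm (v - w)"
    and n_bd: "\<And>v. norm v \<le> \<rho> \<Longrightarrow> norm (n v) \<le> K * norm v powr (p - 1) * norm (v - Z (J v))"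
begin

lemma n0 [simp]: "n 0 = 0"
  using n_bd[of 0] pos by simp

text \<open>\<open>G\<close> is bounded on X, so \<open>ares_perturb\<close> applies and the
  position of the spectrum is the one condition left to check.\<close>

lemma semigroup:
  assumes "\<And>z. z \<in> spectrum UNIV D (\<lambda>u. L u + blinfun_apply G u) \<Longrightarrow> 0 < Re z"
  obtains Li S Y S' Y' \<omega> C where "analytic_semigroup D (\<lambda>u. L u + blinfun_apply G u) J Li S Y S' Y' \<alpha> \<omega> C"
proof (rule semigroup_exists[OF _ dense al injJ JD _ assms])
  have D: "subspace D" using lin by (simp add: linear_op_def)
  show "linear_op D (\<lambda>u. L u + blinfun_apply G u)"
    using D linear_opD[OF lin] unfolding linear_op_def by (simp add: blinfun.add_right blinfun.scaleR_right scaleR_add_right)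
  show "ares D (\<lambda>u. L u + blinfun_apply G u) J \<alpha>"
  proof (rule ares_perturb[OF lin ares al])
    show "linear_op D G" using D unfolding linear_op_def by (simp add: blinfun.add_right blinfun.scaleR_right)
    show "norm (G (J v)) \<le> norm (G o\<^sub>L J) * norm v" for v using norm_blinfun[of "G o\<^sub>L J" v] by simp
  qed simp
qed (erule that | assumption)+

text \<open>The equation is demanded only while the solution is in the ball, so that solutions of
  the original and of the cut-off equation are both covered.\<close>

definition sol_on :: "real \<Rightarrow> (real \<Rightarrow> 'x) \<Rightarrow> bool" where
  "sol_on T v \<longleftrightarrow> continuous_on {0..T} v \<and> (\<forall>t. 0 < t \<and> t < T \<and> norm (v t) \<le> \<rho> \<longrightarrow>
     J (v t) \<in> D \<and> ((\<lambda>s. J (v s)) has_vector_derivative - (L (J (v t)) + n (v t))) (at t))"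

lemma sol_onD:
  assumes "sol_on T v" "0 < t" "t < T" "norm (v t) \<le> \<rho>"
  shows "J (v t) \<in> D" "((\<lambda>s. J (v s)) has_vector_derivative - (L (J (v t)) + n (v t))) (at t)"
  using assms by (auto simp: sol_on_def)

lemma sol_on_mono: "sol_on T v \<Longrightarrow> T' \<le> T \<Longrightarrow> sol_on T' v"
  unfolding sol_on_def by (auto intro: continuous_on_subset)

lemma sol_on_continuous: "sol_on T v \<Longrightarrow> continuous_on {0..T} v"
  by (simp add: sol_on_def)

lemma n_continuous:
  assumes "continuous_on S v" "\<And>s. s \<in> S \<Longrightarrow> norm (v s) \<le> \<rho>"
  shows "continuous_on S (\<lambda>s. n (v s))"
proof -
  have "continuous_on (cball 0 \<rho>) n"
  proof (rule lipschitz_on_continuous_on[of lc], rule lipschitz_onI)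
    show "dist (n x) (n y) \<le> lc * dist x y" if "x \<in> cball 0 \<rho>" "y \<in> cball 0 \<rho>" for x y
      using n_lip that by (simp add: dist_norm)
  qed (use pos in simp)
  thus ?thesis by (rule continuous_on_compose2[OF _ assms(1)]) (use assms(2) in auto)
qed

end

text \<open>The equation is read as u' + (L + G) u = G u - N(u), where L + G has its spectrum in the
  right half-plane. \<open>G\<close> is the projection onto N[L] in the stable case and a multiple
  of the identity in the unstable case.\<close>

locale evolution_sg = evolution D L n J Z \<alpha> \<rho> lc K p +
  sg: analytic_semigroup D "\<lambda>u. L u + blinfun_apply G u" J Li S Y S' Y' \<alpha> \<omega> C
  for D :: "'x::banach set" and L n J Z \<alpha> \<rho> lc K p G Li S Y S' Y' \<omega> C
begin

text \<open>The retraction is applied to the whole right-hand side G J v - n v, which becomes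
  bounded and Lipschitz as \<open>mild_exists\<close> requires. Moving G back to the left gives
  \<open>g\<close>, which is - n on the ball.\<close>

lemma cutoff_solution:
  obtains v g where "continuous_on {0..} v" "v 0 = v0" "\<And>t. 0 < t \<Longrightarrow> J (v t) \<in> D" "continuous_on UNIV g"
    "\<And>v. norm v \<le> \<rho> \<Longrightarrow> g v = - n v" "continuous_on {0<..} (\<lambda>t. L (J (v t)))"
    "\<And>t. 0 < t \<Longrightarrow> ((\<lambda>s. J (v s)) has_vector_derivative (g (v t) - L (J (v t)))) (at t)"
proof -
  define f where "f v = G (J (ret \<rho> v)) - n (ret \<rho> v)" for v
  define l where "l = norm (G o\<^sub>L J) * 2 + lc * 2"
  have lip: "norm (f v - f w) \<le> l * norm (v - w)" for v w
  proof -
    have "norm (f v - f w) \<le> norm ((G o\<^sub>L J) (ret \<rho> v - ret \<rho> w)) + norm (n (ret \<rho> v) - n (ret \<rho> w))"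
      using norm_triangle_ineq4[of "(G o\<^sub>L J) (ret \<rho> v - ret \<rho> w)" "n (ret \<rho> v) - n (ret \<rho> w)"]
      by (simp add: f_def blinfun.diff_right algebra_simps)
    also have "\<dots> \<le> norm (G o\<^sub>L J) * (2 * norm (v - w)) + lc * (2 * norm (v - w))"
      by (intro add_mono order_trans[OF norm_blinfun mult_left_mono] order_trans[OF n_lip mult_left_mono] ret pos(1)
        norm_ge_zero less_imp_le[OF pos(4)])
    finally show ?thesis by (simp add: l_def algebra_simps)
  qed
  have bdd: "norm (f v) \<le> l * \<rho>" for v
  proof -
    have "norm (f (ret \<rho> v) - f 0) \<le> l * norm (ret \<rho> v - 0)" by (rule lip)
    also have "\<dots> \<le> l * \<rho>" using ret(1)[OF pos(1), of v] pos by (intro mult_left_mono) (auto simp: l_def)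
    finally show ?thesis using ret(1)[OF pos(1), of v] ret(2)[OF pos(1), of "0 :: 'x"] ret(2)[OF pos(1), of "ret \<rho> v"] pos
      by (simp add: f_def)
  qed
  obtain v where v: "continuous_on {0..} v" "v 0 = v0" "\<And>t. 0 < t \<Longrightarrow> v t = Y t (J v0) + sg.V (\<lambda>s. f (v s)) t"
    by (rule sg.mild_exists[OF lip bdd]) (rule that)
  have v3: "v t = Y t (J (v 0)) + sg.V (\<lambda>s. f (v s)) t" if "0 < t" for t using v that by simp
  have r1: "J (v t) \<in> D" and r2: "((\<lambda>t. J (v t)) has_vector_derivative f (v t) - (L (J (v t)) + G (J (v t)))) (at t)"
    if t: "0 < t" for t
    by (rule sg.mild_regular(1)[OF v(1) _ lip t] sg.mild_regular(2)[OF v(1) _ lip t], erule v3)+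
  have r3: "continuous_on {0<..} (\<lambda>t. L (J (v t)) + G (J (v t)))"
    by (rule sg.mild_regular(3)[OF v(1) _ lip]) (rule v3)
  have fc: "continuous_on UNIV f"
  proof (rule lipschitz_on_continuous_on[of l], rule lipschitz_onI)
    show "dist (f x) (f y) \<le> l * dist x y" for x y using lip by (simp add: dist_norm)
  qed (use pos in \<open>simp add: l_def\<close>)
  have gc: "continuous_on UNIV (\<lambda>v. f v - G (J v))" by (intro continuous_intros fc)
  have d: "((\<lambda>s. J (v s)) has_vector_derivative ((f (v t) - G (J (v t))) - L (J (v t)))) (at t)" if "0 < t" for t
    using r2[OF that] by (simp add: algebra_simps)
  have "continuous_on {0<..} (\<lambda>t. (L (J (v t)) + G (J (v t))) - G (J (v t)))"
    by (intro continuous_on_diff r3 blinfun.continuous_on continuous_on_const continuous_on_subset[OF v(1)]) auto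
  hence Lc: "continuous_on {0<..} (\<lambda>t. L (J (v t)))" by simp
  show ?thesis by (rule that[OF v(1,2) r1 gc _ Lc d]) (simp_all add: f_def ret[OF pos(1)])
qed

lemma mild_of_sol:
  assumes s: "sol_on T v" and b: "\<And>s. s \<in> {0..T} \<Longrightarrow> norm (v s) \<le> \<rho>" and t: "0 < t" "t \<le> T"
  shows "v t = Y t (J (v 0)) + sg.V (\<lambda>s. G (J (v s)) - n (v s)) t"
proof (rule sg.mild_of_solution[OF t(1)])
  have v: "continuous_on {0..t} v" using sol_on_continuous[OF s] t by (auto intro: continuous_on_subset)
  show "continuous_on {0..t} v" "continuous_on {0..t} (\<lambda>s. G (J (v s)) - n (v s))"
    using b t by (auto intro!: continuous_intros n_continuous v)
  show "J (v r) \<in> D" if "0 < r" "r < t" for r using sol_onD(1)[OF s, of r] b t that by simp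
  show "((\<lambda>s. J (v s)) has_vector_derivative G (J (v r)) - n (v r) - (L (J (v r)) + G (J (v r)))) (at r)"
    if "0 < r" "r < t" for r using sol_onD(2)[OF s, of r] b t that by (simp add: algebra_simps)
qed

lemma sol_unique:
  assumes s: "sol_on T v" "sol_on T w" and b: "\<And>s. s \<in> {0..T} \<Longrightarrow> norm (v s) \<le> \<rho>" "\<And>s. s \<in> {0..T} \<Longrightarrow> norm (w s) \<le> \<rho>"
    and 0: "v 0 = w 0" and t: "t \<in> {0..T}"
  shows "v t = w t"
proof -
  define l where "l = norm (G o\<^sub>L J) + lc"
  have l: "0 < l" using pos by (simp add: l_def add_nonneg_pos)
  define f where "f v = G (J v) - n v" for v
  have lip: "norm (f x - f y) \<le> l * norm (x - y)" if "norm x \<le> \<rho>" "norm y \<le> \<rho>" for x y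
  proof -
    have "norm (f x - f y) \<le> norm ((G o\<^sub>L J) (x - y)) + norm (n x - n y)"
      using norm_triangle_ineq4[of "(G o\<^sub>L J) (x - y)" "n x - n y"] by (simp add: f_def blinfun.diff_right algebra_simps)
    also have "\<dots> \<le> l * norm (x - y)" using norm_blinfun[of "G o\<^sub>L J" "x - y"] n_lip[OF that] by (simp add: l_def distrib_right)
    finally show ?thesis .
  qed
  note vc = sol_on_continuous[OF s(1)] and wc = sol_on_continuous[OF s(2)]
  define B where "B = 2 * (C * l * sg.kap)"
  have B: "0 < B" using sg.pos l sg.kap_pos by (simp add: B_def)
  \<comment> \<open>The weight e^(\<nu> t) is steep enough for the Duhamel integral of the
    difference to be absorbed: C l kap \<nu>^(\<alpha>-1) = 1/2.\<close>
  define \<nu> where "\<nu> = (1 / B) powr (1 / (\<alpha> - 1))"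
  have \<nu>: "0 < \<nu>" "\<nu> powr (\<alpha> - 1) = 1 / B" using B al by (simp_all add: \<nu>_def powr_powr)
  have "norm (v t - w t) \<le> 2 * 0 * exp (\<nu> * t)"
  proof (rule weighted_absorb[OF _ _ _ t])
    show "continuous_on {0..T} (\<lambda>t. norm (v t - w t))" by (intro continuous_intros vc wc)
    fix E t assume t: "t \<in> {0..T}" and E: "0 \<le> E" "\<And>s. s \<in> {0..T} \<Longrightarrow> norm (v s - w s) \<le> E * exp (\<nu> * s)"
    show "norm (v t - w t) \<le> (0 + E / 2) * exp (\<nu> * t)"
    proof (cases "t = 0")
      case False
      hence t': "0 < t" "t \<le> T" using t by auto
      have c: "continuous_on {0..t} (\<lambda>s. f (v s))" "continuous_on {0..t} (\<lambda>s. f (w s))"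
        unfolding f_def using b t by (auto intro!: continuous_intros n_continuous continuous_on_subset[OF vc] continuous_on_subset[OF wc])
      have "v t - w t = sg.V (\<lambda>s. f (v s)) t - sg.V (\<lambda>s. f (w s)) t"
        using mild_of_sol[OF s(1) b(1) t'] mild_of_sol[OF s(2) b(2) t'] by (simp add: f_def 0)
      also have "\<dots> = sg.V (\<lambda>s. f (v s) - f (w s)) t" by (rule sg.V_minus[OF _ c]) (use t in simp)
      finally have "norm (v t - w t) = norm (sg.V (\<lambda>s. f (v s) - f (w s)) t)" by simp
      also have "\<dots> \<le> C * (l * E) * exp (\<nu> * t) * ((\<nu> + \<omega>) powr (\<alpha> - 1) * sg.kap)"
      proof (rule sg.norm_V_weighted)
        show "continuous_on {0..t} (\<lambda>s. f (v s) - f (w s))" by (intro continuous_intros c)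
        show "norm (f (v s) - f (w s)) \<le> l * E * exp (\<nu> * s)" if "s \<in> {0..t}" for s
        proof -
          have "norm (f (v s) - f (w s)) \<le> l * norm (v s - w s)" by (rule lip) (use b that t in auto)
          also have "\<dots> \<le> l * (E * exp (\<nu> * s))" using E(2)[of s] that t l by (intro mult_left_mono) auto
          finally show ?thesis by (simp add: mult_ac)
        qed
      qed (use t \<nu> sg.pos in auto)
      also have "\<dots> \<le> C * (l * E) * exp (\<nu> * t) * (\<nu> powr (\<alpha> - 1) * sg.kap)"
        using sg.C_nonneg l E(1) sg.kap_pos \<nu>(1) sg.pos al by (intro mult_left_mono mult_right_mono powr_mono2') auto
      also have "\<dots> = (B / 2) * E * exp (\<nu> * t) * (\<nu> powr (\<alpha> - 1))" by (simp add: B_def mult_ac)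
      also have "\<dots> = E / 2 * exp (\<nu> * t)" unfolding \<nu>(2) using B by simp
      finally show ?thesis by simp
    qed (use 0 E in simp)
  qed simp
  thus ?thesis by simp
qed

end

context evolution_sg
begin

lemma stable_case:
  assumes G: "\<And>x. G x = J (Z x)"
  obtains \<epsilon> c \<kappa> where "0 < \<epsilon>" "\<epsilon> \<le> \<rho>" "1 \<le> c" "0 < \<kappa>"
    "\<And>T v t. sol_on T v \<Longrightarrow> c * norm (v 0) < \<epsilon> \<Longrightarrow> t \<in> {0..T} \<Longrightarrow> norm (v t) \<le> c * norm (v 0)"
    "\<And>v. (\<And>T. sol_on T v) \<Longrightarrow> c * norm (v 0) < \<epsilon> \<Longrightarrow> \<exists>w. J w \<in> D \<and> L (J w) = 0 \<and>
      (\<forall>t\<ge>0. norm (v t - w) \<le> c * norm (v 0 - Z (J (v 0))) * exp (- \<kappa> * t))"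
proof -
  define m where "m = 1 + norm (J o\<^sub>L Z)"
  have m: "0 < m" by (simp add: m_def add_pos_nonneg)
  define \<kappa> where "\<kappa> = \<omega> / 2"
  have \<kappa>: "0 < \<kappa>" "\<kappa> \<le> \<omega>" "- \<kappa> + \<omega> = \<kappa>" using sg.pos by (auto simp: \<kappa>_def)
  define B where "B = 2 * (C * (m * K) * (\<kappa> powr (\<alpha> - 1) * sg.kap))"
  have B: "0 < B" using sg.pos m pos sg.kap_pos \<kappa> by (simp add: B_def)
  \<comment> \<open>Below this size the nonlinear contribution to the range part has a factor at
    most 1/2 and can be absorbed.\<close>
  define \<epsilon> where "\<epsilon> = min \<rho> ((1 / B) powr (1 / (p - 1)))"
  have e: "0 < \<epsilon>" "\<epsilon> \<le> \<rho>" using pos B by (auto simp: \<epsilon>_def)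
  have "\<epsilon> powr (p - 1) \<le> ((1 / B) powr (1 / (p - 1))) powr (p - 1)"
    using e pos by (intro powr_mono2) (auto simp: \<epsilon>_def)
  hence eB: "\<epsilon> powr (p - 1) \<le> 1 / B" using B pos by (simp add: powr_powr)
  define c1 where "c1 = 2 * (C + 1)"
  \<comment> \<open>Integrating the bound on the derivative of the null part, proportional to
    e^(-\<kappa> t), produces the factor 1/\<kappa>.\<close>
  define c2 where "c2 = norm Z * (K * \<epsilon> powr (p - 1)) * c1 / \<kappa>"
  have c: "1 \<le> c1" "0 \<le> c2" using sg.pos pos e \<kappa> by (auto simp: c1_def c2_def)
  have nb: "norm (n x) \<le> K * \<epsilon> powr (p - 1) * norm (x - Z (J x))" if "norm x \<le> \<epsilon>" for x
  proof -
    have "norm (n x) \<le> K * norm x powr (p - 1) * norm (x - Z (J x))" using n_bd that e by simp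
    also have "\<dots> \<le> K * \<epsilon> powr (p - 1) * norm (x - Z (J x))"
      using that pos by (intro mult_right_mono mult_left_mono powr_mono2) auto
    finally show ?thesis .
  qed
  have range_decay: "norm (v t - Z (J (v t))) \<le> c1 * norm (v 0 - Z (J (v 0))) * exp (- \<kappa> * t)"
    if s: "sol_on T v" and b: "\<And>s. s \<in> {0..T} \<Longrightarrow> norm (v s) \<le> \<epsilon>" and t: "t \<in> {0..T}" for T v t
  proof -
    define w where "w s = v s - Z (J (v s))" for s
    note vc = sol_on_continuous[OF s]
    have wc: "continuous_on {0..T} w" unfolding w_def by (intro continuous_intros vc)
    have "norm (w t) \<le> 2 * ((C + 1) * norm (w 0)) * exp (- \<kappa> * t)"
    proof (rule weighted_absorb[OF _ _ _ t])
      fix E t assume t: "t \<in> {0..T}" and E: "0 \<le> E" "\<And>s. s \<in> {0..T} \<Longrightarrow> norm (w s) \<le> E * exp (- \<kappa> * s)"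
      show "norm (w t) \<le> ((C + 1) * norm (w 0) + E / 2) * exp (- \<kappa> * t)"
      proof (cases "t = 0")
        case True
        have "1 * norm (w 0) \<le> (C + 1) * norm (w 0)" using sg.pos by (intro mult_right_mono) auto
        thus ?thesis using True E by simp
      next
        case False
        hence t': "0 < t" "t \<le> T" using t by auto
        \<comment> \<open>The range part solves the equation of L + G with the range part of - n as
          right-hand side: G vanishes on it, and the projection annihilates L u.\<close>
        define f where "f s = - (n (v s) - J (Z (n (v s))))" for s
        have fc: "continuous_on {0..t} f" unfolding f_def
          by (intro continuous_intros n_continuous continuous_on_subset[OF vc]) (use b e t in \<open>auto intro: order_trans\<close>)
        have fb: "norm (f s) \<le> m * K * \<epsilon> powr (p - 1) * E * exp (- \<kappa> * s)" if "s \<in> {0..t}" for s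
        proof -
          have "norm (f s) \<le> norm (n (v s)) + norm ((J o\<^sub>L Z) (n (v s)))"
            unfolding f_def norm_minus_cancel using norm_triangle_ineq4 by (metis blinfun_apply_blinfun_compose)
          also have "\<dots> \<le> m * norm (n (v s))" using norm_blinfun[of "J o\<^sub>L Z" "n (v s)"] by (simp add: m_def distrib_right)
          also have "\<dots> \<le> m * (K * \<epsilon> powr (p - 1) * norm (w s))"
            unfolding w_def using nb b that t m by (intro mult_left_mono) auto
          also have "\<dots> \<le> m * (K * \<epsilon> powr (p - 1) * (E * exp (- \<kappa> * s)))"
            using E that t m pos by (intro mult_left_mono) auto
          finally show ?thesis by (simp add: mult_ac)
        qed
        have Jw: "J (w r) = J (v r) - J (Z (J (v r)))" for r by (simp add: w_def blinfun.diff_right)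
        have "w t = Y t (J (w 0)) + sg.V f t"
        proof (rule sg.mild_of_solution[OF t'(1) _ fc])
          show "continuous_on {0..t} w" using wc by (rule continuous_on_subset) (use t in auto)
          fix r assume r: "0 < r" "r < t"
          have br: "norm (v r) \<le> \<rho>" using b[of r] r t' e by simp
          have u: "J (v r) \<in> D" "((\<lambda>s. J (v s)) has_vector_derivative - (L (J (v r)) + n (v r))) (at r)"
            using sol_onD[OF s r(1) _ br] r t' by auto
          show "J (w r) \<in> D" unfolding Jw by (intro linear_opD(3)[OF lin] u(1) Z)
          have "((\<lambda>s. J (v s) - (J o\<^sub>L Z) (J (v s))) has_vector_derivative
              - (L (J (v r)) + n (v r)) - (J o\<^sub>L Z) (- (L (J (v r)) + n (v r)))) (at r)"
            by (intro has_vector_derivative_diff u(2) bounded_linear.has_vector_derivative[OF blinfun.bounded_linear_right])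
          moreover have "- (L (J (v r)) + n (v r)) - (J o\<^sub>L Z) (- (L (J (v r)) + n (v r))) = f r - (L (J (w r)) + G (J (w r)))"
            using linear_opD(7)[OF lin u(1) Z(1)] Z(4)[OF u(1)] Z(3)[OF Z(1,2)]
            by (simp add: f_def Jw G Z(2) blinfun.minus_right blinfun.diff_right blinfun.add_right)
          ultimately show "((\<lambda>s. J (w s)) has_vector_derivative f r - (L (J (w r)) + G (J (w r)))) (at r)"
            by (simp add: Jw)
        qed
        moreover have "norm (Y t (J (w 0))) \<le> (C + 1) * norm (w 0) * exp (- \<kappa> * t)"
        proof -
          have "norm ((Y t o\<^sub>L J) (w 0)) \<le> (C * exp (- \<omega> * t)) * norm (w 0)"
            by (intro order_trans[OF norm_blinfun] mult_right_mono sg.nYJ t') simp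
          also have "\<dots> \<le> ((C + 1) * exp (- \<kappa> * t)) * norm (w 0)"
            using sg.pos \<kappa> t' by (intro mult_right_mono mult_mono) auto
          finally show ?thesis by (simp add: mult_ac)
        qed
        moreover have "norm (sg.V f t) \<le> E / 2 * exp (- \<kappa> * t)"
        proof -
          have "norm (sg.V f t) \<le> C * (m * K * \<epsilon> powr (p - 1) * E) * exp (- \<kappa> * t) * ((- \<kappa> + \<omega>) powr (\<alpha> - 1) * sg.kap)"
            by (rule sg.norm_V_weighted[OF _ fc fb]) (use t' \<kappa> in auto)
          also have "\<dots> = B / 2 * \<epsilon> powr (p - 1) * E * exp (- \<kappa> * t)" unfolding \<kappa>(3) by (simp add: B_def mult_ac)
          also have "\<dots> \<le> B / 2 * (1 / B) * E * exp (- \<kappa> * t)"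
            using eB B E(1) by (intro mult_right_mono mult_left_mono) auto
          finally show ?thesis using B by simp
        qed
        ultimately show ?thesis
          using norm_triangle_mono[of "Y t (J (w 0))" _ "sg.V f t"] by (simp only: distrib_right)
      qed
    qed (auto intro!: continuous_intros wc)
    thus ?thesis by (simp add: w_def c1_def algebra_simps)
  qed
  have null_decay: "norm (Z (J (v t)) - Z (J (v s))) \<le> c2 * norm (v 0 - Z (J (v 0))) * exp (- \<kappa> * s)"
    if so: "sol_on T v" and b: "\<And>s. s \<in> {0..T} \<Longrightarrow> norm (v s) \<le> \<epsilon>" and s: "0 \<le> s" "s \<le> t" "t \<le> T" for T v t s
  proof (cases "s = t")
    case True thus ?thesis using c by simp
  next
    case False
    define a where "a = norm (v 0 - Z (J (v 0)))"
    have "norm (Z (J (v t)) - Z (J (v s))) \<le> - c2 * a * exp (- \<kappa> * t) - (- c2 * a * exp (- \<kappa> * s))"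
    proof (rule differentiable_bound_general)
      show "s < t" using s False by simp
      show "continuous_on {s..t} (\<lambda>r. Z (J (v r)))"
        by (intro continuous_intros continuous_on_subset[OF sol_on_continuous[OF so]]) (use s in auto)
      show "continuous_on {s..t} (\<lambda>r. - c2 * a * exp (- \<kappa> * r))" by (intro continuous_intros)
      fix r assume r: "s < r" "r < t"
      have br: "norm (v r) \<le> \<epsilon>" using b[of r] r s by simp
      have u: "J (v r) \<in> D" "((\<lambda>s. J (v s)) has_vector_derivative - (L (J (v r)) + n (v r))) (at r)"
        using sol_onD[OF so, of r] r s e br by auto
      show "((\<lambda>r. Z (J (v r))) has_vector_derivative Z (- (L (J (v r)) + n (v r)))) (at r)"
        by (rule bounded_linear.has_vector_derivative[OF blinfun.bounded_linear_right u(2)])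
      show "((\<lambda>r. - c2 * a * exp (- \<kappa> * r)) has_vector_derivative c2 * a * \<kappa> * exp (- \<kappa> * r)) (at r)"
        unfolding has_real_derivative_iff_has_vector_derivative[symmetric] by (auto intro!: derivative_eq_intros)
      have "norm (Z (- (L (J (v r)) + n (v r)))) = norm (Z (n (v r)))"
        using Z(4)[OF u(1)] by (simp add: blinfun.minus_right blinfun.add_right blinfun.diff_right)
      also have "\<dots> \<le> norm Z * (K * \<epsilon> powr (p - 1) * norm (v r - Z (J (v r))))"
        by (intro order_trans[OF norm_blinfun] mult_left_mono nb br) simp
      also have "\<dots> \<le> norm Z * (K * \<epsilon> powr (p - 1) * (c1 * a * exp (- \<kappa> * r)))"
        unfolding a_def using pos by (intro mult_left_mono range_decay[OF so b]) (use r s in auto)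
      also have "\<dots> = c2 * a * \<kappa> * exp (- \<kappa> * r)" using \<kappa> by (simp add: c2_def)
      finally show "norm (Z (- (L (J (v r)) + n (v r)))) \<le> c2 * a * \<kappa> * exp (- \<kappa> * r)" .
    qed
    also have "\<dots> \<le> c2 * a * exp (- \<kappa> * s)" using c by (simp add: a_def)
    finally show ?thesis by (simp add: a_def)
  qed
  define M where "M = norm (Z o\<^sub>L J)"
  have M: "norm (Z (J x)) \<le> M * norm x" "norm (x - Z (J x)) \<le> (1 + M) * norm x" "0 \<le> M" for x
    using norm_blinfun[of "Z o\<^sub>L J" x] norm_triangle_ineq4[of x "Z (J x)"] by (auto simp: M_def distrib_right)
  \<comment> \<open>Passes from the range part of the initial value to the initial value itself; the
    summand M accounts for its null part.\<close>
  define c' where "c' = (c1 + c2) * (1 + M) + M"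
  have "1 * 1 \<le> (c1 + c2) * (1 + M)" using c M(3) by (intro mult_mono) auto
  hence c': "1 \<le> c'" using M(3) by (simp add: c'_def)
  have step: "norm (v t) \<le> c' * norm (v 0)"
    if s: "sol_on t v" "\<And>s. s \<in> {0..t} \<Longrightarrow> norm (v s) \<le> \<epsilon>" and t: "0 \<le> t" for v t
  proof -
    have "exp (- \<kappa> * t) \<le> 1" using \<kappa> t by simp
    hence "norm (v t - Z (J (v t))) \<le> c1 * norm (v 0 - Z (J (v 0))) * 1"
      using c by (intro order_trans[OF range_decay[OF s]] mult_left_mono) (use t in auto)
    moreover have "norm (Z (J (v t)) - Z (J (v 0))) \<le> c2 * norm (v 0 - Z (J (v 0))) * exp (- \<kappa> * 0)"
      by (rule null_decay[OF s]) (use t in auto)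
    moreover have "norm (v t) \<le> norm (v t - Z (J (v t))) + norm (Z (J (v t)) - Z (J (v 0))) + norm (Z (J (v 0)))"
      using norm_triangle_ineq[of "v t - Z (J (v t))" "Z (J (v t))"]
        norm_triangle_ineq[of "Z (J (v t)) - Z (J (v 0))" "Z (J (v 0))"] by simp
    moreover have "(c1 + c2) * norm (v 0 - Z (J (v 0))) \<le> (c1 + c2) * ((1 + M) * norm (v 0))" using c M by (intro mult_left_mono) auto
    ultimately show ?thesis using M(1)[of "v 0"] by (simp add: c'_def algebra_simps)
  qed
  have small: "norm (v t) < \<epsilon>" if s: "sol_on T v" "c' * norm (v 0) < \<epsilon>" and t: "t \<in> {0..T}" for T v t
  proof (rule bootstrap[OF _ _ _ t])
    show "continuous_on {0..T} (\<lambda>t. norm (v t))" by (intro continuous_intros sol_on_continuous[OF s(1)])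
    have "1 * norm (v 0) \<le> c' * norm (v 0)" using c' by (intro mult_right_mono) auto
    thus "norm (v 0) < \<epsilon>" using s(2) by simp
    show "norm (v t) < \<epsilon>" if "t \<in> {0..T}" "\<And>s. s \<in> {0..t} \<Longrightarrow> norm (v s) \<le> \<epsilon>" for t
      by (rule le_less_trans[OF step[OF sol_on_mono[OF s(1)] that(2)] s(2)]) (use that(1) in auto)
  qed
  show ?thesis
  proof (rule that[OF e c' \<kappa>(1)])
    show "norm (v t) \<le> c' * norm (v 0)" if s: "sol_on T v" "c' * norm (v 0) < \<epsilon>" and t: "t \<in> {0..T}" for T v t
      by (rule step[OF sol_on_mono[OF s(1)] less_imp_le[OF small[OF s]]]) (use t in auto)
    fix v assume s: "\<And>T. sol_on T v" and v0: "c' * norm (v 0) < \<epsilon>"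
    define a where "a = c2 * norm (v 0 - Z (J (v 0)))"
    have b: "norm (v s) \<le> \<epsilon>" if "s \<in> {0..T}" for s T using small[OF s v0 that] by simp
    have nd: "norm (Z (J (v t)) - Z (J (v s))) \<le> a * exp (- \<kappa> * s)" if "0 \<le> s" "s \<le> t" for s t
      unfolding a_def using null_decay[OF s b that order_refl] .
    have ex0: "((\<lambda>t. a * exp (- \<kappa> * t)) \<longlongrightarrow> 0) at_top"
      by (intro tendsto_mult_right_zero filterlim_compose[OF exp_at_bot]
        filterlim_tendsto_neg_mult_at_bot[OF tendsto_const _ filterlim_ident]) (use \<kappa> in simp)
    \<comment> \<open>The limit is taken along integer times; \<open>nd\<close> then compares it
      with the null part at any real time.\<close>
    have "Cauchy (\<lambda>k::nat. Z (J (v (real k))))"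
    proof (rule metric_CauchyI)
      fix r :: real assume r: "0 < r"
      have "\<forall>\<^sub>F k in sequentially. a * exp (- \<kappa> * real k) < r / 2"
        using filterlim_compose[OF ex0 filterlim_real_sequentially] r by (intro order_tendstoD(2)) auto
      then obtain k0 where k0: "a * exp (- \<kappa> * real k0) < r / 2" by (auto simp: eventually_sequentially)
      have "dist (Z (J (v (real k)))) (Z (J (v (real k0)))) < r / 2" if "k0 \<le> k" for k
        using le_less_trans[OF nd k0, of "real k"] that by (simp add: dist_norm)
      thus "\<exists>M. \<forall>m\<ge>M. \<forall>n\<ge>M. dist (Z (J (v (real m)))) (Z (J (v (real n)))) < r" by (metis dist_triangle_half_l)
    qed
    then obtain w where w: "(\<lambda>k. Z (J (v (real k)))) \<longlonglongrightarrow> w" using Cauchy_convergent_iff convergent_def by blast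
    have JZ: "J (Z (J (Z x))) = J (Z x)" for x using Z(3)[OF Z(1,2)] .
    have "(\<lambda>k. J (Z (J (Z (J (v (real k))))))) \<longlonglongrightarrow> J (Z (J w))" by (intro tendsto_intros w)
    moreover have "(\<lambda>k. J (Z (J (v (real k))))) \<longlonglongrightarrow> J w" by (intro tendsto_intros w)
    \<comment> \<open>The projection is idempotent and continuous, so the limit is fixed by it and
      lies in the null space.\<close>
    ultimately have Jw: "J (Z (J w)) = J w" unfolding JZ using LIMSEQ_unique by blast
    have "norm (v t - w) \<le> (c1 + c2) * norm (v 0 - Z (J (v 0))) * exp (- \<kappa> * t)" if t: "0 \<le> t" for t
    proof -
      have "norm (w - Z (J (v t))) \<le> a * exp (- \<kappa> * t)"
      proof (rule tendsto_upperbound[OF tendsto_norm[OF tendsto_diff[OF w tendsto_const]]])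
        obtain k0 :: nat where "t \<le> real k0" using real_arch_simple by blast
        thus "\<forall>\<^sub>F k in sequentially. norm (Z (J (v (real k))) - Z (J (v t))) \<le> a * exp (- \<kappa> * t)"
          using nd t by (auto simp: eventually_sequentially intro!: exI[of _ k0])
      qed simp
      moreover have "norm (v t - Z (J (v t))) \<le> c1 * norm (v 0 - Z (J (v 0))) * exp (- \<kappa> * t)"
        by (rule range_decay[OF s b]) (use t in auto)
      ultimately show ?thesis unfolding a_def using norm_triangle_ineq4[of "v t - Z (J (v t))" "w - Z (J (v t))"] by (simp add: algebra_simps)
    qed
    moreover have "(c1 + c2) * norm (v 0 - Z (J (v 0))) \<le> c' * norm (v 0 - Z (J (v 0)))"
      using c M(3) by (intro mult_right_mono) (auto simp: c'_def algebra_simps)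
    ultimately have "\<forall>t\<ge>0. norm (v t - w) \<le> c' * norm (v 0 - Z (J (v 0))) * exp (- \<kappa> * t)"
      by (meson exp_ge_zero mult_right_mono order_trans)
    thus "\<exists>w. J w \<in> D \<and> L (J w) = 0 \<and> (\<forall>t\<ge>0. norm (v t - w) \<le> c' * norm (v 0 - Z (J (v 0))) * exp (- \<kappa> * t))"
      using Z(1,2)[of "J w"] Jw by auto
  qed
qed

text \<open>\<open>a\<close> and \<open>b\<close> are the two real components of the eigenvector in
  the coordinate v. The initial phase depends on T so that the rotating linear solution arrives at
  time T exactly at \<theta> a, whose norm is known.\<close>

lemma unstable_case:
  assumes G: "\<And>x. G x = s *\<^sub>R x" and w: "J a \<in> D" "J b \<in> D" "a \<noteq> 0"
    and La: "L (J a) = - \<beta> *\<^sub>R J a - \<nu> *\<^sub>R J b" and Lb: "L (J b) = - \<beta> *\<^sub>R J b + \<nu> *\<^sub>R J a"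
    and b: "0 < \<beta>" "s < p * \<beta>"
  obtains e where "0 < e" "\<And>d. 0 < d \<Longrightarrow> \<exists>T>0. \<exists>v0. norm v0 < d \<and>
    (\<forall>v. sol_on T v \<longrightarrow> v 0 = v0 \<longrightarrow> e \<le> norm (v T) \<and> (\<forall>t\<in>{0..T}. norm (v t) < \<rho>))"
proof -
  define M where "M = norm a + norm b"
  have M: "0 < M" "norm a \<le> M" using w by (auto simp: M_def add_pos_nonneg)
  define K' where "K' = K * (1 + norm (Z o\<^sub>L J))"
  have K': "0 < K'" using pos by (simp add: K'_def add_pos_nonneg)
  \<comment> \<open>The Duhamel constant for data of order e^((p \<beta> - s) t) against the
    semigroup of L + s. The choice of \<eta> below makes the nonlinear error at time T at most half
    of the linear solution.\<close>
  define B where "B = C * K' * ((p * \<beta> - s + \<omega>) powr (\<alpha> - 1) * sg.kap)"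
  have B: "0 < B" using sg.pos K' sg.kap_pos b by (simp add: B_def)
  define \<eta> where "\<eta> = min (\<rho> / 2) ((norm a / (4 * M * B)) powr (1 / (p - 1)))"
  have \<eta>: "0 < \<eta>" "\<eta> < \<rho>" using pos w M B by (auto simp: \<eta>_def min_less_iff_disj)
  have "\<eta> powr (p - 1) \<le> ((norm a / (4 * M * B)) powr (1 / (p - 1))) powr (p - 1)"
    using \<eta> pos by (intro powr_mono2) (auto simp: \<eta>_def)
  hence "\<eta> powr (p - 1) \<le> norm a / (4 * M * B)" using pos B M by (simp add: powr_powr)
  hence \<eta>B: "B * \<eta> powr (p - 1) * (2 * M) \<le> norm a / 2" using B M by (simp add: field_simps)
  define \<theta> where "\<theta> = \<eta> / (2 * M)"
  have \<theta>: "0 < \<theta>" "2 * M * \<theta> = \<eta>" using \<eta> M by (auto simp: \<theta>_def)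
  have nb: "norm (n x) \<le> K' * norm x powr p" if "norm x \<le> \<rho>" for x
  proof -
    have "norm (x - Z (J x)) \<le> (1 + norm (Z o\<^sub>L J)) * norm x"
      using norm_blinfun[of "Z o\<^sub>L J" x] norm_triangle_ineq4[of x "Z (J x)"] by (simp add: distrib_right)
    hence "norm (n x) \<le> K * norm x powr (p - 1) * ((1 + norm (Z o\<^sub>L J)) * norm x)"
      using pos by (intro order_trans[OF n_bd[OF that]] mult_left_mono) auto
    also have "\<dots> = K' * (norm x * norm x powr (p - 1))" by (simp add: K'_def mult_ac)
    also have "norm x * norm x powr (p - 1) = norm x powr p" by (simp add: powr_mult_base)
    finally show ?thesis .
  qed
  have main: "norm a * \<theta> / 2 \<le> norm (v T) \<and> (\<forall>t\<in>{0..T}. norm (v t) < \<rho>)"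
    if T: "0 < T" and sol: "sol_on T v" and v0: "v 0 = (\<theta> * exp (- \<beta> * T)) *\<^sub>R (cos (\<nu> * (0 - T)) *\<^sub>R a + sin (\<nu> * (0 - T)) *\<^sub>R b)" for T v
  proof -
    define \<delta> where "\<delta> = \<theta> * exp (- \<beta> * T)"
    have \<delta>: "0 < \<delta>" using \<theta> by (simp add: \<delta>_def)
    have \<delta>\<theta>: "\<delta> * exp (\<beta> * t) \<le> \<theta>" if "t \<le> T" for t
    proof -
      have "exp (- \<beta> * T) * exp (\<beta> * t) \<le> 1" using that b by (simp flip: exp_add)
      thus ?thesis using \<theta> unfolding \<delta>_def mult.assoc by (intro mult_left_le) auto
    qed
    define c where "c t = \<delta> * exp (\<beta> * t) * cos (\<nu> * (t - T))" for t
    define c' where "c' t = \<delta> * exp (\<beta> * t) * sin (\<nu> * (t - T))" for t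
    define l where "l t = c t *\<^sub>R a + c' t *\<^sub>R b" for t
    have l0: "l 0 = v 0" by (simp add: l_def c_def c'_def v0 \<delta>_def scaleR_add_right scaleR_diff_right)
    have nl: "norm (l t) \<le> \<delta> * exp (\<beta> * t) * M" for t
    proof -
      have "\<bar>c t\<bar> \<le> \<delta> * exp (\<beta> * t)" "\<bar>c' t\<bar> \<le> \<delta> * exp (\<beta> * t)"
        using \<delta> by (auto simp: c_def c'_def abs_mult intro: mult_left_le)
      hence "\<bar>c t\<bar> * norm a + \<bar>c' t\<bar> * norm b \<le> \<delta> * exp (\<beta> * t) * norm a + \<delta> * exp (\<beta> * t) * norm b"
        by (intro add_mono mult_right_mono) auto
      thus ?thesis unfolding l_def M_def distrib_left by (intro order_trans[OF norm_triangle_ineq]) simp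
    qed
    have lD: "J (l t) \<in> D" "L (J (l t)) = c t *\<^sub>R L (J a) + c' t *\<^sub>R L (J b)" for t
      unfolding l_def blinfun.add_right blinfun.scaleR_right by (intro linear_opD[OF lin] w)
        (simp add: linear_opD(6)[OF lin linear_opD(4)[OF lin w(1)] linear_opD(4)[OF lin w(2)]] linear_opD(8)[OF lin] w)
    have dl: "((\<lambda>s. J (l s)) has_vector_derivative - L (J (l t))) (at t)" for t
    proof -
      have "(c has_real_derivative (\<beta> * c t - \<nu> * c' t)) (at t)" "(c' has_real_derivative (\<beta> * c' t + \<nu> * c t)) (at t)"
        unfolding c_def c'_def by (auto intro!: derivative_eq_intros simp: algebra_simps)
      hence "((\<lambda>s. c s *\<^sub>R J a + c' s *\<^sub>R J b) has_vector_derivative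
          ((c t *\<^sub>R 0 + (\<beta> * c t - \<nu> * c' t) *\<^sub>R J a) + (c' t *\<^sub>R 0 + (\<beta> * c' t + \<nu> * c t) *\<^sub>R J b))) (at t)"
        by (intro has_vector_derivative_add has_vector_derivative_scaleR has_vector_derivative_const)
      thus ?thesis unfolding lD(2) La Lb by (simp add: l_def blinfun.add_right blinfun.scaleR_right algebra_simps)
    qed
    note vc = sol_on_continuous[OF sol]
    have lc: "continuous_on S l" for S unfolding l_def c_def c'_def by (intro continuous_intros)
    have close: "norm (v t - l t) \<le> norm a / 2 * (\<delta> * exp (\<beta> * t))"
      if t: "t \<in> {0..T}" and bd: "\<And>s. s \<in> {0..t} \<Longrightarrow> norm (v s) \<le> 2 * M * (\<delta> * exp (\<beta> * s))" for t
    proof (cases "t = 0")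
      case False
      hence t': "0 < t" using t by simp
      have e\<eta>: "2 * M * (\<delta> * exp (\<beta> * s)) \<le> \<eta>" if "s \<le> T" for s
        using mult_left_mono[OF \<delta>\<theta>[OF that], of "2 * M"] \<theta> M by simp
      have br: "norm (v s) \<le> \<rho>" if "s \<in> {0..t}" for s using order_trans[OF bd[OF that] e\<eta>] that t \<eta> by auto
      \<comment> \<open>The factor e^(-s r) turns L into L + s, whose semigroup decays, and the
        deviation from the linear solution starts at 0.\<close>
      define d where "d r = exp (- s * r) *\<^sub>R (v r - l r)" for r
      define f where "f r = - (exp (- s * r) *\<^sub>R n (v r))" for r
      have fc: "continuous_on {0..t} f" unfolding f_def
        by (intro continuous_intros n_continuous br continuous_on_subset[OF vc]) (use t in auto)
      have "d t = Y t (J (d 0)) + sg.V f t"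
      proof (rule sg.mild_of_solution[OF t' _ fc])
        show "continuous_on {0..t} d" unfolding d_def
          by (intro continuous_intros lc continuous_on_subset[OF vc]) (use t in auto)
        fix r assume r: "0 < r" "r < t"
        have u: "J (v r) \<in> D" "((\<lambda>s. J (v s)) has_vector_derivative - (L (J (v r)) + n (v r))) (at r)"
          using sol_onD[OF sol r(1) _ br] r t by auto
        have Jd: "J (d q) = exp (- s * q) *\<^sub>R (J (v q) - J (l q))" for q
          by (simp add: d_def blinfun.scaleR_right blinfun.diff_right)
        show "J (d r) \<in> D" unfolding Jd by (intro linear_opD[OF lin] u(1) lD)
        have "((\<lambda>r. exp (- s * r)) has_real_derivative (- s * exp (- s * r))) (at r)" by (auto intro!: derivative_eq_intros)
        hence der: "((\<lambda>q. exp (- s * q) *\<^sub>R (J (v q) - J (l q))) has_vector_derivative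
            (exp (- s * r) *\<^sub>R (- (L (J (v r)) + n (v r)) - (- L (J (l r)))) + (- s * exp (- s * r)) *\<^sub>R (J (v r) - J (l r)))) (at r)"
          by (intro has_vector_derivative_scaleR has_vector_derivative_diff u(2) dl)
        have LJd: "L (J (d r)) = exp (- s * r) *\<^sub>R (L (J (v r)) - L (J (l r)))"
          unfolding Jd using linear_opD(7)[OF lin u(1) lD(1)] linear_opD(3)[OF lin u(1) lD(1)] by (simp add: linear_opD(8)[OF lin])
        have "exp (- s * r) *\<^sub>R (- (L (J (v r)) + n (v r)) - (- L (J (l r)))) + (- s * exp (- s * r)) *\<^sub>R (J (v r) - J (l r)) =
            f r - (L (J (d r)) + G (J (d r)))" unfolding LJd G by (simp add: Jd f_def algebra_simps)
        with der show "((\<lambda>s. J (d s)) has_vector_derivative f r - (L (J (d r)) + G (J (d r)))) (at r)"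
          by (simp only: Jd)
      qed
      hence dV: "d t = sg.V f t" by (simp add: d_def l0)
      have "norm (sg.V f t) \<le> C * (K' * (2 * M * \<delta>) powr p) * exp ((p * \<beta> - s) * t) * ((p * \<beta> - s + \<omega>) powr (\<alpha> - 1) * sg.kap)"
      proof (rule sg.norm_V_weighted[OF _ fc])
        fix r assume r: "r \<in> {0..t}"
        have "norm (f r) \<le> exp (- s * r) * (K' * norm (v r) powr p)"
          unfolding f_def norm_minus_cancel norm_scaleR by (simp add: nb[OF br[OF r]])
        also have "\<dots> \<le> exp (- s * r) * (K' * (2 * M * (\<delta> * exp (\<beta> * r))) powr p)"
          using bd[OF r] K' pos by (intro mult_left_mono powr_mono2) auto
        also have "(2 * M * (\<delta> * exp (\<beta> * r))) powr p = (2 * M * \<delta>) powr p * exp (p * \<beta> * r)"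
          using M \<delta> by (simp add: powr_mult exp_powr_real mult_ac)
        also have "exp (- s * r) * (K' * ((2 * M * \<delta>) powr p * exp (p * \<beta> * r))) = K' * (2 * M * \<delta>) powr p * exp ((p * \<beta> - s) * r)"
          by (simp add: algebra_simps flip: exp_add)
        finally show "norm (f r) \<le> K' * (2 * M * \<delta>) powr p * exp ((p * \<beta> - s) * r)" .
      qed (use t' b sg.pos in auto)
      hence "exp (s * t) * norm (d t) \<le> exp (s * t) * (C * (K' * (2 * M * \<delta>) powr p) * exp ((p * \<beta> - s) * t) * ((p * \<beta> - s + \<omega>) powr (\<alpha> - 1) * sg.kap))"
        unfolding dV by (intro mult_left_mono) auto
      moreover have "exp (s * t) * norm (d t) = norm (v t - l t)" by (simp add: d_def exp_minus)
      moreover have "exp (s * t) * (C * (K' * (2 * M * \<delta>) powr p) * exp ((p * \<beta> - s) * t) * ((p * \<beta> - s + \<omega>) powr (\<alpha> - 1) * sg.kap)) =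
          B * ((2 * M * \<delta>) powr p * (exp (s * t) * exp ((p * \<beta> - s) * t)))" by (simp only: B_def mult_ac)
      moreover have "exp (s * t) * exp ((p * \<beta> - s) * t) = exp (p * \<beta> * t)"
        by (simp add: algebra_simps flip: exp_add)
      ultimately have "norm (v t - l t) \<le> B * ((2 * M * \<delta>) powr p * exp (p * \<beta> * t))" by simp
      also have "(2 * M * \<delta>) powr p * exp (p * \<beta> * t) = (2 * M * (\<delta> * exp (\<beta> * t))) powr p"
        using M \<delta> by (simp add: powr_mult exp_powr_real mult_ac)
      also have "\<dots> = 2 * M * (\<delta> * exp (\<beta> * t)) * (2 * M * (\<delta> * exp (\<beta> * t))) powr (p - 1)"
        using M \<delta> by (simp add: powr_mult_base)
      also have "B * \<dots> \<le> B * (2 * M * (\<delta> * exp (\<beta> * t)) * \<eta> powr (p - 1))"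
        using B M \<delta> pos e\<eta>[of t] t by (intro mult_left_mono powr_mono2) auto
      also have "\<dots> = (B * \<eta> powr (p - 1) * (2 * M)) * (\<delta> * exp (\<beta> * t))" by (simp add: mult_ac)
      also have "\<dots> \<le> norm a / 2 * (\<delta> * exp (\<beta> * t))" using \<eta>B \<delta> by (intro mult_right_mono) auto
      finally show ?thesis .
    qed (use l0 \<delta> in simp)
    \<comment> \<open>The linear solution is at most M \<delta> e^(\<beta> t) and the correction at
      most half of that, so twice this bound is never reached.\<close>
    have bd: "norm (v t) * exp (- \<beta> * t) < 2 * M * \<delta>" if t: "t \<in> {0..T}" for t
    proof (rule bootstrap[OF _ _ _ t])
      show "continuous_on {0..T} (\<lambda>t. norm (v t) * exp (- \<beta> * t))" by (intro continuous_intros vc)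
      show "norm (v 0) * exp (- \<beta> * 0) < 2 * M * \<delta>"
      proof -
        have "norm (v 0) \<le> \<delta> * M" using nl[of 0] by (simp add: l0)
        moreover have "0 < \<delta> * M" using \<delta> M by simp
        ultimately show ?thesis by (simp add: algebra_simps)
      qed
      fix t assume t: "t \<in> {0..T}" and le: "\<And>s. s \<in> {0..t} \<Longrightarrow> norm (v s) * exp (- \<beta> * s) \<le> 2 * M * \<delta>"
      have "norm (v t - l t) \<le> norm a / 2 * (\<delta> * exp (\<beta> * t))"
        by (rule close[OF t]) (use le in \<open>simp add: exp_minus divide_simps mult_ac\<close>)
      also have "\<dots> \<le> M / 2 * (\<delta> * exp (\<beta> * t))" using M \<delta> by (intro mult_right_mono) auto
      finally have "norm (v t) \<le> 3 / 2 * M * (\<delta> * exp (\<beta> * t))"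
        using nl[of t] norm_triangle_sub[of "v t" "l t"] by (simp add: algebra_simps)
      also have "\<dots> < 2 * M * (\<delta> * exp (\<beta> * t))" using M \<delta> by simp
      finally show "norm (v t) * exp (- \<beta> * t) < 2 * M * \<delta>" by (simp add: exp_minus divide_simps mult_ac)
    qed
    hence bd': "norm (v t) \<le> 2 * M * (\<delta> * exp (\<beta> * t))" if "t \<in> {0..T}" for t
      using less_imp_le[OF bd[OF that]] by (simp add: exp_minus divide_simps mult_ac)
    have "norm (v T - l T) \<le> norm a / 2 * (\<delta> * exp (\<beta> * T))" by (rule close) (use T bd' in auto)
    moreover have "\<delta> * exp (\<beta> * T) = \<theta>" by (simp add: \<delta>_def exp_minus)
    moreover from this have "norm (l T) = norm a * \<theta>" using \<theta> by (simp add: l_def c_def c'_def)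
    ultimately have "norm a * \<theta> / 2 \<le> norm (v T)" using norm_triangle_sub[of "l T" "v T"] by (simp add: norm_minus_commute)
    moreover have "norm (v t) < \<rho>" if "t \<in> {0..T}" for t
      using order_trans[OF bd'[OF that] mult_left_mono[OF \<delta>\<theta>, of t "2 * M"]] M that \<theta> \<eta> by auto
    ultimately show ?thesis by blast
  qed
  show ?thesis
  proof (rule that[of "norm a * \<theta> / 2"])
    show "0 < norm a * \<theta> / 2" using w \<theta> by simp
    fix d :: real assume d: "0 < d"
    define x where "x = d / (M * \<theta>)"
    have x: "0 < x" using d M \<theta> by (simp add: x_def)
    \<comment> \<open>Large enough for the initial value, of size at most \<theta> e^(-\<beta> T) M,
      to be smaller than \<open>d\<close>.\<close>
    define T where "T = 1 + \<bar>ln x\<bar> / \<beta>"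
    have T: "0 < T" using b by (simp add: T_def add_pos_nonneg)
    have "- \<beta> * T = - \<beta> - \<bar>ln x\<bar>" using b by (simp add: T_def field_simps)
    hence "- \<beta> * T < ln x" using b by linarith
    hence "exp (- \<beta> * T) < x" using x by (metis exp_less_mono exp_ln)
    hence "exp (- \<beta> * T) * (M * \<theta>) < x * (M * \<theta>)" using M \<theta> by (intro mult_strict_right_mono) auto
    hence small: "\<theta> * exp (- \<beta> * T) * M < d" using M \<theta> by (simp add: x_def mult_ac)
    define v0 where "v0 = (\<theta> * exp (- \<beta> * T)) *\<^sub>R (cos (\<nu> * (0 - T)) *\<^sub>R a + sin (\<nu> * (0 - T)) *\<^sub>R b)"
    have "norm (cos (\<nu> * (0 - T)) *\<^sub>R a + sin (\<nu> * (0 - T)) *\<^sub>R b) \<le> 1 * norm a + 1 * norm b"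
      by (intro order_trans[OF norm_triangle_ineq] add_mono) (auto intro!: mult_left_le_one_le)
    hence "norm v0 \<le> \<theta> * exp (- \<beta> * T) * M" using \<theta> by (simp add: v0_def M_def)
    hence "norm v0 < d" using small by simp
    thus "\<exists>T>0. \<exists>v0. norm v0 < d \<and> (\<forall>v. sol_on T v \<longrightarrow> v 0 = v0 \<longrightarrow>
        norm a * \<theta> / 2 \<le> norm (v T) \<and> (\<forall>t\<in>{0..T}. norm (v t) < \<rho>))" using T main[OF T] unfolding v0_def by blast
  qed
qed

end

text \<open>L - z = (\<mu> + L) (1 - (z + \<mu>) r), and the second factor is a compact perturbation
  of the identity. If it were injective, the Fredholm alternative would give a resolvent at
  z.\<close>

lemma eigenvector_of_spectrum:
  fixes D :: "'x::banach set"
  assumes lin: "linear_op D L" and r: "rresolv D L \<mu> r" "compact_op r" and z: "z \<in> spectrum UNIV D L"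
  obtains w where "w \<in> D \<times> D" "w \<noteq> 0" "cshift L z w = 0"
proof -
  define K where "K = cblin (z + of_real \<mu>) o\<^sub>L dg r"
  define T where "T = id_blinfun - K"
  interpret compact_perturbation K T
  proof
    show "compact_op K" unfolding K_def by (rule compact_op_compose_left[OF compact_op_dg[OF r(2)]])
    show "T x = x - K x" for x unfolding T_def blinfun.diff_left by (rule arg_cong2[where f = minus]) simp_all
  qed
  note res = resolvD[OF resolv_of_rresolv[OF r(1)]]
  have "\<exists>w. T w = 0 \<and> w \<noteq> 0"
  proof (rule ccontr)
    assume "\<not> ?thesis"
    hence "T x = 0 \<Longrightarrow> x = 0" for x by blast
    note inj = this
    obtain c where bij: "bij T" and c: "\<And>x. norm x \<le> c * norm (T x)"
      by (rule inverse_of_injective) (erule inj, rule that)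
    have Ti: "T (inv T x) = x" "inv T (T x) = x" for x using bij by (auto simp: bij_def surj_f_inv_f)
    have "bounded_linear (inv T)"
    proof (rule bounded_linear_intro[where K = c])
      show "inv T (x + y) = inv T x + inv T y" for x y
        using Ti(2)[of "inv T x + inv T y"] by (simp add: blinfun.add_right Ti(1))
      show "inv T (a *\<^sub>R x) = a *\<^sub>R inv T x" for a x
        using Ti(2)[of "a *\<^sub>R inv T x"] by (simp add: blinfun.scaleR_right Ti(1))
      show "norm (inv T x) \<le> norm x * c" for x using c[of "inv T x"] by (simp add: Ti mult.commute)
    qed
    hence ap: "blinfun_apply (Blinfun (inv T)) = inv T" by (rule bounded_linear_Blinfun_apply)
    define R where "R = Blinfun (inv T) o\<^sub>L dg r"
    have R: "R w = dg r (cscale (z + of_real \<mu>) (R w) + w)" for w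
    proof -
      have "T (R w) = dg r w" by (simp add: R_def ap Ti)
      hence "R w - cscale (z + of_real \<mu>) (dg r (R w)) = dg r w" unfolding T K_def by simp
      thus ?thesis using map_prod_cscale[of r] by (simp add: blinfun.add_right algebra_simps)
    qed
    have "resolv D L (- z) R" unfolding resolv_def
    proof (intro conjI allI ballI)
      fix w
      show RD: "R w \<in> D \<times> D" by (subst R) (rule res(1))
      have "cscale (of_real \<mu>) (R w) + map_prod L L (R w) = cscale (z + of_real \<mu>) (R w) + w"
        by (subst (1 2) R) (rule res(4))
      thus "cscale (- z) (R w) + map_prod L L (R w) = w" by (simp add: cscale_add_left cscale_minus_left algebra_simps)
    next
      fix w assume w: "w \<in> D \<times> D"
      have "dg r (cscale (of_real \<mu>) w + map_prod L L w) = w" by (rule res(6)[OF w])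
      moreover have "cscale (of_real \<mu>) w + map_prod L L w = cscale (z + of_real \<mu>) w + (cscale (- z) w + map_prod L L w)"
        by (simp add: cscale_add_left cscale_minus_left)
      ultimately have "T w = dg r (cscale (- z) w + map_prod L L w)"
        unfolding T K_def using map_prod_cscale[of r "z + of_real \<mu>" w] by (simp add: blinfun.add_right algebra_simps)
      thus "R (cscale (- z) w + map_prod L L w) = w" using Ti(2)[of w] by (simp only: R_def ap blinfun_apply_blinfun_compose)
    qed
    from resolvent_set_of_resolv[OF lin this] show False using z by (simp add: spectrum_def)
  qed
  then obtain w where w: "T w = 0" "w \<noteq> 0" by blast
  hence e: "w = dg r (cscale (z + of_real \<mu>) w)" using map_prod_cscale[of r "z + of_real \<mu>" w] by (simp add: T K_def)
  show ?thesis
  proof (rule that[OF _ w(2)])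
    show "w \<in> D \<times> D" by (subst e) (rule res(1))
    have "cscale (of_real \<mu>) w + map_prod L L w = cscale (z + of_real \<mu>) w" by (subst (1 2) e) (rule res(4))
    thus "cshift L z w = 0" by (simp add: cshift_def cscale_add_left algebra_simps)
  qed
qed

section \<open>Spectra of L, of its shifts and of its part in R[L]\<close>

lemma spectrum_bounded_below:
  assumes lin: "linear_op D L" and ares: "ares D L J \<alpha>"
  obtains r where "\<And>z. z \<in> spectrum UNIV D L \<Longrightarrow> - r \<le> Re z"
proof -
  obtain \<delta> r M where d: "0 < \<delta>" "0 < r"
    and res: "\<And>\<zeta>. r \<le> cmod \<zeta> \<Longrightarrow> - \<delta> * \<bar>Im \<zeta>\<bar> \<le> Re \<zeta> \<Longrightarrow> res_bd D L J \<alpha> M \<zeta> (cmod \<zeta>)"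
    using ares unfolding ares_def by blast
  have "- r \<le> Re z" if z: "z \<in> spectrum UNIV D L" for z
  proof (rule ccontr)
    assume "\<not> - r \<le> Re z"
    hence "r \<le> cmod (- z)" "0 \<le> Re (- z)" using complex_Re_le_cmod[of "- z"] d by auto
    moreover have "- \<delta> * \<bar>Im (- z)\<bar> \<le> 0" using d by simp
    ultimately have "res_bd D L J \<alpha> M (- z) (cmod (- z))" by (intro res) auto
    then obtain R where "resolv D L (- z) R" unfolding res_bd_def by blast
    from resolvent_set_of_resolv[OF lin this] show False using z by (simp add: spectrum_def)
  qed
  thus ?thesis by (rule that)
qed

lemma spectrum_shift:
  fixes D :: "'x::real_normed_vector set"
  assumes "z \<in> spectrum UNIV D (\<lambda>u. L u + s *\<^sub>R u)"
  shows "z - of_real s \<in> spectrum UNIV D L"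
proof -
  have "cshift (\<lambda>u. L u + s *\<^sub>R u) z = cshift L (z - of_real s)"
    by (auto simp: fun_eq_iff cshift_def cscale_def algebra_simps)
  thus ?thesis using assms by (simp add: spectrum_def resolvent_set_def)
qed

lemma subspace_range_space:
  fixes D :: "'x::real_normed_vector set"
  assumes lin: "linear_op D L"
  shows "subspace (range_space D L)"
  unfolding subspace_def range_space_def
proof (intro conjI ballI allI)
  show "0 \<in> L ` D" using linear_opD(1,9)[OF lin] by (metis imageI)
  fix x r assume "x \<in> L ` D"
  then obtain u where u: "u \<in> D" "x = L u" by blast
  thus "r *\<^sub>R x \<in> L ` D" using linear_opD(4,8)[OF lin] by (metis imageI)
  show "x + y \<in> L ` D" if "y \<in> L ` D" for y
    using that u linear_opD(2,6)[OF lin] by (metis (no_types, lifting) imageE imageI)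
qed

lemma cscale_subspace: "subspace U \<Longrightarrow> w \<in> U \<times> U \<Longrightarrow> cscale z w \<in> U \<times> U"
  by (auto simp: cscale_def intro!: subspace_diff subspace_add subspace_scale)

text \<open>If z w - L w = f with f in the range, then w = (f + L w) / z lies in the range too,
  since z is not 0. So a resolvent of L restricts to one of the part.\<close>

lemma spectrum_part:
  fixes D :: "'x::real_normed_vector set"
  assumes lin: "linear_op D L" and z: "z \<in> spectrum (range_space D L) (D \<inter> range_space D L) L" "z \<noteq> 0"
  shows "z \<in> spectrum UNIV D L"
proof (rule ccontr)
  assume "z \<notin> spectrum UNIV D L"
  hence bij: "bij_betw (cshift L z) (D \<times> D) UNIV" and "\<exists>K. \<forall>w\<in>D \<times> D. norm w \<le> K * norm (cshift L z w)"
    by (auto simp: spectrum_def resolvent_set_def)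
  then obtain K where K: "\<And>w. w \<in> D \<times> D \<Longrightarrow> norm w \<le> K * norm (cshift L z w)" by blast
  let ?R = "range_space D L"
  note sR = subspace_range_space[OF lin]
  have LR: "map_prod L L w \<in> ?R \<times> ?R" if "w \<in> D \<times> D" for w using that by (auto simp: range_space_def)
  have "bij_betw (cshift L z) ((D \<inter> ?R) \<times> (D \<inter> ?R)) (?R \<times> ?R)" unfolding bij_betw_def
  proof (intro conjI subset_antisym subsetI)
    show "inj_on (cshift L z) ((D \<inter> ?R) \<times> (D \<inter> ?R))" using bij by (auto simp: bij_betw_def intro: inj_on_subset)
    fix f
    show "f \<in> ?R \<times> ?R" if fi: "f \<in> cshift L z ` ((D \<inter> ?R) \<times> (D \<inter> ?R))"
    proof -
      obtain w where w: "f = cshift L z w" "w \<in> (D \<inter> ?R) \<times> (D \<inter> ?R)" using fi by blast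
      hence "w \<in> ?R \<times> ?R" "w \<in> D \<times> D" by auto
      hence "cscale z w \<in> ?R \<times> ?R" "map_prod L L w \<in> ?R \<times> ?R" by - (rule cscale_subspace[OF sR] LR, assumption)+
      thus ?thesis unfolding w(1) cshift_def by (rule subspace_diff[OF subspace_Times[OF sR sR]])
    qed
    assume f: "f \<in> ?R \<times> ?R"
    have "f \<in> cshift L z ` (D \<times> D)" using bij by (simp add: bij_betw_def)
    then obtain w where w: "w \<in> D \<times> D" "f = cshift L z w" by blast
    have "cscale z w = f + map_prod L L w" by (simp add: w(2) cshift_def)
    also have "\<dots> \<in> ?R \<times> ?R" by (rule subspace_add[OF subspace_Times[OF sR sR] f LR[OF w(1)]])
    finally have "cscale (1 / z) (cscale z w) \<in> ?R \<times> ?R" by (rule cscale_subspace[OF sR])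
    hence "w \<in> ?R \<times> ?R" using z(2) by (simp flip: cscale_mult)
    thus "f \<in> cshift L z ` ((D \<inter> ?R) \<times> (D \<inter> ?R))" using w by auto
  qed
  hence "z \<in> resolvent_set ?R (D \<inter> ?R) L" unfolding resolvent_set_def using K by (auto intro!: exI[of _ K])
  thus False using z(1) by (simp add: spectrum_def)
qed

text \<open>L + Q is the identity on N[L] and equals L on R[L]. For Re z \<le> 0 its resolvent is
  therefore composed of (z - 1)^(-1) on the first space and of the resolvent of the part on the
  second; this is \<open>H\<close> in the proof.\<close>

lemma spectrum_plus_projection:
  fixes D :: "'x::banach set" and Q :: "'x \<Rightarrow>\<^sub>L 'x"
  assumes lin: "linear_op D L" and Q: "\<And>x. Q x \<in> D" "\<And>x. L (Q x) = 0" "\<And>x. x - Q x \<in> range_space D L" "\<And>u. u \<in> D \<Longrightarrow> Q (L u) = 0"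
      "\<And>x. Q (Q x) = Q x"
    and sp: "\<And>z. z \<in> spectrum (range_space D L) (D \<inter> range_space D L) L \<Longrightarrow> 0 < Re z"
    and z: "z \<in> spectrum UNIV D (\<lambda>u. L u + Q u)"
  shows "0 < Re z"
proof (rule ccontr)
  assume neg: "\<not> 0 < Re z"
  hence z1: "z \<noteq> 1" by auto
  let ?R = "range_space D L"
  let ?E = "(D \<inter> ?R) \<times> (D \<inter> ?R)"
  let ?L' = "\<lambda>u. L u + Q u"
  define i where "i = inverse (z - 1)"
  have i: "cscale (z - 1) (cscale i w) = w" "cscale i (cscale (z - 1) w) = w" for w :: "'x \<times> 'x"
    using z1 by (simp_all add: i_def flip: cscale_mult)
  have "z \<in> resolvent_set ?R (D \<inter> ?R) L" using sp neg by (auto simp: spectrum_def)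
  then obtain K where bij: "bij_betw (cshift L z) ?E (?R \<times> ?R)" and K: "\<And>w. w \<in> ?E \<Longrightarrow> norm w \<le> K * norm (cshift L z w)"
    by (auto simp: resolvent_set_def)
  define P where "P w = w - dg Q w" for w
  define G where "G f = inv_into ?E (cshift L z) f" for f
  have G: "G f \<in> ?E" "cshift L z (G f) = f" if "f \<in> ?R \<times> ?R" for f
    using bij that unfolding G_def by (auto simp: bij_betw_def inv_into_into f_inv_into_f)
  have G': "G (cshift L z w) = w" if "w \<in> ?E" for w
    using bij that unfolding G_def by (intro inv_into_f_f) (auto simp: bij_betw_def)
  have P: "P w \<in> ?R \<times> ?R" for w using Q(3) by (cases w) (auto simp: P_def)
  have QR: "dg Q w = 0" if "w \<in> ?R \<times> ?R" for w using that Q(4) by (auto simp: range_space_def zero_prod_def)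
  have PD: "P w \<in> ?E" if "w \<in> D \<times> D" for w using that P[of w] linear_opD(3)[OF lin _ Q(1)] by (auto simp: P_def)
  have LQ: "map_prod L L (dg Q w) = 0" for w by (cases w) (simp add: Q(2) zero_prod_def)
  have QD: "dg Q w \<in> D \<times> D" for w using Q(1) by (cases w) simp
  have L': "map_prod ?L' ?L' w = map_prod L L w + dg Q w" for w by (cases w) simp
  have dec: "cshift ?L' z (dg Q u + w) = cscale (z - 1) (dg Q u) + cshift L z w" if w: "w \<in> ?E" for u w
  proof -
    have wD: "w \<in> D \<times> D" and wR: "w \<in> ?R \<times> ?R" using w by auto
    have "dg Q (dg Q u) = dg Q u" by (cases u) (simp add: Q(5))
    thus ?thesis using cx_linear(5)[OF lin QD[of u] wD] LQ[of u] QR[OF wR]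
      unfolding cshift_def L' by (simp add: blinfun.add_right cscale_add_right cscale_diff_left algebra_simps)
  qed
  have wsplit: "dg Q w + P w = w" for w by (simp add: P_def)
  have cs: "cshift ?L' z w = cscale (z - 1) (dg Q w) + cshift L z (P w)" if "w \<in> D \<times> D" for w
    using dec[OF PD[OF that], of w] unfolding wsplit .
  have shR: "cshift L z w \<in> ?R \<times> ?R" if "w \<in> ?E" for w using bij that by (auto simp: bij_betw_def)
  have dQ: "dg Q (cshift ?L' z w) = cscale (z - 1) (dg Q w)" if "w \<in> D \<times> D" for w
  proof -
    have "dg Q (dg Q w) = dg Q w" by (cases w) (simp add: Q(5))
    thus ?thesis unfolding cs[OF that] using QR[OF shR[OF PD[OF that]]] map_prod_cscale[of Q "z - 1" "dg Q w"]
      by (simp add: blinfun.add_right)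
  qed
  have dP: "P (cshift ?L' z w) = cshift L z (P w)" if "w \<in> D \<times> D" for w
    unfolding P_def[of "cshift ?L' z w"] dQ[OF that] by (simp add: cs[OF that])
  define H where "H f = cscale i (dg Q f) + G (P f)" for f
  have HQ: "H f = dg Q (cscale i f) + G (P f)" for f using map_prod_cscale[of Q i f] by (simp add: H_def)
  have H1: "H (cshift ?L' z w) = w" if "w \<in> D \<times> D" for w
    unfolding H_def dQ[OF that] dP[OF that] G'[OF PD[OF that]] i by (simp add: P_def)
  have HD: "H f \<in> D \<times> D" for f unfolding HQ by (rule cx_linear(1)[OF lin QD]) (use G(1)[OF P, of f] in auto)
  have H2: "cshift ?L' z (H f) = f" for f
    unfolding HQ dec[OF G(1)[OF P]] G(2)[OF P] using map_prod_cscale[of Q i f] i by (simp add: P_def)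
  have "bij_betw (cshift ?L' z) (D \<times> D) (UNIV \<times> UNIV)"
  proof (rule bij_betw_byWitness[where f' = H])
    show "H ` (UNIV \<times> UNIV) \<subseteq> D \<times> D" using HD by blast
  qed (simp_all add: H1 H2 del: split_paired_All)
  moreover have "norm w \<le> (norm (cblin i o\<^sub>L dg Q) + \<bar>K\<bar> * (1 + norm (dg Q))) * norm (cshift ?L' z w)" if w: "w \<in> D \<times> D" for w
  proof -
    let ?f = "cshift ?L' z w"
    have "norm (G (P ?f)) \<le> K * norm (P ?f)" using K[OF G(1)[OF P]] unfolding G(2)[OF P] .
    also have "\<dots> \<le> \<bar>K\<bar> * ((1 + norm (dg Q)) * norm ?f)"
    proof (rule mult_mono)
      show "norm (P ?f) \<le> (1 + norm (dg Q)) * norm ?f"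
        unfolding P_def using norm_triangle_ineq4[of ?f "dg Q ?f"] norm_blinfun[of "dg Q" ?f] by (simp add: distrib_right)
    qed auto
    finally have "norm (G (P ?f)) \<le> \<bar>K\<bar> * ((1 + norm (dg Q)) * norm ?f)" .
    moreover have "norm (cscale i (dg Q ?f)) \<le> norm (cblin i o\<^sub>L dg Q) * norm ?f"
      using norm_blinfun[of "cblin i o\<^sub>L dg Q" ?f] by simp
    ultimately have "norm (H ?f) \<le> (norm (cblin i o\<^sub>L dg Q) + \<bar>K\<bar> * (1 + norm (dg Q))) * norm ?f"
      unfolding H_def by (intro order_trans[OF norm_triangle_ineq]) (simp add: distrib_right mult.assoc)
    thus ?thesis unfolding H1[OF w] .
  qed
  ultimately have "z \<in> resolvent_set UNIV D ?L'" unfolding resolvent_set_def by blast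
  thus False using z by (simp add: spectrum_def)
qed

subsection \<open>The evolution problem\<close>

text \<open>\<open>A_bound\<close> lets the graph norm of L control A u, so that continuity of u and
  L u in X gives continuity into X_1.\<close>

locale evolution_frac = evolution D L "\<lambda>v. N (blinfun_apply J v)" J Z \<alpha> \<rho> lc K p
  for D :: "'x::banach set" and L N J Z \<alpha> \<rho> lc K p +
  fixes A :: "'x \<Rightarrow> 'x" and cA :: real
  assumes frac: "frac_dom D A \<alpha> = range J" "\<And>v. frac_power D A \<alpha> (J v) = v"
    and A_bound: "\<And>u. u \<in> D \<Longrightarrow> norm (A u) \<le> cA * (norm (L u) + norm u)"
begin

lemma frac_norm_J: "frac_norm D A \<alpha> (J v) = norm v"
  by (simp add: frac_norm_def frac(2))

lemma continuous_into_frac_iff: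
  assumes "\<And>t. t \<in> S \<Longrightarrow> u t = J (v t)"
  shows "continuous_into_frac D A \<alpha> S u \<longleftrightarrow> continuous_on S v"
proof -
  have "((\<lambda>s. frac_norm D A \<alpha> (u s - u t)) \<longlongrightarrow> 0) (at t within S) \<longleftrightarrow> (v \<longlongrightarrow> v t) (at t within S)"
    if t: "t \<in> S" for t
  proof -
    have "\<forall>\<^sub>F s in at t within S. frac_norm D A \<alpha> (u s - u t) = norm (v s - v t)" unfolding eventually_at_filter
      by (intro always_eventually) (auto simp: assms t frac_norm_J simp flip: blinfun.diff_right)
    hence "((\<lambda>s. frac_norm D A \<alpha> (u s - u t)) \<longlongrightarrow> 0) (at t within S) \<longleftrightarrow> ((\<lambda>s. norm (v s - v t)) \<longlongrightarrow> 0) (at t within S)"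
      by (rule tendsto_cong)
    thus ?thesis by (simp add: tendsto_norm_zero_iff Lim_null[symmetric])
  qed
  moreover have "u t \<in> frac_dom D A \<alpha>" if "t \<in> S" for t using assms[OF that] by (simp add: frac(1))
  ultimately show ?thesis unfolding continuous_into_frac_def continuous_on_def by blast
qed

lemma sol_of_solution_on:
  assumes u: "solution_on D A \<alpha> L N \<tau> u" and \<tau>: "0 < \<tau>"
  obtains v where "\<And>t. 0 \<le> t \<Longrightarrow> ereal t < \<tau> \<Longrightarrow> u t = J (v t)" "\<And>T. ereal T < \<tau> \<Longrightarrow> sol_on T v"
proof -
  have reg: "regular_upto D A \<alpha> T u" if "0 < T" "ereal T < \<tau>" for T using u that by (auto simp: solution_on_def)
  define v where "v t = inv J (u t)" for t
  have v: "u t = J (v t)" if t: "0 \<le> t" "ereal t < \<tau>" for t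
  proof -
    obtain T where T: "0 < T" "t \<le> T" "ereal T < \<tau>"
    proof (cases "t = 0")
      case True
      obtain T where "ereal 0 < ereal T" "ereal T < \<tau>" using ereal_dense2[of 0 \<tau>] \<tau> by (auto simp: zero_ereal_def)
      thus ?thesis using that[of T] True by simp
    qed (use that[of t] t in auto)
    hence "u t \<in> range J"
      using reg[OF T(1,3)] t by (auto simp: regular_upto_def continuous_into_frac_def frac(1))
    thus ?thesis by (simp add: v_def f_inv_into_f)
  qed
  have "sol_on T v" if T: "ereal T < \<tau>" for T
  proof (cases "0 < T")
    case True
    have ut: "u t = J (v t)" if "t \<in> {0..T}" for t
      using v[of t] that le_less_trans[OF _ T, of "ereal t"] by auto
    have uD: "u t \<in> D" if "0 < t" "t < T" for t
      using reg[OF True T] that by (auto simp: regular_upto_def continuous_into_frac_def frac_dom_def)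
    have "((\<lambda>s. J (v s)) has_vector_derivative - (L (J (v t)) + N (J (v t)))) (at t)" if t: "0 < t" "t < T" for t
    proof (rule has_vector_derivative_transform_within_open)
      have "(u has_vector_derivative - (L (u t) + N (u t))) (at t)"
        using u t less_trans[OF _ T, of "ereal t"] by (auto simp: solution_on_def)
      thus "(u has_vector_derivative - (L (J (v t)) + N (J (v t)))) (at t)" using ut[of t] t by simp
    qed (use t ut in \<open>auto intro: open_greaterThanLessThan\<close>)
    moreover have "continuous_on {0..T} v"
      using reg[OF True T] continuous_into_frac_iff[of "{0..T}" u v, OF ut] by (simp add: regular_upto_def)
    ultimately show ?thesis unfolding sol_on_def using uD ut by auto
  next
    case False
    hence "{0..T} \<subseteq> {0}" by auto
    thus ?thesis using False continuous_on_subset[OF continuous_on_sing[of 0 v]] by (auto simp: sol_on_def)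
  qed
  thus ?thesis using that v by blast
qed

text \<open>The cut-off equation is solved for all times but agrees with the original one only
  inside the ball; \<tau> marks how long the solution is known to stay there.\<close>

lemma solution_on_of_sol:
  assumes v: "continuous_on {0..} v" and D: "\<And>t. 0 < t \<Longrightarrow> J (v t) \<in> D" and g: "continuous_on UNIV g"
    "\<And>v. norm v \<le> \<rho> \<Longrightarrow> g v = - N (J v)" and Lc: "continuous_on {0<..} (\<lambda>t. L (J (v t)))"
    and d: "\<And>t. 0 < t \<Longrightarrow> ((\<lambda>s. J (v s)) has_vector_derivative (g (v t) - L (J (v t)))) (at t)"
    and b: "\<And>t. 0 \<le> t \<Longrightarrow> ereal t < \<tau> \<Longrightarrow> norm (v t) \<le> \<rho>"
  shows "solution_on D A \<alpha> L N \<tau> (\<lambda>t. J (v t))"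
  unfolding solution_on_def
proof (intro conjI allI impI)
  fix t :: real assume t: "0 < t"
  show "((\<lambda>s. J (v s)) has_vector_derivative - (L (J (v t)) + N (J (v t)))) (at t)" if "ereal t < \<tau>"
    using d[OF t] g(2)[OF b[of t]] t that by (simp add: add.commute[of "L (J (v t))"])
  have vc: "continuous_on S v" if "S \<subseteq> {0..}" for S using that by (rule continuous_on_subset[OF v])
  show "regular_upto D A \<alpha> t (\<lambda>t. J (v t))" unfolding regular_upto_def
  proof (intro conjI exI ballI)
    show "continuous_into_frac D A \<alpha> {0..t} (\<lambda>t. J (v t))" by (subst continuous_into_frac_iff) (auto intro: vc)
    show "continuous_into_frac D A 1 {0<..t} (\<lambda>t. J (v t))" unfolding continuous_into_frac_def
    proof (intro conjI ballI)
      fix s assume s: "s \<in> {0<..t}"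
      thus "J (v s) \<in> frac_dom D A 1" using D by (simp add: frac_dom_def)
      have "((\<lambda>r. L (J (v r))) \<longlongrightarrow> L (J (v s))) (at s within {0<..t})" "((\<lambda>r. J (v r)) \<longlongrightarrow> J (v s)) (at s within {0<..t})"
        using continuous_on_subset[OF Lc, of "{0<..t}"] vc[of "{0<..t}"] s
        by (simp_all add: continuous_on_def subset_iff blinfun.tendsto)
      hence "((\<lambda>r. cA * (norm (L (J (v r)) - L (J (v s))) + norm (J (v r) - J (v s)))) \<longlongrightarrow>
          cA * (norm (L (J (v s)) - L (J (v s))) + norm (J (v s) - J (v s)))) (at s within {0<..t})"
        by (intro tendsto_mult tendsto_add tendsto_norm tendsto_diff tendsto_const)
      hence lim: "((\<lambda>r. cA * (norm (L (J (v r)) - L (J (v s))) + norm (J (v r) - J (v s)))) \<longlongrightarrow> 0) (at s within {0<..t})"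
        by simp
      have "norm (frac_norm D A 1 (J (v r) - J (v s))) \<le> cA * (norm (L (J (v r)) - L (J (v s))) + norm (J (v r) - J (v s)))"
        if "0 < r" for r
        using A_bound[OF linear_opD(3)[OF lin D[OF that] D[of s]]] linear_opD(7)[OF lin D[OF that] D[of s]] s
        by (simp add: frac_norm_def frac_power_def)
      thus "((\<lambda>r. frac_norm D A 1 (J (v r) - J (v s))) \<longlongrightarrow> 0) (at s within {0<..t})"
        by (intro Lim_null_comparison[OF _ lim]) (auto simp: eventually_at_filter)
    qed
    show "continuous_on {0<..t} (\<lambda>t. g (v t) - L (J (v t)))"
      by (intro continuous_on_diff continuous_on_compose2[OF g(1) vc] continuous_on_subset[OF Lc]) auto
    show "((\<lambda>s. J (v s)) has_vector_derivative g (v s) - L (J (v s))) (at s within {0<..t})" if "s \<in> {0<..t}" for s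
      by (rule has_vector_derivative_at_within[OF d]) (use that in simp)
  qed
qed

lemma sol_on_of_cutoff:
  assumes v: "continuous_on {0..} v" and D: "\<And>t. 0 < t \<Longrightarrow> J (v t) \<in> D" and g: "\<And>v. norm v \<le> \<rho> \<Longrightarrow> g v = - N (J v)"
    and d: "\<And>t. 0 < t \<Longrightarrow> ((\<lambda>s. J (v s)) has_vector_derivative (g (v t) - L (J (v t)))) (at t)"
  shows "sol_on T v"
  unfolding sol_on_def
proof (intro conjI allI impI)
  show "continuous_on {0..T} v" by (rule continuous_on_subset[OF v]) auto
  fix t assume t: "0 < t \<and> t < T \<and> norm (v t) \<le> \<rho>"
  thus "J (v t) \<in> D" using D by simp
  show "((\<lambda>s. J (v s)) has_vector_derivative - (L (J (v t)) + N (J (v t)))) (at t)" using d[of t] g[of "v t"] t by (simp add: add.commute[of "L (J (v t))"])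
qed

lemma stable:
  assumes rng: "\<And>x. x - J (Z x) \<in> range_space D L" and part: "\<And>x. range_part D L x = x - J (Z x)"
    and sp: "\<forall>z \<in> spectrum (range_space D L) (D \<inter> range_space D L) L. 0 < Re z"
  shows "\<exists>\<rho>\<^sub>0>0. \<forall>a \<in> frac_dom D A \<alpha>. frac_norm D A \<alpha> a < \<rho>\<^sub>0 \<longrightarrow>
       (\<exists>u. solution_on D A \<alpha> L N \<infinity> u \<and> u 0 = a \<and>
          (\<forall>v. solution_on D A \<alpha> L N \<infinity> v \<and> v 0 = a \<longrightarrow> (\<forall>t\<ge>0. v t = u t)))" (is ?exist)
    "stable_zero D A \<alpha> L N"
    "\<exists>\<eta>>0. \<exists>c>0. \<exists>\<kappa>>0. \<forall>u. solution_on D A \<alpha> L N \<infinity> u \<and> frac_norm D A \<alpha> (u 0) < \<eta> \<longrightarrow>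
       (\<exists>w \<in> null_space D L. \<forall>t>0.
          frac_norm D A \<alpha> (u t - w) \<le> c * frac_norm D A \<alpha> (range_part D L (u 0)) * exp (- \<kappa> * t))" (is ?decay)
proof -
  have G: "0 < Re z" if "z \<in> spectrum UNIV D (\<lambda>u. L u + (J o\<^sub>L Z) u)" for z
    by (rule spectrum_plus_projection[OF lin _ _ _ _ _ sp[rule_format] that])
      (use Z Z(3)[OF Z(1,2)] rng in \<open>simp_all\<close>)
  obtain Li S Y S' Y' \<omega> C where sg: "analytic_semigroup D (\<lambda>u. L u + (J o\<^sub>L Z) u) J Li S Y S' Y' \<alpha> \<omega> C"
    by (rule semigroup[where G = "J o\<^sub>L Z"]) (erule G, rule that)
  interpret evolution_sg D L "\<lambda>v. N (J v)" J Z \<alpha> \<rho> lc K p "J o\<^sub>L Z" Li S Y S' Y' \<omega> C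
    by (intro evolution_sg.intro evolution_axioms sg)
  obtain \<epsilon> c \<kappa> where e: "0 < \<epsilon>" "\<epsilon> \<le> \<rho>" and c: "1 \<le> c" and \<kappa>: "0 < \<kappa>"
    and bound: "\<And>T v t. sol_on T v \<Longrightarrow> c * norm (v 0) < \<epsilon> \<Longrightarrow> t \<in> {0..T} \<Longrightarrow> norm (v t) \<le> c * norm (v 0)"
    and decay: "\<And>v. (\<And>T. sol_on T v) \<Longrightarrow> c * norm (v 0) < \<epsilon> \<Longrightarrow> \<exists>w. J w \<in> D \<and> L (J w) = 0 \<and>
      (\<forall>t\<ge>0. norm (v t - w) \<le> c * norm (v 0 - Z (J (v 0))) * exp (- \<kappa> * t))"
  proof (rule stable_case, goal_cases)
    case (2 \<epsilon> c \<kappa>) from 2(2-) show thesis by (rule 2(1))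
  qed simp
  have less: "c * x < \<epsilon>" if "x < \<epsilon> / c" for x using that c by (simp add: field_simps)
  show ?exist
  proof (intro exI[of _ "\<epsilon> / c"] conjI ballI impI)
    fix a assume a: "a \<in> frac_dom D A \<alpha>" "frac_norm D A \<alpha> a < \<epsilon> / c"
    then obtain v0 where v0: "a = J v0" "norm v0 < \<epsilon> / c" by (auto simp: frac(1) frac_norm_J)
    obtain v g where v: "continuous_on {0..} v" "v 0 = v0" "\<And>t. 0 < t \<Longrightarrow> J (v t) \<in> D" "continuous_on UNIV g"
      "\<And>v. norm v \<le> \<rho> \<Longrightarrow> g v = - N (J v)" "continuous_on {0<..} (\<lambda>t. L (J (v t)))"
      "\<And>t. 0 < t \<Longrightarrow> ((\<lambda>s. J (v s)) has_vector_derivative (g (v t) - L (J (v t)))) (at t)"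
      by (rule cutoff_solution) (rule that)
    have sol: "sol_on T v" for T by (rule sol_on_of_cutoff[OF v(1,3,5,7)])
    have small: "norm (v t) \<le> \<rho>" if "0 \<le> t" for t using bound[OF sol, of t t] less[OF v0(2)] that e v(2) by auto
    \<comment> \<open>The a priori bound holds for every solution with this initial value, so a
      competitor stays in the ball as well and \<open>sol_unique\<close> applies.\<close>
    have unique: "v' t = J (v t)" if v': "solution_on D A \<alpha> L N \<infinity> v'" "v' 0 = a" and t: "0 \<le> t" for v' t
    proof -
      obtain w where w: "\<And>t. 0 \<le> t \<Longrightarrow> ereal t < \<infinity> \<Longrightarrow> v' t = J (w t)" "\<And>T. ereal T < \<infinity> \<Longrightarrow> sol_on T w"
        by (rule sol_of_solution_on[OF v'(1)]) (simp, rule that)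
      have w0: "w 0 = v 0" using w(1)[of 0] v'(2) v0(1) v(2) injD[OF injJ] by simp
      have "w t = v t"
      proof (rule sol_unique[OF w(2) sol _ _ w0])
        show "norm (w s) \<le> \<rho>" if "s \<in> {0..t}" for s
          using bound[OF w(2), of t s] less[OF v0(2)] that e w0 v(2) by auto
      qed (use small t in auto)
      thus ?thesis using w(1)[OF t] by simp
    qed
    have "solution_on D A \<alpha> L N \<infinity> (\<lambda>t. J (v t))" by (rule solution_on_of_sol[OF v(1,3-) small])
    thus "\<exists>u. solution_on D A \<alpha> L N \<infinity> u \<and> u 0 = a \<and>
        (\<forall>v. solution_on D A \<alpha> L N \<infinity> v \<and> v 0 = a \<longrightarrow> (\<forall>t\<ge>0. v t = u t))"
      by (intro exI[of _ "\<lambda>t. J (v t)"] conjI allI impI) (simp_all add: v(2) v0(1) unique)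
  qed (use e c in simp)
  show "stable_zero D A \<alpha> L N" unfolding stable_zero_def
  proof (intro allI impI)
    fix \<epsilon>' :: real assume e': "0 < \<epsilon>'"
    \<comment> \<open>Aiming at \<epsilon>' / 2 leaves room for the strict inequality of the
      supremum.\<close>
    define d where "d = min \<epsilon> (\<epsilon>' / 2) / c"
    have d: "0 < d" "c * d \<le> \<epsilon>" "c * d \<le> \<epsilon>' / 2" using e e' c by (auto simp: d_def)
    show "\<exists>\<delta>>0. \<forall>\<tau>>0. \<forall>u. solution_on D A \<alpha> L N \<tau> u \<and> frac_norm D A \<alpha> (u 0) < \<delta> \<longrightarrow>
          bdd_above ((\<lambda>t. frac_norm D A \<alpha> (u t)) ` {t. 0 \<le> t \<and> ereal t < \<tau>}) \<and>
          (SUP t\<in>{t. 0 \<le> t \<and> ereal t < \<tau>}. frac_norm D A \<alpha> (u t)) < \<epsilon>'"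
    proof (intro exI[of _ d] conjI allI impI d(1))
      fix \<tau> :: ereal and u assume \<tau>: "0 < \<tau>" and u: "solution_on D A \<alpha> L N \<tau> u \<and> frac_norm D A \<alpha> (u 0) < d"
      obtain v where v: "\<And>t. 0 \<le> t \<Longrightarrow> ereal t < \<tau> \<Longrightarrow> u t = J (v t)" "\<And>T. ereal T < \<tau> \<Longrightarrow> sol_on T v"
        by (rule sol_of_solution_on[OF conjunct1[OF u] \<tau>]) (rule that)
      have 0: "ereal 0 < \<tau>" using \<tau> by (simp add: zero_ereal_def)
      have "norm (v 0) < d" using conjunct2[OF u] v(1)[OF order_refl 0] by (simp add: frac_norm_J)
      hence v0: "c * norm (v 0) < c * d" using c by simp
      have le: "frac_norm D A \<alpha> (u t) \<le> \<epsilon>' / 2" if "0 \<le> t" "ereal t < \<tau>" for t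
        using bound[OF v(2)[OF that(2)], of t] v0 d that by (simp add: v(1) frac_norm_J)
      show "bdd_above ((\<lambda>t. frac_norm D A \<alpha> (u t)) ` {t. 0 \<le> t \<and> ereal t < \<tau>})"
        by (rule bdd_aboveI2[of _ _ "\<epsilon>' / 2"]) (use le in simp)
      have "(SUP t\<in>{t. 0 \<le> t \<and> ereal t < \<tau>}. frac_norm D A \<alpha> (u t)) \<le> \<epsilon>' / 2"
        using le 0 by (intro cSUP_least) auto
      thus "(SUP t\<in>{t. 0 \<le> t \<and> ereal t < \<tau>}. frac_norm D A \<alpha> (u t)) < \<epsilon>'" using e' by simp
    qed
  qed
  have "\<forall>u. solution_on D A \<alpha> L N \<infinity> u \<and> frac_norm D A \<alpha> (u 0) < \<epsilon> / c \<longrightarrow>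
       (\<exists>w \<in> null_space D L. \<forall>t>0.
          frac_norm D A \<alpha> (u t - w) \<le> c * frac_norm D A \<alpha> (range_part D L (u 0)) * exp (- \<kappa> * t))"
  proof (intro allI impI)
    fix u assume u: "solution_on D A \<alpha> L N \<infinity> u \<and> frac_norm D A \<alpha> (u 0) < \<epsilon> / c"
    obtain v where v: "\<And>t. 0 \<le> t \<Longrightarrow> ereal t < \<infinity> \<Longrightarrow> u t = J (v t)" "\<And>T. ereal T < \<infinity> \<Longrightarrow> sol_on T v"
      by (rule sol_of_solution_on[OF conjunct1[OF u]]) (simp, rule that)
    have sol: "sol_on T v" for T by (rule v(2)) simp
    have "norm (v 0) < \<epsilon> / c" using u v(1)[of 0] by (simp add: frac_norm_J)
    from decay[OF sol less[OF this]] obtain w where w: "J w \<in> D" "L (J w) = 0"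
      "\<And>t. 0 \<le> t \<Longrightarrow> norm (v t - w) \<le> c * norm (v 0 - Z (J (v 0))) * exp (- \<kappa> * t)" by blast
    have "range_part D L (u 0) = J (v 0 - Z (J (v 0)))" using v(1)[of 0] by (simp add: part blinfun.diff_right)
    hence r: "frac_norm D A \<alpha> (range_part D L (u 0)) = norm (v 0 - Z (J (v 0)))" by (simp only: frac_norm_J)
    have "frac_norm D A \<alpha> (u t - J w) = norm (v t - w)" if "0 \<le> t" for t
      using v(1)[OF that] by (simp add: frac_norm_J flip: blinfun.diff_right)
    thus "\<exists>w \<in> null_space D L. \<forall>t>0. frac_norm D A \<alpha> (u t - w) \<le> c * frac_norm D A \<alpha> (range_part D L (u 0)) * exp (- \<kappa> * t)"
      unfolding r using w by (intro bexI[of _ "J w"]) (auto simp: null_space_def)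
  qed
  moreover have "0 < \<epsilon> / c" "0 < c" using e c by auto
  ultimately show ?decay using \<kappa> by blast
qed

lemma unstable:
  assumes r: "rresolv D L \<mu> r" "compact_op r" and DJ: "D \<subseteq> range J"
    and sp: "z\<^sub>0 \<in> spectrum (range_space D L) (D \<inter> range_space D L) L" "Re z\<^sub>0 < 0"
  shows "\<not> stable_zero D A \<alpha> L N"
proof
  assume stable: "stable_zero D A \<alpha> L N"
  let ?S = "(\<lambda>z. - Re z) ` spectrum UNIV D L"
  define \<beta> where "\<beta> = Sup ?S"
  obtain b where b: "\<And>z. z \<in> spectrum UNIV D L \<Longrightarrow> - b \<le> Re z" by (rule spectrum_bounded_below[OF lin ares]) (rule that)
  have bdd: "bdd_above ?S"
  proof (rule bdd_aboveI2)
    show "- Re z \<le> b" if "z \<in> spectrum UNIV D L" for z using b[OF that] by simp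
  qed
  have z0: "z\<^sub>0 \<in> spectrum UNIV D L" by (rule spectrum_part[OF lin sp(1)]) (use sp(2) in auto)
  hence "- Re z\<^sub>0 \<le> \<beta>" unfolding \<beta>_def by (intro cSup_upper bdd imageI)
  hence \<beta>: "0 < \<beta>" using sp(2) by simp
  have "\<beta> / p < \<beta>" using \<beta> pos by (simp add: divide_simps)
  then obtain z where z: "z \<in> spectrum UNIV D L" "\<beta> / p < - Re z"
    unfolding \<beta>_def using less_cSup_iff[OF _ bdd] z0 by blast
  define \<beta>' where "\<beta>' = - Re z"
  have \<beta>': "0 < \<beta>'" "\<beta> < p * \<beta>'" using z(2) \<beta> pos order.strict_trans[of 0 "\<beta> / p" \<beta>'] by (auto simp: \<beta>'_def field_simps)
  \<comment> \<open>Above \<beta>, so that L + s has its spectrum in the right half-plane, and below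
    p \<beta>', so that a forcing of order e^(p \<beta>' t) produces a response of the same
    order.\<close>
  define s where "s = (\<beta> + p * \<beta>') / 2"
  have s: "\<beta> < s" "s < p * \<beta>'" using \<beta>' by (simp_all add: s_def mult.commute[of p])
  have G: "0 < Re y" if "y \<in> spectrum UNIV D (\<lambda>u. L u + (s *\<^sub>R id_blinfun) u)" for y
  proof -
    have "y \<in> spectrum UNIV D (\<lambda>u. L u + s *\<^sub>R u)" using that by (simp add: blinfun.scaleR_left)
    from spectrum_shift[OF this] have "- Re (y - of_real s) \<le> \<beta>" unfolding \<beta>_def by (intro cSup_upper bdd imageI)
    thus ?thesis using s by simp
  qed
  obtain Li S Y S' Y' \<omega> C where sg: "analytic_semigroup D (\<lambda>u. L u + (s *\<^sub>R id_blinfun) u) J Li S Y S' Y' \<alpha> \<omega> C"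
    by (rule semigroup[where G = "s *\<^sub>R id_blinfun"]) (erule G, rule that)
  interpret evolution_sg D L "\<lambda>v. N (J v)" J Z \<alpha> \<rho> lc K p "s *\<^sub>R id_blinfun" Li S Y S' Y' \<omega> C
    by (intro evolution_sg.intro evolution_axioms sg)
  obtain w where w: "w \<in> D \<times> D" "w \<noteq> 0" "cshift L z w = 0" by (rule eigenvector_of_spectrum[OF lin r z(1)]) (rule that)
  \<comment> \<open>\<open>unstable_case\<close> requires a nonzero real part; if it vanishes, the
    eigenvector is multiplied by i.\<close>
  have "\<exists>x y. x \<in> D \<and> y \<in> D \<and> x \<noteq> 0 \<and> cshift L z (x, y) = 0"
  proof (cases "fst w = 0")
    case True
    then obtain y where y: "w = (0, y)" "y \<in> D" "y \<noteq> 0" using w by (cases w) (auto simp: zero_prod_def)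
    have "cshift L z (- y, 0) = 0"
      using w(3) y linear_opD(9)[OF lin] linear_opD(10)[OF lin y(2)] by (auto simp: cshift_def cscale_def zero_prod_def)
    hence "- y \<in> D \<and> 0 \<in> D \<and> - y \<noteq> 0 \<and> cshift L z (- y, 0) = 0" using y linear_opD(1,5)[OF lin] by simp
    thus ?thesis by (intro exI)
  next
    case False
    hence "fst w \<in> D \<and> snd w \<in> D \<and> fst w \<noteq> 0 \<and> cshift L z (fst w, snd w) = 0" using w by (simp add: mem_Times_iff)
    thus ?thesis by (intro exI)
  qed
  then obtain x y where xy: "x \<in> D" "y \<in> D" "x \<noteq> 0" "cshift L z (x, y) = 0" by blast
  obtain a b where ab: "x = J a" "y = J b" using DJ xy(1,2) by blast
  have La: "L (J a) = - \<beta>' *\<^sub>R J a - Im z *\<^sub>R J b" and Lb: "L (J b) = - \<beta>' *\<^sub>R J b + Im z *\<^sub>R J a"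
    using xy(4) unfolding ab by (simp_all add: cshift_def cscale_def zero_prod_def \<beta>'_def)
  have Gs: "(s *\<^sub>R id_blinfun) x = s *\<^sub>R x" for x :: 'x by (simp add: blinfun.scaleR_left)
  have JD': "J a \<in> D" "J b \<in> D" "a \<noteq> 0" using xy ab by auto
  obtain e where e: "0 < e" and ex: "\<And>d. 0 < d \<Longrightarrow> \<exists>T>0. \<exists>v0. norm v0 < d \<and>
    (\<forall>v. sol_on T v \<longrightarrow> v 0 = v0 \<longrightarrow> e \<le> norm (v T) \<and> (\<forall>t\<in>{0..T}. norm (v t) < \<rho>))"
    by (rule unstable_case[OF Gs JD' La Lb \<beta>'(1) s(2)]) (rule that)
  from stable[unfolded stable_zero_def, THEN spec, THEN mp, OF e]
  obtain d where d: "0 < d" and st: "\<forall>\<tau>>0. \<forall>u. solution_on D A \<alpha> L N \<tau> u \<and> frac_norm D A \<alpha> (u 0) < d \<longrightarrow>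
      bdd_above ((\<lambda>t. frac_norm D A \<alpha> (u t)) ` {t. 0 \<le> t \<and> ereal t < \<tau>}) \<and>
      (SUP t\<in>{t. 0 \<le> t \<and> ereal t < \<tau>}. frac_norm D A \<alpha> (u t)) < e" by (elim exE conjE) (rule that)
  obtain T v0 where T: "0 < T" "norm v0 < d"
    and far: "\<And>v. sol_on T v \<Longrightarrow> v 0 = v0 \<Longrightarrow> e \<le> norm (v T) \<and> (\<forall>t\<in>{0..T}. norm (v t) < \<rho>)" using ex[OF d] by blast
  obtain v g where v: "continuous_on {0..} v" "v 0 = v0" "\<And>t. 0 < t \<Longrightarrow> J (v t) \<in> D" "continuous_on UNIV g"
    "\<And>v. norm v \<le> \<rho> \<Longrightarrow> g v = - N (J v)" "continuous_on {0<..} (\<lambda>t. L (J (v t)))"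
    "\<And>t. 0 < t \<Longrightarrow> ((\<lambda>s. J (v s)) has_vector_derivative (g (v t) - L (J (v t)))) (at t)"
    by (rule cutoff_solution) (rule that)
  have sol: "sol_on T v" by (rule sol_on_of_cutoff[OF v(1,3,5,7)])
  have vT: "e \<le> norm (v T)" "\<And>t. t \<in> {0..T} \<Longrightarrow> norm (v t) < \<rho>" using far[OF sol v(2)] by auto
  \<comment> \<open>After T the solution of the cut-off equation may leave the ball and cease to
    solve the original one, so it is used on a bounded interval.\<close>
  have "solution_on D A \<alpha> L N (ereal T) (\<lambda>t. J (v t))"
  proof (rule solution_on_of_sol[OF v(1,3-)])
    show "norm (v t) \<le> \<rho>" if "0 \<le> t" "ereal t < ereal T" for t using less_imp_le[OF vT(2)[of t]] that by simp
  qed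
  hence S: "bdd_above ((\<lambda>t. norm (v t)) ` {0..<T})" "(SUP t\<in>{0..<T}. norm (v t)) < e"
    using st[THEN spec, of "ereal T", THEN mp, THEN spec, of "\<lambda>t. J (v t)"] T v(2)
    by (simp_all add: frac_norm_J atLeastLessThan_def atLeast_def lessThan_def Collect_conj_eq)
  have cl: "closure {0..<T} = {0..T}" using T by simp
  \<comment> \<open>The supremum extends over times before T only; continuity carries the bound to
    T.\<close>
  have "norm (v T) \<le> (SUP t\<in>{0..<T}. norm (v t))"
  proof (rule continuous_le_on_closure[of "{0..<T}" "\<lambda>t. norm (v t)"])
    show "continuous_on (closure {0..<T}) (\<lambda>t. norm (v t))"
      unfolding cl by (intro continuous_intros continuous_on_subset[OF v(1)]) auto
    show "T \<in> closure {0..<T}" unfolding cl using T by simp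
    show "norm (v t) \<le> (SUP t\<in>{0..<T}. norm (v t))" if "t \<in> {0..<T}" for t by (rule cSUP_upper[OF that S(1)])
  qed
  thus False using S(2) vT(1) by simp
qed

end

section \<open>From the hypotheses on A, B and N to the transformed equation\<close>

lemma powr_le_self:
  fixes x :: real
  assumes "0 \<le> x" "x \<le> 1" "1 \<le> k"
  shows "x powr k \<le> x"
  using powr_mono'[of 1 k x] assms by (cases "x = 0") auto

text \<open>A r is bounded, so r = A^(-1) (A r) is a bounded map followed by a compact one.\<close>

lemma compact_op_resolvent:
  fixes DA :: "'x::banach set" and r :: "'x \<Rightarrow>\<^sub>L 'x"
  assumes lin: "linear_op DA A" and ci: "compact_inverse DA A" and r: "\<And>x. r x \<in> DA" "\<And>x. norm (A (r x)) \<le> c * norm x"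
  shows "compact_op r"
  unfolding compact_op_def
proof (intro allI impI)
  fix s :: "nat \<Rightarrow> 'x" assume s: "\<forall>n. norm (s n) \<le> 1"
  define b where "b = \<bar>c\<bar> + 1"
  have b: "0 < b" by (simp add: b_def)
  have ba: "norm (A (r (s n))) \<le> b" for n
  proof -
    have "c * norm (s n) \<le> b * 1" using s by (intro mult_mono) (auto simp: b_def)
    thus ?thesis using r(2)[of "s n"] by simp
  qed
  let ?K = "closure (inv_into DA A ` cball 0 1)"
  have inj: "inj_on A DA" and K: "compact ?K" using ci by (auto simp: compact_inverse_def bij_betw_def)
  have "r (s n) /\<^sub>R b \<in> ?K" for n
  proof -
    have "inv_into DA A (A (r (s n) /\<^sub>R b)) = r (s n) /\<^sub>R b"
      by (rule inv_into_f_f[OF inj linear_opD(4)[OF lin r(1)]])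
    moreover have "norm (A (r (s n) /\<^sub>R b)) \<le> 1"
      using ba[of n] b by (simp add: linear_opD(8)[OF lin r(1)] divide_simps)
    ultimately have "r (s n) /\<^sub>R b \<in> inv_into DA A ` cball 0 1" by (metis image_eqI mem_cball_0)
    thus ?thesis by (rule subsetD[OF closure_subset])
  qed
  then obtain l q where q: "strict_mono q" "((\<lambda>n. r (s n) /\<^sub>R b) \<circ> q) \<longlonglongrightarrow> l"
    using K unfolding compact_def by metis
  have "(\<lambda>n. b *\<^sub>R (((\<lambda>n. r (s n) /\<^sub>R b) \<circ> q) n)) \<longlonglongrightarrow> b *\<^sub>R l" by (intro tendsto_intros q(2))
  hence "(\<lambda>n. r (s (q n))) \<longlonglongrightarrow> b *\<^sub>R l" using b by simp
  thus "\<exists>l q. strict_mono q \<and> (\<lambda>n. r (s (q n))) \<longlonglongrightarrow> l" using q(1) by blast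
qed

text \<open>T = 1 - \<mu> r = L r has the kernel and the range of L, and (H2) is the condition of
  \<open>kernel_projection\<close>. On the kernel Q = \<mu> r Q = J (\<mu> W Q), which gives the
  factor \<open>Z\<close> with values in the coordinate space.\<close>

lemma null_projection:
  fixes D :: "'x::banach set" and r J W :: "'x \<Rightarrow>\<^sub>L 'x"
  assumes lin: "linear_op D L" and r: "rresolv D L \<mu> r" "compact_op r" "\<And>x. r x = J (W x)"
    and tr: "null_space D L \<inter> range_space D L = {0}"
  obtains Z :: "'x \<Rightarrow>\<^sub>L 'x" where "\<And>x. J (Z x) \<in> D" "\<And>x. L (J (Z x)) = 0" "\<And>u. u \<in> D \<Longrightarrow> L u = 0 \<Longrightarrow> J (Z u) = u"
    "\<And>u. u \<in> D \<Longrightarrow> Z (L u) = 0" "\<And>x. x - J (Z x) \<in> range_space D L"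
proof -
  define T where "T = id_blinfun - \<mu> *\<^sub>R r"
  have Tx: "T x = x - \<mu> *\<^sub>R r x" "T x = L (r x)" for x
    using rresolvD(2)[OF r(1), of x] by (simp_all add: T_def blinfun.diff_left blinfun.scaleR_left algebra_simps)
  interpret compact_perturbation "\<mu> *\<^sub>R r" T
  proof
    have "compact_op ((\<mu> *\<^sub>R id_blinfun) o\<^sub>L r)" by (rule compact_op_compose_left[OF r(2)])
    moreover have "(\<mu> *\<^sub>R id_blinfun) o\<^sub>L r = \<mu> *\<^sub>R r" by (rule blinfun_eqI) (simp add: blinfun.scaleR_left)
    ultimately show "compact_op (\<mu> *\<^sub>R r)" by simp
  qed (simp add: Tx(1) blinfun.scaleR_left)
  have ker: "u \<in> D" "L u = 0" if "T u = 0" for u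
  proof -
    have u: "u = \<mu> *\<^sub>R r u" using that by (simp add: Tx(1))
    show "u \<in> D" by (subst u) (intro linear_opD(4)[OF lin] rresolvD(1)[OF r(1)])
    have "L u = \<mu> *\<^sub>R L (r u)" by (subst u) (rule linear_opD(8)[OF lin rresolvD(1)[OF r(1)]])
    thus "L u = 0" using that by (simp add: Tx(2))
  qed
  have ker': "T u = 0" if "u \<in> D" "L u = 0" for u
    using rresolvD(3)[OF r(1) that(1)] that(2) by (simp add: Tx(1) blinfun.scaleR_right)
  have rT: "T x \<in> range_space D L" for x unfolding Tx(2) range_space_def using rresolvD(1)[OF r(1)] by blast
  have LT: "L u = T (\<mu> *\<^sub>R u + L u)" if "u \<in> D" for u by (simp add: Tx(2) rresolvD(3)[OF r(1) that])
  have inj: "T x = 0" if "T (T x) = 0" for x using ker[OF that] rT[of x] tr by (auto simp: null_space_def)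
  obtain Q :: "'x \<Rightarrow>\<^sub>L 'x" where Q: "\<And>x. T (Q x) = 0" "\<And>x. x - Q x \<in> range T" "\<And>x. T x = 0 \<Longrightarrow> Q x = x" "\<And>x. Q (T x) = 0"
    by (rule kernel_projection) (erule inj, rule that)
  define Z where "Z = \<mu> *\<^sub>R (W o\<^sub>L Q)"
  have JZ: "J (Z x) = Q x" for x
    using Q(1)[of x] r(3)[of "Q x"] by (simp add: Z_def Tx(1) blinfun.scaleR_left blinfun.scaleR_right)
  show ?thesis
  proof (rule that[of Z])
    show "Z (L u) = 0" if "u \<in> D" for u
      using Q(4)[of "\<mu> *\<^sub>R u + L u"] LT[OF that] by (simp add: Z_def blinfun.scaleR_left blinfun.zero_right)
    show "x - J (Z x) \<in> range_space D L" for x using Q(2)[of x] rT by (auto simp: JZ)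
  qed (simp_all add: JZ ker Q ker')
qed

lemma range_part_eq:
  fixes D :: "'x::banach set"
  assumes lin: "linear_op D L" and tr: "null_space D L \<inter> range_space D L = {0}"
    and "x - q \<in> range_space D L" "q \<in> null_space D L"
  shows "range_part D L x = x - q"
  unfolding range_part_def
proof (rule the_equality)
  show "x - q \<in> range_space D L \<and> x - (x - q) \<in> null_space D L" using assms(3,4) by simp
  fix v assume v: "v \<in> range_space D L \<and> x - v \<in> null_space D L"
  have "(x - q) - v \<in> range_space D L" using subspace_diff[OF subspace_range_space[OF lin] assms(3)] v by blast
  moreover have "(x - v) - q \<in> null_space D L"
    using v assms(4) linear_opD(3,7)[OF lin, of "x - v" q] by (simp add: null_space_def)
  ultimately have "(x - q) - v \<in> null_space D L \<inter> range_space D L" by (simp add: algebra_simps)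
  thus "v = x - q" using tr by simp
qed

text \<open>Boundedness of J and of Z J turns (H5) into powers of |v| and of |w|, where w = v - Z J
  v. One factor |w| is kept: it makes the nonlinearity vanish on N[L].\<close>

lemma nonlinearity_bound:
  fixes D :: "'x::banach set" and J Z :: "'x \<Rightarrow>\<^sub>L 'x"
  assumes Z: "\<And>x. J (Z x) \<in> null_space D L" "\<And>x. x - J (Z x) \<in> range_space D L"
    and frac: "frac_dom D A \<alpha> = range J" "\<And>v. frac_norm D A \<alpha> (J v) = norm v"
    and H5: "\<exists>c>0. \<exists>\<kappa>\<^sub>1\<ge>1. \<exists>\<kappa>\<^sub>2\<ge>1. \<exists>\<kappa>\<^sub>3>1. \<forall>u\<^sub>0 \<in> null_space D L. \<forall>u\<^sub>1 \<in> range_space D L.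
      u\<^sub>0 + u\<^sub>1 \<in> frac_dom D A \<alpha> \<longrightarrow> norm (N (u\<^sub>0 + u\<^sub>1)) \<le>
        c * ((norm u\<^sub>0 + norm u\<^sub>1 powr \<kappa>\<^sub>1) * norm u\<^sub>1 powr \<kappa>\<^sub>2 + frac_norm D A \<alpha> u\<^sub>1 powr \<kappa>\<^sub>3)"
  obtains \<rho> K p where "0 < \<rho>" "0 < K" "1 < p"
    "\<And>v. norm v \<le> \<rho> \<Longrightarrow> norm (N (J v)) \<le> K * norm v powr (p - 1) * norm (v - Z (J v))"
proof -
  obtain c \<kappa>\<^sub>1 \<kappa>\<^sub>2 \<kappa>\<^sub>3 where c: "0 < c" and k: "1 \<le> \<kappa>\<^sub>1" "1 \<le> \<kappa>\<^sub>2" "1 < \<kappa>\<^sub>3"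
    and h: "\<And>u\<^sub>0 u\<^sub>1. u\<^sub>0 \<in> null_space D L \<Longrightarrow> u\<^sub>1 \<in> range_space D L \<Longrightarrow> u\<^sub>0 + u\<^sub>1 \<in> frac_dom D A \<alpha> \<Longrightarrow> norm (N (u\<^sub>0 + u\<^sub>1)) \<le>
        c * ((norm u\<^sub>0 + norm u\<^sub>1 powr \<kappa>\<^sub>1) * norm u\<^sub>1 powr \<kappa>\<^sub>2 + frac_norm D A \<alpha> u\<^sub>1 powr \<kappa>\<^sub>3)"
    using H5 by metis
  define M1 where "M1 = norm ((J o\<^sub>L Z) o\<^sub>L J)"
  define M2 where "M2 = 1 + norm (Z o\<^sub>L J)"
  define MJ where "MJ = norm J"
  have M: "0 \<le> M1" "1 \<le> M2" "0 \<le> MJ" by (auto simp: M1_def M2_def MJ_def)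
  \<comment> \<open>Makes |w| and |J w| at most 1, so that the exponents \<kappa>1 and \<kappa>2 may
    be lowered to 1 and \<kappa>3 to p.\<close>
  define \<rho> where "\<rho> = 1 / (M2 * (1 + MJ))"
  \<comment> \<open>The mixed terms give |v| |w|, which is at most |v|^(p-1) |w| because p \<le> 2
    and |v| \<le> 1; the last term gives |w|^p.\<close>
  define p where "p = min 2 \<kappa>\<^sub>3"
  define K where "K = c * ((M1 + MJ * M2) * MJ + M2 powr (p - 1))"
  have p: "1 < p" "p \<le> 2" "p \<le> \<kappa>\<^sub>3" using k by (auto simp: p_def)
  have "1 * 1 \<le> M2 * (1 + MJ)" using M by (intro mult_mono) auto
  hence \<rho>: "0 < \<rho>" "\<rho> \<le> 1" "M2 * (1 + MJ) * \<rho> = 1" by (auto simp: \<rho>_def)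
  have "0 < M2 powr (p - 1)" using M by simp
  hence K: "0 < K" using c M by (auto simp: K_def intro!: mult_pos_pos add_nonneg_pos)
  have "norm (N (J v)) \<le> K * norm v powr (p - 1) * norm (v - Z (J v))" if v: "norm v \<le> \<rho>" for v
  proof -
    define w where "w = v - Z (J v)"
    have w: "norm w \<le> M2 * norm v"
      using norm_blinfun[of "Z o\<^sub>L J" v] norm_triangle_ineq4[of v "Z (J v)"] by (simp add: w_def M2_def distrib_right)
    have u0: "norm (J (Z (J v))) \<le> M1 * norm v" using norm_blinfun[of "(J o\<^sub>L Z) o\<^sub>L J" v] by (simp add: M1_def)
    have u1: "norm (J w) \<le> MJ * norm w" unfolding MJ_def by (rule norm_blinfun)
    have Mv: "M2 * norm v \<le> M2 * \<rho>" using v M by (intro mult_left_mono) auto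
    have "M2 * \<rho> + MJ * (M2 * \<rho>) = 1" using \<rho>(3) by (simp add: algebra_simps)
    moreover have "0 \<le> M2 * \<rho>" "0 \<le> MJ * (M2 * \<rho>)" using M \<rho> by simp_all
    moreover have "MJ * norm w \<le> MJ * (M2 * \<rho>)" using order_trans[OF w Mv] M by (intro mult_left_mono) auto
    ultimately have w1: "norm w \<le> 1" "norm (J w) \<le> 1" using order_trans[OF w Mv] u1 by auto
    have v1: "norm v \<le> norm v powr (p - 1)"
      using powr_mono'[of "p - 1" 1 "norm v"] p v \<rho> by (cases "v = 0") auto
    have Jv: "J (Z (J v)) + J w = J v" by (simp add: w_def blinfun.diff_right)
    have "J w \<in> range_space D L" using Z(2)[of "J v"] by (simp add: w_def blinfun.diff_right)
    from h[OF Z(1)[of "J v"] this] have "norm (N (J v)) \<le>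
        c * ((norm (J (Z (J v))) + norm (J w) powr \<kappa>\<^sub>1) * norm (J w) powr \<kappa>\<^sub>2 + norm w powr \<kappa>\<^sub>3)"
      unfolding Jv frac by simp
    also have "\<dots> \<le> c * ((M1 * norm v + MJ * (M2 * norm v)) * (MJ * norm w) + (M2 * norm v) powr (p - 1) * norm w)"
    proof (intro mult_left_mono add_mono mult_mono)
      have "norm (J w) powr \<kappa>\<^sub>1 \<le> norm (J w)" "norm (J w) powr \<kappa>\<^sub>2 \<le> norm (J w)"
        by (intro powr_le_self w1 k norm_ge_zero)+
      moreover have "MJ * norm w \<le> MJ * (M2 * norm v)" using w M by (intro mult_left_mono) auto
      ultimately show "norm (J w) powr \<kappa>\<^sub>1 \<le> MJ * (M2 * norm v)" "norm (J w) powr \<kappa>\<^sub>2 \<le> MJ * norm w" using u1 by auto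
      have "norm w powr \<kappa>\<^sub>3 \<le> norm w powr p" using powr_mono'[OF p(3), of "norm w"] w1 by simp
      also have "norm w powr p = norm w powr (p - 1) * norm w" using powr_mult_base[of "norm w" "p - 1"] by (simp add: mult.commute)
      also have "\<dots> \<le> (M2 * norm v) powr (p - 1) * norm w" using w p by (intro mult_right_mono powr_mono2) auto
      finally show "norm w powr \<kappa>\<^sub>3 \<le> (M2 * norm v) powr (p - 1) * norm w" .
    qed (use u0 c M in auto)
    also have "\<dots> = c * ((M1 + MJ * M2) * MJ * norm v + M2 powr (p - 1) * norm v powr (p - 1)) * norm w"
      using M by (simp add: powr_mult algebra_simps)
    also have "\<dots> \<le> c * ((M1 + MJ * M2) * MJ * norm v powr (p - 1) + M2 powr (p - 1) * norm v powr (p - 1)) * norm w"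
      using c M v1 by (intro mult_right_mono mult_left_mono add_mono) auto
    also have "\<dots> = K * norm v powr (p - 1) * norm w" by (simp add: K_def algebra_simps)
    finally show ?thesis by (simp add: w_def)
  qed
  thus ?thesis by (rule that[OF \<rho>(1) K p(1)])
qed

theorem theorem1p1:
  fixes DA DB :: "'x::banach set"
    and A B L N :: "'x \<Rightarrow> 'x"
    and \<alpha> c\<^sub>1 :: real
    and m :: nat
  assumes alpha: "0 \<le> \<alpha>" "\<alpha> < 1"
    and A_sectorial: "sectorial DA A"
    and A_compact_inverse: "compact_inverse DA A"
    and A_spectrum: "\<forall>z \<in> spectrum UNIV DA A. 0 < Re z"
    and B_linear: "linear_op DB B"
    and B_domain: "DA \<subseteq> DB"
    and B_bound: "\<forall>u\<in>DA. norm (B u) \<le> c\<^sub>1 * frac_norm DA A \<alpha> u"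
    and L_eq: "L = (\<lambda>u. A u + B u)"
    and H1: "dim (null_space DA L) = m" "m \<ge> 1"
    and H1_finite: "\<exists>S. finite S \<and> null_space DA L \<subseteq> span S"
    and H2: "null_space DA L \<inter> range_space DA L = {0}"
    and H3: "spectrum UNIV DA L \<inter> {z. Re z = 0} = {0}"
    and H4: "\<exists>c>0. \<exists>U. open U \<and> 0 \<in> U \<and>
               (\<forall>u\<^sub>1 \<in> frac_dom DA A \<alpha> \<inter> U. \<forall>u\<^sub>2 \<in> frac_dom DA A \<alpha> \<inter> U.
                  norm (N u\<^sub>1 - N u\<^sub>2) \<le> c * frac_norm DA A \<alpha> (u\<^sub>1 - u\<^sub>2))"
    and H5: "\<exists>c>0. \<exists>\<kappa>\<^sub>1\<ge>1. \<exists>\<kappa>\<^sub>2\<ge>1. \<exists>\<kappa>\<^sub>3>1.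
               \<forall>u\<^sub>0 \<in> null_space DA L. \<forall>u\<^sub>1 \<in> range_space DA L.
                 u\<^sub>0 + u\<^sub>1 \<in> frac_dom DA A \<alpha> \<longrightarrow>
                 norm (N (u\<^sub>0 + u\<^sub>1)) \<le>
                   c * ((norm u\<^sub>0 + norm u\<^sub>1 powr \<kappa>\<^sub>1) * norm u\<^sub>1 powr \<kappa>\<^sub>2
                        + frac_norm DA A \<alpha> u\<^sub>1 powr \<kappa>\<^sub>3)"
  shows "((\<forall>z \<in> spectrum (range_space DA L) (DA \<inter> range_space DA L) L. 0 < Re z) \<longrightarrow>
            (\<exists>\<rho>\<^sub>0>0. \<forall>a \<in> frac_dom DA A \<alpha>. frac_norm DA A \<alpha> a < \<rho>\<^sub>0 \<longrightarrow>
               (\<exists>u. solution_on DA A \<alpha> L N \<infinity> u \<and> u 0 = a \<and>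
                  (\<forall>v. solution_on DA A \<alpha> L N \<infinity> v \<and> v 0 = a \<longrightarrow> (\<forall>t\<ge>0. v t = u t)))) \<and>
            stable_zero DA A \<alpha> L N \<and>
            (\<exists>\<eta>>0. \<exists>c>0. \<exists>\<kappa>>0. \<forall>u.
               solution_on DA A \<alpha> L N \<infinity> u \<and> frac_norm DA A \<alpha> (u 0) < \<eta> \<longrightarrow>
               (\<exists>w \<in> null_space DA L. \<forall>t>0.
                  frac_norm DA A \<alpha> (u t - w)
                    \<le> c * frac_norm DA A \<alpha> (range_part DA L (u 0)) * exp (- \<kappa> * t)))) \<and>
         ((\<exists>z \<in> spectrum (range_space DA L) (DA \<inter> range_space DA L) L. Re z < 0) \<longrightarrow>
            \<not> stable_zero DA A \<alpha> L N)"
proof -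
  have lin_A: "linear_op DA A" and dense: "closure DA = UNIV" using A_sectorial by (auto simp: sectorial_def)
  have sD: "subspace DA" using lin_A by (simp add: linear_op_def)
  obtain J :: "'x \<Rightarrow>\<^sub>L 'x" where J: "inj J" "frac_dom DA A \<alpha> = range J" "\<And>v. frac_power DA A \<alpha> (J v) = v"
    "ares DA A J \<alpha>" "\<And>u. u \<in> DA \<Longrightarrow> J u \<in> DA" by (rule frac_space[OF A_sectorial A_spectrum alpha]) (rule that)
  have fn: "frac_norm DA A \<alpha> (J v) = norm v" for v by (simp add: frac_norm_def J(3))
  have lin_B: "linear_op DA B" using B_linear B_domain sD unfolding linear_op_def by (meson subsetD)
  have Bb: "norm (B (J v)) \<le> c\<^sub>1 * norm v" if "J v \<in> DA" for v using B_bound that fn by auto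
  have lin: "linear_op DA L" using lin_A lin_B unfolding linear_op_def L_eq by (simp add: algebra_simps)
  have ares: "ares DA L J \<alpha>" by (rule ares_perturb[OF lin_A J(4) alpha lin_B Bb]) (simp_all add: L_eq)
  \<comment> \<open>A real point at which the asymptotic bounds apply. \<open>W\<close> is the real
    part of the factor Y of the resolvent, and r = J W shows that the domain lies in
    X_\<alpha>.\<close>
  obtain \<mu> and r W :: "'x \<Rightarrow>\<^sub>L 'x" where r: "rresolv DA L \<mu> r" "\<And>x. r x = J (W x)"
  proof -
    obtain \<delta> b M where d: "0 < \<delta>" "0 < b"
      and res: "\<And>\<zeta>. b \<le> cmod \<zeta> \<Longrightarrow> - \<delta> * \<bar>Im \<zeta>\<bar> \<le> Re \<zeta> \<Longrightarrow> res_bd DA L J \<alpha> M \<zeta> (cmod \<zeta>)"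
      using ares unfolding ares_def by blast
    have "res_bd DA L J \<alpha> M (of_real b) (cmod (of_real b))" by (rule res) (use d in auto)
    then obtain R Y where R: "resolv DA L (of_real b) R" "R = dg J o\<^sub>L Y" unfolding res_bd_def by blast
    show thesis
      by (rule that[OF rresolv_of_resolv(1)[OF lin R(1)], of "re_part Y"]) (simp add: re_part_apply R(2) map_prod_def split_beta)
  qed
  \<comment> \<open>B u = B J W (\<mu> u + L u) is bounded by the graph norm of L, hence so is A u =
    L u - B u.\<close>
  have A_bd: "norm (A u) \<le> (1 + \<bar>c\<^sub>1\<bar> * norm W * (\<bar>\<mu>\<bar> + 1)) * (norm (L u) + norm u)" if u: "u \<in> DA" for u
  proof -
    have "u = J (W (\<mu> *\<^sub>R u + L u))" using rresolvD(3)[OF r(1) u] r(2) by simp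
    hence "norm (B u) \<le> c\<^sub>1 * norm (W (\<mu> *\<^sub>R u + L u))" using Bb u by metis
    also have "\<dots> \<le> \<bar>c\<^sub>1\<bar> * (norm W * norm (\<mu> *\<^sub>R u + L u))" by (intro mult_mono norm_blinfun) auto
    also have "norm (\<mu> *\<^sub>R u + L u) \<le> (\<bar>\<mu>\<bar> + 1) * (norm (L u) + norm u)"
      using norm_triangle_ineq[of "\<mu> *\<^sub>R u" "L u"] mult_nonneg_nonneg[OF abs_ge_zero norm_ge_zero, of \<mu> "L u"] norm_ge_zero[of u]
      unfolding distrib_left distrib_right mult_1 norm_scaleR by linarith
    finally have "norm (B u) \<le> \<bar>c\<^sub>1\<bar> * norm W * (\<bar>\<mu>\<bar> + 1) * (norm (L u) + norm u)"
      by (simp add: mult.assoc mult_left_mono)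
    moreover have "norm (A u) \<le> norm (L u) + norm (B u)" using norm_triangle_ineq4[of "L u" "B u"] by (simp add: L_eq)
    ultimately show ?thesis using norm_ge_zero[of u] unfolding distrib_right[of 1] mult_1 by linarith
  qed
  define cA where "cA = 1 + \<bar>c\<^sub>1\<bar> * norm W * (\<bar>\<mu>\<bar> + 1)"
  have compact: "compact_op r"
  proof (rule compact_op_resolvent[OF lin_A A_compact_inverse rresolvD(1)[OF r(1)]])
    fix x
    have "L (r x) = x - \<mu> *\<^sub>R r x" using rresolvD(2)[OF r(1), of x] by (simp add: algebra_simps)
    hence "norm (L (r x)) \<le> norm x + \<bar>\<mu>\<bar> * norm (r x)" using norm_triangle_ineq4[of x "\<mu> *\<^sub>R r x"] by simp
    moreover have "\<bar>\<mu>\<bar> * norm (r x) \<le> \<bar>\<mu>\<bar> * (norm r * norm x)" by (intro mult_left_mono norm_blinfun) simp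
    ultimately have "norm (L (r x)) + norm (r x) \<le> (1 + \<bar>\<mu>\<bar> * norm r + norm r) * norm x"
      using norm_blinfun[of r x] by (simp add: algebra_simps)
    hence "cA * (norm (L (r x)) + norm (r x)) \<le> cA * ((1 + \<bar>\<mu>\<bar> * norm r + norm r) * norm x)"
      by (intro mult_left_mono) (simp_all add: cA_def)
    thus "norm (A (r x)) \<le> cA * (1 + \<bar>\<mu>\<bar> * norm r + norm r) * norm x"
      using A_bd[OF rresolvD(1)[OF r(1)], of x] by (simp add: cA_def mult.assoc)
  qed
  obtain Z :: "'x \<Rightarrow>\<^sub>L 'x" where proj: "\<And>x. J (Z x) \<in> DA" "\<And>x. L (J (Z x)) = 0" "\<And>u. u \<in> DA \<Longrightarrow> L u = 0 \<Longrightarrow> J (Z u) = u"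
    "\<And>u. u \<in> DA \<Longrightarrow> Z (L u) = 0" "\<And>x. x - J (Z x) \<in> range_space DA L"
    by (rule null_projection[OF lin r(1) compact r(2) H2]) (rule that)
  have Zn: "J (Z x) \<in> null_space DA L" for x using proj(1,2) by (simp add: null_space_def)
  obtain \<rho>1 K p where rho1: "0 < \<rho>1" "0 < K" "1 < p"
    "\<And>v. norm v \<le> \<rho>1 \<Longrightarrow> norm (N (J v)) \<le> K * norm v powr (p - 1) * norm (v - Z (J v))"
    by (rule nonlinearity_bound[OF Zn proj(5) J(2) fn H5]) (rule that)
  obtain lc U where lc: "0 < lc" and U: "open U" "0 \<in> U"
    and lip: "\<And>u\<^sub>1 u\<^sub>2. u\<^sub>1 \<in> frac_dom DA A \<alpha> \<inter> U \<Longrightarrow> u\<^sub>2 \<in> frac_dom DA A \<alpha> \<inter> U \<Longrightarrow>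
      norm (N u\<^sub>1 - N u\<^sub>2) \<le> lc * frac_norm DA A \<alpha> (u\<^sub>1 - u\<^sub>2)" using H4 by metis
  \<comment> \<open>(H4) holds in a neighbourhood of 0 in X; its preimage under the continuous
    \<open>J\<close> contains a ball of X_\<alpha>, read in the coordinate v.\<close>
  have "open (J -` U)" using U(1) by (intro open_vimage blinfun.continuous_on continuous_on_const continuous_on_id)
  hence "\<exists>e>0. cball 0 e \<subseteq> J -` U" by (rule open_contains_cball[THEN iffD1, rule_format]) (use U(2) in simp)
  then obtain e where e: "0 < e" "cball 0 e \<subseteq> J -` U" by blast
  define \<rho> where "\<rho> = min e \<rho>1"
  interpret evolution_frac DA L N J Z \<alpha> \<rho> lc K p A cA
  proof unfold_locales
    show "norm (N (J v) - N (J w)) \<le> lc * norm (v - w)" if "norm v \<le> \<rho>" "norm w \<le> \<rho>" for v w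
    proof -
      have "v \<in> cball 0 e" "w \<in> cball 0 e" using that by (auto simp: \<rho>_def)
      hence "J v \<in> U" "J w \<in> U" using e(2) by auto
      thus ?thesis using lip[of "J v" "J w"] by (simp add: J(2) fn flip: blinfun.diff_right)
    qed
    show "norm (N (J v)) \<le> K * norm v powr (p - 1) * norm (v - Z (J v))" if "norm v \<le> \<rho>" for v
      using rho1(4) that by (simp add: \<rho>_def)
    show "norm (A u) \<le> cA * (norm (L u) + norm u)" if "u \<in> DA" for u using A_bd[OF that] by (simp add: cA_def)
  qed (use lin dense alpha J ares proj e rho1 lc in \<open>simp_all add: \<rho>_def\<close>)
  have part: "range_part DA L x = x - J (Z x)" for x by (rule range_part_eq[OF lin H2 proj(5) Zn])
  have DJ: "DA \<subseteq> range J"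
  proof
    fix u assume "u \<in> DA"
    hence "u = J (W (\<mu> *\<^sub>R u + L u))" using rresolvD(3)[OF r(1)] r(2) by simp
    thus "u \<in> range J" by (rule range_eqI)
  qed
  show ?thesis
    by (intro conjI impI; (rule stable[OF proj(5) part], assumption | erule bexE, rule unstable[OF r(1) compact DJ], assumption+))
qed

end
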